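(* Let $d\ge1$, let $\omega=(\omega_j)$ be a Poisson point process on $\mathbb{R}^d$ with intensity given by Lebesgue measure, and let $W:\mathbb{R}^d\to[0,\infty[$ be a measurable function which is not negligible (i.e. not Lebesgue-a.e. zero) and which satisfies, for some $\gamma>d$ and some positive constant $c$, $$W(x)\le c\,(|x|^{-\gamma}\wedge1)\qquad\text{for all }x\in\mathbb{R}^d.$$ Let $V(x,\omega)=\sum_jW(x-\omega_j)$. Then: (1) $\sup_{x\in B(0)}V(x,\cdot)\in L_{\mathbb{P}}(d,1)$; (2) $\lambda_V=\inf_\Omega V$; (3) there exist positive constants $\rho,\varepsilon$ and a measurable function $u:\Omega\to\mathbb{R}^d$ such that $\mathbb{P}$-a.s. $\mathrm{Leb}(\{x\in\mathbb{R}^d:V(x,\omega)>\varepsilon\}\cap B(u(\omega),\rho))>\varepsilon$, and $\mathbb{E}(|u(\cdot)|^d)<\infty$; (4) the Lyapunov exponent $\alpha(\cdot)$ is a norm on $\mathbb{R}^d$.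
   Context: $(\Omega,\mathbb{P})$ is the probability space of the Poisson point process (locally finite configurations), with expectation $\mathbb{E}$; $\inf_\Omega V$ denotes $\inf_{\omega\in\Omega}V(0,\omega)$. Notation. $\mathrm{Leb}$ is Lebesgue measure on $\mathbb{R}^d$; $B(y,R)=\{x:|x-y|<R\}$, $B(y)=B(y,1)$, $\overline B(y)$ its closure. $L_{\mathbb{P}}(d,1)$ is the Lorentz space of real random variables $f$ with $\int_0^1 f^*(s)s^{(1/d)-1}ds<\infty$, where $f^*:[0,1]\to\mathbb{R}^+$ is the non-increasing right-continuous function having the same distribution as $|f|$. $\lambda_V:=\inf\{\int_{\mathbb{R}^d}(\frac12|\nabla\varphi|^2+V\varphi^2)dx:\varphi\in C_c^\infty(\mathbb{R}^d),\int\varphi^2dx=1\}$, which is $\mathbb{P}$-a.s. constant by ergodicity. Lyapunov exponent. With $(Z_s)$ standard Brownian motion on $\mathbb{R}^d$ started at $0$ under $P_0$ (expectation $E_0$) and $H(y):=\inf\{t\ge0:Z_t\in\overline B(y)\}$, $\alpha(x)$ is the non-random $\mathbb{P}$-a.s. limit $$\alpha(x)=\lim_{r\to\infty}-\frac1r\log E_0\Big[\exp\Big(-\int_0^{H(rx)}V(Z_s,\omega)ds\Big)\mathbf 1_{\{H(rx)<\infty\}}\Big],\qquad x\in\mathbb{R}^d.$$ *)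

theory Defs
  imports "HOL-Probability.Probability"
begin

section \<open>Poisson point process\<close>

text \<open>A configuration \<open>(\<omega>\<^sub>j)\<close> is identified with the locally finite set of its points; the Poisson
  process with Lebesgue intensity has almost surely no multiple points.\<close>

definition configurations :: "'a::euclidean_space set set" where
  "configurations = {\<omega>. \<forall>B. bounded B \<longrightarrow> finite (\<omega> \<inter> B)}"

definition config_space :: "'a::euclidean_space set measure" where
  "config_space = sigma configurations
     {{\<omega> \<in> configurations. card (\<omega> \<inter> B) = n} | B n. B \<in> sets borel \<and> bounded B}"

definition poisson_process :: "'a::euclidean_space set measure \<Rightarrow> bool" where
  "poisson_process P \<longleftrightarrow>
     prob_space P \<and> sets P = sets config_space \<and>
     (\<forall>B n. B \<in> sets borel \<longrightarrow> bounded B \<longrightarrow>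
        measure P {\<omega> \<in> space P. card (\<omega> \<inter> B) = n} =
          exp (- measure lborel B) * measure lborel B ^ n / fact n) \<and>
     (\<forall>(A :: nat \<Rightarrow> 'a set) n.
        (\<forall>i<n. A i \<in> sets borel \<and> bounded (A i)) \<longrightarrow> disjoint_family_on A {..<n} \<longrightarrow>
        prob_space.indep_vars P (\<lambda>_. count_space UNIV) (\<lambda>i \<omega>. card (\<omega> \<inter> A i)) {..<n})"

text \<open>The value is \<open>\<infinity>\<close> where the series diverges.\<close>

definition potential ::
    "('a::euclidean_space \<Rightarrow> real) \<Rightarrow> 'a \<Rightarrow> 'a set \<Rightarrow> ennreal" where
  "potential W x \<omega> = (\<integral>\<^sup>+ y. ennreal (W (x - y)) \<partial>count_space \<omega>)"


section \<open>Lorentz space\<close>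

text \<open>\<open>g\<close> is the non-increasing right-continuous function with the distribution of \<open>\<bar>f\<bar>\<close>.
  It is considered on the open unit interval: at \<open>0\<close> it would be infinite when \<open>f\<close> is unbounded, at
  \<open>1\<close> its value is not determined, and neither value matters for the integral below.\<close>

definition decreasing_rearrangement :: "'b measure \<Rightarrow> ('b \<Rightarrow> real) \<Rightarrow> (real \<Rightarrow> real) \<Rightarrow> bool" where
  "decreasing_rearrangement M f g \<longleftrightarrow>
     (\<forall>s\<in>{0<..<1}. 0 \<le> g s) \<and>
     monotone_on {0<..<1} (\<le>) (\<ge>) g \<and>
     (\<forall>s\<in>{0<..<1}. continuous (at_right s) g) \<and>
     distr (restrict_space lborel {0<..<1}) borel g = distr M borel (\<lambda>\<omega>. \<bar>f \<omega>\<bar>)"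

definition lorentz_space :: "'b measure \<Rightarrow> nat \<Rightarrow> ('b \<Rightarrow> real) set" where
  "lorentz_space M d = {f \<in> borel_measurable M.
     \<exists>g. decreasing_rearrangement M f g \<and>
         (\<integral>\<^sup>+ s\<in>{0<..<1}. ennreal (g s * s powr (1 / real d - 1)) \<partial>lborel) < \<infinity>}"


section \<open>Bottom of the spectrum\<close>

fun C_k :: "nat \<Rightarrow> ('a::euclidean_space \<Rightarrow> real) \<Rightarrow> bool" where
  "C_k 0 f \<longleftrightarrow> continuous_on UNIV f"
| "C_k (Suc k) f \<longleftrightarrow> (\<forall>x. f differentiable (at x)) \<and>
     (\<forall>b\<in>Basis. C_k k (\<lambda>x. frechet_derivative f (at x) b))"

definition test_functions :: "('a::euclidean_space \<Rightarrow> real) set" where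
  "test_functions = {\<phi>. (\<forall>k. C_k k \<phi>) \<and> compact (closure {x. \<phi> x \<noteq> 0})}"

definition gradient :: "('a::euclidean_space \<Rightarrow> real) \<Rightarrow> 'a \<Rightarrow> 'a" where
  "gradient \<phi> x = (THE D. GDERIV \<phi> x :> D)"

definition bottom_spectrum :: "('a::euclidean_space \<Rightarrow> ennreal) \<Rightarrow> ennreal" where
  "bottom_spectrum v =
     (INF \<phi>\<in>{\<phi> \<in> test_functions. (\<integral>x. (\<phi> x)\<^sup>2 \<partial>lborel) = 1}.
        \<integral>\<^sup>+ x. ennreal (1/2 * (norm (gradient \<phi> x))\<^sup>2) + v x * ennreal ((\<phi> x)\<^sup>2) \<partial>lborel)"


section \<open>Brownian motion and the Lyapunov exponent\<close>

text \<open>Only the restriction of \<open>Z\<close> to times \<open>t \<ge> 0\<close> is relevant.\<close>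

definition standard_brownian_motion ::
    "'w measure \<Rightarrow> (real \<Rightarrow> 'w \<Rightarrow> 'a::euclidean_space) \<Rightarrow> bool" where
  "standard_brownian_motion M Z \<longleftrightarrow>
     prob_space M \<and>
     (\<forall>t\<ge>0. Z t \<in> borel_measurable M) \<and>
     (AE w in M. Z 0 w = 0) \<and>
     (\<forall>w\<in>space M. continuous_on {0..} (\<lambda>t. Z t w)) \<and>
     (\<forall>s t. 0 \<le> s \<longrightarrow> s < t \<longrightarrow>
        distributed M lborel (\<lambda>w. Z t w - Z s w)
          (\<lambda>x. ennreal (\<Prod>b\<in>Basis. normal_density 0 (sqrt (t - s)) (x \<bullet> b)))) \<and>
     (\<forall>(\<tau> :: nat \<Rightarrow> real) n. 0 \<le> \<tau> 0 \<longrightarrow> strict_mono \<tau> \<longrightarrow>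
        prob_space.indep_vars M (\<lambda>_. borel) (\<lambda>i w. Z (\<tau> (Suc i)) w - Z (\<tau> i) w) {..<n})"

definition hitting_time ::
    "(real \<Rightarrow> 'w \<Rightarrow> 'a::euclidean_space) \<Rightarrow> 'a \<Rightarrow> 'w \<Rightarrow> ennreal" where
  "hitting_time Z y w = (INF t\<in>{t. 0 \<le> t \<and> Z t w \<in> cball y 1}. ennreal t)"

definition exp_minus :: "ennreal \<Rightarrow> real" where
  "exp_minus a = (if a = \<infinity> then 0 else exp (- enn2real a))"

definition survival ::
    "'w measure \<Rightarrow> (real \<Rightarrow> 'w \<Rightarrow> 'a::euclidean_space) \<Rightarrow> ('a \<Rightarrow> ennreal) \<Rightarrow> 'a \<Rightarrow> real" where
  "survival M Z v y =
     (\<integral>w. exp_minus (\<integral>\<^sup>+ s\<in>{s. 0 \<le> s \<and> ennreal s \<le> hitting_time Z y w}. v (Z s w) \<partial>lborel)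
           * indicator {w. hitting_time Z y w < \<infinity>} w \<partial>M)"

definition minus_log :: "real \<Rightarrow> ereal" where
  "minus_log p = (if p = 0 then \<infinity> else ereal (- ln p))"

definition lyapunov_limit ::
    "'w measure \<Rightarrow> (real \<Rightarrow> 'w \<Rightarrow> 'a::euclidean_space) \<Rightarrow> ('a \<Rightarrow> ennreal) \<Rightarrow> 'a \<Rightarrow> real \<Rightarrow> bool" where
  "lyapunov_limit M Z v x a \<longleftrightarrow>
     ((\<lambda>r. minus_log (survival M Z v (r *\<^sub>R x)) / ereal r) \<longlongrightarrow> ereal a) at_top"

definition lyapunov_exponent ::
    "'a::euclidean_space set measure \<Rightarrow> 'w measure \<Rightarrow> (real \<Rightarrow> 'w \<Rightarrow> 'a) \<Rightarrow>
     ('a \<Rightarrow> 'a set \<Rightarrow> ennreal) \<Rightarrow> 'a \<Rightarrow> real" where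
  "lyapunov_exponent P M Z V x =
     (THE a. AE \<omega> in P. lyapunov_limit M Z (\<lambda>y. V y \<omega>) x a)"

definition is_norm :: "('a::real_vector \<Rightarrow> real) \<Rightarrow> bool" where
  "is_norm N \<longleftrightarrow>
     (\<forall>x. 0 \<le> N x) \<and> (\<forall>x. N x = 0 \<longleftrightarrow> x = 0) \<and>
     (\<forall>c x. N (c *\<^sub>R x) = \<bar>c\<bar> * N x) \<and> (\<forall>x y. N (x + y) \<le> N x + N y)"

end

(* Let S be the sum of the weights (1 + |y|)^(-gamma) over the points y of the configuration. All its
   moments are finite, and V(x) is at most c (2 + |x|)^gamma S. This bounds the supremum in (1), and
   applied to translates it shows that V almost surely grows sublinearly. For (2), ergodicity of the
   shifts provides arbitrarily large balls on which V is arbitrarily small, and they carry suitable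
   test functions. For (3), u is the centre of the first nonempty ball in a sequence of disjoint unit
   balls along a line.

   For (4), let e(z,y) be the expected weight of a path from z that hits the closed unit ball around y.
   By the strong Markov property the infimum of e(z,y) over the unit ball around x is
   supermultiplicative in (x,y), so Kingman's theorem yields a limit along the multiples of x. (The
   infimum is measurable because projections of Borel sets are Suslin sets.) A Harnack inequality
   compares the starting point 0 with the infimum, at a cost that sublinearity makes negligible.
   The triangle inequality follows from stationarity, comparing in probability. For symmetry, reverse
   the Wiener paths and integrate over both endpoints; the Green function of the path sampled at
   discrete times bounds the number of visits to a ball. For positivity, the expectation of e(0,y)
   decays exponentially, because the path has to cross many parallel hyperplanes and between any
   two of them it meets obstacles independent of the previous ones. *)
theory Submission
 imports Defs "HOL-Real_Asymp.Real_Asymp"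
begin

text \<open>\<open>W\<close> has an integrable tail but is otherwise arbitrary: it may be
  discontinuous, of unbounded support, and zero on most of space. So \<open>V\<close> has infinite
  range, and uncountable suprema and infima are treated as random variables of the completion of
  \<open>P\<close>. Infinite range is overcome by monotonicity: in the annealed estimate each slab
  is charged with its own Poisson points only, and in the quiet event the far points are small
  through the tail of \<open>S\<close>. Changing the starting point costs a factor
  \<open>exp\<close> of the local maximum of \<open>V\<close> and adds an exit probability. In a
  ball of radius proportional to the distance the first is subexponential by sublinearity, and the
  free parameter \<theta> makes the second decay faster than any crossing probability in question.
  Symmetry rests on a Green function. Brownian motion is recurrent in dimensions one and two, so its
  finiteness comes from the killing by \<open>V\<close>, hence from \<open>W\<close> being
  non-negligible. Almost sure limits say nothing about configurations shifted by \<open>n x\<close>,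
  since the shift varies with \<open>n\<close>; probabilities are unaffected by it. Therefore the
  norm properties are derived from convergence in probability.\<close>

notation LIMSEQ ("(_/ ----> _)" [60, 60] 60)

syntax "_nint" :: "pttrn \<Rightarrow> 'a measure \<Rightarrow> ennreal \<Rightarrow> ennreal" ("(3NINT _|_./ _)" [0,110,10] 10)
translations "NINT x|M. f" \<rightleftharpoons> "CONST nn_integral M (\<lambda>x. f)"

abbreviation (input) bmeas where "bmeas \<equiv> borel_measurable"
abbreviation (input) en where "en \<equiv> ennreal"
abbreviation (input) ind where "ind \<equiv> indicator"

text \<open>The \<open>ennreal\<close> form of \<open>exp (- a)\<close>, with value 0 at infinity:
  sums of costs become products of weights (\<open>em_add\<close>) without finiteness conditions,
  and weights can be integrated with \<open>nn_integral\<close>.\<close>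

definition em :: "ennreal => ennreal" where "em a = en (exp_minus a)"

lemma em_0 [simp]: "em 0 = 1" and em_top [simp]: "em \<top> = 0" by (simp_all add: em_def exp_minus_def)

lemma em_ennreal: "0 \<le> r ==> em (en r) = en (exp (- r))" by (simp add: em_def exp_minus_def)

lemma em_le_1: "em a \<le> 1"
 by (cases a) (auto simp: em_ennreal simp flip: ennreal_1 intro!: ennreal_leI)

lemma em_less_top [simp]: "em a < \<top>" "em a \<noteq> \<top>" by (simp_all add: em_def)

lemma em_add: "em (a + b) = em a * em b"
 by (cases a; cases b) (auto simp: em_ennreal ennreal_plus[symmetric] mult_exp_exp
  ennreal_mult[symmetric] simp del: ennreal_plus)

lemma em_antimono: "a \<le> b ==> em b \<le> em a"
 by (cases a; cases b) (auto simp: em_ennreal ennreal_le_iff top_unique intro!: ennreal_leI)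

lemma em_measurable [measurable]: "em \<in> bmeas borel"
 unfolding em_def exp_minus_def[abs_def] infinity_ennreal_def by measurable

lemma ennreal_exp_minus [simp]: "en (exp_minus a) = em a" by (simp add: em_def)

lemma exp_minus_nonneg: "0 \<le> exp_minus a" by (simp add: exp_minus_def)

lemma exp_minus_eq: "exp_minus a = enn2real (em a)"
 by (simp only: em_def enn2real_ennreal exp_minus_nonneg)

lemma em_tendsto:
 assumes "(f \<longlongrightarrow> a) F"
 shows "((%x. em (f x)) \<longlongrightarrow> em a) F"
proof (cases a)
 case (real r)
 hence "eventually (%x. f x < \<top>) F" using order_tendstoD(2)[OF assms, of \<top>] by simp
 hence "eventually (%x. en (exp (- enn2real (f x))) = em (f x)) F"
  by eventually_elim (simp add: em_def exp_minus_def)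
 moreover have "((%x. en (exp (- enn2real (f x)))) \<longlongrightarrow> en (exp (- enn2real a))) F"
  using assms real by (intro tendsto_ennrealI tendsto_exp tendsto_minus tendsto_enn2real) auto
 ultimately have "((%x. em (f x)) \<longlongrightarrow> en (exp (- enn2real a))) F" by (rule Lim_transform_eventually[rotated])
 thus ?thesis using real by (simp add: em_ennreal)
next
 case top
 have "((%x. em (f x)) \<longlongrightarrow> 0) F"
 proof (rule order_tendstoI, goal_cases)
  case e: (2 e)
  obtain r where r: "0 < r" "en r \<le> e" "r \<le> 1"
  proof (cases e)
   case (real s)
   with e show ?thesis by (intro that[of "min s 1"]) (auto intro: ennreal_leI)
  qed (auto intro: that[of 1])
  \<comment> \<open>At the level \<open>1 - ln r\<close> the weight is \<open>r\<close> divided by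
    \<open>exp 1\<close>; the bound \<open>r \<le> 1\<close> keeps this level positive.\<close>
  have "eventually (%x. en (1 - ln r) < f x) F" using order_tendstoD(1)[OF assms] top by simp
  thus ?case
  proof eventually_elim
   case (elim x)
   have ln: "ln r \<le> 0" using r by simp
   have "em (f x) \<le> em (en (1 - ln r))" using elim by (intro em_antimono) simp
   also have "... = en (exp (ln r - 1))" using ln by (simp add: em_ennreal)
   also have "... < en r" using r by (subst ennreal_less_iff) (auto simp: exp_diff divide_less_eq)
   also have "... \<le> e" by fact
   finally show ?case .
  qed
 qed auto
 thus ?thesis using top by simp
qed

lemma em_eq_0_iff [simp]: "em a = 0 \<longleftrightarrow> a = \<top>" by (cases a) (auto simp: em_ennreal)

lemma em_less_1: "0 < a ==> em a < 1"
 by (cases a) (auto simp: em_ennreal simp flip: ennreal_1 intro!: ennreal_lessI)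

section \<open>Suslin sets and measurability of suprema\<close>

text \<open>Suslin's operation. \<open>F n r\<close> stands for the set attached to the finite
  sequence \<open>r 0, ..., r (n - 1)\<close>; infinite sequences with dependence on the first
  \<open>n\<close> entries replace a coding by lists.\<close>

definition suslin :: "'b set set => 'b set set" where
 "suslin \<F> = {{p. \<exists>r. \<forall>n. p \<in> F n r} | F :: nat => (nat => nat) => 'b set. (\<forall>n r. F n r \<in> \<F>) \<and> (\<forall>n r
  t. (\<forall>j<n. r j = t j) \<longrightarrow> F n r = F n t)}"

lemma suslin_iff:
 "A \<in> suslin \<F> \<longleftrightarrow> (\<exists>F :: nat => (nat => nat) => 'b set. (\<forall>n r. F n r \<in> \<F>) \<and> (\<forall>n r t. (\<forall>j<n. r j = t
  j) \<longrightarrow> F n r = F n t) \<and> A = {p. \<exists>r. \<forall>n. p \<in> F n r})"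
 by (auto simp: suslin_def)

lemma suslinE:
 fixes A :: "'b set"
 assumes "A \<in> suslin \<F>"
 obtains F :: "nat => (nat => nat) => 'b set"
 where "\<forall>n r. F n r \<in> \<F>" "\<forall>n r t. (\<forall>j<n. r j = t j) \<longrightarrow> F n r = F n t" "A = {p. \<exists>r. \<forall>n. p \<in> F n r}"
 using assms unfolding suslin_iff by blast

lemma suslin_seqE:
 fixes A :: "nat => 'b set"
 assumes A: "!!i. A i \<in> suslin \<F>"
 obtains F :: "nat => nat => (nat => nat) => 'b set"
 where "\<forall>i n r. F i n r \<in> \<F>" "\<forall>i n r t. (\<forall>j<n. r j = t j) \<longrightarrow> F i n r = F i n t"
 "\<forall>i. A i = {p. \<exists>r. \<forall>n. p \<in> F i n r}"
proof -
 have "\<forall>i. \<exists>F :: nat => (nat => nat) => 'b set. (\<forall>n r. F n r \<in> \<F>) \<and> (\<forall>n r t. (\<forall>j<n. r j = t j) \<longrightarrow> F n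
  r = F n t) \<and> A i = {p. \<exists>r. \<forall>n. p \<in> F n r}"
  by (rule allI) (rule A[unfolded suslin_iff])
 from choice[OF this] obtain F :: "nat => nat => (nat => nat) => 'b set" where
  F: "\<forall>i. (\<forall>n r. F i n r \<in> \<F>) \<and> (\<forall>n r t. (\<forall>j<n. r j = t j) \<longrightarrow> F i n r = F i n t) \<and> A i = {p. \<exists>r. \<forall>n.
   p \<in> F i n r}" by (rule exE)
 show thesis by (rule that[of F]) (use F in blast)+
qed

lemma suslinI:
 fixes F :: "nat => (nat => nat) => 'b set"
 assumes "!!n r. F n r \<in> \<F>" "!!n r t. (!!j. j < n ==> r j = t j) ==> F n r = F n t"
 "A = {p. \<exists>r. \<forall>n. p \<in> F n r}"
 shows "A \<in> suslin \<F>" unfolding suslin_def using assms by blast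

lemma suslin_basic: "A \<in> \<F> ==> A \<in> suslin \<F>" by (rule suslinI[of "%_ _. A"]) auto

text \<open>The first entry of the branch selects the set, and the remaining entries form a branch
  of its scheme.\<close>

lemma suslin_UN:
 fixes A :: "nat => 'b set"
 assumes A: "!!i. A i \<in> suslin \<F>" and \<Omega>: "\<Omega> \<in> \<F>" "!!A. A \<in> \<F> ==> A \<subseteq> \<Omega>"
 shows "(\<Union>i. A i) \<in> suslin \<F>"
proof -
 obtain F :: "nat => nat => (nat => nat) => 'b set" where F':
  "\<forall>i n r. F i n r \<in> \<F>" "\<forall>i n r t. (\<forall>j<n. r j = t j) \<longrightarrow> F i n r = F i n t"
  "\<forall>i. A i = {p. \<exists>r. \<forall>n. p \<in> F i n r}" by (rule suslin_seqE[OF A])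
 note F = F'[rule_format]
 \<comment> \<open>Level 0 must not depend on \<open>r\<close>, so it carries the whole space, and
   level \<open>n\<close> of the old scheme moves to level \<open>Suc n\<close>.\<close>
 define G where "G n r = (case n of 0 => \<Omega> | Suc n => F (r 0) n (%j. r (Suc j)))"
  for n and r :: "nat => nat"
 have all: "(\<forall>n. p \<in> G n r) \<longleftrightarrow> (\<forall>n. p \<in> F (r 0) n (%j. r (Suc j)))" for p r
 proof
  assume "\<forall>n. p \<in> G n r"
  thus "\<forall>n. p \<in> F (r 0) n (%j. r (Suc j))" by (auto simp: G_def dest: spec[of _ "Suc _"])
 next
  assume *: "\<forall>n. p \<in> F (r 0) n (%j. r (Suc j))"
  hence "p \<in> \<Omega>" using F(1) \<Omega>(2) by blast
  with * show "\<forall>n. p \<in> G n r" by (auto simp: G_def split: nat.split)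
 qed
 show ?thesis
 proof (rule suslinI[of G])
  show "G n r \<in> \<F>" for n r using F(1) \<Omega>(1) by (auto simp: G_def split: nat.split)
  show "G n r = G n t" if "!!j. j < n ==> r j = t j" for n r t
   using that by (auto simp: G_def split: nat.split intro!: F(2))
  have "\<exists>r. \<forall>n. p \<in> G n r" if "\<forall>n. p \<in> F i n r" for p i r
   using that by (intro exI[of _ "case_nat i r"]) (simp add: all)
  moreover have "\<exists>i r. \<forall>n. p \<in> F i n r" if "\<forall>n. p \<in> G n r" for p r using that unfolding all by blast
  ultimately show "(\<Union>i. A i) = {p. \<exists>r. \<forall>n. p \<in> G n r}"
   unfolding F(3) UN_iff set_eq_iff mem_Collect_eq by (meson UNIV_I)
 qed
qed

text \<open>One branch encodes countably many: its entry at \<open>prod_encode (i, j)\<close> is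
  entry \<open>j\<close> of the branch for \<open>A i\<close>.\<close>

lemma suslin_INT:
 fixes A :: "nat => 'b set"
 assumes A: "!!i. A i \<in> suslin \<F>"
 shows "(\<Inter>i. A i) \<in> suslin \<F>"
proof -
 obtain F :: "nat => nat => (nat => nat) => 'b set" where F':
  "\<forall>i n r. F i n r \<in> \<F>" "\<forall>i n r t. (\<forall>j<n. r j = t j) \<longrightarrow> F i n r = F i n t"
  "\<forall>i. A i = {p. \<exists>r. \<forall>n. p \<in> F i n r}" by (rule suslin_seqE[OF A])
 note F = F'[rule_format]
 define G where "G k r = (case prod_decode k of (i, n) => F i n (%j. r (prod_encode (i, j))))"
  for k and r :: "nat => nat"
 \<comment> \<open>The pairing increases in \<open>j\<close>, so level
   \<open>prod_encode (i, n)\<close> already sees all entries \<open>j < n\<close> of branch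
   \<open>i\<close>.\<close>
 have enc: "prod_encode (i, j) < prod_encode (i, n)" if "j < n" for i j n
 proof -
  have "triangle (i + j) < triangle (i + n)" using that by (induction n) (auto simp: less_Suc_eq)
  thus ?thesis using that by (simp add: prod_encode_def)
 qed
 show ?thesis
 proof (rule suslinI[of G])
  show "G n r \<in> \<F>" for n r using F(1) by (auto simp: G_def split: prod.split)
  show "G k r = G k t" if "!!j. j < k ==> r j = t j" for k r t
  proof -
   obtain i n where k: "k = prod_encode (i, n)" by (metis prod_decode_inverse prod.exhaust)
   show ?thesis unfolding k G_def using that by (auto intro!: F(2) simp: enc k)
  qed
  let ?X = "{p. \<exists>r. \<forall>n. p \<in> G n r}"
  show "(\<Inter>i. A i) = ?X"
  proof (intro equalityI subsetI)
   fix p assume "p \<in> (\<Inter>i. A i)"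
   hence "\<forall>i. \<exists>r. \<forall>n. p \<in> F i n r" unfolding F(3) by auto
   then obtain s where s: "!!i n. p \<in> F i n (s i)" by metis
   hence "\<forall>k. p \<in> G k (%m. case prod_decode m of (i, j) => s i j)"
    by (simp add: G_def split: prod.split)
   thus "p \<in> ?X" by blast
  next
   fix p assume "p \<in> ?X"
   then obtain r where "!!k. p \<in> G k r" by blast
   from this[of "prod_encode (_, _)"] show "p \<in> (\<Inter>i. A i)" unfolding F(3) by (auto simp: G_def)
  qed
 qed
qed

text \<open>Koenig's lemma for boundedly branching trees.\<close>

lemma bounded_branch:
 fixes F :: "nat => (nat => nat) => 'b set"
 assumes F: "!!n r t. (!!j. j < n ==> r j = t j) ==> F n r = F n t"
 and p: "!!k. \<exists>r. (\<forall>j. r j \<le> N j) \<and> (\<forall>n\<le>k. p \<in> F n r)"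
 shows "\<exists>r. \<forall>n. p \<in> F n r"
proof -
 define C where "C k = {r. (\<forall>j. r j \<le> N j) \<and> (\<forall>n\<le>k. p \<in> F n r)}" for k
 have mono: "C l \<subseteq> C k" if "k \<le> l" for k l using that by (auto simp: C_def)
 define P where "P j g \<longleftrightarrow> (\<forall>k. \<exists>r\<in>C k. \<forall>i<j. r i = g i)" for j and g :: "nat => nat"
 have "\<exists>f. \<forall>n. P n (f n) \<and> (\<exists>m. f (Suc n) = (f n)(n := m))"
 proof (rule dependent_nat_choice)
  show "\<exists>x. P 0 x" using p by (auto simp: P_def C_def)
 next
  fix g n assume g: "P n g"
  \<comment> \<open>Otherwise each of the finitely many values up to \<open>N n\<close> is excluded
    from some level on; at the largest of these levels no continuation of \<open>g\<close> would
    remain.\<close>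
  have "\<exists>m. P (Suc n) (g(n := m))"
  proof (rule ccontr)
   assume "\<not> ?thesis"
   hence "\<forall>m. \<exists>k. \<forall>r\<in>C k. \<not> (\<forall>i<Suc n. r i = (g(n := m)) i)" by (simp add: P_def)
   then obtain K where K: "!!m r. r \<in> C (K m) ==> \<not> (\<forall>i<Suc n. r i = (g(n := m)) i)" by metis
   define k where "k = Max (K ` {..N n})"
   obtain r where r: "r \<in> C k" "\<forall>i<n. r i = g i" using g by (auto simp: P_def)
   have "K (r n) \<le> k" using r(1) by (auto simp: C_def k_def intro!: Max_ge)
   hence "r \<in> C (K (r n))" using mono r(1) by blast
   with K r(2) show False by (fastforce simp: less_Suc_eq)
  qed
  thus "\<exists>y. P (Suc n) y \<and> (\<exists>m. y = g(n := m))" by blast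
 qed
 then obtain f where f: "!!n. P n (f n)" "!!n. \<exists>m. f (Suc n) = (f n)(n := m)" by metis
 define r where "r j = f (Suc j) j" for j
 have fr: "f n j = r j" if "j < n" for n j using that
 proof (induction n)
  case (Suc n)
  thus ?case using f(2)[of n] by (cases "j = n") (auto simp: r_def)
 qed simp
 have "p \<in> F n r" for n
 proof -
  obtain t where t: "t \<in> C n" "\<forall>i<n. t i = f n i" using f(1)[of n] by (auto simp: P_def)
  hence "F n t = F n r" by (intro F) (auto simp: fr)
  with t(1) show ?thesis by (auto simp: C_def)
 qed
 thus ?thesis by blast
qed

text \<open>Choquet's capacitability argument. The entries of the branch are bounded one after
  another, each bound so large that the outer measure stays above \<open>c\<close>; this works
  because outer measure is continuous along increasing sequences of arbitrary sets. With all entries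
  bounded by \<open>N\<close> the finite levels are measurable, and Koenig's lemma puts their
  intersection inside \<open>A\<close>.\<close>

lemma suslin_inner_approx:
 assumes fin: "finite_measure M" and A: "A \<in> suslin (sets M)" and c: "c < outer_measure_of M A"
 shows "\<exists>B\<in>sets M. B \<subseteq> A \<and> c \<le> emeasure M B"
proof -
 interpret finite_measure M by fact
 obtain F :: "nat => (nat => nat) => 'a set" where F':
  "\<forall>n r. F n r \<in> sets M" "\<forall>n r t. (\<forall>j<n. r j = t j) \<longrightarrow> F n r = F n t"
  "A = {p. \<exists>r. \<forall>n. p \<in> F n r}" using A by (rule suslinE)
 note F = F'(1)[rule_format] F'(2)[rule_format] F'(3)
 define S where "S k N = {p. \<exists>r. (\<forall>j<k. r j \<le> N j) \<and> (\<forall>n. p \<in> F n r)}" for k and N :: "nat => nat"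
 have S_sp: "S k N \<subseteq> space M" for k N using F(1) sets.sets_into_space by (fastforce simp: S_def)
 have "\<exists>f. \<forall>k. c < outer_measure_of M (S k (f k)) \<and> (\<exists>m. f (Suc k) = (f k)(k := m))"
 proof (rule dependent_nat_choice)
  show "\<exists>N. c < outer_measure_of M (S 0 N)" using c by (auto simp: S_def F(3))
 next
  fix N k assume N: "c < outer_measure_of M (S k N)"
  have inc: "incseq (%m. S (Suc k) (N(k := m)))"
   by (auto simp: incseq_def S_def less_Suc_eq) (metis le_trans nat_neq_iff)
  have "(\<Union>m. S (Suc k) (N(k := m))) = S k N" by (auto simp: S_def CollectI exI less_Suc_eq)
  hence "(SUP m. outer_measure_of M (S (Suc k) (N(k := m)))) = outer_measure_of M (S k N)"
   using SUP_outer_measure_of_incseq[of "%m. S (Suc k) (N(k := m))" M] S_sp inc by auto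
  with N obtain m where "c < outer_measure_of M (S (Suc k) (N(k := m)))" by (metis less_SUP_iff)
  thus "\<exists>y. c < outer_measure_of M (S (Suc k) y) \<and> (\<exists>m. y = N(k := m))" by blast
 qed
 then obtain f where f: "!!k. c < outer_measure_of M (S k (f k))"
  "!!k. \<exists>m. f (Suc k) = (f k)(k := m)" by metis
 define N where "N j = f (Suc j) j" for j
 have fN: "f n j = N j" if "j < n" for n j using that
 proof (induction n)
  case (Suc n)
  thus ?case using f(2)[of n] by (cases "j = n") (auto simp: N_def)
 qed simp
 define D where "D k = {p. \<exists>r. (\<forall>j. r j \<le> N j) \<and> (\<forall>n\<le>k. p \<in> F n r)}" for k
 \<comment> \<open>Level \<open>k\<close> depends on the first \<open>k\<close> entries only, and
   below \<open>N\<close> there are finitely many choices for them, so \<open>D k\<close> is a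
   finite union.\<close>
 have D_eq: "D k = (\<Union>s\<in>PiE {..<k} (%j. {..N j}). \<Inter>n\<le>k. F n (%j. if j < k then s j else 0))" for k
 proof (intro equalityI subsetI)
  fix p assume "p \<in> D k"
  then obtain r where r: "!!j. r j \<le> N j" "!!n. n \<le> k ==> p \<in> F n r" by (auto simp: D_def)
  have "F n (%j. if j < k then restrict r {..<k} j else 0) = F n r" if "n \<le> k" for n
   using that by (intro F(2)) auto
  thus "p \<in> (\<Union>s\<in>PiE {..<k} (%j. {..N j}). \<Inter>n\<le>k. F n (%j. if j < k then s j else 0))"
   using r by (intro UN_I[of "restrict r {..<k}"]) auto
 next
  fix p assume "p \<in> (\<Union>s\<in>PiE {..<k} (%j. {..N j}). \<Inter>n\<le>k. F n (%j. if j < k then s j else 0))"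
  then obtain s where "s \<in> PiE {..<k} (%j. {..N j})" "\<forall>n\<le>k. p \<in> F n (%j. if j < k then s j else 0)"
   by auto
  thus "p \<in> D k"
   unfolding D_def by (intro CollectI exI[of _ "%j. if j < k then s j else 0"]) (auto simp: PiE_def)
 qed
 have D_sets: "D k \<in> sets M" for k
  unfolding D_eq by (intro sets.finite_UN finite_PiE sets.finite_INT) (auto intro: F(1))
 have D_ge: "c \<le> emeasure M (D k)" for k
 proof -
  have "S k (f k) \<subseteq> D k"
  proof
   fix p assume "p \<in> S k (f k)"
   then obtain r where r: "\<forall>j<k. r j \<le> N j" "\<forall>n. p \<in> F n r" by (auto simp: S_def fN)
   have "F n (%j. if j < k then r j else 0) = F n r" if "n \<le> k" for n
    using that by (intro F(2)) auto
   with r show "p \<in> D k"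
    unfolding D_def by (intro CollectI exI[of _ "%j. if j < k then r j else 0"]) auto
  qed
  hence "outer_measure_of M (S k (f k)) \<le> emeasure M (D k)"
   using outer_measure_of_mono[of "S k (f k)" "D k" M] D_sets by simp
  with f(1)[of k] show ?thesis by simp
 qed
 have dec: "decseq D" by (auto simp: decseq_def D_def)
 have "c \<le> emeasure M (\<Inter>k. D k)"
  using INF_emeasure_decseq[of D M] D_sets dec D_ge by (metis INF_greatest emeasure_finite
   image_subsetI infinity_ennreal_def)
 moreover have "(\<Inter>k. D k) \<subseteq> A"
  unfolding F(3) using bounded_branch[of F N, OF F(2)] by (auto simp: D_def)
 moreover have "(\<Inter>k. D k) \<in> sets M" using D_sets by auto
 ultimately show ?thesis by blast
qed

text \<open>\<open>A\<close> lies between a measurable hull \<open>E\<close> and a countable union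
  \<open>L\<close> of inner approximations with the same finite measure.\<close>

lemma suslin_completion:
 assumes fin: "finite_measure M" and A: "A \<in> suslin (sets M)"
 shows "A \<in> sets (completion M)"
proof -
 interpret finite_measure M by fact
 have AM: "A \<subseteq> space M" using A by (rule suslinE) (use sets.sets_into_space in blast)
 let ?o = "outer_measure_of M A"
 obtain E where E: "E \<in> sets M" "A \<subseteq> E" "?o = emeasure M E"
  using outer_measure_of_attain[OF AM] by blast
 have "\<exists>L\<in>sets M. L \<subseteq> A \<and> emeasure M L = ?o"
 proof (cases "?o = 0")
  case True
  thus ?thesis by (intro bexI[of _ "{}"]) auto
 next
  case False
  have fino: "?o < \<infinity>" using E(3) by (simp add: less_top[symmetric])
  define c where "c n = ?o - en (1 / Suc n)" for n
  have "c n < ?o" for n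
   using False fino unfolding c_def by (intro ennreal_between) (auto simp: zero_less_iff_neq_zero)
  hence "\<exists>B\<in>sets M. B \<subseteq> A \<and> c n \<le> emeasure M B" for n by (intro suslin_inner_approx[OF fin A])
  then obtain B where B: "!!n. B n \<in> sets M" "!!n. B n \<subseteq> A" "!!n. c n \<le> emeasure M (B n)" by metis
  let ?L = "\<Union>n. B n"
  have "?o \<le> emeasure M ?L"
  proof (rule ennreal_le_epsilon, goal_cases)
   case (1 e)
   then obtain n where n: "1 / Suc n < e" using nat_approx_posE by blast
   have "?o \<le> c n + en (1 / Suc n)"
    using ennreal_minus_le_iff[of ?o "en (1 / Suc n)" "c n"] by (simp add: c_def add.commute)
   also have "... \<le> emeasure M ?L + en e"
    using B n by (intro add_mono order_trans[OF B(3)] emeasure_mono ennreal_leI) auto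
   finally show ?case .
  qed
  moreover have "emeasure M ?L \<le> ?o" unfolding E(3) using B(2) E by (intro emeasure_mono) blast+
  ultimately show ?thesis using B by (intro bexI[of _ ?L]) auto
 qed
 then obtain L where L: "L \<in> sets M" "L \<subseteq> A" "emeasure M L = ?o" by blast
 have "emeasure M (E - L) = 0" using E L by (subst emeasure_Diff) auto
 thus ?thesis using E L L E by (intro sets_completionI[of A L "A - L" "E - L"]) auto
qed

definition closed_rectangles :: "'b measure => ('b \<times> 'c::topological_space) set set" where
 "closed_rectangles N = {A \<times> K | A K. A \<in> sets N \<and> closed K}"

text \<open>Suslin sets need not be closed under complements, so each induction over a sigma-algebra
  carries a set together with its complement.\<close>

lemma pair_sets_suslin:
 fixes N :: "'b measure" and S :: "('b \<times> 'c::euclidean_space) set"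
 assumes "S \<in> sets (N \<Otimes>\<^sub>M borel)"
 shows "S \<in> suslin (closed_rectangles N)"
proof -
 let ?R = "closed_rectangles N :: ('b \<times> 'c) set set"
 have top: "space N \<times> UNIV \<in> ?R" "!!A. A \<in> ?R ==> A \<subseteq> space N \<times> UNIV"
  using sets.sets_into_space[where M=N] unfolding closed_rectangles_def by (blast, blast)
 have basic: "A \<times> K \<in> suslin ?R" if "A \<in> sets N" "closed K" for A and K :: "'c set"
  using that by (intro suslin_basic) (auto simp: closed_rectangles_def)
 have un: "A \<union> B \<in> suslin ?R" if "A \<in> suslin ?R" "B \<in> suslin ?R" for A B
 proof -
  let ?X = "\<Union>i::nat. if i = 0 then A else B"
  have "?X \<in> suslin ?R" using that by (intro suslin_UN[OF _ top]) auto
  also have "?X = A \<union> B" by (auto split: if_splits)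
  finally show ?thesis .
 qed
 have rect: "A \<times> B \<in> suslin ?R \<and> A \<times> (UNIV - B) \<in> suslin ?R" if A: "A \<in> sets N" and "B \<in> sets borel"
  for A and B :: "'c set"
 proof -
  have "B \<in> sigma_sets UNIV {S. open S}" using \<open>B \<in> sets borel\<close> by (simp add: borel_def)
  thus ?thesis
  proof induction
   case (Basic U)
   hence "fsigma_in euclidean U" by (intro open_imp_fsigma_in metrizable_space_euclidean) simp
   then obtain C :: "nat => 'c set" where C: "!!n. closed (C n)" "U = (\<Union>n. C n)"
    unfolding fsigma_in_ascending by force
   have "A \<times> U = (\<Union>n. A \<times> C n)" by (auto simp: C)
   thus ?case using suslin_UN[of "%n. A \<times> C n" ?R, OF _ top] basic[OF A] C Basic by (auto intro!:
    basic[OF A])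
  next
   case Empty
   thus ?case using basic[OF A, of UNIV] basic[OF A, of "{}"] by simp
  next
   case (Compl a)
   thus ?case by (simp add: double_diff)
  next
   case (Union a)
   have "A \<times> (\<Union>i. a i) = (\<Union>i. A \<times> a i)" "A \<times> (UNIV - (\<Union>i. a i)) = (\<Inter>i. A \<times> (UNIV - a i))" by auto
   thus ?case using Union suslin_UN[of "%i. A \<times> a i" ?R, OF _ top] suslin_INT[of "%i. A \<times> (UNIV - a
    i)" ?R] by simp
  qed
 qed
 have "S \<in> sigma_sets (space N \<times> UNIV) {a \<times> b | a b. a \<in> sets N \<and> b \<in> sets (borel :: 'c measure)}"
  using assms by (simp add: sets_pair_measure)
 hence "S \<in> suslin ?R \<and> space N \<times> UNIV - S \<in> suslin ?R"
 proof induction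
  case (Basic a)
  then obtain A B where AB: "a = A \<times> B" "A \<in> sets N" "B \<in> sets borel" by auto
  have "space N \<times> UNIV - a = (space N - A) \<times> UNIV \<union> A \<times> (UNIV - B)"
   using AB sets.sets_into_space[OF AB(2)] by auto
  thus ?case using AB rect[OF AB(2,3)] by (auto intro!: un basic)
 next
  case Empty
  thus ?case using top(1) basic[of "{}" "{}"] by (auto intro: suslin_basic)
 next
  case (Compl a)
  moreover have "a \<subseteq> space N \<times> UNIV"
   using sigma_sets_into_sp[OF _ Compl(1)] sets.sets_into_space by fastforce
  ultimately show ?case by (simp add: double_diff)
 next
  case (Union a)
  show ?case using Union suslin_UN[of a ?R, OF _ top] suslin_INT[of "%i. space N \<times> UNIV - a i" ?R] by simp
 qed
 thus ?thesis ..
qed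

text \<open>A branch survives the projection if each finite number of its levels has a common second
  coordinate in \<open>C\<close>. By compactness these nested nonempty sections then have a point in
  common for the whole branch, so emptiness of the sections can be tested level by level in
  \<open>G\<close>.\<close>

lemma suslin_fst:
 fixes S :: "('b \<times> 'c::euclidean_space) set"
 assumes S: "S \<in> suslin (closed_rectangles N)" and bd: "S \<subseteq> UNIV \<times> C" and C: "compact C"
 shows "fst ` S \<in> suslin (sets N)"
proof -
 obtain F :: "nat => (nat => nat) => ('b \<times> 'c) set" where F':
  "\<forall>n r. F n r \<in> closed_rectangles N" "\<forall>n r t. (\<forall>j<n. r j = t j) \<longrightarrow> F n r = F n t"
  "S = {p. \<exists>r. \<forall>n. p \<in> F n r}" using S by (rule suslinE)
 note F = F'(1)[rule_format] F'(2)[rule_format] F'(3)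
 have "\<forall>R\<in>closed_rectangles N. \<exists>A K. A \<in> sets N \<and> closed (K :: 'c set) \<and> R = A \<times> K"
  by (auto simp: closed_rectangles_def)
 then obtain a k where ak: "!!R. R \<in> closed_rectangles N ==> a R \<in> sets N"
  "!!R. R \<in> closed_rectangles N ==> closed (k R :: 'c set)"
  "!!R. R \<in> closed_rectangles N ==> R = a R \<times> k R" by metis
 define A where "A n r = a (F n r)" for n r
 define K where "K n r = k (F n r)" for n r
 have FA: "F n r = A n r \<times> K n r" for n r using ak(3) F(1) by (simp add: A_def K_def)
 define G where "G m r = (if C \<inter> (\<Inter>n\<le>m. K n r) = {} then {} else (\<Inter>n\<le>m. A n r))" for m r
 show ?thesis
 proof (rule suslinI[of G])
  show "G n r \<in> sets N" for n r
   unfolding G_def using ak(1) F(1) by (auto simp: A_def intro!: sets.finite_INT)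
  show "G m r = G m t" if "!!j. j < m ==> r j = t j" for m r t
  proof -
   have "F n r = F n t" if "n \<le> m" for n using that \<open>!!j. j < m ==> r j = t j\<close> by (intro F(2)) auto
   thus ?thesis by (simp add: G_def A_def K_def cong: INF_cong_simp)
  qed
  let ?X = "{p. \<exists>r. \<forall>n. p \<in> G n r}"
  show "fst ` S = ?X"
  proof (intro equalityI subsetI)
   fix p assume "p \<in> fst ` S"
   then obtain x where x: "(p, x) \<in> S" by auto
   hence "x \<in> C" using bd by auto
   from x obtain r where "!!n. (p, x) \<in> F n r" unfolding F(3) by auto
   hence "p \<in> A n r" "x \<in> K n r" for n unfolding FA by auto
   thus "p \<in> ?X" using \<open>x \<in> C\<close> by (auto simp: G_def intro!: exI[of _ r])
  next
   fix p assume "p \<in> ?X"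
   then obtain r where r: "!!n. p \<in> G n r" by auto
   have ne: "C \<inter> (\<Inter>n\<le>m. K n r) \<noteq> {}" for m using r[of m] by (auto simp: G_def split: if_splits)
   have "\<Inter>(range (%m. C \<inter> (\<Inter>n\<le>m. K n r))) \<noteq> {}"
   proof (rule compact_nest)
    show "compact (C \<inter> (\<Inter>n\<le>m. K n r))" for m
     using C ak(2) F(1) by (intro compact_Int_closed closed_INT) (auto simp: K_def)
    show "C \<inter> (\<Inter>n\<le>m. K n r) \<subseteq> C \<inter> (\<Inter>n\<le>m'. K n r)" if "m' \<le> m" for m m' using that by force
   qed (rule ne)
   then obtain x where x: "!!n. x \<in> K n r" by auto
   moreover have "p \<in> A n r" for n using r[of n] ne by (auto simp: G_def)
   ultimately show "p \<in> fst ` S" unfolding F(3) FA by force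
  qed
 qed
qed

text \<open>Cutting the second coordinate to balls supplies the compactness for
  \<open>suslin_fst\<close>.\<close>

theorem measurable_projection:
 fixes S :: "('b \<times> 'c::euclidean_space) set"
 assumes M: "finite_measure M" and S: "S \<in> sets (M \<Otimes>\<^sub>M borel)"
 shows "fst ` S \<in> sets (completion M)"
proof -
 let ?X = "%n. space M \<times> cball 0 (real n)"
 have "fst ` (S \<inter> (?X n)) \<in> sets (completion M)" for n
  by (auto intro!: suslin_completion M suslin_fst S pair_sets_suslin compact_cball)
 moreover have "fst ` S = (\<Union>n. fst ` (S \<inter> (?X n)))"
 proof -
  have "\<exists>n. (p, x) \<in> S \<inter> (?X n)" if "(p, x) \<in> S" for p x
   using that sets.sets_into_space[OF S] real_arch_simple[of "norm x"] by (auto simp: space_pair_measure)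
  thus ?thesis by (force simp: image_iff)
 qed
 ultimately show ?thesis by auto
qed

text \<open>A superlevel set of the supremum is the projection of a superlevel set of
  \<open>g\<close>. This covers suprema over uncountable sets of functions without any
  continuity.\<close>

lemma borel_measurable_SUP_completion:
 fixes g :: "'b => 'c::euclidean_space => ennreal"
 assumes M: "finite_measure M" and A: "A \<in> sets borel"
 and g: "(%(p, x). g p x) \<in> bmeas (M \<Otimes>\<^sub>M borel)"
 shows "(%p. SUP x\<in>A. g p x) \<in> bmeas (completion M)"
proof (rule borel_measurableI_greater, goal_cases)
 case (1 a)
 let ?X = "{px \<in> space (M \<Otimes>\<^sub>M borel). a < (case px of (p, x) => g p x)}"
 have "?X \<inter> (space M \<times> A) \<in> sets (M \<Otimes>\<^sub>M borel)" using g A by measurable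
 from measurable_projection[OF M this]
 have "fst ` (?X \<inter> (space M \<times> A)) \<in> sets (completion M)" .
 also have "fst ` (?X \<inter> (space M \<times> A)) = {p \<in> space (completion M). a < (SUP x\<in>A. g p x)}"
  by (auto simp: space_pair_measure less_SUP_iff image_iff) force
 finally show ?case .
qed

lemma borel_measurable_INF_completion:
 fixes g :: "'b => 'c::euclidean_space => ennreal"
 assumes M: "finite_measure M" and A: "A \<in> sets borel"
 and g: "(%(p, x). g p x) \<in> bmeas (M \<Otimes>\<^sub>M borel)"
 shows "(%p. INF x\<in>A. g p x) \<in> bmeas (completion M)"
proof (rule borel_measurableI_less, goal_cases)
 case (1 a)
 let ?X = "{px \<in> space (M \<Otimes>\<^sub>M borel). (case px of (p, x) => g p x) < a}"
 have "?X \<inter> (space M \<times> A) \<in> sets (M \<Otimes>\<^sub>M borel)" using g A by measurable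
 from measurable_projection[OF M this]
 have "fst ` (?X \<inter> (space M \<times> A)) \<in> sets (completion M)" .
 also have "fst ` (?X \<inter> (space M \<times> A)) = {p \<in> space (completion M). (INF x\<in>A. g p x) < a}"
  by (auto simp: space_pair_measure INF_less_iff image_iff) force
 finally show ?case .
qed

section \<open>A moment criterion for the Lorentz space\<close>

text \<open>Markov's inequality for the moment of order \<open>d + 1\<close> bounds the
  rearrangement by \<open>(C / s) powr (1 / (d + 1))\<close>. Against the weight of the Lorentz norm
  this leaves the exponent \<open>1 / d - 1 - 1 / (d + 1) > - 1\<close>, which is integrable at
  0.\<close>

lemma lorentz_spaceI:
 fixes f :: "'b => real"
 assumes M: "prob_space M" and f[measurable]: "f \<in> bmeas M" and d: "0 < d"
 and int: "integrable M (%x. \<bar>f x\<bar> ^ Suc d)"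
 shows "f \<in> lorentz_space M d"
proof -
 interpret prob_space M by fact
 let ?N = "distr M borel (%x. \<bar>f x\<bar>)" and ?L = "restrict_space lborel {0<..<1::real}"
 interpret N: cdf_distribution ?N
  unfolding cdf_distribution_def by (rule real_distribution_distr) simp
 define S where "S t = 1 - N.C t" for t
 \<comment> \<open>\<open>N.I\<close> is the quantile function of \<open>\<bar>f\<bar>\<close>; read
   from 1 downwards it decreases, and \<open>galois\<close> below ties it to the tail
   \<open>S\<close>.\<close>
 define g where "g s = N.I (1 - s)" for s
 have S: "S t = prob {x \<in> space M. t < \<bar>f x\<bar>}" for t
 proof -
  have "{x \<in> space M. t < \<bar>f x\<bar>} = space M - {x \<in> space M. \<bar>f x\<bar> \<le> t}" by auto
  moreover have "N.C t = prob {x \<in> space M. \<bar>f x\<bar> \<le> t}"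
   by (simp add: cdf_def measure_distr vimage_def Int_def conj_commute)
  ultimately show ?thesis by (simp add: prob_compl S_def)
 qed
 have galois: "g s \<le> t \<longleftrightarrow> S t \<le> s" if "s \<in> {0<..<1}" for s t
  using N.pseudoinverse[of "1 - s" t] that by (auto simp: g_def S_def)
 have g0: "0 \<le> g s" if s: "s \<in> {0<..<1}" for s
 proof (rule ccontr)
  assume "\<not> 0 \<le> g s"
  hence "{x \<in> space M. g s < \<bar>f x\<bar>} = space M" by auto
  thus False using galois[OF s, of "g s"] s by (simp add: S prob_space)
 qed
 have S_mono: "S u \<le> S t" if "t \<le> u" for t u using N.mono that by (simp add: S_def mono_def)
 have meas: "g \<in> bmeas ?L"
 proof (rule borel_measurableI_le)
  fix t
  have "{s \<in> space ?L. g s \<le> t} = {0<..<1} \<inter> {S t..}" by (auto simp: space_restrict_space galois)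
  thus "{s \<in> space ?L. g s \<le> t} \<in> sets ?L" by (auto simp: sets_restrict_space)
 qed
 have mono: "monotone_on {0<..<1} (\<le>) (\<ge>) g"
 proof (rule monotone_onI)
  fix x y :: real assume "x \<in> {0<..<1}" "y \<in> {0<..<1}" "x \<le> y"
  thus "g y \<le> g x" using galois[of x "g x"] by (auto simp: galois)
 qed
 have cont: "continuous (at_right s) g" if s: "s \<in> {0<..<1}" for s unfolding continuous_within
 proof (rule order_tendstoI)
  have ev: "\<forall>\<^sub>F x in at_right s. x < u \<and> s < x \<and> x < 1" if "s < u" for u
   using s that by (auto simp: eventually_at_right_field intro!: exI[of _ "min u 1"])
  fix a
  show "\<forall>\<^sub>F x in at_right s. a < g x" if "a < g s"
  proof -
   have "s < S a" using galois[OF s, of a] that by simp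
   from ev[OF this] show ?thesis by eventually_elim (use s galois[of _ a] in \<open>auto simp flip: not_le\<close>)
  qed
  show "\<forall>\<^sub>F x in at_right s. g x < a" if "g s < a"
   using ev[of 1] s by (auto elim!: eventually_mono intro!: le_less_trans[OF monotone_onD[OF mono] that])
 qed
 interpret L: prob_space ?L
  by (rule prob_spaceI) (simp add: emeasure_restrict_space space_restrict_space)
 have "distr ?L borel g = ?N"
 proof (rule cdf_unique)
  show "real_distribution (distr ?L borel g)" by (rule L.real_distribution_distr) (rule meas)
  show "cdf (distr ?L borel g) = N.C"
  proof
   fix t
   have "cdf (distr ?L borel g) t = measure ?L ({S t..} \<inter> {0<..<1})"
    using meas by (auto simp: cdf_def measure_distr space_restrict_space galois intro!:
     arg_cong2[where f=measure])
   also have "... = measure lborel ({S t..} \<inter> {0<..<1})" by (subst measure_restrict_space) auto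
   also have "... = measure lborel {S t..1}"
   proof (rule measure_eq_AE)
    have "0 \<le> S t" by (simp add: S)
    show "AE s in lborel. s \<in> {S t..} \<inter> {0<..<1} \<longleftrightarrow> s \<in> {S t..1}"
     using AE_lborel_singleton[of "0::real"] AE_lborel_singleton[of "1::real"]
     by eventually_elim (use \<open>0 \<le> S t\<close> in auto)
   qed auto
   finally show "cdf (distr ?L borel g) t = N.C t" by (simp add: S_def N.cdf_nonneg)
  qed
 qed unfold_locales
 hence rearr: "decreasing_rearrangement M f g"
  unfolding decreasing_rearrangement_def using g0 mono cont by auto
 let ?G = "%x. \<bar>f x\<bar> ^ Suc d"
 \<comment> \<open>The summand 1 keeps \<open>C\<close> positive when \<open>f\<close> vanishes
   almost surely.\<close>
 define C where "C = expectation ?G + 1"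
 have C: "0 < C" unfolding C_def by (intro add_nonneg_pos integral_nonneg) auto
 define b where "b s = (C / s) powr (1 / (real d + 1))" for s
 have b: "g s \<le> b s" if s: "s \<in> {0<..<1}" for s
 proof -
  have b0: "0 < b s" using s C by (simp add: b_def)
  have "b s ^ Suc d = b s powr real (Suc d)" using b0 by (simp add: powr_realpow del: power_Suc of_nat_Suc)
  also have "... = C / s" using s C by (simp add: b_def powr_powr add.commute)
  finally have bs: "b s ^ Suc d = C / s" .
  have "S (b s) \<le> prob {x \<in> space M. b s ^ Suc d \<le> ?G x}"
   unfolding S using b0 by (intro finite_measure_mono) (auto intro!: power_mono mult_mono)
  also have "... \<le> expectation ?G / b s ^ Suc d"
   using b0 int by (intro integral_Markov_inequality_measure[where A="{}"]) auto
  also have "... \<le> s" unfolding bs using C s by (simp add: C_def field_simps)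
  finally show ?thesis using galois[OF s] by simp
 qed
 define a where "a = 1 / real d - 1 - 1 / (real d + 1)"
 have "1 / (real d + 1) < 1 / real d" using d by (intro divide_strict_left_mono) auto
 hence a: "-1 < a" by (simp add: a_def)
 let ?K = "C powr (1 / (real d + 1))"
 have "(\<integral>\<^sup>+ s\<in>{0<..<1}. en (g s * s powr (1 / real d - 1)) \<partial>lborel) \<le> (NINT s|lborel. en (if s \<in>
  {0..1} then ?K * s powr a else 0))"
 proof (rule nn_integral_mono, goal_cases)
  case (1 s)
  show ?case
  proof (cases "s \<in> {0<..<1}")
   case True
   hence "g s * s powr (1 / real d - 1) \<le> b s * s powr (1 / real d - 1)" using b by (intro
    mult_right_mono) auto
   also have "... = ?K * s powr a" using True C by (simp add: b_def powr_divide a_def powr_diff)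
   finally show ?thesis using True by (auto intro: ennreal_leI)
  qed auto
 qed
 also have "... = en (?K * (1 powr (a + 1) / (a + 1)))"
  using a by (intro nn_integral_has_integral_lborel)
  (auto simp only: has_integral_restrict_UNIV intro!: has_integral_mult_right
   has_integral_powr_from_0, auto)
 finally show ?thesis using rearr by (auto simp: lorentz_space_def le_less_trans)
qed

section \<open>Test functions and the bottom of the spectrum\<close>

text \<open>The negative powers of \<open>t\<close> make the family closed under differentiation, up
  to linear combinations over different \<open>n\<close>.\<close>

definition flat_exp :: "nat => real => real" where
 "flat_exp n t = (if 0 < t then exp (- (1 / t)) / t ^ n else 0)"

lemma flat_exp_nonneg: "0 \<le> flat_exp n t" by (simp add: flat_exp_def)

lemma power_div_fact_le_exp:
 fixes x :: real
 assumes "0 \<le> x"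
 shows "x ^ n / fact n \<le> exp x"
proof -
 let ?X = "%k. x ^ k /\<^sub>R fact k"
 have e: "?X sums exp x" by (rule exp_converges)
 have "sum ?X {n} \<le> (\<Sum>k. x ^ k /\<^sub>R fact k)"
  using assms by (intro sum_le_suminf sums_summable[OF e]) auto
 thus ?thesis using sums_unique[OF e] by (simp add: divide_inverse_commute)
qed

text \<open>The term of order \<open>n + 2\<close> of the exponential series at \<open>1 / t\<close>
  is enough. Quadratic decay yields derivative 0 at the origin, and the same bound controls the size
  of the test function.\<close>

lemma flat_exp_le: "flat_exp n t \<le> fact (n + 2) * t\<^sup>2"
proof (cases "0 < t")
 case True
 let ?X = "fact (n + 2) * t ^ (n + 2)"
 have "1 = (1 / t) ^ (n + 2) / fact (n + 2) * ?X"
  using True by (simp add: power_one_over del: fact_Suc power_Suc add_2_eq_Suc')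
 also have "... \<le> exp (1 / t) * ?X" using True by (intro mult_right_mono power_div_fact_le_exp) auto
 finally show ?thesis using True by (simp add: exp_minus inverse_eq_divide divide_le_eq mult.commute
  flat_exp_def power_add power2_eq_square mult_ac del: fact_Suc power_Suc add_2_eq_Suc')
qed (simp add: flat_exp_def)

lemma DERIV_flat_exp:
 "(flat_exp n has_real_derivative (- real n * flat_exp (n + 1) t + flat_exp (n + 2) t)) (at t)"
proof -
 consider "t < 0" | "t = 0" | "0 < t" by linarith
 thus ?thesis
 proof cases
  case 1
  have "(flat_exp n has_real_derivative 0) (at t)" by (rule
   has_field_derivative_transform_within_open[where S="{..<0}"]) (use 1 in \<open>auto simp:
   flat_exp_def\<close>)
  thus ?thesis using 1 by (simp add: flat_exp_def)
 next
  case 2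
  have "(flat_exp n has_real_derivative 0) (at 0)" unfolding has_field_derivative_iff
  proof (rule Lim_null_comparison)
   show "\<forall>\<^sub>F h in at 0. norm ((flat_exp n h - flat_exp n 0) / (h - 0)) \<le> fact (n + 2) * \<bar>h\<bar>"
   proof (rule always_eventually, rule allI, goal_cases)
    case (1 h)
    have "flat_exp n h \<le> fact (n + 2) * \<bar>h\<bar> * \<bar>h\<bar>" using flat_exp_le[of n h] by (simp add:
     power2_eq_square mult.assoc)
    thus ?case
     using flat_exp_nonneg[of n h] by (cases "h = 0") (auto simp: flat_exp_def[of n 0] divide_le_eq)
   qed
   show "((%h. fact (n + 2) * \<bar>h\<bar>) \<longlongrightarrow> 0) (at (0::real))" by (auto intro!: tendsto_eq_intros)
  qed
  thus ?thesis using 2 by (simp add: flat_exp_def)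
 next
  case 3
  let ?X = "exp (- (1 / t)) * (1 / t\<^sup>2) * t ^ n - exp (- (1 / t)) * (real n * t ^ (n - 1))"
  let ?Y = "%t. exp (- (1 / t)) / t ^ n"
  have "(?Y has_real_derivative ?X / (t ^ n * t ^ n)) (at t)"
   using 3 by (auto intro!: derivative_eq_intros simp: power2_eq_square)
  moreover have "?X / (t ^ n * t ^ n) = - real n * flat_exp (n + 1) t + flat_exp (n + 2) t"
   using 3 by (cases n) (auto simp: flat_exp_def field_simps power2_eq_square)
  ultimately have "(?Y has_real_derivative - real n * flat_exp (n + 1) t + flat_exp (n + 2) t) (at t)"
   by simp
  thus ?thesis
   by (rule has_field_derivative_transform_within_open[where S="{0<..}"]) (use 3 in \<open>auto simp:
    flat_exp_def\<close>)
 qed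
qed

text \<open>A class that contains the bump and is closed under directional derivatives, so that
  smoothness of every order is a single induction (\<open>bump_class_C_k\<close>).\<close>

inductive_set bump_class :: "real => 'a::euclidean_space => ('a => real) set" for a x0 where
 base: "(%x. flat_exp n (1 - (a *\<^sub>R (x - x0)) \<bullet> (a *\<^sub>R (x - x0)))) \<in> bump_class a x0"
 | scale: "f \<in> bump_class a x0 ==> (%x. c * f x) \<in> bump_class a x0"
 | add: "f \<in> bump_class a x0 ==> g \<in> bump_class a x0 ==> (%x. f x + g x) \<in> bump_class a x0"
 | coord: "f \<in> bump_class a x0 ==> (%x. ((a *\<^sub>R (x - x0)) \<bullet> b) * f x) \<in> bump_class a x0"

lemma bump_base_derivative:
 "((%x. flat_exp n (1 - (a *\<^sub>R (x - x0)) \<bullet> (a *\<^sub>R (x - x0)))) has_derivative (%h. (a *\<^sub>R (x - x0) \<bullet>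
  h) * ((- 2 * a) * (- real n * flat_exp (n + 1) (1 - (a *\<^sub>R (x - x0)) \<bullet> (a *\<^sub>R (x - x0))) +
  flat_exp (n + 2) (1 - (a *\<^sub>R (x - x0)) \<bullet> (a *\<^sub>R (x - x0))))))) (at x)"
proof -
 let ?Z = "%x. a *\<^sub>R (x - x0)"
 let ?s = "1 - (?Z x) \<bullet> (?Z x)"
 let ?X = "%x. 1 - (?Z x) \<bullet> (?Z x)"
 let ?Y = "%h. - 2 * a * (a *\<^sub>R (x - x0) \<bullet> h)"
 have "(?X has_derivative ?Y) (at x)"
  by (auto intro!: derivative_eq_intros simp: inner_commute algebra_simps)
 moreover have "(flat_exp n has_derivative (%h. h * (- real n * flat_exp (n + 1) ?s + flat_exp (n +
  2) ?s))) (at ?s)"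
  using DERIV_flat_exp[of n ?s] by (simp add: has_field_derivative_def mult_commute_abs)
 ultimately have "(flat_exp n \<circ> ?X has_derivative (%h. h * (- real n * flat_exp (n + 1) ?s +
  flat_exp (n + 2) ?s)) \<circ> ?Y) (at x)"
  by (rule diff_chain_at)
 from has_derivative_eq_rhs[OF this] show ?thesis by (simp add: comp_def fun_eq_iff algebra_simps)
qed

lemma bump_class_derivative:
 assumes "f \<in> bump_class a x0"
 shows "\<exists>D. (\<forall>x. (f has_derivative D x) (at x)) \<and> (\<forall>h. (%x. D x h) \<in> bump_class a x0)" using assms
proof induction
 case (base n)
 let ?Y = "%x. 1 - (a *\<^sub>R (x - x0)) \<bullet> (a *\<^sub>R (x - x0))"
 show ?case
  by (rule exI[of _ "%x h. (a *\<^sub>R (x - x0) \<bullet> h) * ((- 2 * a) * (- real n * flat_exp (n + 1) (?Y x) +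
   flat_exp (n + 2) (?Y x)))"])
  (intro conjI allI bump_base_derivative bump_class.intros)
next
 case (scale f c)
 then obtain D where D: "!!x. (f has_derivative D x) (at x)" "!!h. (%x. D x h) \<in> bump_class a x0" by auto
 show ?case
  by (rule exI[of _ "%x h. c * D x h"]) (auto intro!: D bump_class.intros derivative_intros)
next
 case (add f g)
 then obtain D E where D: "!!x. (f has_derivative D x) (at x)" "!!h. (%x. D x h) \<in> bump_class a x0"
  "!!x. (g has_derivative E x) (at x)" "!!h. (%x. E x h) \<in> bump_class a x0" by blast
 show ?case
  by (rule exI[of _ "%x h. D x h + E x h"]) (auto intro!: D bump_class.intros derivative_intros)
next
 case (coord f b)
 then obtain D where D: "!!x. (f has_derivative D x) (at x)" "!!h. (%x. D x h) \<in> bump_class a x0" by auto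
 let ?X = "%x b. (a *\<^sub>R (x - x0)) \<bullet> b"
 have "((%x. (?X x b) * f x) has_derivative (%h. (?X x b) * D x h + (a * (h \<bullet> b)) * f x)) (at x)" for x
  by (auto intro!: derivative_eq_intros D(1))
 moreover have "(%x. (?X x b) * D x h + (a * (h \<bullet> b)) * f x) \<in> bump_class a x0" for h
  by (intro bump_class.intros D coord)
 ultimately show ?case by (intro exI[of _ "%x h. (?X x b) * D x h + (a * (h \<bullet> b)) * f x"]) blast
qed

lemma bump_class_C_k: "f \<in> bump_class a x0 ==> C_k k f"
proof (induction k arbitrary: f)
 case 0
 then obtain D where "!!x. (f has_derivative D x) (at x)" using bump_class_derivative by blast
 thus ?case by (auto intro!: continuous_at_imp_continuous_on has_derivative_continuous)
next
 case (Suc k)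
 obtain D where D: "!!x. (f has_derivative D x) (at x)" "!!h. (%x. D x h) \<in> bump_class a x0"
  using bump_class_derivative[OF Suc.prems] by blast
 have "frechet_derivative f (at x) = D x" for x by (rule frechet_derivative_at[OF D(1), symmetric])
 thus ?case using D Suc.IH by (auto simp: differentiable_def)
qed

lemma flat_exp_0_mono: "s \<le> t ==> flat_exp 0 s \<le> flat_exp 0 t" by (auto simp: flat_exp_def frac_le)

text \<open>The bump is rescaled to the ball and normalised, so its energy is of order
  \<open>1 / R\<^sup>2\<close>. Origin of the constants: \<open>1152 = 2 * 24\<^sup>2\<close>, where
  \<open>24 = fact 4\<close> bounds \<open>E 2\<close>; \<open>2 ^ DIM('a)\<close> is the volume
  ratio of the balls of radius \<open>R\<close> and \<open>R / 2\<close>;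
  \<open>flat_exp 0 (3 / 4)\<close> is the least value of the bump on the smaller ball.\<close>

lemma bottom_spectrum_le_aux:
 fixes x0 :: "'a::euclidean_space"
 assumes R: "0 < R" and v: "!!x. x \<in> ball x0 R ==> v x \<le> \<epsilon>"
 shows "bottom_spectrum v \<le> en (1152 * 2 ^ DIM('a) / (flat_exp 0 (3 / 4))\<^sup>2 / R\<^sup>2) + \<epsilon>"
proof -
 define a where "a = 1 / R"
 have a: "0 < a" using R by (simp add: a_def)
 define y where "y x = a *\<^sub>R (x - x0)" for x
 define E where "E n x = flat_exp n (1 - y x \<bullet> y x)" for n x
 have E0: "0 \<le> E n x" for n x by (simp add: E_def flat_exp_nonneg)
 have ny: "norm (y x) = dist x0 x / R" for x using R by (simp add: y_def a_def dist_norm norm_minus_commute)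
 have out: "E n x = 0" if "x \<notin> ball x0 R" for n x
 proof -
  have "1 \<le> norm (y x)" unfolding ny using that R by simp
  hence "1 \<le> (norm (y x))\<^sup>2" by (rule one_le_power)
  thus ?thesis by (simp add: E_def flat_exp_def dot_square_norm)
 qed
 have bd: "E n x \<le> fact (n + 2) * ind (ball x0 R) x" for n x
 proof (cases "x \<in> ball x0 R")
  case True
  hence "norm (y x) \<le> 1" unfolding ny using R by simp
  hence "(1 - y x \<bullet> y x)\<^sup>2 \<le> 1\<^sup>2" by (intro power_mono) (auto simp: dot_square_norm power_le_one)
  hence "fact (n + 2) * (1 - y x \<bullet> y x)\<^sup>2 \<le> fact (n + 2) * 1" by (intro mult_left_mono) auto
  from order_trans[OF flat_exp_le this] show ?thesis using True by (simp only: E_def mult_1_right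
   indicator_simps)
 next
  case False
  show ?thesis unfolding out[OF False] by simp
 qed
 define m where "m = flat_exp 0 (3 / 4)"
 have m: "0 < m" by (simp add: m_def flat_exp_def)
 have low: "m \<le> E 0 x" if "x \<in> ball x0 (R / 2)" for x
 proof -
  have "(norm (y x))\<^sup>2 \<le> (1 / 2)\<^sup>2" unfolding ny using that R by (intro power_mono) auto
  thus ?thesis unfolding m_def E_def by (intro flat_exp_0_mono) (simp add: dot_square_norm power_divide)
 qed
 have \<psi>: "E 0 \<in> bump_class a x0" unfolding E_def[abs_def] y_def by (rule bump_class.base)
 have [measurable]: "E 0 \<in> bmeas borel"
  using bump_class_C_k[OF \<psi>, of 0] by (intro borel_measurable_continuous_onI) simp
 define B where "B = unit_ball_vol (real DIM('a)) * (R / 2) ^ DIM('a)"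
 have B: "0 < B" using R by (simp add: B_def)
 have vol: "emeasure lborel (ball x0 (R / 2)) = en B" "emeasure lborel (ball x0 R) = en (2 ^ DIM('a) * B)"
  using R by (auto simp: emeasure_ball B_def power_divide)
 define J where "J = (NINT x|lborel. en ((E 0 x)\<^sup>2))"
 have "J \<le> (NINT x|lborel. en 4 * ind (ball x0 R) x)" unfolding J_def
 proof (rule nn_integral_mono, goal_cases)
  case (1 x)
  have "(E 0 x)\<^sup>2 \<le> (2 * ind (ball x0 R) x)\<^sup>2" using bd[of 0 x] by (intro power_mono) (auto simp: E0
   numeral_2_eq_2)
  thus ?case using ennreal_leI[of "(E 0 x)\<^sup>2" 4] by (auto simp: indicator_def)
 qed
 also have "... < \<infinity>" by (simp add: nn_integral_cmult_indicator vol ennreal_mult_less_top)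
 finally obtain N where N: "J = en N" "0 \<le> N" by (cases J) auto
 have "en (m\<^sup>2 * B) = (NINT x|lborel. en (m\<^sup>2) * ind (ball x0 (R / 2)) x)"
  using B by (simp add: nn_integral_cmult_indicator vol ennreal_mult)
 also have "... \<le> J"
  unfolding J_def using low m by (intro nn_integral_mono) (auto simp: indicator_def power_mono ennreal_leI)
 finally have mN: "m\<^sup>2 * B \<le> N" using N by (simp add: ennreal_le_iff)
 have "0 < m\<^sup>2 * B" using m B by simp
 hence N0: "0 < N" using mN by simp
 define c where "c = 1 / sqrt N"
 have c: "c\<^sup>2 = 1 / N" using N0 by (simp add: c_def power_divide)
 define \<phi> where "\<phi> x = c * E 0 x" for x
 have [measurable]: "\<phi> \<in> bmeas borel" unfolding \<phi>_def by measurable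
 have \<phi>_out: "\<phi> x = 0" if "x \<notin> ball x0 R" for x using out[OF that] by (simp add: \<phi>_def)
 have "closure {x. \<phi> x \<noteq> 0} \<subseteq> cball x0 R"
 proof (intro closure_minimal subsetI closed_cball, goal_cases)
  case (1 x)
  thus ?case using \<phi>_out[of x] by (cases "x \<in> ball x0 R") auto
 qed
 hence "compact (closure {x. \<phi> x \<noteq> 0})"
  using bounded_subset compact_eq_bounded_closed bounded_cball by blast
 hence test: "\<phi> \<in> test_functions"
  using bump_class_C_k[OF bump_class.scale[OF \<psi>, of c]] by (auto simp: test_functions_def \<phi>_def[abs_def])
 let ?Z = "(NINT x|lborel. en ((\<phi> x)\<^sup>2))"
 have "?Z = en (c\<^sup>2) * J"
  unfolding J_def by (subst nn_integral_cmult[symmetric]) (auto simp: \<phi>_def power_mult_distrib ennreal_mult)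
 hence nn1: "?Z = 1" using N0 by (simp add: c N flip: ennreal_mult)
 hence norm1: "(LINT x|lborel. (\<phi> x)\<^sup>2) = 1" by (subst integral_eq_nn_integral) auto
 have grad: "gradient \<phi> x = (c * (- 2 * a) * E 2 x) *\<^sub>R y x" for x
 proof -
  let ?D = "(c * (- 2 * a) * E 2 x) *\<^sub>R y x"
  have gd: "GDERIV \<phi> x :> ?D"
   using has_derivative_mult_right[OF bump_base_derivative[of 0 a x0 x], of c]
   by (simp add: gderiv_def \<phi>_def[abs_def] E_def y_def inner_commute algebra_simps numeral_2_eq_2)
  show ?thesis unfolding gradient_def
  proof (intro the_equality gd, goal_cases)
   case (1 D)
   with gd have "(%h. h \<bullet> D) = (%h. h \<bullet> ?D)" unfolding gderiv_def by (rule has_derivative_unique[rotated])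
   thus ?case by (metis vector_eq_ldot)
  qed
 qed
 let ?Y = "1152 * a\<^sup>2 / N"
 have g: "1 / 2 * (norm (gradient \<phi> x))\<^sup>2 \<le> ?Y * ind (ball x0 R) x" for x
 proof (cases "x \<in> ball x0 R")
  case True
  have "norm (y x) * E 2 x \<le> 1 * 24"
   using True R bd[of 2 x] by (intro mult_mono) (auto simp: ny E0 fact_numeral)
  hence "(norm (y x) * E 2 x)\<^sup>2 \<le> 24\<^sup>2" by (intro power_mono) (auto simp: E0)
  hence "(2 * a\<^sup>2 / N) * (norm (y x) * E 2 x)\<^sup>2 \<le> (2 * a\<^sup>2 / N) * 24\<^sup>2" using N by (intro
   mult_left_mono) auto
  moreover have "1 / 2 * (norm (gradient \<phi> x))\<^sup>2 = (2 * a\<^sup>2 / N) * (norm (y x) * E 2 x)\<^sup>2"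
   unfolding grad norm_scaleR[of "c * (- 2 * a) * E 2 x"] by (simp add: power_mult_distrib c mult_ac)
  ultimately show ?thesis using True by simp
 qed (simp add: grad out)
 let ?X = "%x. 1 / 2 * (norm (gradient \<phi> x))\<^sup>2"
 have "en (?X x) + v x * en ((\<phi> x)\<^sup>2) \<le> en ?Y * ind (ball x0 R) x + \<epsilon> * en ((\<phi> x)\<^sup>2)" for x
 proof (rule add_mono)
  have "en (?X x) \<le> en (1152 * a\<^sup>2 / N * ind (ball x0 R) x)" by (rule ennreal_leI[OF g])
  thus "en (?X x) \<le> en ?Y * ind (ball x0 R) x" by (auto simp: indicator_def)
  show "v x * en ((\<phi> x)\<^sup>2) \<le> \<epsilon> * en ((\<phi> x)\<^sup>2)"
   using v \<phi>_out[of x] by (cases "x \<in> ball x0 R") (auto intro!: mult_right_mono)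
 qed
 hence "(NINT x|lborel. en (?X x) + v x * en ((\<phi> x)\<^sup>2)) \<le> (NINT x|lborel. en ?Y * ind (ball x0 R) x
  + \<epsilon> * en ((\<phi> x)\<^sup>2))"
  by (rule nn_integral_mono)
 also have "... = en ?Y * en (2 ^ DIM('a) * B) + \<epsilon>"
  by (subst nn_integral_add) (auto simp: nn_integral_cmult_indicator nn_integral_cmult nn1 vol
   intro!: borel_measurable_times_ennreal borel_measurable_indicator)
 also have "en ?Y * en (2 ^ DIM('a) * B) \<le> en (1152 * 2 ^ DIM('a) / m\<^sup>2 / R\<^sup>2)"
 proof -
  have "B / N \<le> 1 / m\<^sup>2" using mN N0 m by (simp add: divide_simps mult.commute)
  hence "1152 * 2 ^ DIM('a) * a\<^sup>2 * (B / N) \<le> 1152 * 2 ^ DIM('a) * a\<^sup>2 * (1 / m\<^sup>2)" by (intro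
   mult_left_mono) auto
  thus ?thesis using B by (subst ennreal_mult''[symmetric]) (auto intro!: ennreal_leI simp: a_def
   power_divide mult_ac)
 qed
 moreover have "bottom_spectrum v \<le> (NINT x|lborel. en (?X x) + v x * en ((\<phi> x)\<^sup>2))"
  unfolding bottom_spectrum_def using test norm1 by (intro INF_lower) auto
 ultimately show ?thesis unfolding m_def by (auto intro: order_trans add_right_mono)
qed

lemma bottom_spectrum_eq_0:
 fixes v :: "'a::euclidean_space => ennreal"
 assumes v: "!!n::nat. \<exists>x0. \<forall>x\<in>ball x0 (Suc n). v x \<le> en (1 / Suc n)"
 shows "bottom_spectrum v = 0"
proof -
 define K where "K = 1152 * 2 ^ DIM('a) / (flat_exp 0 (3 / 4))\<^sup>2"
 have "bottom_spectrum v \<le> en (K / (real (Suc n))\<^sup>2 + 1 / real (Suc n))" for n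
 proof -
  obtain x0 where "\<forall>x\<in>ball x0 (Suc n). v x \<le> en (1 / Suc n)" using v by blast
  hence "bottom_spectrum v \<le> en (K / (real (Suc n))\<^sup>2) + en (1 / Suc n)"
   unfolding K_def by (intro bottom_spectrum_le_aux) auto
  thus ?thesis by (simp add: ennreal_plus K_def)
 qed
 moreover have "(%n. en (K / (real (Suc n))\<^sup>2 + 1 / real (Suc n))) ----> en 0"
  by (intro tendsto_ennrealI) real_asymp
 ultimately have "bottom_spectrum v \<le> en 0" by (intro LIMSEQ_le_const) auto
 thus ?thesis by simp
qed

section \<open>Kingman's subadditive ergodic theorem\<close>

definition preserves :: "'b measure => ('b => 'b) => bool" where
 "preserves M T \<longleftrightarrow> T \<in> M \<rightarrow>\<^sub>M M \<and> distr M M T = M"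

lemma preserves_measurable: "preserves M T ==> T \<in> M \<rightarrow>\<^sub>M M" by (simp add: preserves_def)

lemma preserves_funpow: "preserves M T ==> preserves M (T ^^ n)"
proof (induction n)
 case 0
 thus ?case by (simp add: preserves_def distr_id2)
next
 case (Suc n)
 hence "distr M M (T \<circ> (T ^^ n)) = distr (distr M M (T ^^ n)) M T"
  by (intro distr_distr[symmetric]) (auto simp: preserves_def)
 also have "... = M" using Suc by (simp add: preserves_def)
 finally show ?case
  using Suc measurable_comp[of "T ^^ n" M M T M] unfolding preserves_def funpow.simps by blast
qed

lemma preserves_emeasure:
 assumes "preserves M T" "A \<in> sets M"
 shows "emeasure M (T -` A \<inter> space M) = emeasure M A"
 using assms by (metis emeasure_distr preserves_def)

lemma preserves_AE:
 assumes T: "preserves M T" and "AE x in M. Q x"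
 shows "AE x in M. Q (T x)"
proof -
 have m: "T \<in> M \<rightarrow>\<^sub>M M" and d: "distr M M T = M" using T by (auto simp: preserves_def)
 have "AE x in distr M M T. Q x" unfolding d by fact
 thus ?thesis by (rule AE_distrD[OF m])
qed

lemma preserves_integrable:
 fixes f :: "'b => real"
 assumes T: "preserves M T" and f: "integrable M f"
 shows "integrable M (%x. f (T x))" "(LINT x|M. f (T x)) = (LINT x|M. f x)"
proof -
 have m: "T \<in> M \<rightarrow>\<^sub>M M" and d: "distr M M T = M" using T by (auto simp: preserves_def)
 have fm: "f \<in> bmeas M" using f by simp
 show "integrable M (%x. f (T x))" using integrable_distr_eq[OF m fm] f unfolding d by simp
 show "(LINT x|M. f (T x)) = (LINT x|M. f x)" using integral_distr[OF m fm] unfolding d by simp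
qed

lemma funpow_add_apply: "(T ^^ (m + n)) x = (T ^^ n) ((T ^^ m) x)"
 by (metis add.commute comp_apply funpow_add)

text \<open>The indices are scanned from the left: from a counted index the scan jumps over a block
  of length \<open>k\<close> whose sum exceeds \<open>r * k\<close>, past any other index it moves
  by one. The blocks are disjoint, contain at most their length of counted indices, and overshoot
  the window by at most \<open>n\<close>.\<close>

lemma maximal_covering:
 fixes g :: "nat => real" and r :: real
 assumes g: "!!i. 0 \<le> g i" and r: "0 \<le> r"
 shows "r * card {j\<in>{a..<a + m}. \<exists>k\<in>{1..n}. r * k < (\<Sum>i=j..<j + k. g i)} \<le> (\<Sum>i=a..<a + m + n. g i)"
proof (induction m arbitrary: a rule: less_induct)
 case (less m)
 let ?E = "%j. \<exists>k\<in>{1..n}. r * k < (\<Sum>i=j..<j + k. g i)"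
 let ?N = "%a m. real (card {j\<in>{a..<a + m}. ?E j})"
 show ?case
 proof (cases "m = 0")
  case True
  thus ?thesis by (simp add: sum_nonneg g)
 next
  case False
  let ?Y = "\<Sum>i=a..<a + m + n. g i"
  show ?thesis
  proof (cases "?E a")
   case False
   have "{j\<in>{a..<a + m}. ?E j} = {j\<in>{Suc a..<Suc a + (m - 1)}. ?E j}"
    using False \<open>m \<noteq> 0\<close> by (auto simp: Suc_le_eq order.order_iff_strict)
   hence "r * ?N a m \<le> (\<Sum>i=Suc a..<Suc a + (m - 1) + n. g i)"
    using less[of "m - 1" "Suc a"] \<open>m \<noteq> 0\<close> by simp
   also have "... \<le> ?Y" using \<open>m \<noteq> 0\<close> by (intro sum_mono2) (auto simp: g)
   finally show ?thesis .
  next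
   case True
   then obtain k where k: "1 \<le> k" "k \<le> n" "r * k < (\<Sum>i=a..<a + k. g i)" by auto
   show ?thesis
   proof (cases "k < m")
    case False
    have "{j\<in>{a..<a + m}. ?E j} \<subseteq> {a..<a + m}" by blast
    from card_mono[OF _ this] have "r * ?N a m \<le> r * k" using False r by (intro mult_left_mono) auto
    also have "... \<le> (\<Sum>i=a..<a + k. g i)" using k by simp
    also have "... \<le> ?Y" using k by (intro sum_mono2) (auto simp: g)
    finally show ?thesis .
   next
    case True
    let ?X = "{j\<in>{a + k..<a + k + (m - k)}. ?E j}"
    have "card {j\<in>{a..<a + m}. ?E j} \<le> card ({a..<a + k} \<union> ?X)" using True by (intro card_mono) auto
    also have "... \<le> k + card ?X" using card_Un_le[of "{a..<a + k}"] by simp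
    finally have "r * ?N a m \<le> r * (k + ?N (a + k) (m - k))"
     using r by (intro mult_left_mono) linarith+
    also have "... = r * k + r * ?N (a + k) (m - k)" by (simp add: distrib_left)
    also have "... \<le> (\<Sum>i=a..<a + k. g i) + (\<Sum>i=a + k..<a + k + (m - k) + n. g i)"
     using k True less[of "m - k" "a + k"] by (intro add_mono) auto
    also have "... = ?Y" using True by (subst sum.atLeastLessThan_concat) auto
    finally show ?thesis .
   qed
  qed
 qed
qed

text \<open>The covering estimate is integrated along a stationary orbit of length \<open>m\<close>.
  The overshoot costs the factor \<open>1 + n / m\<close>, which disappears as \<open>m\<close>
  grows.\<close>

lemma maximal_inequality:
 fixes f :: "'b => real"
 assumes M: "prob_space M" and T: "preserves M T" and f: "integrable M f" "!!x. 0 \<le> f x" and r: "0 < r"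
 shows "measure M {x \<in> space M. \<exists>n\<ge>1. r * real n < (\<Sum>i<n. f ((T ^^ i) x))} \<le> integral\<^sup>L M f / r"
proof -
 interpret prob_space M by fact
 have Tm[measurable]: "T ^^ i \<in> M \<rightarrow>\<^sub>M M" for i
  using preserves_measurable[OF preserves_funpow[OF T]] .
 have [measurable]: "f \<in> bmeas M" using f by simp
 let ?E = "%n. {x \<in> space M. \<exists>k\<in>{1..n}. r * real k < (\<Sum>i<k. f ((T ^^ i) x))}"
 have E[measurable]: "?E n \<in> sets M" for n by measurable
 let ?X = "integral\<^sup>L M f / r"
 have bound: "prob (?E n) \<le> (1 + real n / real m) * ?X" if m: "0 < m" for n m
 proof -
  have iE: "integrable M (ind (?E n) :: 'b => real)"
   by (intro integrable_real_indicator E) (auto simp: less_top[symmetric])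
  note jE = preserves_integrable[OF preserves_funpow[OF T] iE]
  let ?Y = "(LINT x|M. r * (\<Sum>j<m. ind (?E n) ((T ^^ j) x)))"
  let ?Z = "(LINT x|M. (\<Sum>i<m + n. f ((T ^^ i) x)))"
  have "?Y \<le> ?Z"
  proof (rule integral_mono)
   show "integrable M (%x. r * (\<Sum>j<m. ind (?E n) ((T ^^ j) x)))"
    by (intro integrable_mult_right Bochner_Integration.integrable_sum jE)
   show "integrable M (%x. \<Sum>i<m + n. f ((T ^^ i) x))"
    using preserves_integrable(1)[OF preserves_funpow[OF T] f(1)] by (intro
     Bochner_Integration.integrable_sum)
   fix x assume x: "x \<in> space M"
   have sp: "(T ^^ j) x \<in> space M" for j using measurable_space[OF Tm x] .
   have "(\<Sum>j<m. ind (?E n) ((T ^^ j) x)) = (\<Sum>j<m. of_bool (\<exists>k\<in>{1..n}. r * k < (\<Sum>i=j..<j + k. f ((T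
    ^^ i) x))) :: real)"
   proof (rule sum.cong, goal_cases)
    case (2 j)
    have "(\<Sum>i<k. f ((T ^^ i) ((T ^^ j) x))) = (\<Sum>i=j..<j + k. f ((T ^^ i) x))" for k
     by (rule sum.reindex_bij_witness[of _ "%i. i - j" "%i. i + j"]) (auto simp: funpow_add)
    thus ?case using sp by (simp add: indicator_def)
   qed simp
   also have "... = card {j\<in>{0..<0 + m}. \<exists>k\<in>{1..n}. r * k < (\<Sum>i=j..<j + k. f ((T ^^ i) x))}"
    by (simp add: of_bool_def sum.If_cases lessThan_atLeast0 Int_def conj_commute)
   finally show "r * (\<Sum>j<m. ind (?E n) ((T ^^ j) x)) \<le> (\<Sum>i<m + n. f ((T ^^ i) x))"
    using maximal_covering[of "%i. f ((T ^^ i) x)" r 0 m n] f(2) r by (simp add: lessThan_atLeast0)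
  qed
  also have "?Z = (m + n) * integral\<^sup>L M f"
   using preserves_integrable[OF preserves_funpow[OF T] f(1)] by (subst
    Bochner_Integration.integral_sum) auto
  also have "?Y = r * (m * prob (?E n))"
   using jE by (subst integral_mult_right_zero, subst Bochner_Integration.integral_sum) auto
  finally show ?thesis using m r by (simp add: field_simps)
 qed
 have "prob (?E n) \<le> integral\<^sup>L M f / r" for n
 proof (rule LIMSEQ_le_const)
  let ?U = "%m. (1 + real n / real m) * ?X"
  have "?U ----> (1 + 0) * ?X" by (intro tendsto_intros)
  thus "?U ----> integral\<^sup>L M f / r" by simp
  show "\<exists>N. \<forall>m\<ge>N. prob (?E n) \<le> (1 + real n / real m) * ?X" using bound by (intro exI[of _ 1]) auto
 qed
 moreover have "(%n. prob (?E n)) ----> prob (\<Union>n. ?E n)"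
  by (rule finite_Lim_measure_incseq) (auto simp: incseq_def intro: order_trans)
 ultimately have "prob (\<Union>n. ?E n) \<le> integral\<^sup>L M f / r" by (blast intro: LIMSEQ_le_const2)
 also have "(\<Union>n. ?E n) = {x \<in> space M. \<exists>n\<ge>1. r * real n < (\<Sum>i<n. f ((T ^^ i) x))}"
  by (auto, metis atLeastAtMost_iff One_nat_def le_refl)
 finally show ?thesis .
qed

lemma integral_truncated_tendsto_0:
 fixes f :: "'b => real"
 assumes f: "integrable M f" "!!x. 0 \<le> f x" and B[measurable]: "!!n. B n \<in> sets M"
 and ev: "AE x in M. eventually (%n. x \<notin> B n) sequentially"
 shows "(%n. (LINT x|M. f x * ind (B n) x)) ----> 0"
proof -
 have "(%n. (LINT x|M. f x * ind (B n) x)) ----> (LINT x|M. 0)"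
 proof (rule integral_dominated_convergence[where w=f])
  show "AE x in M. (%n. f x * ind (B n) x) ----> 0" using ev
  proof eventually_elim
   case (elim x)
   hence "eventually (%n. f x * ind (B n) x = 0) sequentially" by eventually_elim simp
   thus ?case by (rule tendsto_eventually)
  qed
 qed (use f in \<open>auto simp: indicator_def\<close>)
 thus ?thesis by simp
qed

lemma AE_if_small_measure:
 assumes M: "prob_space M" and D: "D \<in> sets M" and e: "e ----> 0" and le: "!!n. measure M D \<le> e n"
 shows "AE x in M. x \<notin> D"
proof -
 interpret prob_space M by fact
 have "prob D \<le> 0" using e le by (intro LIMSEQ_le_const[of e]) auto
 hence "emeasure M D = 0" using measure_nonneg[of M D] by (simp add: emeasure_eq_measure)
 thus ?thesis using D by (intro AE_not_in) auto
qed

text \<open>By stationarity the expected sum of the squares is the second moment of \<open>f\<close>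
  times the convergent series of \<open>1 / n\<^sup>2\<close>; so the squares are almost surely
  summable.\<close>

lemma stationary_over_n_tendsto_0:
 fixes f :: "'b => real"
 assumes T: "preserves M T" and f: "f \<in> bmeas M" "integrable M (%x. (f x)\<^sup>2)" "!!x. 0 \<le> f x"
 shows "AE x in M. (%n. f ((T ^^ n) x) / real n) ----> 0"
proof -
 let ?g = "%n x. (f ((T ^^ n) x) / real n)\<^sup>2"
 let ?X = "(LINT x|M. (f x)\<^sup>2)"
 have i: "integrable M (?g n)" "(LINT x|M. ?g n x) = ?X * (1 / real n ^ 2)" for n
  using preserves_integrable[OF preserves_funpow[OF T] f(2), of n] by (auto simp: power_divide)
 have "(NINT x|M. (\<Sum>n. en (?g n x))) = (\<Sum>n. (NINT x|M. en (?g n x)))"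
  by (rule nn_integral_suminf) (use i(1) in auto)
 also have "... = (\<Sum>n. en (?X * (1 / real n ^ 2)))"
  by (subst nn_integral_eq_integral[OF i(1)]) (auto simp: i(2))
 also have "... \<noteq> \<infinity>"
  using inverse_power_summable[of 2, where 'a=real] unfolding infinity_ennreal_def
  by (intro ennreal_suminf_neq_top summable_mult) (auto simp: inverse_eq_divide)
 finally have "AE x in M. (\<Sum>n. en (?g n x)) \<noteq> \<infinity>" by (intro nn_integral_PInf_AE) (use i(1) in auto)
 thus ?thesis
 proof eventually_elim
  case (elim x)
  have "summable (%n. ?g n x)" using elim by (intro summable_suminf_not_top) auto
  from tendsto_real_sqrt[OF summable_LIMSEQ_zero[OF this]] show ?case using f(3) by simp
 qed
qed

text \<open>A walk from \<open>k\<close> to \<open>k + m\<close>: if a block of length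
  \<open>l \<le> N\<close> costs at most \<open>l * c\<close> and still fits, it is taken. Otherwise
  one step is taken, paid by \<open>w\<close> or, within the last \<open>N\<close> places, by the
  second sum.\<close>

lemma subadditive_covering:
 fixes Y :: "nat => nat => real"
 assumes Y: "!!k m n. Y k (m + n) \<le> Y k m + Y (k + m) n" "!!k. Y k 0 = 0" "!!k n. 0 \<le> Y k n" and c: "0 \<le> c"
 and w: "!!k. 0 \<le> w k" "!!k. (\<forall>l\<in>{1..N}. real l * c < Y k l) ==> w k = Y k 1"
 shows "Y k m \<le> m * c + (\<Sum>j\<in>{k..<k + m}. w j) + (\<Sum>j\<in>{j\<in>{k..<k + m}. k + m \<le> j + N}. Y j 1)"
proof (induction m arbitrary: k rule: less_induct)
 case (less m)
 let ?R = "%k m. \<Sum>j\<in>{j\<in>{k..<k + m}. k + m \<le> j + N}. Y j 1"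
 show ?case
 proof (cases "m = 0")
  case True
  thus ?thesis by (simp add: Y)
 next
  case False
  have "(\<exists>l\<in>{1..N}. l \<le> m \<and> Y k l \<le> l * c) \<or> w k = Y k 1 \<or> m \<le> N" using w(2)[of k] by force
  then consider l where "l \<in> {1..N}" "l \<le> m" "Y k l \<le> l * c" | "w k = Y k 1 \<or> m \<le> N" by blast
  thus ?thesis
  proof cases
   case 1
   have "Y k m \<le> Y k l + Y (k + l) (m - l)" using Y(1)[of k l "m - l"] 1 by simp
   also have "... \<le> l * c + ((m - l) * c + (\<Sum>j\<in>{k + l..<k + l + (m - l)}. w j) + ?R (k + l) (m - l))"
    using 1 less[of "m - l" "k + l"] by (intro add_mono) (auto simp: of_nat_diff)
   also have "... \<le> m * c + (\<Sum>j\<in>{k..<k + m}. w j) + ?R k m"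
   proof -
    have "(\<Sum>j\<in>{k + l..<k + l + (m - l)}. w j) \<le> (\<Sum>j\<in>{k..<k + m}. w j)"
     using 1 w by (intro sum_mono2) auto
    moreover have "?R (k + l) (m - l) \<le> ?R k m" using 1 Y(3) by (intro sum_mono2) auto
    moreover have "l * c + (m - l) * c = m * c" using 1 by (simp add: of_nat_diff algebra_simps)
    ultimately show ?thesis by linarith
   qed
   finally show ?thesis .
  next
   case 2
   have "Y k m \<le> Y k 1 + Y (Suc k) (m - 1)" using Y(1)[of k 1 "m - 1"] False by simp
   also have "... \<le> Y k 1 + ((m - 1) * c + (\<Sum>j\<in>{Suc k..<Suc k + (m - 1)}. w j) + ?R (Suc k) (m - 1))"
    using less[of "m - 1" "Suc k"] False by (intro add_mono) auto
   also have "... \<le> m * c + (\<Sum>j\<in>{k..<k + m}. w j) + ?R k m"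
   proof -
    have i: "{k..<k + m} = insert k {Suc k..<Suc k + (m - 1)}" using False by auto
    have s: "(\<Sum>j\<in>{k..<k + m}. w j) = w k + (\<Sum>j\<in>{Suc k..<Suc k + (m - 1)}. w j)" unfolding i by simp
    have R: "(if m \<le> N then Y k 1 else 0) + ?R (Suc k) (m - 1) \<le> ?R k m"
    proof (cases "m \<le> N")
     case True
     have "Y k 1 + ?R (Suc k) (m - 1) = (\<Sum>j\<in>insert k {j\<in>{Suc k..<Suc k + (m - 1)}. Suc k + (m - 1) \<le>
      j + N}. Y j 1)"
      by (subst sum.insert) auto
     also have "... \<le> ?R k m" using True False Y(3) by (intro sum_mono2) auto
     finally show ?thesis using True by simp
    next
     case False
     thus ?thesis using Y(3) by (auto intro!: sum_mono2)
    qed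
    have "(m - 1) * c \<le> m * c" using c by (intro mult_right_mono) auto
    thus ?thesis using 2 s R Y(3)[of k 1] w(1)[of k] by (auto split: if_splits)
   qed
   finally show ?thesis .
  qed
 qed
qed

text \<open>The sum has at most \<open>N\<close> terms, each of smaller order than
  \<open>n\<close>.\<close>

lemma last_terms_negligible:
 fixes h :: "nat => real" and r :: real
 assumes h: "(%n. h n / real n) ----> 0" and r: "0 < r"
 shows "eventually (%n. (\<Sum>j\<in>{j\<in>{0..<n}. n \<le> j + N}. h j) \<le> r * n) sequentially"
proof -
 have "eventually (%n. h n / real n < r / (real N + 1)) sequentially"
  using h r by (intro order_tendstoD(2)[OF h]) auto
 then obtain J where J: "!!n. J \<le> n ==> h n / real n < r / (real N + 1)" unfolding
  eventually_sequentially by blast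
 let ?X = "%j n. {j\<in>{0..<n}. n \<le> j + N}"
 have "(\<Sum>j\<in>(?X j n). h j) \<le> r * n" if n: "J + N + 1 \<le> n" for n
 proof -
  have "(\<Sum>j\<in>(?X j n). h j) \<le> real (card (?X j n)) * (r / (real N + 1) * n)"
  proof (rule sum_bounded_above, goal_cases)
   case j: (1 j)
   hence "h j / real j < r / (real N + 1)" "0 < real j" using n by (auto intro!: J)
   hence "h j \<le> r / (real N + 1) * j" by (simp add: field_simps)
   also have "... \<le> r / (real N + 1) * n" using j r by (intro mult_left_mono) auto
   finally show ?case .
  qed
  also have "... \<le> (real N + 1) * (r / (real N + 1) * n)"
  proof (rule mult_right_mono, goal_cases)
   case 1
   have "card (?X j n) \<le> card {n - N..<n}" by (intro card_mono) auto
   thus ?case by simp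
  qed (use r in auto)
  also have "... = r * n" by simp
  finally show ?thesis .
 qed
 thus ?thesis unfolding eventually_sequentially by blast
qed

text \<open>The lower limit is invariant, hence constant; Steele's covering argument bounds the upper
 limit, and only the maximal inequality is needed for the covering errors.\<close>

theorem kingman:
 fixes X :: "nat => 'b => real"
 assumes M: "prob_space M" and T: "preserves M T"
 and erg: "!!A. A \<in> sets M ==> (AE x in M. x \<in> A \<longleftrightarrow> T x \<in> A) ==> measure M A = 0 \<or> measure M A = 1"
 and Xm[measurable]: "!!n. X n \<in> bmeas M" and X0: "!!n x. 0 \<le> X n x" "!!x. X 0 x = 0"
 and X1: "integrable M (%x. (X 1 x)\<^sup>2)"
 and sub: "!!m n. AE x in M. X (m + n) x \<le> X m x + X n ((T ^^ m) x)"
 obtains a where "0 \<le> a" "AE x in M. (%n. X n x / real n) ----> a"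
proof -
 interpret prob_space M by fact
 note X2 = X1 and X1 = square_integrable_imp_integrable[OF Xm X1]
 have Tm[measurable]: "T ^^ i \<in> M \<rightarrow>\<^sub>M M" for i
  using preserves_measurable[OF preserves_funpow[OF T]] .
 have Tm1[measurable]: "T \<in> M \<rightarrow>\<^sub>M M" using preserves_measurable[OF T] .
 have "AE x in M. X (m + n) ((T ^^ k) x) \<le> X m ((T ^^ k) x) + X n ((T ^^ (k + m)) x)" for k m n
  using preserves_AE[OF preserves_funpow[OF T] sub[of m n], of k] by (simp add: funpow_add_apply)
 hence subA: "AE x in M. \<forall>k m n. X (m + n) ((T ^^ k) x) \<le> X m ((T ^^ k) x) + X n ((T ^^ (k + m)) x)"
  unfolding AE_all_countable by blast
 \<comment> \<open>The event that the lower limit of \<open>X n / n\<close> exceeds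
   \<open>q\<close>; the gap \<open>1 / Suc k\<close> makes the inequality strict.\<close>
 define A where "A q = {x \<in> space M. \<exists>k N::nat. \<forall>n\<ge>N. real n * (q + 1 / Suc k) \<le> X n x}" for q
 have A[measurable]: "A q \<in> sets M" for q unfolding A_def by measurable
 have A_inv: "AE x in M. x \<in> A q \<longleftrightarrow> T x \<in> A q" for q
 proof -
  \<comment> \<open>Subadditivity bounds \<open>X (Suc n) x\<close> by
    \<open>X 1 x + X n (T x)\<close>, which gives this inclusion only. The reverse one follows
    almost everywhere because the event and its preimage have equal probability.\<close>
  have *: "AE x in M. x \<in> A q \<longrightarrow> T x \<in> A q" using subA AE_space
  proof eventually_elim
   case (elim x)
   show ?case
   proof
    assume "x \<in> A q"
    then obtain k N where kN: "!!n. N \<le> n ==> real n * (q + 1 / Suc k) \<le> X n x" by (auto simp: A_def)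
    define d where "d = 1 / real (Suc (2 * k + 1))"
    have d: "0 < d" "1 / real (Suc k) = 2 * d" by (auto simp: d_def field_simps)
    obtain K where K: "(X 1 x - q) / d < real K" using reals_Archimedean2 by blast
    have "real n * (q + d) \<le> X n (T x)" if n: "max N K \<le> n" for n
    proof -
     have "real (Suc n) * (q + 2 * d) \<le> X (Suc n) x" using kN[of "Suc n"] n d by simp
     also have "... \<le> X 1 x + X n (T x)" using elim(1)[rule_format, of 1 n 0] by simp
     finally have 1: "real (Suc n) * (q + 2 * d) \<le> X 1 x + X n (T x)" .
     have "X 1 x - q < d * real K" using K d by (simp add: field_simps)
     also have "... \<le> d * real n" using n d by simp
     finally show ?thesis using 1 d by (simp add: algebra_simps)
    qed
    thus "T x \<in> A q" using measurable_space[OF Tm1 elim(2)] unfolding A_def d_def by blast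
   qed
  qed
  let ?D = "T -` A q \<inter> space M - A q"
  have "emeasure M (T -` A q \<inter> space M) = emeasure M (A q)" using preserves_emeasure[OF T A] .
  hence "prob (T -` A q \<inter> space M) = prob (A q)" by (simp add: measure_def)
  moreover have "prob (T -` A q \<inter> space M \<inter> A q) = prob (A q)"
  proof (rule finite_measure_eq_AE, goal_cases)
   case 1
   show ?case using * AE_space by eventually_elim auto
  qed measurable
  ultimately have "prob ?D = 0" by (subst finite_measure_Diff') auto
  hence "AE x in M. x \<notin> ?D" by (intro AE_not_in) (auto simp: emeasure_eq_measure)
  thus ?thesis using * AE_space by eventually_elim auto
 qed
 have A01: "prob (A q) = 0 \<or> prob (A q) = 1" for q using erg[OF A A_inv] .
 have A_mono: "A q' \<subseteq> A q" if "q \<le> q'" for q q'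
 proof -
  have "real n * (q + 1 / Suc k) \<le> real n * (q' + 1 / Suc k)" for n k using that by (intro
   mult_left_mono) auto
  thus ?thesis unfolding A_def by (blast intro: order_trans)
 qed
 have A_neg: "A q = space M" if q: "q < 0" for q
 proof -
  obtain k where "1 / Suc k < - q" using nat_approx_posE[of "- q"] q by auto
  hence "real n * (q + 1 / Suc k) \<le> X n x" for n x using X0(1)[of n x] by (intro order_trans[OF
   mult_nonneg_nonpos]) auto
  thus ?thesis by (auto simp: A_def)
 qed
 \<comment> \<open>At the level mean plus one the maximal inequality for \<open>X 1\<close> shows
   that \<open>A r\<close> is not almost sure, which bounds the supremum \<open>a\<close>
   below.\<close>
 define r where "r = integral\<^sup>L M (X 1) + 1"
 have r: "0 < r" unfolding r_def using X0 by (intro add_nonneg_pos integral_nonneg) auto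
 let ?X = "{x \<in> space M. \<exists>n\<ge>1. r * real n < (\<Sum>i<n. X 1 ((T ^^ i) x))}"
 have "prob (A r) \<le> prob ?X"
 proof (rule finite_measure_mono_AE, goal_cases)
  case 1
  show ?case using subA
  proof eventually_elim
   case (elim x)
   have le: "X n x \<le> (\<Sum>i<n. X 1 ((T ^^ i) x))" for n
   proof (induction n)
    case (Suc n)
    thus ?case using elim[rule_format, of n 1 0] by simp
   qed (simp add: X0)
   show ?case
   proof
    assume "x \<in> A r"
    then obtain k N where kN: "x \<in> space M" "!!n. N \<le> n ==> real n * (r + 1 / Suc k) \<le> X n x" by
     (auto simp: A_def)
    have "r * real (Suc N) < real (Suc N) * (r + 1 / Suc k)" by (simp add: field_simps)
    also have "... \<le> X (Suc N) x" by (rule kN) simp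
    also have "... \<le> (\<Sum>i<Suc N. X 1 ((T ^^ i) x))" by (rule le)
    finally show "x \<in> ?X" using kN(1) by (intro CollectI conjI exI[of _ "Suc N"]) auto
   qed
  qed
 qed measurable
 also have "... \<le> integral\<^sup>L M (X 1) / r" using r X0 by (intro maximal_inequality[OF M T X1]) auto
 also have "... < 1" using r by (simp add: r_def)
 finally have A_big: "prob (A r) < 1" .
 define Q where "Q = {q. prob (A q) = 1}"
 have Q_neg: "q \<in> Q" if "q < 0" for q using A_neg[OF that] prob_space by (simp add: Q_def)
 have Q_bd: "q < r" if "q \<in> Q" for q
 proof (rule ccontr)
  assume "\<not> q < r"
  hence "prob (A q) \<le> prob (A r)" by (intro finite_measure_mono A_mono) auto
  with A_big that show False by (simp add: Q_def)
 qed
 define a where "a = Sup Q"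
 have bdd: "bdd_above Q" using Q_bd by (intro bdd_aboveI[of _ r]) (auto intro: less_imp_le)
 have ne: "Q \<noteq> {}" using Q_neg[of "-1"] by auto
 have a0: "0 \<le> a" by (simp add: dense_le a_def cSup_upper Q_neg bdd)
 have low: "AE x in M. x \<in> A q" if q: "q < a" for q
 proof -
  obtain q' where q': "q' \<in> Q" "q < q'" using q less_cSup_iff[OF ne bdd, of q] by (auto simp: a_def)
  hence "AE x in M. x \<in> A q'" using A by (simp add: Q_def AE_in_set_eq_1)
  thus ?thesis using A_mono[of q q'] q'(2) by (auto elim!: eventually_mono)
 qed
 have high: "AE x in M. x \<notin> A q" if "a < q" for q
 proof -
  have "prob (A q) = 0" using that cSup_upper[OF _ bdd, of q] A01[of q] by (auto simp: a_def Q_def)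
  thus ?thesis by (intro AE_not_in) (auto simp: emeasure_eq_measure)
 qed
 have h0: "AE x in M. (%n. X 1 ((T ^^ n) x) / real n) ----> 0"
  by (rule stationary_over_n_tendsto_0[OF T Xm X2]) (simp add: X0)
 have upper: "AE x in M. eventually (%n. X n x \<le> real n * (a + e + 2 * e)) sequentially" if e: "0 < e" for e
 proof -
  define c where "c = a + e"
  have c: "0 < c" using a0 e by (simp add: c_def)
  \<comment> \<open>No block of length at most \<open>N\<close> is cheap at \<open>x\<close>. Almost
    every point leaves these events for large \<open>N\<close>, because the lower limit is at most
    \<open>a < c\<close>.\<close>
  define B where "B N = {x \<in> space M. \<forall>l\<in>{1..N}. real l * c < X l x}" for N :: nat
  have B[measurable]: "B N \<in> sets M" for N unfolding B_def by measurable
  define f where "f N x = X 1 x * ind (B N) x" for N x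
  have f: "integrable M (f N)" "0 \<le> f N x" for N x
   unfolding f_def using integrable_real_mult_indicator[OF B X1] X0 by auto
  have fm[measurable]: "f N \<in> bmeas M" for N using f by simp
  have "a < a + e / 2" using e by simp
  from high[OF this] AE_space have evB: "AE x in M. eventually (%N. x \<notin> B N) sequentially"
  proof eventually_elim
   case (elim x)
   obtain k where k: "1 / Suc k < e / 2" using nat_approx_posE[of "e/2"] e by auto
   from elim obtain n where n: "1 \<le> n" "\<not> real n * (a + e / 2 + 1 / Suc k) \<le> X n x" unfolding A_def by blast
   have "X n x \<le> real n * (a + e / 2 + 1 / Suc k)" using n by simp
   also have "... \<le> real n * c" using k by (intro mult_left_mono) (auto simp: c_def)
   finally show ?case unfolding eventually_sequentially B_def using n by (intro exI[of _ n]) force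
  qed
  let ?D = "{x \<in> space M. \<not> eventually (%n. X n x \<le> real n * (c + 2 * e)) sequentially}"
  have D: "?D \<in> sets M" unfolding eventually_sequentially by measurable
  have small: "prob ?D \<le> integral\<^sup>L M (f N) / e" for N
  proof -
   let ?Y = "{x \<in> space M. \<exists>n\<ge>1. e * real n < (\<Sum>i<n. f N ((T ^^ i) x))}"
   have "prob ?D \<le> prob ?Y"
   proof (rule finite_measure_mono_AE, goal_cases)
    case 1
    show ?case using subA h0 AE_space
    proof eventually_elim
     case (elim x)
     have sp: "(T ^^ j) x \<in> space M" for j using measurable_space[OF Tm elim(3)] .
     have cov: "X n x \<le> n * c + (\<Sum>j<n. f N ((T ^^ j) x)) + (\<Sum>j\<in>{j\<in>{0..<n}. n \<le> j + N}. X 1 ((T ^^ j)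
      x))" for n
      using subadditive_covering[of "%k n. X n ((T ^^ k) x)" c "%k. f N ((T ^^ k) x)" N 0 n] elim(1)
       X0 c f sp
      by (simp add: f_def B_def lessThan_atLeast0)
     show ?case
     proof (rule impI, rule ccontr)
      assume x: "x \<in> ?D" and "x \<notin> ?Y"
      hence le: "(\<Sum>i<n. f N ((T ^^ i) x)) \<le> e * real n" if "1 \<le> n" for n using that by force
      have "eventually (%n. X n x \<le> real n * (c + 2 * e)) sequentially"
       using last_terms_negligible[OF elim(2) e, of N] eventually_ge_at_top[of 1]
      proof eventually_elim
       case (elim n)
       thus ?case using cov[of n] le[of n] by (simp add: algebra_simps)
      qed
      with x show False by simp
     qed
    qed
   qed measurable
   also have "... \<le> integral\<^sup>L M (f N) / e" using f e by (intro maximal_inequality[OF M T]) auto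
   finally show ?thesis .
  qed
  have "(%N. integral\<^sup>L M (f N)) ----> 0"
   unfolding f_def by (rule integral_truncated_tendsto_0[OF X1 _ B evB]) (simp add: X0)
  hence "(%N. integral\<^sup>L M (f N) / e) ----> 0 / e" by (intro tendsto_divide tendsto_const) (use e in auto)
  hence "AE x in M. x \<notin> ?D" using small by (intro AE_if_small_measure[OF M D]) auto
  thus ?thesis unfolding c_def by (rule AE_mp) (rule AE_I2, simp)
 qed
 have "AE x in M. \<forall>k. eventually (%n. X n x \<le> real n * (a + 1 / Suc k + 2 * (1 / Suc k))) sequentially"
  unfolding AE_all_countable by (intro allI upper) simp
 moreover have "AE x in M. \<forall>k. x \<in> A (a - 1 / Suc k)"
  unfolding AE_all_countable by (intro allI low) simp
 ultimately have "AE x in M. (%n. X n x / real n) ----> a"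
 proof eventually_elim
  case (elim x)
  show ?case
  proof (rule tendstoI, goal_cases)
   case (1 e)
   then obtain k where k: "1 / Suc k < e / 3" using nat_approx_posE[of "e/3"] by auto
   define d where "d = 1 / real (Suc k)"
   from elim(2)[rule_format, of k] obtain l N where lN: "!!n. N \<le> n ==> real n * (a - 1 / Suc k + 1
    / Suc l) \<le> X n x" unfolding A_def by blast
   show ?case using elim(1)[rule_format, of k] eventually_ge_at_top[of N] eventually_gt_at_top[of 0]
   proof eventually_elim
    case (elim n)
    have "X n x / real n \<le> a + 3 * (1 / Suc k)"
     using elim unfolding d_def[symmetric] by (simp add: field_simps)
    moreover have "a - 1 / Suc k \<le> X n x / real n"
    proof -
     have "real n * (a - 1 / Suc k) \<le> real n * (a - 1 / Suc k + 1 / Suc l)" by (intro mult_left_mono) auto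
     also have "... \<le> X n x" by (rule lN) (use elim in simp)
     finally show ?thesis using elim(3) by (simp add: field_simps)
    qed
    ultimately show ?case using k \<open>0 < e\<close> by (simp add: dist_real_def abs_less_iff)
   qed
  qed
 qed
 with a0 show thesis by (rule that)
qed

section \<open>Poisson configurations\<close>

text \<open>Void events generate the same sigma-algebra as the counts and, in contrast to single
  count events, are stable under intersection: the conditions for \<open>A\<close> and
  \<open>B\<close> combine to the one for \<open>A \<union> B\<close>.\<close>

definition void_events :: "'a::euclidean_space set => 'a set set set" where
 "void_events D = {{\<omega> \<in> configurations. \<omega> \<inter> B = {}} | B. B \<in> sets borel \<and> bounded B \<and> B \<subseteq> D}"

lemma void_events_Pow: "void_events D \<subseteq> Pow configurations" by (auto simp: void_events_def)

lemma Int_stable_void_events: "Int_stable (void_events D)"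
proof (rule Int_stableI, goal_cases)
 case (1 a b)
 then obtain A B where AB: "a = {\<omega> \<in> configurations. \<omega> \<inter> A = {}}" "A \<in> sets borel" "bounded A" "A \<subseteq> D"
  "b = {\<omega> \<in> configurations. \<omega> \<inter> B = {}}" "B \<in> sets borel" "bounded B" "B \<subseteq> D"
  unfolding void_events_def by blast
 show ?case using AB unfolding void_events_def using AB by (intro CollectI exI[of _ "A \<union> B"]) auto
qed

lemma config_finite: "\<omega> \<in> configurations ==> bounded B ==> finite (\<omega> \<inter> B)"
 by (simp add: configurations_def)

lemma config_subset: "\<omega> \<in> configurations ==> \<omega>' \<subseteq> \<omega> ==> \<omega>' \<in> configurations"
 unfolding configurations_def by (simp, meson Int_mono finite_subset order_refl)

lemma config_countable:
 assumes "\<omega> \<in> configurations" shows "countable (\<omega> :: 'a::euclidean_space set)"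
proof -
 let ?X = "\<Union>n::nat. \<omega> \<inter> ball 0 (real n)"
 have "\<omega> = ?X" using reals_Archimedean2 by auto
 moreover have "countable ?X"
  using assms by (intro countable_UN) (auto intro: countable_finite config_finite)
 ultimately show ?thesis by simp
qed

text \<open>Void events determine all counts: a finite set has more than \<open>k\<close> points iff some basic open
 set catches a point while at least \<open>k\<close> points remain outside.\<close>

lemma card_ge_void:
 assumes "B \<in> sets borel" "bounded (B :: 'a::euclidean_space set)"
 shows "{\<omega> \<in> configurations. k \<le> card (\<omega> \<inter> B)} \<in> sigma_sets configurations (void_events UNIV)"
 using assms
proof (induction k arbitrary: B)
 case 0
 thus ?case using sigma_sets_top by simp
next
 case (Suc k)
 interpret S: sigma_algebra configurations "sigma_sets configurations (void_events (UNIV :: 'a set))"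
  by (rule sigma_algebra_sigma_sets[OF void_events_Pow])
 obtain \<B> :: "'a set set" where \<B>: "countable \<B>" "topological_basis \<B>" using ex_countable_basis by blast
 have op: "open U" if "U \<in> \<B>" for U using topological_basis_open[OF \<B>(2) that] .
 let ?X = "%\<omega> U. {\<omega> \<in> configurations. \<omega> \<inter> (B \<inter> U) = {}}"
 have "{\<omega> \<in> configurations. Suc k \<le> card (\<omega> \<inter> B)} = (\<Union>U\<in>\<B>. (configurations - (?X \<omega> U)) \<inter> {\<omega> \<in>
  configurations. k \<le> card (\<omega> \<inter> (B - U))})"
  (is "?L = ?R")
 proof (intro equalityI subsetI)
  fix \<omega> assume w: "\<omega> \<in> ?L"
  hence fin: "finite (\<omega> \<inter> B)" using Suc.prems config_finite by blast
  from w obtain p where p: "p \<in> \<omega> \<inter> B" by (cases "\<omega> \<inter> B = {}") auto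
  let ?Y = "\<omega> \<inter> B - {p}"
  have "open (- ?Y)" using fin by (intro open_Compl finite_imp_closed) auto
  moreover have "p \<in> - ?Y" by simp
  ultimately obtain U where U: "U \<in> \<B>" "p \<in> U" "U \<subseteq> - ?Y" using \<B>(2) topological_basisE by metis
  have "\<omega> \<inter> (B - U) = \<omega> \<inter> B - {p}" using U p by auto
  hence "card (\<omega> \<inter> (B - U)) = card (\<omega> \<inter> B) - 1" using p fin by (simp add: card_Diff_singleton)
  moreover have "Suc k \<le> card (\<omega> \<inter> B)" using w by blast
  ultimately show "\<omega> \<in> ?R" using w p U by auto
 next
  fix \<omega> assume "\<omega> \<in> ?R"
  then obtain U where U: "U \<in> \<B>" "\<omega> \<in> configurations" "\<omega> \<inter> (B \<inter> U) \<noteq> {}" "k \<le> card (\<omega> \<inter> (B - U))" by auto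
  hence fin: "finite (\<omega> \<inter> B)" using Suc.prems config_finite by blast
  have "card (\<omega> \<inter> (B - U)) < card (\<omega> \<inter> B)" using U fin by (intro psubset_card_mono) auto
  thus "\<omega> \<in> ?L" using U by auto
 qed
 also have "... \<in> sigma_sets configurations (void_events UNIV)"
 proof (rule S.countable_UN'[OF \<B>(1)], rule subsetI, goal_cases)
  case (1 X)
  then obtain U where U: "U \<in> \<B>" and X: "X = (configurations - (?X \<omega> U)) \<inter> {\<omega> \<in> configurations. k \<le>
   card (\<omega> \<inter> (B - U))}" by auto
  have b: "B \<inter> U \<in> sets borel" "bounded (B \<inter> U)" "B - U \<in> sets borel" "bounded (B - U)"
   using Suc.prems op[OF U] by (auto intro: bounded_subset)
  have "(?X \<omega> U) \<in> sigma_sets configurations (void_events UNIV)"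
   using b by (intro sigma_sets.Basic) (auto simp: void_events_def)
  thus ?case unfolding X using Suc.IH[OF b(3,4)] by (intro S.Int S.compl_sets) auto
 qed
 finally show ?case .
qed

lemma sets_config_space:
 "sets (config_space :: 'a::euclidean_space set measure) = sigma_sets configurations (void_events UNIV)"
proof -
 let ?G = "{{\<omega> \<in> configurations. card (\<omega> \<inter> B) = n} | B n. B \<in> sets borel \<and> bounded (B :: 'a set)}"
 interpret S: sigma_algebra configurations "sigma_sets configurations (void_events (UNIV :: 'a set))"
  by (rule sigma_algebra_sigma_sets[OF void_events_Pow])
 have "sets (config_space :: 'a set measure) = sigma_sets configurations ?G"
  unfolding config_space_def by (rule sets_measure_of) auto
 also have "... = sigma_sets configurations (void_events UNIV)"
 proof (rule sigma_sets_eqI)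
  fix a assume "a \<in> ?G"
  then obtain B n where B: "a = {\<omega> \<in> configurations. card (\<omega> \<inter> B) = n}" "B \<in> sets borel" "bounded B" by auto
  have "a = {\<omega> \<in> configurations. n \<le> card (\<omega> \<inter> B)} - {\<omega> \<in> configurations. Suc n \<le> card (\<omega> \<inter> B)}"
   using B(1) by auto
  thus "a \<in> sigma_sets configurations (void_events UNIV)"
   using card_ge_void[OF B(2,3)] by (simp add: S.Diff)
 next
  fix b :: "'a set set" assume "b \<in> void_events UNIV"
  then obtain B where B: "b = {\<omega> \<in> configurations. \<omega> \<inter> B = {}}" "B \<in> sets borel" "bounded B"
   by (auto simp: void_events_def)
  hence "b = {\<omega> \<in> configurations. card (\<omega> \<inter> B) = 0}"
   using config_finite[OF _ B(3)] by (auto simp only: card_0_eq card.empty)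
  thus "b \<in> sigma_sets configurations ?G" using B by (intro sigma_sets.Basic) blast
 qed
 finally show ?thesis .
qed

lemma space_config_space: "space config_space = configurations"
 by (simp add: config_space_def space_measure_of_conv)

lemma measurable_configI:
 assumes "sets P = sets (config_space :: 'a::euclidean_space set measure)"
 and f: "!!x. x \<in> space N ==> f x \<in> configurations"
 and v: "!!B. B \<in> sets borel ==> bounded B ==> {x \<in> space N. f x \<inter> B = {}} \<in> sets N"
 shows "f \<in> N \<rightarrow>\<^sub>M P"
proof (rule measurable_sigma_sets[where A="void_events UNIV" and \<Omega>=configurations])
 show "sets P = sigma_sets configurations (void_events UNIV)" using assms(1) by (simp add:
  sets_config_space)
 fix y :: "'a set set" assume "y \<in> void_events UNIV"
 then obtain B where B: "y = {\<omega> \<in> configurations. \<omega> \<inter> B = {}}" "B \<in> sets borel" "bounded B"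
  by (auto simp: void_events_def)
 hence "f -` y \<inter> space N = {x \<in> space N. f x \<inter> B = {}}" using f by auto
 thus "f -` y \<inter> space N \<in> sets N" using v[OF B(2,3)] by simp
qed (use f void_events_Pow in auto)

section \<open>Translations of configurations and the basic facts on Poisson processes\<close>

definition shift :: "'a::euclidean_space => 'a set => 'a set" where "shift u \<omega> = (%y. y - u) ` \<omega>"

lemma shift_0 [simp]: "shift 0 \<omega> = \<omega>" by (simp add: shift_def)

lemma shift_shift: "shift u (shift v \<omega>) = shift (v + u) \<omega>"
 by (simp add: shift_def image_image algebra_simps)

lemma shift_Int: "shift u \<omega> \<inter> B = shift u (\<omega> \<inter> (+) u ` B)"
proof -
 have "y \<in> (+) u ` B \<longleftrightarrow> y - u \<in> B" for y by (auto simp: image_iff algebra_simps intro: bexI[of _ "y - u"])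
 thus ?thesis by (auto simp: shift_def)
qed

lemma shift_empty_iff [simp]: "shift u \<omega> = {} \<longleftrightarrow> \<omega> = {}" by (simp add: shift_def)

lemma shift_config: "\<omega> \<in> configurations ==> shift u \<omega> \<in> configurations" unfolding configurations_def
proof (intro CollectI allI impI, goal_cases)
 case (1 B)
 thus ?case unfolding shift_Int using bounded_translation[of B u] by (simp add: shift_def)
qed

lemma shift_funpow: "(shift u ^^ n) \<omega> = shift (real n *\<^sub>R u) \<omega>"
 by (induction n) (auto simp: shift_shift algebra_simps)

lemma potential_shift: "potential W (x + u) \<omega> = potential W x (shift u \<omega>)"
proof -
 have "potential W x (shift u \<omega>) = (NINT y|count_space ((%y. y - u) ` \<omega>). en (W (x - y)))"
  by (simp add: potential_def shift_def)
 also have "... = (NINT y|count_space \<omega>. en (W (x - (y - u))))"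
  by (subst nn_integral_bij_count_space[where g="%y. y - u" and A=\<omega>, symmetric]) (auto simp:
   bij_betw_def inj_on_def)
 finally show ?thesis by (simp add: potential_def algebra_simps)
qed

lemma translation_borel:
 fixes B :: "'a::euclidean_space set"
 assumes "B \<in> sets borel"
 shows "(+) u ` B \<in> sets borel" "measure lborel ((+) u ` B) = measure lborel B"
proof -
 have "(+) u ` B = (%y. y - u) -` B \<inter> space borel"
  by (auto simp: image_iff algebra_simps intro!: bexI[of _ "_ - u"])
 also have "... \<in> sets borel" using assms by (intro measurable_sets[of _ borel borel]) auto
 finally show b: "(+) u ` B \<in> sets borel" .
 have "measure lborel ((+) u ` B) = measure lebesgue ((+) u ` B)" using b by simp
 also have "... = measure lebesgue B" by (rule measure_translation)
 finally show "measure lborel ((+) u ` B) = measure lborel B" using assms by simp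
qed

locale poisson =
 fixes P :: "'a::euclidean_space set measure"
 assumes poisson: "poisson_process P"
begin

sublocale prob_space P using poisson by (simp add: poisson_process_def)

lemma sets_P: "sets P = sets config_space" using poisson by (simp add: poisson_process_def)

lemma space_P: "space P = configurations"
 using sets_eq_imp_space_eq[OF sets_P] by (simp add: space_config_space)

lemma sets_P': "sets P = sigma_sets configurations (void_events UNIV)"
 by (simp add: sets_P sets_config_space)

lemma card_event [measurable]: "B \<in> sets borel ==> bounded B ==> {\<omega> \<in> space P. card (\<omega> \<inter> B) = n} \<in> sets P"
 unfolding sets_P space_P config_space_def by (subst sets_measure_of) (auto intro!: sigma_sets.Basic)

lemma card_measurable:
 assumes B: "B \<in> sets borel" "bounded B"
 shows "(%\<omega>. card (\<omega> \<inter> B)) \<in> P \<rightarrow>\<^sub>M count_space UNIV"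
 unfolding measurable_count_space_eq_countable[OF countableI_type]
proof (intro conjI ballI, goal_cases)
 case (2 n)
 have "(%\<omega>. card (\<omega> \<inter> B)) -` {n} \<inter> space P = {\<omega> \<in> space P. card (\<omega> \<inter> B) = n}" by blast
 thus ?case using card_event[OF B] by simp
qed simp

lemma prob_card:
 "B \<in> sets borel ==> bounded B ==> prob {\<omega> \<in> space P. card (\<omega> \<inter> B) = n} = exp (- measure lborel B) *
  measure lborel B ^ n / fact n"
 using poisson by (simp add: poisson_process_def)

lemma indep_card:
 "(!!i. i < n ==> A i \<in> sets borel \<and> bounded (A i)) ==> disjoint_family_on A {..<n} ==> indep_vars
  (%_. count_space UNIV) (%i \<omega>. card (\<omega> \<inter> A i)) {..<n::nat}"
 using poisson by (simp add: poisson_process_def)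

lemma void_event: "B \<in> sets borel ==> bounded B ==> {\<omega> \<in> space P. \<omega> \<inter> B = {}} \<in> sets P"
 unfolding sets_P' space_P by (intro sigma_sets.Basic) (auto simp: void_events_def)

lemma prob_void:
 assumes "B \<in> sets borel" "bounded B"
 shows "prob {\<omega> \<in> space P. \<omega> \<inter> B = {}} = exp (- measure lborel B)"
proof -
 have "{\<omega> \<in> space P. \<omega> \<inter> B = {}} = {\<omega> \<in> space P. card (\<omega> \<inter> B) = 0}"
  using config_finite[OF _ assms(2)] unfolding space_P by (auto simp only: card_0_eq card.empty)
 thus ?thesis using prob_card[OF assms, of 0] by simp
qed

lemma measurable_config:
 assumes "!!x. x \<in> space N ==> f x \<in> configurations"
 and "!!B. B \<in> sets borel ==> bounded B ==> {x \<in> space N. f x \<inter> B = {}} \<in> sets N"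
 shows "f \<in> N \<rightarrow>\<^sub>M P" by (rule measurable_configI[OF sets_P]) (use assms in auto)

lemma shift_measurable [measurable]: "shift u \<in> P \<rightarrow>\<^sub>M P"
proof (rule measurable_config, goal_cases)
 case B: (2 B)
 show ?case using void_event[of "(+) u ` B"] translation_borel[OF B(1)] B(2) by (simp add: shift_Int
  bounded_translation)
qed (simp add: space_P shift_config)

lemma shift_distr: "distr P P (shift u) = P"
proof (rule measure_eqI_generator_eq[where E="void_events UNIV" and \<Omega>=configurations and A="%_.
 configurations"])
 fix X :: "'a set set" assume "X \<in> void_events UNIV"
 then obtain B where B: "X = {\<omega> \<in> space P. \<omega> \<inter> B = {}}" "B \<in> sets borel" "bounded B"
  by (auto simp: void_events_def space_P)
 have "shift u -` X \<inter> space P = {\<omega> \<in> space P. \<omega> \<inter> (+) u ` B = {}}"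
  using shift_config by (auto simp: B(1) shift_Int space_P)
 thus "emeasure (distr P P (shift u)) X = emeasure P X" using translation_borel[OF B(2), of u] B
  void_event[OF B(2,3)] by (simp add: prob_void bounded_translation emeasure_distr B(1)
  emeasure_eq_measure)
next
 show "range (%_. configurations) \<subseteq> void_events UNIV" by (auto simp: void_events_def)
 interpret D: prob_space "distr P P (shift u)" by (rule prob_space_distr) simp
 show "emeasure (distr P P (shift u)) configurations \<noteq> \<infinity>" by simp
qed (simp_all add: Int_stable_void_events void_events_Pow sets_P')

lemma restrict_config_measurable:
 assumes "D \<in> sets borel"
 shows "(%\<omega>. \<omega> \<inter> D) \<in> sigma configurations (void_events D) \<rightarrow>\<^sub>M P"
proof (rule measurable_config, goal_cases)
 case B: (2 B)
 have "{\<omega> \<in> configurations. \<omega> \<inter> D \<inter> B = {}} = {\<omega> \<in> configurations. \<omega> \<inter> (D \<inter> B) = {}}" by auto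
 also have "... \<in> sigma_sets configurations (void_events D)"
  using B assms bounded_subset[of B "D \<inter> B"] unfolding void_events_def by (intro sigma_sets.Basic
   CollectI exI[of _ "D \<inter> B"]) auto
 finally show ?case by (simp add: sets_measure_of[OF void_events_Pow] space_measure_of_conv)
qed (auto simp: space_measure_of_conv intro: config_subset)

lemma void_events_events: "sigma_sets configurations (void_events D) \<subseteq> sets P"
 unfolding sets_P' by (intro sigma_sets_mono') (auto simp: void_events_def)

lemma restrict_measurable [measurable]:
 assumes "D \<in> sets borel" shows "(%\<omega>. \<omega> \<inter> D) \<in> P \<rightarrow>\<^sub>M P"
proof (rule measurableI, goal_cases)
 case (2 A)
 from measurable_sets[OF restrict_config_measurable[OF assms] this]
 show ?case using void_events_events by (auto simp: sets_measure_of[OF void_events_Pow]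
  space_measure_of_conv space_P)
qed (auto simp: space_P intro: config_subset)

text \<open>Void probabilities are multiplicative over disjoint regions, and void events form a pi-system,
 so the configurations in disjoint regions are independent.\<close>

lemma indep_regions:
 assumes D: "D1 \<in> sets borel" "D2 \<in> sets borel" "D1 \<inter> D2 = {}" and A: "A1 \<in> sets P" "A2 \<in> sets P"
 shows "prob {\<omega> \<in> space P. \<omega> \<inter> D1 \<in> A1 \<and> \<omega> \<inter> D2 \<in> A2} = prob {\<omega> \<in> space P. \<omega> \<inter> D1 \<in> A1} * prob {\<omega> \<in>
  space P. \<omega> \<inter> D2 \<in> A2}"
proof -
 have "indep_set (void_events D1) (void_events D2)"
 proof (rule indep_setI, goal_cases)
  case (3 a b)
  then obtain B C where B: "a = {\<omega> \<in> space P. \<omega> \<inter> B = {}}" "B \<in> sets borel" "bounded B" "B \<subseteq> D1"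
   and C: "b = {\<omega> \<in> space P. \<omega> \<inter> C = {}}" "C \<in> sets borel" "bounded C" "C \<subseteq> D2"
   by (auto simp: void_events_def space_P)
  have ab: "a \<inter> b = {\<omega> \<in> space P. \<omega> \<inter> (B \<union> C) = {}}" using B C by auto
  have "measure lborel (B \<union> C) = measure lborel B + measure lborel C"
   using B C D emeasure_bounded_finite[of B] emeasure_bounded_finite[of C]
   by (intro measure_Union) auto
  thus ?case unfolding ab using B C by (simp add: prob_void exp_add[symmetric])
 qed (use void_events_events sigma_sets.Basic in blast)+
 hence ind: "indep_set (sigma_sets (space P) (void_events D1)) (sigma_sets (space P) (void_events D2))"
  by (intro indep_set_sigma_sets Int_stable_void_events)
 have ev: "{\<omega> \<in> space P. \<omega> \<inter> D \<in> A} \<in> sigma_sets (space P) (void_events D)" if "D \<in> sets borel" "A \<in>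
  sets P" for D A
  using measurable_sets[OF restrict_config_measurable[OF that(1)] that(2)]
  by (simp add: sets_measure_of[OF void_events_Pow] space_measure_of_conv space_P vimage_def Int_def
   conj_commute)
 have "{\<omega> \<in> space P. \<omega> \<inter> D1 \<in> A1 \<and> \<omega> \<inter> D2 \<in> A2} = {\<omega> \<in> space P. \<omega> \<inter> D1 \<in> A1} \<inter> {\<omega> \<in> space P. \<omega> \<inter> D2
  \<in> A2}" by auto
 thus ?thesis using indep_setD[OF ind ev[OF D(1) A(1)] ev[OF D(2) A(2)]] by simp
qed

abbreviation cs :: "nat => 'a set => 'a measure" where "cs n \<omega> \<equiv> count_space (\<omega> \<inter> ball 0 (real n))"

text \<open>The sets \<open>E\<close> for which this holds form a Dynkin system containing the
  rectangles. The restriction to a ball makes all sums finite, as the subtraction in the complement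
  step requires.\<close>

lemma indicator_sum_measurable:
 assumes E: "E \<in> sets (N \<Otimes>\<^sub>M borel)"
 shows "(%(x, \<omega>). (NINT y|cs n \<omega>. ind E (x, y))) \<in> bmeas (N \<Otimes>\<^sub>M P)"
proof -
 let ?f = "%E. %(x, \<omega>). (NINT y|cs n \<omega>. ind E (x, y))"
 have fin: "finite (\<omega> \<inter> ball 0 (real n))" if "\<omega> \<in> space P" for \<omega>
  using that by (simp add: space_P config_finite)
 let ?U = "N \<Otimes>\<^sub>M P"
 have rect: "?f (A \<times> B) \<in> bmeas ?U" if A: "A \<in> sets N" and B: "B \<in> sets borel" for A B
 proof -
  let ?V = "B \<inter> ball 0 (real n)"
  have c: "(%\<omega>. card (\<omega> \<inter> ?V)) \<in> P \<rightarrow>\<^sub>M count_space UNIV"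
   using B by (intro card_measurable) (auto intro: bounded_subset[OF bounded_ball])
  have "(%(x, \<omega>). ind A x * en (real (card (\<omega> \<inter> ?V)))) \<in> bmeas ?U" using A c by measurable
  also have "?this \<longleftrightarrow> ?thesis"
  proof (rule measurable_cong, goal_cases)
   case (1 p)
   then obtain x \<omega> where p: "p = (x, \<omega>)" "\<omega> \<in> space P" by (auto simp: space_pair_measure)
   have "(NINT y|cs n \<omega>. ind (A \<times> B) (x, y)) = (\<Sum>y\<in>\<omega> \<inter> ball 0 (real n). ind A x * ind B y)"
    using fin[OF p(2)] by (simp add: nn_integral_count_space_finite indicator_times)
   also have "... = ind A x * en (real (card (\<omega> \<inter> ?V)))"
    using fin[OF p(2)] by (simp add: sum_distrib_left[symmetric] indicator_def sum.If_cases Int_ac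
     ennreal_of_nat_eq_real_of_nat)
   finally show ?case by (simp add: p)
  qed
  finally show ?thesis .
 qed
 let ?G = "{a \<times> b | a b. a \<in> sets N \<and> b \<in> sets (borel :: 'a measure)}"
 have "Int_stable ?G" by (rule Int_stable_pair_measure_generator)
 moreover have "?G \<subseteq> Pow (space N \<times> UNIV)" using sets.sets_into_space by fastforce
 moreover have "E \<in> sigma_sets (space N \<times> UNIV) ?G" using E by (simp add: sets_pair_measure)
 ultimately show ?thesis
 proof (induction rule: sigma_sets_induct_disjoint)
  case (basic A)
  thus ?case using rect by auto
 next
  case empty
  thus ?case by simp
 next
  case (compl A)
  have "(%p. ?f (space N \<times> UNIV) p - ?f A p) \<in> bmeas ?U"
   using compl.IH rect[of "space N" UNIV] by (intro borel_measurable_minus_ennreal) auto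
  also have "?this \<longleftrightarrow> ?case"
  proof (rule measurable_cong, goal_cases)
   case (1 p)
   then obtain x \<omega> where p: "p = (x, \<omega>)" "\<omega> \<in> space P" "x \<in> space N" by (auto simp: space_pair_measure)
   let ?X = "\<Sum>y\<in>\<omega> \<inter> ball 0 (real n). ind A (x, y)"
   let ?Y = "\<Sum>y\<in>\<omega> \<inter> ball 0 (real n). (1::ennreal)"
   let ?Z = "\<Sum>y\<in>\<omega> \<inter> ball 0 (real n). ind (space N \<times> UNIV - A) (x, y)"
   have "?Y = ?Z + ?X"
    unfolding sum.distrib[symmetric] using p by (intro sum.cong) (auto simp: indicator_def)
   moreover have "?X \<noteq> (\<infinity>::ennreal)"
   proof -
    have "?X \<le> ?Y" by (intro sum_mono) (auto simp: indicator_def)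
    also have "... < \<infinity>" by (simp add: of_nat_less_top)
    finally show ?thesis by simp
   qed
   ultimately show ?case using fin[OF p(2)] p by (simp add: nn_integral_count_space_finite indicator_times)
  qed
  finally show ?case .
 next
  case (union A)
  let ?E = "%p. \<Sum>i. ?f (A i) p"
  have "?E \<in> bmeas ?U" using union.IH by (intro borel_measurable_suminf_order) auto
  also have "?E = ?f (\<Union>i. A i)"
  proof
   fix p :: "'b \<times> 'a set"
   obtain x \<omega> where p: "p = (x, \<omega>)" by fastforce
   have "(\<Sum>i. (NINT y|cs n \<omega>. ind (A i) (x, y))) = (NINT y|cs n \<omega>. (\<Sum>i. ind (A i) (x, y)))"
    by (rule nn_integral_suminf[symmetric]) simp
   thus "(\<Sum>i. ?f (A i) p) = ?f (\<Union>i. A i) p" using suminf_indicator[OF union(1)] by (simp add: p)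
  qed
  finally show ?case .
 qed
qed

lemma sum_measurable_ball:
 assumes "g \<in> bmeas (N \<Otimes>\<^sub>M borel)"
 shows "(%(x, \<omega>). (NINT y|cs n \<omega>. g (x, y))) \<in> bmeas (N \<Otimes>\<^sub>M P)" using assms
proof (induction rule: borel_measurable_induct)
 case (cong f g)
 have "(%(x, \<omega>). (NINT y|cs n \<omega>. f (x, y))) \<in> bmeas (N \<Otimes>\<^sub>M P) \<longleftrightarrow> (%(x, \<omega>). (NINT y|cs n \<omega>. g (x, y)))
  \<in> bmeas (N \<Otimes>\<^sub>M P)"
  using cong by (intro measurable_cong) (auto simp: space_pair_measure intro!: nn_integral_cong)
 thus ?case using cong by simp
next
 case (set A)
 thus ?case by (rule indicator_sum_measurable)
next
 case (mult u c)
 show ?case using mult by (simp add: nn_integral_cmult case_prod_unfold)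
next
 case (add u v)
 show ?case using add by (simp add: nn_integral_add case_prod_unfold)
next
 case (seq U)
 have "(%p. SUP i. (case p of (x, \<omega>) => (NINT y|cs n \<omega>. U i (x, y)))) \<in> bmeas (N \<Otimes>\<^sub>M P)"
  using seq by measurable
 moreover have "incseq (%i y. U i (x, y))" for x using seq by (auto simp: incseq_def le_fun_def)
 ultimately show ?case
  by (simp add: case_prod_unfold nn_integral_monotone_convergence_SUP SUP_apply[abs_def] image_comp)
qed

lemma nn_integral_count_space_SUP_ball:
 "(NINT y|count_space \<omega>. g y) = (SUP n. (NINT y|cs n \<omega>. g y))"
proof -
 let ?X = "%n y. SUP n. g y * ind (ball 0 (real n)) y"
 have "(SUP n. (NINT y|count_space \<omega>. g y * ind (ball 0 (real n)) y)) = (NINT y|count_space \<omega>. (?X n y))"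
  by (rule nn_integral_monotone_convergence_SUP[symmetric])
  (auto simp: incseq_def le_fun_def intro!: mult_left_mono indicator_leI)
 also have "... = (NINT y|count_space \<omega>. g y)"
 proof (rule nn_integral_cong, goal_cases)
  case (1 y)
  obtain n where "norm y < real n" using reals_Archimedean2 by blast
  hence "g y \<le> (?X n y)" by (intro SUP_upper2[of n]) auto
  moreover have "(?X n y) \<le> g y" by (intro SUP_least) (auto simp: indicator_def)
  ultimately show ?case by (rule order_antisym[rotated])
 qed
 moreover have "(NINT y|count_space \<omega>. g y * ind (ball 0 (real n)) y) = (NINT y|cs n \<omega>. g y)" for n
  by (simp add: nn_integral_count_space_indicator[of \<omega>] nn_integral_count_space_indicator[of "\<omega> \<inter>
   ball 0 (real n)"])
  (auto intro!: nn_integral_cong simp: indicator_def)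
 ultimately show ?thesis by simp
qed

lemma sum_measurable:
 assumes "(%(x, y). g x y) \<in> bmeas (N \<Otimes>\<^sub>M borel)"
 shows "(%(x, \<omega>). (NINT y|count_space \<omega>. g x y)) \<in> bmeas (N \<Otimes>\<^sub>M P)"
proof -
 have eq: "(%(x, \<omega>). (NINT y|count_space \<omega>. g x y)) = (%p. SUP n. case p of (x, \<omega>) => (NINT y|cs n
  \<omega>. (case (x, y) of (x, y) => g x y)))"
  by (auto simp: fun_eq_iff intro: nn_integral_count_space_SUP_ball)
 show ?thesis unfolding eq by (intro borel_measurable_SUP sum_measurable_ball[OF assms]) auto
qed

lemma sum_measurable':
 assumes [measurable]: "g \<in> bmeas borel"
 shows "(%\<omega>. (NINT y|count_space \<omega>. g y)) \<in> bmeas P"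
proof -
 have "(%\<omega>. (0::real, \<omega>)) \<in> P \<rightarrow>\<^sub>M borel \<Otimes>\<^sub>M P" by simp
 from measurable_compose[OF this sum_measurable[of "%_. g" borel]] show ?thesis by simp
qed

end

text \<open>Finite range and bounded support reduce a Poisson sum to finitely many counts of bounded
  sets, and \<open>poisson_process\<close> is formulated in terms of such counts.\<close>

lemma simple_approximation:
 fixes f :: "'a::euclidean_space => real"
 assumes f[measurable]: "f \<in> bmeas borel" and f0: "!!x. 0 \<le> f x"
 obtains h :: "nat => 'a => real" where "!!n. h n \<in> bmeas borel" "!!n. finite (range (h n))"
 "!!n. bounded {x. h n x \<noteq> 0}" "!!n x. 0 \<le> h n x" "!!n x. h n x \<le> f x" "!!x. incseq (%n. h n x)"
 "!!x. (%n. h n x) ----> f x"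
proof -
 have "(%x. en (f x)) \<in> bmeas borel" by measurable
 then obtain U where U: "!!i. simple_function borel (U i)" "incseq U" "!!i x. U i x < top" "!!x.
  (SUP i. U i x) = en (f x)"
  by (rule borel_measurable_implies_simple_function_sequence') blast
 have inc: "incseq (%i. U i x)" for x using U(2) by (auto simp: incseq_def le_fun_def)
 have [measurable]: "U i \<in> bmeas borel" for i using U(1) by (rule borel_measurable_simple_function)
 define h where "h n x = enn2real (U n x) * ind (cball 0 (real n)) x" for n x
 have le: "enn2real (U n x) \<le> f x" for n x using SUP_upper[of n UNIV "%i. U i x"] f0 by (intro
  enn2real_leI) (auto simp: U(4))
 show thesis
 proof (rule that[of h])
  show "h n \<in> bmeas borel" for n
   unfolding h_def by (intro borel_measurable_times borel_measurable_indicator) auto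
  show "finite (range (h n))" for n
   by (rule finite_subset[of _ "insert 0 (enn2real ` range (U n))"])
   (use simple_functionD(1)[OF U(1)[of n]] in \<open>auto simp: h_def indicator_def\<close>)
  show "bounded {x. h n x \<noteq> 0}" for n
   by (rule bounded_subset[OF bounded_cball[of 0 "real n"]]) (auto simp: h_def split: split_indicator_asm)
  show "incseq (%n. h n x)" for x
   using inc[of x] U(3) by (auto simp: incseq_def h_def indicator_def intro: enn2real_mono)
  have "(%n. U n x) ----> en (f x)" for x using LIMSEQ_SUP[OF inc[of x]] by (simp add: U(4))
  hence "(%n. enn2real (U n x)) ----> f x" for x using tendsto_enn2real[of "%n. U n x"] f0 by fastforce
  moreover have "eventually (%n. enn2real (U n x) = h n x) sequentially" for x
  proof -
   have "eventually (%n. norm x \<le> real n) sequentially" by real_asymp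
   thus ?thesis by eventually_elim (simp add: h_def)
  qed
  ultimately show "(%n. h n x) ----> f x" for x by (rule Lim_transform_eventually)
 qed (use le f0 in \<open>auto simp: h_def indicator_def\<close>)
qed

section \<open>Exponential moments of Poisson sums\<close>

definition psum :: "('a => real) => 'a set => ennreal" where
 "psum f \<omega> = (NINT y|count_space \<omega>. en (f y))"

lemma psum_mono: "(!!y. f y \<le> g y) ==> psum f \<omega> \<le> psum g \<omega>"
 unfolding psum_def by (intro nn_integral_mono ennreal_leI)

lemma potential_psum: "potential W x = psum (%y. W (x - y))"
 by (simp add: potential_def psum_def fun_eq_iff)

context poisson
begin

lemma psum_measurable [measurable]: "f \<in> bmeas borel ==> psum f \<in> bmeas P"
 unfolding psum_def[abs_def] by (intro sum_measurable') measurable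

lemma nn_integral_card:
 assumes "B \<in> sets borel" "bounded B"
 shows "(NINT \<omega>|P. en (exp (v * real (card (\<omega> \<inter> B))))) = en (exp (measure lborel B * (exp v - 1)))"
proof -
 let ?m = "measure lborel B"
 let ?X = "%\<omega> k. {\<omega> \<in> space P. card (\<omega> \<inter> B) = k}"
 have ev: "(?X \<omega> k) \<in> sets P" for k by (rule card_event[OF assms])
 have "(NINT \<omega>|P. en (exp (v * real (card (\<omega> \<inter> B))))) = (NINT \<omega>|P. (\<Sum>k. en (exp (v * real k)) * ind
  (?X \<omega> k) \<omega>))"
 proof (rule nn_integral_cong, goal_cases)
  case w: (1 \<omega>)
  have "(\<Sum>k. en (exp (v * real k)) * ind (?X \<omega> k) \<omega>) = (\<Sum>k\<in>{card (\<omega> \<inter> B)}. en (exp (v * real k)) *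
   ind (?X \<omega> k) \<omega>)"
   by (intro suminf_finite) auto
  thus ?case using w by simp
 qed
 also have "... = (\<Sum>k. (NINT \<omega>|P. en (exp (v * real k)) * ind (?X \<omega> k) \<omega>))"
  by (intro nn_integral_suminf borel_measurable_times_ennreal borel_measurable_const
   borel_measurable_indicator ev)
 also have "... = (\<Sum>k. en (exp (- ?m) * ((exp v * ?m) ^ k /\<^sub>R fact k)))"
 proof (rule suminf_cong, goal_cases)
  case (1 k)
  have "(NINT \<omega>|P. en (exp (v * real k)) * ind (?X \<omega> k) \<omega>) = en (exp (v * real k)) * en (exp (- ?m)
   * ?m ^ k / fact k)"
   using ev by (simp add: nn_integral_cmult_indicator emeasure_eq_measure prob_card[OF assms])
  also have "... = en (exp (- ?m) * ((exp v * ?m) ^ k /\<^sub>R fact k))"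
   by (simp add: ennreal_mult[symmetric] power_mult_distrib exp_of_nat2_mult divide_inverse mult_ac)
  finally show ?case .
 qed
 also have "... = en (exp (- ?m) * exp (exp v * ?m))"
  by (intro suminf_ennreal_eq sums_mult exp_converges) auto
 also have "exp (- ?m) * exp (exp v * ?m) = exp (?m * (exp v - 1))"
  by (simp add: mult_exp_exp algebra_simps)
 finally show ?thesis .
qed

text \<open>The level sets of \<open>h\<close> are disjoint and bounded, so the sum is a linear
  combination of independent Poisson counts. This is Campbell's exponential formula.\<close>

lemma laplace_simple:
 fixes h :: "'a => real"
 assumes h[measurable]: "h \<in> bmeas borel" and fin: "finite (range h)" and bd: "bounded {x. h x \<noteq> 0}"
 shows "(NINT \<omega>|P. en (exp (\<Sum>y\<in>\<omega> \<inter> {x. h x \<noteq> 0}. h y))) = en (exp (LINT x|lborel. exp (h x) - 1))"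
proof -
 define R where "R = range h - {0}"
 have R: "finite R" using fin by (simp add: R_def)
 then obtain r where r: "bij_betw r {..<card R} R" using ex_bij_betw_nat_finite lessThan_atLeast0 by metis
 define A where "A v = h -` {v}" for v
 have A: "A v \<in> sets borel" for v unfolding A_def using measurable_sets[OF h, of "{v}"] by simp
 have Ab: "bounded (A v)" if "v \<noteq> 0" for v
  using that by (intro bounded_subset[OF bd]) (auto simp: A_def)
 have rR: "r i \<noteq> 0" "r i \<in> R" if "i < card R" for i using bij_betwE[OF r] that by (auto simp: R_def)
 have inj: "inj_on r {..<card R}" using r by (simp add: bij_betw_def)
 have ind: "indep_vars (%_. count_space UNIV) (%i \<omega>. card (\<omega> \<inter> A (r i))) {..<card R}"
 proof (rule indep_card, goal_cases)
  case 2
  show ?case using inj by (auto simp: disjoint_family_on_def A_def inj_on_def)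
 qed (use A Ab rR in auto)
 have ind': "indep_vars (%_. borel) (%i \<omega>. en (exp (r i * real (card (\<omega> \<inter> A (r i)))))) {..<card R}"
  by (rule indep_vars_compose2[OF ind]) measurable
 have sum_eq: "(\<Sum>y\<in>\<omega> \<inter> {x. h x \<noteq> 0}. h y) = (\<Sum>i<card R. r i * real (card (\<omega> \<inter> A (r i))))" if "\<omega> \<in>
  space P" for \<omega>
 proof -
  have f: "finite (\<omega> \<inter> {x. h x \<noteq> 0})" using that bd by (simp add: space_P config_finite)
  have "(\<Sum>y\<in>\<omega> \<inter> {x. h x \<noteq> 0}. h y) = (\<Sum>v\<in>R. \<Sum>y\<in>{y \<in> \<omega> \<inter> {x. h x \<noteq> 0}. h y = v}. h y)"
   by (rule sum.group[symmetric, OF f R]) (auto simp: R_def)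
  also have "... = (\<Sum>v\<in>R. v * real (card (\<omega> \<inter> A v)))"
  proof (rule sum.cong, goal_cases)
   case (2 v)
   hence "{y \<in> \<omega> \<inter> {x. h x \<noteq> 0}. h y = v} = \<omega> \<inter> A v" by (auto simp: R_def A_def)
   moreover have "(\<Sum>y\<in>\<omega> \<inter> A v. h y) = (\<Sum>y\<in>\<omega> \<inter> A v. v)" by (intro sum.cong) (auto simp: A_def)
   ultimately show ?case by simp
  qed simp
  also have "... = (\<Sum>i<card R. r i * real (card (\<omega> \<inter> A (r i))))"
   by (rule sum.reindex_bij_betw[OF r, symmetric])
  finally show ?thesis .
 qed
 have "(NINT \<omega>|P. en (exp (\<Sum>y\<in>\<omega> \<inter> {x. h x \<noteq> 0}. h y))) = (NINT \<omega>|P. (\<Prod>i<card R. en (exp (r i * real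
  (card (\<omega> \<inter> A (r i)))))))"
  by (intro nn_integral_cong) (simp add: sum_eq exp_sum prod_ennreal)
 also have "... = (\<Prod>i<card R. (NINT \<omega>|P. en (exp (r i * real (card (\<omega> \<inter> A (r i)))))))"
  by (intro indep_vars_nn_integral ind') auto
 also have "... = (\<Prod>i<card R. en (exp (measure lborel (A (r i)) * (exp (r i) - 1))))"
  using rR by (intro prod.cong nn_integral_card A Ab) auto
 also have "... = en (exp (\<Sum>i<card R. measure lborel (A (r i)) * (exp (r i) - 1)))"
  by (simp add: exp_sum prod_ennreal)
 also have "(\<Sum>i<card R. measure lborel (A (r i)) * (exp (r i) - 1)) = (\<Sum>v\<in>R. measure lborel (A v) *
  (exp v - 1))"
  by (rule sum.reindex_bij_betw[OF r])
 also have "... = (LINT x|lborel. (\<Sum>v\<in>R. (exp v - 1) * ind (A v) x))"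
 proof (subst Bochner_Integration.integral_sum, goal_cases)
  case (1 v)
  thus ?case using A[of v] emeasure_bounded_finite[OF Ab] by (intro integrable_mult_right
   integrable_real_indicator) auto
 qed (simp add: mult.commute)
 also have "(%x. (\<Sum>v\<in>R. (exp v - 1) * ind (A v) x)) = (%x. exp (h x) - 1)"
 proof
  fix x
  show "(\<Sum>v\<in>R. (exp v - 1) * ind (A v) x) = exp (h x) - 1"
  proof (cases "h x = 0")
   case True
   thus ?thesis by (auto simp: R_def A_def indicator_def intro!: sum.neutral)
  next
   case False
   hence "h x \<in> R" by (simp add: R_def)
   hence "(\<Sum>v\<in>R. (exp v - 1) * ind (A v) x) = (\<Sum>v\<in>{h x}. (exp v - 1) * ind (A v) x)"
    using R by (intro sum.mono_neutral_right) (auto simp: A_def indicator_def)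
   thus ?thesis by (simp add: A_def)
  qed
 qed
 finally show ?thesis .
qed

lemma psum_simple:
 assumes "\<omega> \<in> space P" "bounded {x. h x \<noteq> 0}" "!!x. 0 \<le> h x"
 shows "psum h \<omega> = en (\<Sum>y\<in>\<omega> \<inter> {x. h x \<noteq> 0}. h y)"
proof -
 let ?X = "\<omega> \<inter> {x. h x \<noteq> 0}"
 have f: "finite ?X" using assms by (simp add: space_P config_finite)
 have "psum h \<omega> = (NINT y|count_space ?X. en (h y))"
  unfolding psum_def by (rule nn_integral_count_space_eq) auto
 thus ?thesis using f assms(3) by (simp add: nn_integral_count_space_finite sum_ennreal)
qed

text \<open>The exponential formula is applied to approximations from below: replacing
  \<open>f\<close> by \<open>h n\<close> only increases the left-hand side, and the right-hand side
  converges by monotone convergence.\<close>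

lemma laplace_le:
 fixes f :: "'a => real"
 assumes f[measurable]: "f \<in> bmeas borel" and f0: "!!x. 0 \<le> f x"
 shows "(NINT \<omega>|P. em (psum f \<omega>)) \<le> em (NINT x|lborel. 1 - em (en (f x)))"
proof -
 obtain h where h[measurable]: "!!n. h n \<in> bmeas borel" and hf: "!!n. finite (range (h n))"
  "!!n. bounded {x. h n x \<noteq> 0}" and h0: "!!n x. 0 \<le> h n x" "!!n x. h n x \<le> f x" and hi: "!!x. incseq
   (%n. h n x)"
  and hl: "!!x. (%n. h n x) ----> f x" using simple_approximation[OF f f0] by metis
 have e1: "1 - em (en t) = en (1 - exp (- t))" if "0 \<le> t" for t
  using that by (simp add: em_ennreal ennreal_minus flip: ennreal_1)
 let ?X = "(NINT \<omega>|P. em (psum f \<omega>))"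
 have *: "?X \<le> em (NINT x|lborel. 1 - em (en (h n x)))" for n
 proof -
  have rg: "finite (range (%x. - h n x))" using finite_imageI[OF hf(1)[of n], of uminus] by (simp
   add: image_image)
  have "?X \<le> (NINT \<omega>|P. em (psum (h n) \<omega>))" by (intro nn_integral_mono em_antimono psum_mono h0)
  also have "... = (NINT \<omega>|P. en (exp (\<Sum>y\<in>\<omega> \<inter> {x. - h n x \<noteq> 0}. - h n y)))"
   by (intro nn_integral_cong) (simp add: psum_simple hf h0 em_ennreal sum_nonneg sum_negf)
  also have "... = en (exp (LINT x|lborel. exp (- h n x) - 1))"
   using hf(2)[of n] rg by (intro laplace_simple) auto
  also have "(LINT x|lborel. exp (- h n x) - 1) = - (LINT x|lborel. 1 - exp (- h n x))"
   by (subst Bochner_Integration.integral_minus[symmetric]) simp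
  also have "en (exp (- (LINT x|lborel. 1 - exp (- h n x)))) = em (en (LINT x|lborel. 1 - exp (- h n x)))"
   using h0 by (subst em_ennreal) (auto intro!: integral_nonneg)
  also have "en (LINT x|lborel. 1 - exp (- h n x)) = (NINT x|lborel. en (1 - exp (- h n x)))"
  proof (rule nn_integral_eq_integral[symmetric], goal_cases)
   case 1
   have "integrable lborel (%x. ind {x. h n x \<noteq> 0} x :: real)"
    using emeasure_bounded_finite[OF hf(2)[of n]] by (intro integrable_real_indicator) auto
   thus ?case by (rule Bochner_Integration.integrable_bound) (use h0 in \<open>auto simp: indicator_def\<close>)
  qed (use h0 in auto)
  finally show ?thesis using h0 by (simp add: e1)
 qed
 let ?Y = "(NINT x|lborel. 1 - em (en (f x)))"
 have "(%n. (NINT x|lborel. 1 - em (en (h n x)))) ----> ?Y"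
 proof (rule nn_integral_LIMSEQ)
  show "incseq (%n x. 1 - em (en (h n x)))"
   using hi by (auto simp: incseq_def le_fun_def intro!: ennreal_mono_minus em_antimono ennreal_leI)
  show "(%n. 1 - em (en (h n x))) ----> 1 - em (en (f x))" for x
   unfolding e1[OF f0] e1[OF h0(1)] by (intro tendsto_ennrealI tendsto_intros hl)
 qed measurable
 hence "(%n. em (NINT x|lborel. 1 - em (en (h n x)))) ----> em ?Y" by (rule em_tendsto)
 thus ?thesis by (rule LIMSEQ_le_const) (use * in auto)
qed

text \<open>For \<open>0 \<le> t \<le> 1\<close> one has
  \<open>exp t - 1 \<le> t + t\<^sup>2 \<le> 3 * t\<close>, so the exponential formula stays below
  \<open>exp (3 * J)\<close> for all approximations. Monotone convergence then gives finiteness of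
  the sum, and Fatou's lemma carries the bound over to \<open>f\<close>.\<close>

lemma exp_moment:
 fixes f :: "'a => real"
 assumes f[measurable]: "f \<in> bmeas borel" and f0: "!!x. 0 \<le> f x" and f1: "!!x. f x \<le> 1"
 and int: "(NINT x|lborel. en (f x)) \<le> en J" and J: "0 \<le> J"
 shows "AE \<omega> in P. psum f \<omega> < \<infinity>" and "(NINT \<omega>|P. en (exp (enn2real (psum f \<omega>)))) \<le> en (exp (3 * J))"
proof -
 obtain h where h[measurable]: "!!n. h n \<in> bmeas borel" and hf: "!!n. finite (range (h n))"
  "!!n. bounded {x. h n x \<noteq> 0}" and h0: "!!n x. 0 \<le> h n x" "!!n x. h n x \<le> f x" and hi: "!!x. incseq
   (%n. h n x)"
  and hl: "!!x. (%n. h n x) ----> f x" using simple_approximation[OF f f0] by metis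
 define F where "F n \<omega> = (\<Sum>y\<in>\<omega> \<inter> {x. h n x \<noteq> 0}. h n y)" for n \<omega>
 have F: "psum (h n) \<omega> = en (F n \<omega>)" "0 \<le> F n \<omega>" if "\<omega> \<in> space P" for n \<omega>
  using that by (auto simp: psum_simple hf h0 F_def intro!: sum_nonneg)
 let ?Z = "%\<omega> n. (NINT \<omega>|P. en (exp (F n \<omega>)))"
 have E: "(?Z \<omega> n) \<le> en (exp (3 * J))" for n
 proof -
  let ?V = "(LINT x|lborel. exp (h n x) - 1)"
  have "(?Z \<omega> n) = en (exp ?V)" unfolding F_def using hf by (intro laplace_simple) auto
  also have "?V \<le> 3 * J"
  proof -
   have le: "exp (h n x) - 1 \<le> 3 * f x" for x
   proof -
    have t: "0 \<le> h n x" "h n x \<le> 1" using h0[of n x] f1[of x] by auto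
    have "exp (h n x) \<le> 1 + h n x + (h n x)\<^sup>2" using t by (rule exp_bound)
    also have "(h n x)\<^sup>2 \<le> h n x" using t by (simp add: power2_eq_square mult_left_le)
    finally show ?thesis using h0(2)[of n x] f0[of x] by simp
   qed
   let ?U = "(NINT x|lborel. en (exp (h n x) - 1))"
   have "?U \<le> (NINT x|lborel. en 3 * en (f x))"
    using le f0 by (intro nn_integral_mono) (auto simp: ennreal_mult[symmetric] simp del:
     ennreal_numeral intro!: ennreal_leI)
   also have "... = en 3 * (NINT x|lborel. en (f x))" by (rule nn_integral_cmult) measurable
   also have "... \<le> en 3 * en J" by (intro mult_left_mono int) auto
   also have "... = en (3 * J)" using J by (simp add: ennreal_mult)
   finally have "enn2real ?U \<le> 3 * J" using J by (intro enn2real_leI) auto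
   thus ?thesis using h0 by (subst integral_eq_nn_integral) auto
  qed
  finally show ?thesis by (simp add: ennreal_leI)
 qed
 have lim: "(%n. psum (h n) \<omega>) ----> psum f \<omega>" for \<omega> unfolding psum_def
 proof (rule nn_integral_LIMSEQ)
  show "incseq (%n y. en (h n y))" using hi by (auto simp: incseq_def le_fun_def intro!: ennreal_leI)
  show "(%n. en (h n y)) ----> en (f y)" for y by (intro tendsto_ennrealI hl)
 qed auto
 let ?X = "(NINT \<omega>|P. psum f \<omega>)"
 have "?X \<le> en (exp (3 * J))"
 proof (rule LIMSEQ_le_const2)
  show "(%n. (NINT \<omega>|P. psum (h n) \<omega>)) ----> ?X"
  proof (rule nn_integral_LIMSEQ, goal_cases)
   case 1
   show ?case
    using hi by (auto simp: incseq_def le_fun_def psum_def intro!: nn_integral_mono ennreal_leI)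
  qed (use lim in auto)
  have "(NINT \<omega>|P. psum (h n) \<omega>) \<le> (?Z \<omega> n)" for n
  proof (rule nn_integral_mono, goal_cases)
   case w: (1 \<omega>)
   have "F n \<omega> \<le> exp (F n \<omega>)" using exp_ge_add_one_self[of "F n \<omega>"] by linarith
   thus ?case using w by (simp add: F ennreal_leI)
  qed
  thus "\<exists>N. \<forall>n\<ge>N. (NINT \<omega>|P. psum (h n) \<omega>) \<le> en (exp (3 * J))" using E by (meson order_trans)
 qed
 thus AE: "AE \<omega> in P. psum f \<omega> < \<infinity>" using nn_integral_noteq_infinite[of "psum f" P] by (fastforce
  simp: top_unique less_top)
 have [measurable]: "(%\<omega>. en (exp (F n \<omega>))) \<in> bmeas P" for n
 proof -
  have "(%\<omega>. en (exp (enn2real (psum (h n) \<omega>)))) \<in> bmeas P" by measurable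
  thus ?thesis by (rule measurable_cong[THEN iffD1, rotated]) (simp add: F)
 qed
 let ?Y = "(NINT \<omega>|P. en (exp (enn2real (psum f \<omega>))))"
 have "?Y \<le> (NINT \<omega>|P. liminf (%n. en (exp (F n \<omega>))))"
 proof (rule nn_integral_mono_AE, goal_cases)
  case 1
  show ?case using AE AE_space
  proof eventually_elim
   case (elim \<omega>)
   have "(%n. enn2real (psum (h n) \<omega>)) ----> enn2real (psum f \<omega>)" using lim elim by (intro
    tendsto_enn2real) auto
   hence "(%n. en (exp (F n \<omega>))) ----> en (exp (enn2real (psum f \<omega>)))"
    using elim by (intro tendsto_ennrealI tendsto_exp) (simp add: F)
   thus ?case using lim_imp_Liminf[OF sequentially_bot] by fastforce
  qed
 qed
 also have "... \<le> liminf (%n. (NINT \<omega>|P. en (exp (F n \<omega>))))" by (rule nn_integral_liminf) measurable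
 also have "... \<le> en (exp (3 * J))" by (intro Liminf_le eventually_sequentiallyI[of 0] E) auto
 finally show "?Y \<le> en (exp (3 * J))" .
qed

end

section \<open>Ergodicity of the translations\<close>

context poisson
begin

lemma preserves_shift: "preserves P (shift u)" by (simp add: preserves_def shift_distr)

lemma measure_sym_diff_le:
 assumes "A \<in> sets P" "B \<in> sets P"
 shows "\<bar>prob A - prob B\<bar> \<le> prob ((A - B) \<union> (B - A))"
proof -
 let ?X = "(A - B) \<union> (B - A)"
 have "prob A \<le> prob (B \<union> ?X)" using assms by (intro finite_measure_mono) auto
 also have "... \<le> prob B + prob ?X" using assms by (intro measure_Un_le) auto
 finally have 1: "prob A \<le> prob B + prob ?X" .
 have "prob B \<le> prob (A \<union> ?X)" using assms by (intro finite_measure_mono) auto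
 also have "... \<le> prob A + prob ?X" using assms by (intro measure_Un_le) auto
 finally show ?thesis using 1 by linarith
qed

definition local_event :: "real => 'a set set => 'a set set" where
 "local_event R A = {\<omega> \<in> space P. \<omega> \<inter> ball 0 R \<in> A}"

lemma local_event_sets [measurable]: "A \<in> sets P ==> local_event R A \<in> sets P"
 using measurable_sets[OF restrict_measurable[of "ball 0 R"]]
 by (simp add: local_event_def vimage_def Int_def conj_commute)

lemma local_event_mono: "R \<le> R' ==> local_event R A = local_event R' (local_event R A)"
proof -
 assume "R \<le> R'"
 hence "\<omega> \<inter> ball 0 R' \<inter> ball 0 R = \<omega> \<inter> ball 0 R" for \<omega> :: "'a set" by auto
 thus ?thesis by (auto simp: local_event_def space_P intro: config_subset)
qed

text \<open>Approximability passes through complements and countable unions: a union is cut to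
  finitely many terms up to \<open>e / 2\<close>, and the symmetric differences of these terms share
  the other half.\<close>

lemma local_approximation:
 assumes "A \<in> sets P" "0 < e"
 shows "\<exists>R A'. A' \<in> sets P \<and> prob ((A - local_event R A') \<union> (local_event R A' - A)) < e"
proof -
 have "A \<in> sigma_sets configurations (void_events UNIV)" using assms(1) by (simp add: sets_P')
 thus ?thesis using assms(2)
 proof (induction arbitrary: e)
  case (Basic a)
  then obtain B where B: "a = {\<omega> \<in> configurations. \<omega> \<inter> B = {}}" "B \<in> sets borel" "bounded B"
   by (auto simp: void_events_def)
  obtain R where R: "B \<subseteq> ball 0 R" using bounded_subset_ballD[OF B(3)] by blast
  have "\<omega> \<inter> ball 0 R \<inter> B = \<omega> \<inter> B" for \<omega> using R by auto
  hence "local_event R a = a" by (auto simp: local_event_def B(1) space_P intro: config_subset)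
  moreover have "a \<in> sets P" using Basic by (simp add: sets_P' sigma_sets.Basic)
  ultimately show ?case using Basic by (intro exI[of _ R] exI[of _ a]) auto
 next
  case Empty
  thus ?case by (intro exI[of _ 0] exI[of _ "{}"]) (auto simp: local_event_def)
 next
  case (Compl a)
  obtain R A' where A': "A' \<in> sets P" "prob ((a - local_event R A') \<union> (local_event R A' - a)) < e"
   using Compl.IH[OF Compl.prems] by blast
  have "local_event R (space P - A') = space P - local_event R A'"
   by (auto simp: local_event_def space_P intro: config_subset)
  moreover have "(configurations - a) - (space P - local_event R A') = local_event R A' - a"
   by (auto simp: local_event_def space_P)
  moreover have "(space P - local_event R A') - (configurations - a) = a - local_event R A'"
   using sigma_sets_into_sp[OF void_events_Pow Compl.hyps] by (auto simp: space_P)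
  ultimately show ?case using A' by (intro exI[of _ R] exI[of _ "space P - A'"]) (auto simp: Un_commute)
 next
  case (Union a)
  have a: "a i \<in> sets P" for i using Union by (simp add: sets_P')
  let ?U = "\<Union>i. a i"
  let ?V = "\<Union>n. \<Union>i<n. a i"
  have "(%n. prob (\<Union>i<n. a i)) ----> prob ?V"
   using a by (intro finite_Lim_measure_incseq) (auto simp: incseq_def intro: less_le_trans)
  also have "?V = ?U" by auto
  finally have "eventually (%n. prob ?U - e / 2 < prob (\<Union>i<n. a i)) sequentially"
   using Union.prems by (intro order_tendstoD(1)) auto
  then obtain n where n: "prob ?U - e / 2 < prob (\<Union>i<n. a i)" by (auto simp: eventually_sequentially)
  let ?Z = "?U - (\<Union>i<n. a i)"
  have rest: "prob ?Z < e / 2" using n a by (subst finite_measure_Diff) auto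
  have "\<forall>i. \<exists>R A'. A' \<in> sets P \<and> prob ((a i - local_event R A') \<union> (local_event R A' - a i)) < e / (2
   * Suc n)"
   using Union.prems by (intro allI Union.IH) auto
  then obtain R A' where A': "!!i. A' i \<in> sets P"
   "!!i. prob ((a i - local_event (R i) (A' i)) \<union> (local_event (R i) (A' i) - a i)) < e / (2 * Suc
    n)" by metis
  define R' where "R' = Max (insert 0 (R ` {..<n}))"
  have R': "R i \<le> R'" if "i < n" for i unfolding R'_def using that by (intro Max_ge) auto
  define L where "L i = local_event (R i) (A' i)" for i
  have L: "L i \<in> sets P" for i unfolding L_def using A' by simp
  have "local_event R' (\<Union>i<n. L i) = (\<Union>i<n. local_event R' (L i))" by (auto simp: local_event_def)
  also have "... = (\<Union>i<n. L i)" unfolding L_def by (intro SUP_cong refl local_event_mono[symmetric] R') simp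
  finally have L': "local_event R' (\<Union>i<n. L i) = (\<Union>i<n. L i)" .
  let ?X = "\<Union>i<n. (a i - L i) \<union> (L i - a i)"
  let ?Y = "(?U - (\<Union>i<n. L i)) \<union> ((\<Union>i<n. L i) - ?U)"
  have "prob ?Y \<le> prob (?Z \<union> ?X)" using a L by (intro finite_measure_mono) auto
  also have "... \<le> prob ?Z + prob ?X" using a L by (intro measure_Un_le) auto
  also have "prob ?X \<le> (\<Sum>i<n. prob ((a i - L i) \<union> (L i - a i)))"
   using a L by (intro finite_measure_subadditive_finite) auto
  also have "(\<Sum>i<n. prob ((a i - L i) \<union> (L i - a i))) \<le> (\<Sum>i<n. e / (2 * Suc n))"
   using A'(2) by (intro sum_mono less_imp_le) (simp add: L_def)
  also have "... \<le> e / 2" using Union.prems by (simp add: field_simps)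
  finally show ?case using rest L L' by (intro exI[of _ R'] exI[of _ "\<Union>i<n. L i"]) auto
 qed
qed

text \<open>Far translates of a local event are independent of it, so an invariant event \<open>A\<close> satisfies
 \<open>prob A = (prob A)\<^sup>2\<close> up to an arbitrarily small error.\<close>

theorem shift_ergodic:
 assumes u: "u \<noteq> 0" and A: "A \<in> sets P" and inv: "AE \<omega> in P. \<omega> \<in> A \<longleftrightarrow> shift u \<omega> \<in> A"
 shows "prob A = 0 \<or> prob A = 1"
proof -
 have inv_n: "AE \<omega> in P. \<omega> \<in> A \<longleftrightarrow> shift (real n *\<^sub>R u) \<omega> \<in> A" for n
 proof (induction n)
  case (Suc n)
  have "AE \<omega> in P. shift (real n *\<^sub>R u) \<omega> \<in> A \<longleftrightarrow> shift u (shift (real n *\<^sub>R u) \<omega>) \<in> A"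
   by (rule preserves_AE[OF preserves_shift inv])
  with Suc show ?case by (auto simp: shift_shift algebra_simps)
 qed simp
 \<comment> \<open>The four errors: two for replacing \<open>A\<close> and its translate by
   \<open>L\<close> and the translate of \<open>L\<close>, and two for passing from
   \<open>(prob L)\<^sup>2\<close> to \<open>(prob A)\<^sup>2\<close>.\<close>
 have "\<bar>prob A - (prob A)\<^sup>2\<bar> \<le> 4 * e" if e: "0 < e" for e
 proof -
  obtain R A' where A': "A' \<in> sets P" and close: "prob ((A - local_event R A') \<union> (local_event R A' -
   A)) < e"
   using local_approximation[OF A e] by blast
  define L where "L = local_event R A'"
  have L[measurable]: "L \<in> sets P" unfolding L_def using A' by simp
  \<comment> \<open>A translation so long that the ball of radius \<open>R\<close> and its translate
    are disjoint.\<close>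
  obtain n :: nat where n: "2 * \<bar>R\<bar> / norm u < real n" using reals_Archimedean2 by blast
  define z where "z = real n *\<^sub>R u"
  have z: "2 * \<bar>R\<bar> < norm z" using n u by (simp add: z_def field_simps)
  have disj: "ball 0 R \<inter> ball z R = {}"
  proof (rule ccontr)
   assume "\<not> ?thesis"
   then obtain y where y: "norm y < R" "dist z y < R" by auto
   have "norm z \<le> norm (z - y) + norm y" using norm_triangle_ineq[of "z - y" y] by simp
   with y z show False by (simp add: dist_norm)
  qed
  define TL where "TL = {\<omega> \<in> space P. shift z \<omega> \<in> L}"
  have TL[measurable]: "TL \<in> sets P" unfolding TL_def by measurable
  have eqn: "shift z \<omega> \<inter> ball 0 R = shift z (\<omega> \<inter> ball z R)" for \<omega> by (simp add: shift_Int)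
  let ?X = "{\<omega> \<in> space P. shift z \<omega> \<in> A'}"
  have TL_eq: "TL = {\<omega> \<in> space P. \<omega> \<inter> ball z R \<in> ?X}"
   using eqn by (auto simp: TL_def L_def local_event_def space_P shift_config intro: config_subset)
  have sA': "?X \<in> sets P" using A' by measurable
  have pT: "prob TL = prob L"
   using preserves_emeasure[OF preserves_shift[of z] L] by (simp add: TL_def measure_def vimage_def
    Int_def conj_commute)
  have "L \<inter> TL = {\<omega> \<in> space P. \<omega> \<inter> ball 0 R \<in> A' \<and> \<omega> \<inter> ball z R \<in> ?X}"
   unfolding TL_eq by (auto simp: L_def local_event_def)
  hence "prob (L \<inter> TL) = prob L * prob TL"
   using indep_regions[OF _ _ disj A' sA'] unfolding TL_eq by (simp add: L_def local_event_def)
  hence pLT: "prob (L \<inter> TL) = (prob L)\<^sup>2" by (simp add: pT power2_eq_square)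
  define TA where "TA = {\<omega> \<in> space P. shift z \<omega> \<in> A}"
  have TA[measurable]: "TA \<in> sets P" unfolding TA_def using A by measurable
  have "prob (A \<inter> TA) = prob A"
  proof (rule finite_measure_eq_AE, goal_cases)
   case 1
   show ?case using inv_n[of n] AE_space by eventually_elim (auto simp: TA_def z_def)
  qed (use A in auto)
  let ?Y = "(A - L) \<union> (L - A)"
  have "(TA - TL) \<union> (TL - TA) = shift z -` ?Y \<inter> space P" by (auto simp: TA_def TL_def)
  hence dT: "prob ((TA - TL) \<union> (TL - TA)) = prob ?Y" using preserves_emeasure[OF preserves_shift[of
   z], of "(A - L) \<union> (L - A)"] A L
   by (simp add: measure_def)
  have "\<bar>prob (A \<inter> TA) - prob (L \<inter> TL)\<bar> \<le> prob ((A \<inter> TA - L \<inter> TL) \<union> (L \<inter> TL - A \<inter> TA))"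
   using A by (intro measure_sym_diff_le) auto
  also have "... \<le> prob (?Y \<union> ((TA - TL) \<union> (TL - TA)))" using A by (intro finite_measure_mono) auto
  also have "... \<le> prob ?Y + prob ((TA - TL) \<union> (TL - TA))" using A by (intro measure_Un_le) auto
  also have "... \<le> 2 * e" using close by (simp add: dT L_def)
  finally have 1: "\<bar>prob A - (prob L)\<^sup>2\<bar> \<le> 2 * e" by (simp add: \<open>prob (A \<inter> TA) = prob A\<close> pLT)
  have "\<bar>prob A - prob L\<bar> \<le> e" using measure_sym_diff_le[OF A L] close by (simp add: L_def)
  moreover have "\<bar>(prob A)\<^sup>2 - (prob L)\<^sup>2\<bar> = \<bar>prob A - prob L\<bar> * \<bar>prob A + prob L\<bar>"
   by (simp only: abs_mult[symmetric] square_diff_square_factored power2_eq_square mult.commute)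
  moreover have "\<bar>prob A + prob L\<bar> \<le> 2"
   using prob_le_1[of A] prob_le_1[of L] measure_nonneg[of P A] measure_nonneg[of P L] by linarith
  ultimately have "\<bar>(prob A)\<^sup>2 - (prob L)\<^sup>2\<bar> \<le> e * 2" by (simp add: mult_mono)
  with 1 show ?thesis by linarith
 qed
 hence "\<bar>prob A - (prob A)\<^sup>2\<bar> \<le> 0"
  using field_le_epsilon[of "\<bar>prob A - (prob A)\<^sup>2\<bar>" 0] by (metis add_0 mult.commute
   nonzero_mult_div_cancel_right zero_less_divide_iff zero_less_numeral zero_neq_numeral
   times_divide_eq_left)
 thus ?thesis by (auto simp: power2_eq_square algebra_simps)
qed

text \<open>The event \<open>A\<close> that some multiple of \<open>u\<close> leads into
  \<open>E\<close> contains its own preimage under \<open>shift u\<close>. Both have the same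
  probability, so \<open>A\<close> is invariant up to a null set, hence trivial, and it contains
  \<open>E\<close>.\<close>

lemma AE_exists_shift:
 assumes u: "u \<noteq> 0" and E: "E \<in> sets P" and pos: "0 < prob E"
 shows "AE \<omega> in P. \<exists>n::nat. shift (real n *\<^sub>R u) \<omega> \<in> E"
proof -
 define A where "A = {\<omega> \<in> space P. \<exists>n::nat. shift (real n *\<^sub>R u) \<omega> \<in> E}"
 have A[measurable]: "A \<in> sets P" unfolding A_def using E by measurable
 have sub: "shift u -` A \<inter> space P \<subseteq> A"
 proof
  fix \<omega> assume w: "\<omega> \<in> shift u -` A \<inter> space P"
  then obtain n :: nat where "shift (real n *\<^sub>R u) (shift u \<omega>) \<in> E" by (auto simp: A_def)
  hence "shift (real (Suc n) *\<^sub>R u) \<omega> \<in> E" by (simp add: shift_shift algebra_simps)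
  with w show "\<omega> \<in> A" unfolding A_def by blast
 qed
 let ?X = "shift u -` A \<inter> space P"
 have "prob ?X = prob A"
  using preserves_emeasure[OF preserves_shift[of u] A] by (simp add: measure_def)
 hence "prob (A - ?X) = 0" using sub A by (subst finite_measure_Diff) auto
 hence "AE \<omega> in P. \<omega> \<notin> A - ?X" by (intro AE_not_in) (auto simp: emeasure_eq_measure)
 hence "AE \<omega> in P. \<omega> \<in> A \<longleftrightarrow> shift u \<omega> \<in> A" using AE_space by eventually_elim (use sub in auto)
 hence "prob A = 0 \<or> prob A = 1" by (rule shift_ergodic[OF u A])
 moreover have "prob E \<le> prob A"
 proof (rule finite_measure_mono)
  show "E \<subseteq> A"
  proof
   fix \<omega> assume w: "\<omega> \<in> E"
   hence "shift (real 0 *\<^sub>R u) \<omega> \<in> E" by simp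
   with w sets.sets_into_space[OF E] show "\<omega> \<in> A" unfolding A_def by blast
  qed
 qed simp
 ultimately have "AE \<omega> in P. \<omega> \<in> A" using pos A by (simp add: AE_in_set_eq_1)
 thus ?thesis by eventually_elim (simp add: A_def)
qed

end

section \<open>Polynomial weights\<close>

definition wt :: "real => 'a::euclidean_space => real" where "wt \<gamma> y = (1 + norm y) powr (- \<gamma>)"

lemma wt_measurable [measurable]: "wt \<gamma> \<in> bmeas borel" unfolding wt_def by measurable

lemma wt_pos: "0 < wt \<gamma> y"
proof -
 have "0 < 1 + norm y" by (simp add: add_pos_nonneg)
 thus ?thesis by (simp add: wt_def)
qed

lemma wt_le_1: "0 \<le> \<gamma> ==> wt \<gamma> y \<le> 1"
 using powr_mono2'[of "- \<gamma>" 1 "1 + norm y"] by (simp add: wt_def)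

text \<open>The function \<open>1 + norm\<close> of a sum is at most the product of its values at
  the summands.\<close>

lemma wt_shift_le: "0 \<le> \<gamma> ==> wt \<gamma> (y - u) \<le> (1 + norm u) powr \<gamma> * wt \<gamma> y"
proof -
 assume g: "0 \<le> \<gamma>"
 have "1 + norm y \<le> 1 + norm u + norm (y - u)" using norm_triangle_ineq[of u "y - u"] by simp
 also have "... \<le> (1 + norm u) * (1 + norm (y - u))" by (simp add: algebra_simps)
 finally have "((1 + norm u) * (1 + norm (y - u))) powr (- \<gamma>) \<le> (1 + norm y) powr (- \<gamma>)"
  using g by (intro powr_mono2') (auto simp: add_pos_nonneg)
 hence "(1 + norm u) powr (- \<gamma>) * wt \<gamma> (y - u) \<le> wt \<gamma> y" by (simp add: wt_def powr_mult)
 hence "(1 + norm u) powr \<gamma> * ((1 + norm u) powr (- \<gamma>) * wt \<gamma> (y - u)) \<le> (1 + norm u) powr \<gamma> * wt \<gamma> y"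
  by (intro mult_left_mono) auto
 moreover have "(1 + norm u) powr \<gamma> * (1 + norm u) powr (- \<gamma>) = 1"
  using add_pos_nonneg[OF zero_less_one norm_ge_zero[of u]] by (simp add: powr_add[symmetric])
 ultimately show ?thesis by (simp add: mult.assoc[symmetric])
qed

text \<open>Dyadic shells: where \<open>1 + norm y\<close> is at least \<open>2 ^ k\<close> the
  weight is at most \<open>2 powr (- \<gamma> * k)\<close>, while the ball of radius
  \<open>2 ^ Suc k\<close> has volume of order \<open>2 ^ (k * DIM('a))\<close>. The geometric
  series has ratio \<open>2 powr (DIM('a) - \<gamma>) < 1\<close>.\<close>

lemma wt_integrable:
 assumes "real DIM('a) < \<gamma>"
 shows "(NINT y|lborel. en (wt \<gamma> (y::'a::euclidean_space))) < \<infinity>"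
proof -
 let ?B = "%k::nat. ball (0::'a) (2 ^ Suc k)"
 have g: "0 < \<gamma>" using assms by (intro le_less_trans[OF _ assms]) auto
 let ?X = "%k. 2 powr (- \<gamma> * real k)"
 let ?Y = "%k y. \<Sum>k. en (?X k) * ind (?B k) y"
 have "en (wt \<gamma> y) \<le> (?Y k y)" for y :: 'a
 proof -
  define k where "k = nat \<lfloor>log 2 (1 + norm y)\<rfloor>"
  have l: "0 \<le> log 2 (1 + norm y)" by (subst zero_le_log_cancel_iff) (auto simp: add_pos_nonneg)
  have k: "real k \<le> log 2 (1 + norm y)" "log 2 (1 + norm y) < real k + 1"
   using l unfolding k_def by linarith+
  have "2 powr real k \<le> 1 + norm y" using k(1) by (simp add: le_log_iff add_pos_nonneg)
  hence "wt \<gamma> y \<le> (2 powr real k) powr (- \<gamma>)" unfolding wt_def using g by (intro powr_mono2') auto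
  also have "... = 2 powr (- \<gamma> * real k)" by (simp add: powr_powr mult.commute)
  finally have *: "en (wt \<gamma> y) \<le> en (?X k) * 1" by simp
  have "1 + norm y < 2 powr (real k + 1)" using k(2) by (simp add: log_less_iff add_pos_nonneg)
  moreover have "2 powr (real k + 1) = (2::real) ^ Suc k" using powr_realpow[of 2 "Suc k"] by (simp
   add: add.commute)
  ultimately have "ind (?B k) y = (1::ennreal)" by simp
  with * have "en (wt \<gamma> y) \<le> sum (%k. en (?X k) * ind (?B k) y) {k}" by simp
  also have "... \<le> (?Y k y)" by (intro sum_le_suminf) auto
  finally show ?thesis .
 qed
 hence "(NINT y|lborel. en (wt \<gamma> (y::'a))) \<le> (NINT y|lborel. (?Y k y))" by (intro nn_integral_mono)
 also have "... = (\<Sum>k. (NINT y|lborel. en (?X k) * ind (?B k) y))"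
  by (intro nn_integral_suminf borel_measurable_times_ennreal borel_measurable_const
   borel_measurable_indicator) auto
 also have "... = (\<Sum>k. en (unit_ball_vol (real DIM('a)) * 2 ^ DIM('a) * (2 powr (real DIM('a) - \<gamma>)) ^ k))"
 proof (rule suminf_cong, goal_cases)
  case (1 k)
  let ?Z = "unit_ball_vol (real DIM('a)) * (2 ^ Suc k) ^ DIM('a)"
  have "(NINT y|lborel. en (?X k) * ind (?B k) y) = en (2 powr (- \<gamma> * real k) * ?Z)"
   by (simp add: nn_integral_cmult_indicator emeasure_ball ennreal_mult)
  also have "2 powr (- \<gamma> * real k) * ?Z = unit_ball_vol (real DIM('a)) * 2 ^ DIM('a) * (2 powr (real
   DIM('a) - \<gamma>)) ^ k"
  proof -
   have "(2 powr (real DIM('a) - \<gamma>)) ^ k = 2 powr ((real DIM('a) - \<gamma>) * real k)" by (simp add: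
    powr_powr[symmetric] powr_realpow[symmetric])
   also have "... = 2 powr (- \<gamma> * real k) * 2 powr (real k * real DIM('a))" by (simp add:
    powr_add[symmetric] algebra_simps)
   also have "2 powr (real k * real DIM('a)) = (2 ^ k) ^ DIM('a)" by (simp add: powr_powr[symmetric]
    powr_realpow)
   finally show ?thesis by (simp add: power_mult_distrib)
  qed
  finally show ?case .
 qed
 also have "... = en (\<Sum>k. unit_ball_vol (real DIM('a)) * 2 ^ DIM('a) * (2 powr (real DIM('a) - \<gamma>)) ^ k)"
 proof (rule suminf_ennreal2, goal_cases)
  case 2
  have "2 powr (real DIM('a) - \<gamma>) < 2 powr 0" using assms by (intro powr_less_mono) auto
  thus ?case by (intro summable_mult summable_geometric) auto
 qed (auto intro!: mult_nonneg_nonneg)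
 also have "... < \<infinity>" by simp
 finally show ?thesis .
qed

text \<open>This rests on \<open>1 + norm y \<le> (2 + norm x) * max 1 (norm (x - y))\<close>. The
  case distinction at \<open>x = 0\<close> is there because \<open>0 powr (- \<gamma>)\<close> is 0
  in HOL.\<close>

lemma W_le_wt:
 fixes W :: "'a::euclidean_space => real"
 assumes W: "!!x. W x \<le> c * (if x = 0 then 1 else min (norm x powr (- \<gamma>)) 1)" and c: "0 < c" and g: "0 \<le> \<gamma>"
 shows "W (x - y) \<le> c * (2 + norm x) powr \<gamma> * wt \<gamma> y"
proof -
 define b where "b = max 1 (norm (x - y))"
 have b: "1 \<le> b" "norm (x - y) \<le> b" by (auto simp: b_def)
 have "1 + norm y \<le> (1 + norm x) * 1 + b" using norm_triangle_sub[of y x] b by (simp add: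
  norm_minus_commute)
 also have "... \<le> (1 + norm x) * b + b" using b by (intro add_right_mono mult_left_mono) auto
 also have "... = (2 + norm x) * b" by (simp add: algebra_simps)
 finally have "((2 + norm x) * b) powr (- \<gamma>) \<le> wt \<gamma> y" unfolding wt_def using g by (intro
  powr_mono2') (auto simp: add_pos_nonneg)
 hence "(2 + norm x) powr \<gamma> * ((2 + norm x) powr (- \<gamma>) * b powr (- \<gamma>)) \<le> (2 + norm x) powr \<gamma> * wt \<gamma> y"
  using b by (intro mult_left_mono) (auto simp: powr_mult)
 moreover have "2 + norm x \<noteq> 0" using norm_ge_zero[of x] by linarith
 hence "(2 + norm x) powr \<gamma> * (2 + norm x) powr (- \<gamma>) = 1" by (simp flip: powr_add)
 ultimately have "b powr (- \<gamma>) \<le> (2 + norm x) powr \<gamma> * wt \<gamma> y" by (simp flip: mult.assoc)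
 moreover have "(if x - y = 0 then 1 else min (norm (x - y) powr (- \<gamma>)) 1) \<le> b powr (- \<gamma>)" by (auto
  simp: b_def max_def)
 ultimately have "c * (if x - y = 0 then 1 else min (norm (x - y) powr (- \<gamma>)) 1) \<le> c * ((2 + norm x)
  powr \<gamma> * wt \<gamma> y)"
  using c by (auto intro!: mult_left_mono intro: order_trans)
 with W[of "x - y"] show ?thesis by (simp add: mult.assoc)
qed

section \<open>Brownian paths\<close>

text \<open>Paths are total functions pinned to 0 on the nonpositive half-line, so that negative
  times carry no information. Continuity is imposed by restricting the space, since the continuous
  functions do not form a measurable subset of the product.\<close>

definition paths :: "(real => 'a::euclidean_space) measure" where
 "paths = restrict_space (PiM UNIV (%_. borel)) {f. continuous_on UNIV f \<and> (\<forall>t\<le>0. f t = 0)}"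

lemma space_paths: "f \<in> space paths \<longleftrightarrow> continuous_on UNIV f \<and> (\<forall>t\<le>0. f t = 0)"
 by (auto simp: paths_def space_restrict_space space_PiM)

lemma path_cont: "f \<in> space paths ==> continuous_on A f"
 by (auto simp: space_paths intro: continuous_on_subset)

lemma path_0: "f \<in> space paths ==> t \<le> 0 ==> f t = 0" by (simp add: space_paths)

lemma measurable_pathsI:
 assumes "!!x. x \<in> space N ==> h x \<in> space paths" "!!t. (%x. h x t) \<in> bmeas N"
 shows "h \<in> N \<rightarrow>\<^sub>M paths" unfolding paths_def
proof (rule measurable_restrict_space2, goal_cases)
 case 2
 show ?case by (rule measurable_PiM_single') (use assms in auto)
qed (use assms(1) in \<open>auto simp: space_paths\<close>)

lemma path_eval: "(%f. f t) \<in> bmeas paths"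
 unfolding paths_def by (rule measurable_restrict_space1) simp

lemma path_eval': "h \<in> N \<rightarrow>\<^sub>M paths ==> (%x. h x t) \<in> bmeas N"
 by (rule measurable_compose[OF _ path_eval])

text \<open>Random times are rounded down to dyadic numbers, which take countably many values;
  continuity gives the limit.\<close>

lemma cont_eval_measurable:
 fixes h :: "'n => real => 'a::euclidean_space"
 assumes h[measurable]: "!!t. (%x. h x t) \<in> bmeas N"
 and c: "!!x. x \<in> space N ==> continuous_on UNIV (h x)" and g[measurable]: "g \<in> bmeas N"
 shows "(%x. h x (g x)) \<in> bmeas N"
proof (rule borel_measurable_LIMSEQ_metric)
 fix n :: nat
 show "(%x. h x (real_of_int \<lfloor>2 ^ n * g x\<rfloor> / 2 ^ n)) \<in> bmeas N"
  by (rule measurable_compose_countable[where f="%k x. h x (real_of_int k / 2 ^ n)" and g="%x. \<lfloor>2 ^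
   n * g x\<rfloor>"]) measurable
next
 fix x assume x: "x \<in> space N"
 have "(%n. real_of_int \<lfloor>2 ^ n * g x\<rfloor> / 2 ^ n) ----> g x"
 proof (rule tendsto_sandwich)
  let ?X = "%n. g x - (1 / 2) ^ n"
  have "?X ----> g x - 0" by (intro tendsto_intros LIMSEQ_realpow_zero) auto
  thus "?X ----> g x" by simp
  show "eventually (%n. g x - (1 / 2) ^ n \<le> real_of_int \<lfloor>2 ^ n * g x\<rfloor> / 2 ^ n) sequentially"
  proof (rule always_eventually, rule allI, goal_cases)
   case (1 n)
   have "(2 ^ n * g x - 1) / 2 ^ n \<le> real_of_int \<lfloor>2 ^ n * g x\<rfloor> / 2 ^ n" by (intro divide_right_mono) auto
   thus ?case by (simp add: diff_divide_distrib power_one_over)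
  qed
  show "eventually (%n. real_of_int \<lfloor>2 ^ n * g x\<rfloor> / 2 ^ n \<le> g x) sequentially"
   by (auto simp: divide_le_eq mult.commute)
 qed simp
 thus "(%n. h x (real_of_int \<lfloor>2 ^ n * g x\<rfloor> / 2 ^ n)) ----> h x (g x)"
  using c[OF x] by (intro isCont_tendsto_compose[of _ "h x"]) (auto simp: continuous_on_eq_continuous_at)
qed

lemma path_eval_measurable:
 assumes h[measurable]: "h \<in> N \<rightarrow>\<^sub>M paths" and g[measurable]: "g \<in> bmeas N"
 shows "(%x. h x (g x)) \<in> bmeas N"
 by (rule cont_eval_measurable[OF path_eval'[OF h] _ g]) (use measurable_space[OF h] path_cont in blast)

definition stop :: "real => (real => 'a) => real => 'a" where "stop t f = (%s. f (min s t))"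

text \<open>\<open>max s 0\<close> keeps the shifted path in \<open>paths\<close>: it is 0 at
  negative times.\<close>

definition after :: "real => (real => 'a::real_vector) => real => 'a" where
 "after t f = (%s. f (t + max s 0) - f t)"

lemma stop_path:
 assumes "f \<in> space paths" shows "stop t f \<in> space paths"
proof -
 have "continuous_on UNIV (%s. f (min s t))"
  by (rule continuous_on_compose2[OF path_cont[OF assms, of UNIV]]) (auto intro!: continuous_intros)
 moreover have "f (min s t) = 0" if "s \<le> 0" for s using path_0[OF assms, of "min s t"] that by simp
 ultimately show ?thesis by (simp add: space_paths stop_def)
qed

lemma after_path:
 assumes "f \<in> space paths" shows "after t f \<in> space paths"
proof -
 have "continuous_on UNIV (%s. f (t + max s 0))"
  by (rule continuous_on_compose2[OF path_cont[OF assms, of UNIV]]) (auto intro!: continuous_intros)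
 thus ?thesis by (auto simp: space_paths after_def max_def intro!: continuous_intros)
qed

lemma stop_stop: "s \<le> t ==> stop s (stop t f) = stop s f"
 by (auto simp: stop_def fun_eq_iff min_def)

lemma stop_measurable:
 assumes h: "h \<in> N \<rightarrow>\<^sub>M paths" and g: "g \<in> bmeas N"
 shows "(%x. stop (g x) (h x)) \<in> N \<rightarrow>\<^sub>M paths"
proof (rule measurable_pathsI)
 show "stop (g x) (h x) \<in> space paths" if "x \<in> space N" for x
  using measurable_space[OF h that] by (rule stop_path)
 show "(%x. stop (g x) (h x) t) \<in> bmeas N" for t
 proof -
  have "(%x. min t (g x)) \<in> bmeas N" using g by measurable
  thus ?thesis unfolding stop_def by (rule path_eval_measurable[OF h])
 qed
qed

lemma after_measurable:
 assumes h: "h \<in> N \<rightarrow>\<^sub>M paths" and g[measurable]: "g \<in> bmeas N"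
 shows "(%x. after (g x) (h x)) \<in> N \<rightarrow>\<^sub>M paths"
proof (rule measurable_pathsI)
 show "after (g x) (h x) \<in> space paths" if "x \<in> space N" for x
  using measurable_space[OF h that] by (rule after_path)
 show "(%x. after (g x) (h x) t) \<in> bmeas N" for t
 proof -
  have "(%x. g x + max t 0) \<in> bmeas N" by measurable
  from path_eval_measurable[OF h this] path_eval_measurable[OF h g]
  show ?thesis unfolding after_def by (rule borel_measurable_diff)
 qed
qed

lemma stop_measurable' [measurable]: "stop t \<in> paths \<rightarrow>\<^sub>M paths"
 using stop_measurable[of "%f. f" paths "%_. t"] by simp

lemma after_measurable' [measurable]: "after t \<in> paths \<rightarrow>\<^sub>M paths"
 using after_measurable[of "%f. f" paths "%_. t"] by simp

definition cyl :: "real set => (real => 'a::euclidean_space set) => (real => 'a) set" where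
 "cyl J F = {f \<in> space paths. \<forall>t\<in>J. f t \<in> F t}"

text \<open>Closed sets are chosen because their indicators are limits of continuous functions, as
  \<open>path_measure_eqI_product\<close> uses; at times \<open>t \<le> 0\<close> all paths
  agree.\<close>

definition cylinders :: "(real => 'a::euclidean_space) set set" where
 "cylinders = {cyl J F | J F. finite J \<and> (\<forall>t\<in>J. 0 < t) \<and> (\<forall>t. closed (F t))}"

lemma Int_stable_cylinders: "Int_stable cylinders"
proof (rule Int_stableI, goal_cases)
 case (1 a b)
 then obtain J F K G where *: "a = cyl J F" "finite J" "\<forall>t\<in>J. 0 < t" "\<forall>t. closed (F t)"
  "b = cyl K G" "finite K" "\<forall>t\<in>K. 0 < t" "\<forall>t. closed (G t)" unfolding cylinders_def by blast
 let ?H = "%t. (if t \<in> J then F t else UNIV) \<inter> (if t \<in> K then G t else UNIV)"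
 have "a \<inter> b = cyl (J \<union> K) ?H" using * by (auto simp: cyl_def split: if_splits)
 moreover have "\<forall>t. closed (?H t)" using * by auto
 ultimately show ?case unfolding cylinders_def using * by blast
qed

lemma cyl_sets: "finite J ==> (!!t. closed (F t)) ==> cyl J F \<in> sets paths"
proof -
 assume "finite J" and F: "!!t. closed (F t)"
 have pre: "(%f. f t) -` F t \<inter> space paths \<in> sets paths" for t
  using F by (intro measurable_sets[OF path_eval]) auto
 have eq: "cyl J F = space paths \<inter> (\<Inter>t\<in>J. (%f. f t) -` F t \<inter> space paths)" by (auto simp: cyl_def)
 show ?thesis
 proof (cases "J = {}")
  case True
  thus ?thesis unfolding eq by simp
 next
  case False
  show ?thesis unfolding eq by (intro sets.Int sets.top sets.finite_INT \<open>finite J\<close> False pre)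
 qed
qed

lemma cylinders_Pow: "cylinders \<subseteq> Pow (space paths)" by (auto simp: cylinders_def cyl_def)

lemma sets_paths: "sets paths = sigma_sets (space paths) cylinders"
proof
 have "cylinders \<subseteq> sets paths" by (auto simp: cylinders_def intro: cyl_sets)
 thus "sigma_sets (space paths) cylinders \<subseteq> sets paths" by (rule sets.sigma_sets_subset)
 let ?S = "sigma (space paths) cylinders :: (real => 'a) measure"
 have S: "sets ?S = sigma_sets (space paths) cylinders" "space ?S = space paths"
  by (rule sets_measure_of[OF cylinders_Pow], rule space_measure_of_conv)
 have m: "(%f. f) \<in> ?S \<rightarrow>\<^sub>M paths"
 proof (rule measurable_pathsI, goal_cases)
  case (2 t)
  show ?case
  proof (rule borel_measurableI, goal_cases)
   case U: (1 U)
   show ?case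
   proof (cases "t \<le> 0")
    case True
    hence "(%f. f t) -` U \<inter> space ?S = (if 0 \<in> U then space ?S else {})" by (auto simp: S path_0)
    thus ?thesis by auto
   next
    case False
    have "finite {t}" "\<forall>s\<in>{t}. 0 < s" "\<forall>s::real. closed (- U)" using False U by auto
    hence "cyl {t} (%_. - U) \<in> cylinders" unfolding cylinders_def by blast
    hence "cyl {t} (%_. - U) \<in> sets ?S" unfolding S by (rule sigma_sets.Basic)
    hence "space ?S - cyl {t} (%_. - U) \<in> sets ?S" by auto
    also have "space ?S - cyl {t} (%_. - U) = (%f. f t) -` U \<inter> space ?S" by (auto simp: S cyl_def)
    finally show ?thesis .
   qed
  qed
 qed (simp add: S)
 show "sets (paths :: (real => 'a) measure) \<subseteq> sigma_sets (space paths) cylinders"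
 proof (intro subsetI, goal_cases)
  case A: (1 A)
  have "(%f. f) -` A \<inter> space ?S = A" using sets.sets_into_space[OF A] by (auto simp: S)
  thus ?case using measurable_sets[OF m A] by (simp add: S)
 qed
qed

lemma path_measure_eqI:
 assumes "sets M = sets paths" "sets N = sets paths" "finite_measure M"
 and eq: "!!J F. finite J ==> (!!t. t \<in> J ==> 0 < t) ==> (!!t. closed (F t)) ==> emeasure M (cyl J
  F) = emeasure N (cyl J F)"
 shows "M = N"
proof (rule measure_eqI_generator_eq[where E=cylinders and \<Omega>="space paths" and A="%_. space paths"])
 interpret finite_measure M by fact
 have "space paths = cyl {} (%_. UNIV)" by (auto simp: cyl_def)
 thus "range (%_. space paths) \<subseteq> cylinders" unfolding cylinders_def by blast
 show "emeasure M (space paths) \<noteq> \<infinity>" by simp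
 fix X :: "(real => 'a) set" assume "X \<in> cylinders"
 thus "emeasure M X = emeasure N X" using eq unfolding cylinders_def by blast
qed (use assms in \<open>simp_all add: Int_stable_cylinders cylinders_Pow sets_paths\<close>)

text \<open>Brings a finite set of times into the form in which \<open>brownian_on\<close> speaks of
  increments, a strictly increasing infinite sequence.\<close>

lemma strict_mono_enumeration:
 assumes "finite K" "!!t. t \<in> K ==> (0::real) < t"
 obtains \<tau> :: "nat => real" and n where "strict_mono \<tau>" "\<tau> 0 = 0" "\<tau> ` {..n} = insert 0 K"
proof -
 have "\<exists>\<tau> n. strict_mono (\<tau> :: nat => real) \<and> \<tau> 0 = 0 \<and> \<tau> ` {..n} = insert 0 K" using assms
 proof (induction K rule: finite_linorder_max_induct)
  case empty
  show ?case by (intro exI[of _ real] exI[of _ 0]) (auto simp: strict_mono_def)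
 next
  case (insert b K)
  then obtain \<tau> n where t: "strict_mono (\<tau> :: nat => real)" "\<tau> 0 = 0" "\<tau> ` {..n} = insert 0 K" by auto
  have nb: "\<tau> n < b" using t(3) insert by (metis atMost_iff image_eqI insertE insertI1 order_refl)
  \<comment> \<open>After the last relevant time the sequence goes on with unit steps, only to
    remain strictly increasing.\<close>
  define \<sigma> where "\<sigma> i = (if i \<le> n then \<tau> i else b + real (i - Suc n))" for i
  have "strict_mono \<sigma>"
  proof (rule strict_mono_Suc_iff[THEN iffD2], rule allI, goal_cases)
   case (1 i)
   show ?case using nb t(1) by (cases "i = n") (auto simp: \<sigma>_def strict_mono_def Suc_diff_le)
  qed
  moreover have "\<sigma> ` {..Suc n} = insert 0 (insert b K)" using atMost_Suc \<sigma>_def t by auto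
  moreover have "\<sigma> 0 = 0" using t(2) by (simp add: \<sigma>_def)
  ultimately show ?case by blast
 qed
 thus thesis using that by blast
qed

section \<open>Gaussian increments and uniqueness of the Wiener measure\<close>

definition gauss :: "real => 'a::euclidean_space measure" where
 "gauss t = density lborel (%x. en (\<Prod>b\<in>Basis. normal_density 0 (sqrt t) (x \<bullet> b)))"

lemma sets_gauss [simp, measurable_cong]: "sets (gauss t) = sets borel" by (simp add: gauss_def)

text \<open>The horizon \<open>T\<close> allows for the reversed path, which is Brownian only up to
  the time of reversal; a full Brownian motion satisfies this for every \<open>T\<close>.\<close>

definition brownian_on :: "real => 'n measure => ('n => real => 'a::euclidean_space) => bool" where
 "brownian_on T N X \<longleftrightarrow> prob_space N \<and> X \<in> N \<rightarrow>\<^sub>M paths \<and> (\<forall>s t. 0 \<le> s \<longrightarrow> s < t \<longrightarrow> t \<le> T \<longrightarrow> distr N borel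
  (%x. X x t - X x s) = gauss (t - s)) \<and> (\<forall>(\<tau> :: nat => real) n. 0 \<le> \<tau> 0 \<longrightarrow> strict_mono \<tau> \<longrightarrow> \<tau> n \<le> T \<longrightarrow>
  prob_space.indep_vars N (%_. borel) (%i x. X x (\<tau> (Suc i)) - X x (\<tau> i)) {..<n})"

lemma increments_telescope:
 fixes X :: "real => 'a::real_vector"
 assumes "m \<le> k" shows "X (\<tau> k) - X (\<tau> m) = (\<Sum>i\<in>{m..<k}. X (\<tau> (Suc i)) - X (\<tau> i))"
 using sum_Suc_diff'[OF assms, of "%i. X (\<tau> i)"] by simp

lemma increments_distr:
 assumes X: "brownian_on T N X" and \<tau>: "0 \<le> \<tau> 0" "strict_mono \<tau>" "\<tau> n \<le> T"
 shows "distr N (PiM {..<n} (%_. borel)) (%x. \<lambda>i\<in>{..<n}. X x (\<tau> (Suc i)) - X x (\<tau> i)) = PiM {..<n}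
  (%i. gauss (\<tau> (Suc i) - \<tau> i))"
proof -
 interpret prob_space N using X by (simp add: brownian_on_def)
 have Xm: "X \<in> N \<rightarrow>\<^sub>M paths" using X by (simp add: brownian_on_def)
 have [measurable]: "(%x. X x t) \<in> bmeas N" for t by (rule measurable_compose[OF Xm path_eval])
 have "indep_vars (%_. borel) (%i x. X x (\<tau> (Suc i)) - X x (\<tau> i)) {..<n}"
  using X \<tau> by (simp add: brownian_on_def)
 hence "distr N (PiM {..<n} (%_. borel)) (%x. \<lambda>i\<in>{..<n}. X x (\<tau> (Suc i)) - X x (\<tau> i)) = PiM {..<n}
  (%i. distr N borel (%x. X x (\<tau> (Suc i)) - X x (\<tau> i)))"
 proof (cases "n = 0")
  case True
  show ?thesis
  proof (rule measure_eqI, goal_cases)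
   case (2 A)
   hence "A = {} \<or> A = {%_. undefined}" using True by (auto simp: PiM_empty)
   thus ?case using True by (auto simp: PiM_empty restrict_def emeasure_distr emeasure_space_1)
  qed (simp add: True PiM_empty)
 next
  case False
  thus ?thesis using \<open>indep_vars _ _ _\<close> by (subst (asm) indep_vars_iff_distr_eq_PiM') auto
 qed
 also have "... = PiM {..<n} (%i. gauss (\<tau> (Suc i) - \<tau> i))"
 proof (rule PiM_cong, goal_cases)
  case i: (2 i)
  have "\<tau> 0 \<le> \<tau> i" using \<tau>(2) by (simp add: strict_mono_less_eq)
  hence "0 \<le> \<tau> i" using \<tau>(1) by simp
  moreover have "\<tau> (Suc i) \<le> \<tau> n" using \<tau>(2) i by (simp add: strict_mono_less_eq)
  hence "\<tau> (Suc i) \<le> T" using \<tau>(3) by simp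
  moreover have "\<tau> i < \<tau> (Suc i)" using \<tau>(2) by (simp add: strict_mono_def)
  ultimately show ?case using X by (simp add: brownian_on_def)
 qed simp
 finally show ?thesis .
qed

text \<open>Values at finitely many times are partial sums of independent Gaussian increments, so
  the probability of a cylinder is determined by the product measure of these increments.\<close>

lemma brownian_stop_unique:
 assumes T: "0 \<le> T" and X: "brownian_on T N X" and Y: "brownian_on T N' Y"
 shows "distr N paths (%x. stop T (X x)) = distr N' paths (%x. stop T (Y x))"
proof (rule path_measure_eqI)
 interpret N: prob_space N using X by (simp add: brownian_on_def)
 have Xm[measurable]: "X \<in> N \<rightarrow>\<^sub>M paths" and Ym[measurable]: "Y \<in> N' \<rightarrow>\<^sub>M paths"
  using X Y by (auto simp: brownian_on_def)
 let ?Z = "distr N paths (%x. stop T (X x))"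
 show "finite_measure ?Z" by (intro prob_space.finite_measure N.prob_space_distr) measurable
 fix J :: "real set" and F :: "real => 'b set" assume J: "finite J" "!!t. t \<in> J ==> 0 < t" and F:
  "!!t. closed (F t)"
 define K where "K = (%t. min t T) ` J \<inter> {0<..}"
 have "finite K" "!!t. t \<in> K ==> 0 < t" using J by (auto simp: K_def)
 then obtain \<tau> :: "nat => real" and n where \<tau>: "strict_mono \<tau>" "\<tau> 0 = 0" "\<tau> ` {..n} = insert 0 K"
  by (rule strict_mono_enumeration)
 have "\<exists>k\<le>n. \<tau> k = max 0 (min t T)" if "t \<in> J" for t
 proof -
  have "max 0 (min t T) \<in> insert 0 K" using that by (auto simp: K_def max_def)
  thus ?thesis unfolding \<tau>(3)[symmetric] by auto
 qed
 then obtain k where k: "!!t. t \<in> J ==> k t \<le> n" "!!t. t \<in> J ==> \<tau> (k t) = max 0 (min t T)" by metis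
 have "\<tau> n \<in> insert 0 K" unfolding \<tau>(3)[symmetric] by simp
 hence nT: "\<tau> n \<le> T" using T by (auto simp: K_def)
 let ?Y = "PiM {..<n} (%_. borel :: 'b measure)"
 define S where "S = {v \<in> space ?Y. \<forall>t\<in>J. (\<Sum>i\<in>{0..<k t}. v i) \<in> F t}"
 have m: "(%v. \<Sum>i\<in>{0..<k t}. v i) \<in> bmeas ?Y" if "t \<in> J" for t
  using k(1)[OF that] by (intro borel_measurable_sum measurable_component_singleton) auto
 let ?X = "PiM {..<n} (%_. borel)"
 have "{v \<in> space ?X. (\<Sum>i\<in>{0..<k t}. v i) \<in> F t} \<in> sets ?Y" if "t \<in> J" for t
  using measurable_sets[OF m[OF that], of "F t"] F by (simp add: vimage_def Int_def conj_commute)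
 hence Sm: "S \<in> sets ?X" unfolding S_def using J(1) by (intro sets.sets_Collect_finite_All) (auto
  simp: space_PiM)
 let ?U = "%i. gauss (\<tau> (Suc i) - \<tau> i)"
 have *: "emeasure (distr L paths (%x. stop T (Z x))) (cyl J F) = emeasure (PiM {..<n} ?U) S"
  if Z: "brownian_on T L Z" for L :: "'x measure" and Z
 proof -
  have Zm[measurable]: "Z \<in> L \<rightarrow>\<^sub>M paths" using Z by (simp add: brownian_on_def)
  have [measurable]: "(%x. Z x t) \<in> bmeas L" for t by (rule measurable_compose[OF Zm path_eval])
  let ?inc = "%x. \<lambda>i\<in>{..<n}. Z x (\<tau> (Suc i)) - Z x (\<tau> i)"
  have "emeasure (distr L paths (%x. stop T (Z x))) (cyl J F) = emeasure L ((%x. stop T (Z x)) -`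
   cyl J F \<inter> space L)"
   using cyl_sets[OF J(1) F] by (intro emeasure_distr) auto
  also have "(%x. stop T (Z x)) -` cyl J F \<inter> space L = ?inc -` S \<inter> space L"
  proof -
   have "stop T (Z x) \<in> cyl J F \<longleftrightarrow> ?inc x \<in> S" if x: "x \<in> space L" for x
   proof -
    have Zx: "Z x \<in> space paths" using measurable_space[OF Zm x] .
    have "stop T (Z x) t = (\<Sum>i\<in>{0..<k t}. ?inc x i)" if "t \<in> J" for t
    proof -
     have "(\<Sum>i\<in>{0..<k t}. ?inc x i) = (\<Sum>i\<in>{0..<k t}. Z x (\<tau> (Suc i)) - Z x (\<tau> i))"
      using k(1)[OF that] by (intro sum.cong) auto
     also have "... = Z x (\<tau> (k t)) - Z x (\<tau> 0)" by (rule increments_telescope[symmetric]) simp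
     also have "... = Z x (max 0 (min t T))" using k(2)[OF that] \<tau>(2) path_0[OF Zx] by simp
     also have "... = stop T (Z x) t" using J(2)[OF that] T by (simp add: stop_def max_def)
     finally show ?thesis by simp
    qed
    thus ?thesis using stop_path[OF Zx] by (auto simp: cyl_def S_def space_PiM)
   qed
   thus ?thesis by auto
  qed
  also have "emeasure L ... = emeasure (distr L ?X ?inc) S"
   using Sm by (intro emeasure_distr[symmetric]) auto
  also have "distr L ?X ?inc = PiM {..<n} ?U" using \<tau> nT by (intro increments_distr[OF Z]) auto
  finally show ?thesis .
 qed
 show "emeasure ?Z (cyl J F) = emeasure (distr N' paths (%x. stop T (Y x))) (cyl J F)"
  unfolding *[OF X] *[OF Y] ..
qed simp_all

lemma brownian_unique:
 assumes X: "!!T. brownian_on T N X" and Y: "!!T. brownian_on T N' Y"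
 shows "distr N paths X = distr N' paths Y"
proof (rule path_measure_eqI)
 interpret N: prob_space N using X by (simp add: brownian_on_def)
 have Xm[measurable]: "X \<in> N \<rightarrow>\<^sub>M paths" and Ym[measurable]: "Y \<in> N' \<rightarrow>\<^sub>M paths"
  using X Y by (auto simp: brownian_on_def)
 show "finite_measure (distr N paths X)"
  by (intro prob_space.finite_measure N.prob_space_distr) measurable
 fix J :: "real set" and F :: "real => 'b set" assume J: "finite J" "!!t. t \<in> J ==> 0 < t" and F:
  "!!t. closed (F t)"
 define T where "T = Max (insert 0 J)"
 have T: "t \<le> T" if "t \<in> insert 0 J" for t unfolding T_def using that J by (intro Max_ge) auto
 have *: "emeasure (distr L paths Z) (cyl J F) = emeasure (distr L paths (%x. stop T (Z x))) (cyl J F)"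
  if Zm[measurable]: "Z \<in> L \<rightarrow>\<^sub>M paths" for L :: "'x measure" and Z
 proof -
  have "stop T (Z x) \<in> cyl J F \<longleftrightarrow> Z x \<in> cyl J F" if "x \<in> space L" for x
   using measurable_space[OF Zm that] stop_path[OF measurable_space[OF Zm that]] T
   by (auto simp: cyl_def stop_def min_absorb1)
  hence "(%x. stop T (Z x)) -` cyl J F \<inter> space L = Z -` cyl J F \<inter> space L" by auto
  thus ?thesis using cyl_sets[OF J(1) F] by (simp add: emeasure_distr)
 qed
 show "emeasure (distr N paths X) (cyl J F) = emeasure (distr N' paths Y) (cyl J F)"
  unfolding *[OF Xm] *[OF Ym] brownian_stop_unique[OF T[OF insertI1] X Y] ..
qed simp_all

section \<open>Markov and strong Markov properties\<close>

locale wiener = prob_space W for W :: "(real => 'a::euclidean_space) measure" +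
 assumes sets_W [measurable_cong]: "sets W = sets paths"
 and brownian_W: "!!T. brownian_on T W (%f. f)"
begin

lemma space_W: "space W = space paths" by (rule sets_eq_imp_space_eq[OF sets_W])

lemma distr_brownian:
 assumes "!!T. brownian_on T N X" shows "distr N paths X = W"
 by (metis assms brownian_unique brownian_W distr_id2 sets_W)

lemma after_distr:
 assumes t: "0 \<le> t" shows "distr W paths (after t) = W"
proof (rule distr_brownian, goal_cases)
 case (1 T)
 have b: "brownian_on (t + max T 0) W (%f. f)" by (rule brownian_W)
 have b1: "distr W borel (%f. f u - f s) = gauss (u - s)" if "0 \<le> s" "s < u" "u \<le> t + max T 0" for s u
  using b that unfolding brownian_on_def by blast
 have b2: "indep_vars (%_. borel) (%i f. f (\<tau> (Suc i)) - f (\<tau> i)) {..<n}"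
  if "0 \<le> \<tau> 0" "strict_mono \<tau>" "\<tau> n \<le> t + max T 0" for \<tau> :: "nat => real" and n
  using b that unfolding brownian_on_def by blast
 show ?case unfolding brownian_on_def
 proof (intro conjI allI impI)
  show "prob_space W" by unfold_locales
  show "after t \<in> W \<rightarrow>\<^sub>M paths" using after_measurable' measurable_cong_sets[OF sets_W refl] by blast
  fix s u :: real assume su: "0 \<le> s" "s < u" "u \<le> T"
  have "distr W borel (%f. f (t + u) - f (t + s)) = gauss ((t + u) - (t + s))"
   using t su by (intro b1) auto
  thus "distr W borel (%f. after t f u - after t f s) = gauss (u - s)"
   using su by (simp add: after_def)
 next
  fix \<tau> :: "nat => real" and n assume \<tau>: "0 \<le> \<tau> 0" "strict_mono \<tau>" "\<tau> n \<le> T"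
  have pos: "0 \<le> \<tau> i" for i using \<tau>(1) strict_mono_less_eq[OF \<tau>(2), of 0 i] by simp
  have "strict_mono (%i. t + \<tau> i)" using \<tau>(2) by (simp add: strict_mono_def)
  moreover have "t + \<tau> n \<le> t + max T 0" using \<tau>(3) by simp
  ultimately have "indep_vars (%_. borel) (%i f. f (t + \<tau> (Suc i)) - f (t + \<tau> i)) {..<n}"
   using t pos[of 0] by (intro b2) auto
  thus "indep_vars (%_. borel) (%i f. after t f (\<tau> (Suc i)) - after t f (\<tau> i)) {..<n}"
   using pos by (simp add: after_def max_absorb1)
 qed
qed

text \<open>Both sets of times are merged into one grid that contains \<open>t\<close>. The stopped
  path is then a function of the increments before \<open>t\<close>, the later path one of the
  increments after \<open>t\<close>.\<close>

lemma markov_cylinders: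
 assumes t: "0 \<le> t" and C: "C \<in> cylinders" and D: "D \<in> cylinders"
 shows "prob {f \<in> space W. stop t f \<in> C \<and> after t f \<in> D} = prob {f \<in> space W. stop t f \<in> C} * prob
  {f \<in> space W. after t f \<in> D}"
proof -
 obtain J F where J: "C = cyl J F" "finite J" "!!s. s \<in> J ==> 0 < s" "!!s. closed (F s)" using C by
  (auto simp: cylinders_def)
 obtain J' F' where J': "D = cyl J' F'" "finite J'" "!!s. s \<in> J' ==> 0 < s" "!!s. closed (F' s)"
  using D by (auto simp: cylinders_def)
 define K where "K = ((%s. min s t) ` J \<union> {t} \<union> (%s. t + s) ` J') \<inter> {0<..}"
 have "finite K" "!!t. t \<in> K ==> 0 < t" using J J' by (auto simp: K_def)
 then obtain \<tau> :: "nat => real" and n where \<tau>: "strict_mono \<tau>" "\<tau> 0 = 0" "\<tau> ` {..n} = insert 0 K"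
  by (rule strict_mono_enumeration)
 have ex: "\<exists>k\<le>n. \<tau> k = s" if "s \<in> insert 0 K" for s using that unfolding \<tau>(3)[symmetric] by auto
 have "t \<in> insert 0 K" using t by (auto simp: K_def)
 from ex[OF this] obtain m where m: "m \<le> n" "\<tau> m = t" by blast
 have "\<exists>k\<le>n. \<tau> k = min s t" if "s \<in> J" for s
  using that t J(3)[OF that] by (intro ex) (auto simp: K_def min_def)
 then obtain k where k: "!!s. s \<in> J ==> \<tau> (k s) = min s t" by metis
 have km: "k s \<le> m" if "s \<in> J" for s
  using k[OF that] m(2) strict_mono_less_eq[OF \<tau>(1), of "k s" m] by simp
 have "\<exists>k\<le>n. \<tau> k = t + s" if "s \<in> J'" for s
  using that t J'(3)[OF that] by (intro ex) (auto simp: K_def)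
 then obtain l where l: "!!s. s \<in> J' ==> l s \<le> n" "!!s. s \<in> J' ==> \<tau> (l s) = t + s" by metis
 have ml: "m \<le> l s" if "s \<in> J'" for s
  using l[OF that] m(2) J'(3)[OF that] strict_mono_less_eq[OF \<tau>(1), of m "l s"] by simp
 let ?X = "%i f. f (\<tau> (Suc i)) - f (\<tau> i) :: 'a"
 have ind: "indep_vars (%_. borel) ?X {..<n}"
  using brownian_W[of "\<tau> n"] \<tau> by (simp add: brownian_on_def)
 let ?Z = "%f. restrict (%i. ?X i f) {m..<n}"
 let ?U = "%f. restrict (%i. ?X i f) {..<m}"
 let ?V = "PiM {m..<n} (%_. borel)"
 let ?E = "PiM {..<m} (%_. borel)"
 have iv: "indep_var ?E ?U ?V ?Z" using m by (intro indep_var_restrict[OF ind]) auto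
 let ?Y = "%_. borel :: 'a measure"
 define S where "S = {v \<in> space (PiM {..<m} ?Y). \<forall>s\<in>J. (\<Sum>i\<in>{0..<k s}. v i) \<in> F s}"
 define S' where "S' = {v \<in> space (PiM {m..<n} ?Y). \<forall>s\<in>J'. (\<Sum>i\<in>{m..<l s}. v i) \<in> F' s}"
 have sm: "{v \<in> space (PiM I (%_. borel)). (\<Sum>i\<in>I'. v i) \<in> G} \<in> sets (PiM I ?Y)"
  if "I' \<subseteq> I" "closed G" for I I' :: "nat set" and G
 proof -
  have "(%v. \<Sum>i\<in>I'. v i) \<in> bmeas (PiM I ?Y)"
   using that(1) by (intro borel_measurable_sum measurable_component_singleton) auto
  from measurable_sets[OF this, of G] that(2) show ?thesis by (simp add: vimage_def Int_def conj_commute)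
 qed
 have S: "S \<in> sets ?E" unfolding S_def using J km by (intro sets.sets_Collect_finite_All sm) force+
 have S': "S' \<in> sets ?V" unfolding S'_def
  using J' l by (intro sets.sets_Collect_finite_All sm) force+
 have e1: "stop t f \<in> C \<longleftrightarrow> restrict (%i. ?X i f) {..<m} \<in> S" if f: "f \<in> space W" for f
 proof -
  have fp: "f \<in> space paths" using f by (simp add: space_W)
  have "stop t f s = (\<Sum>i\<in>{0..<k s}. restrict (%i. ?X i f) {..<m} i)" if "s \<in> J" for s
  proof -
   have "(\<Sum>i\<in>{0..<k s}. restrict (%i. ?X i f) {..<m} i) = (\<Sum>i\<in>{0..<k s}. ?X i f)"
    using km[OF that] by (intro sum.cong) auto
   also have "... = f (\<tau> (k s)) - f (\<tau> 0)" by (rule increments_telescope[symmetric]) simp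
   finally show ?thesis using k[OF that] \<tau>(2) path_0[OF fp] by (simp add: stop_def)
  qed
  thus ?thesis using stop_path[OF fp] by (auto simp: J(1) cyl_def S_def space_PiM)
 qed
 have e2: "after t f \<in> D \<longleftrightarrow> restrict (%i. ?X i f) {m..<n} \<in> S'" if f: "f \<in> space W" for f
 proof -
  have fp: "f \<in> space paths" using f by (simp add: space_W)
  have "after t f s = (\<Sum>i\<in>{m..<l s}. restrict (%i. ?X i f) {m..<n} i)" if "s \<in> J'" for s
  proof -
   have "(\<Sum>i\<in>{m..<l s}. restrict (%i. ?X i f) {m..<n} i) = (\<Sum>i\<in>{m..<l s}. ?X i f)"
    using l(1)[OF that] by (intro sum.cong) auto
   also have "... = f (\<tau> (l s)) - f (\<tau> m)" by (rule increments_telescope[symmetric, OF ml[OF that]])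
   finally show ?thesis using l(2)[OF that] m(2) J'(3)[OF that] by (simp add: after_def max_def)
  qed
  thus ?thesis using after_path[OF fp] by (auto simp: J'(1) cyl_def S'_def space_PiM)
 qed
 have "{f \<in> space W. stop t f \<in> C \<and> after t f \<in> D} = (%f. (restrict (%i. ?X i f) {..<m}, restrict
  (%i. ?X i f) {m..<n})) -` (S \<times> S') \<inter> space W"
  using e1 e2 by auto
 moreover have "{f \<in> space W. stop t f \<in> C} = ?U -` S \<inter> space W" using e1 by auto
 moreover have "{f \<in> space W. after t f \<in> D} = ?Z -` S' \<inter> space W" using e2 by auto
 ultimately show ?thesis using indep_varD[OF iv S S'] by simp
qed

lemma stop_W: "stop t \<in> W \<rightarrow>\<^sub>M paths"
 using stop_measurable' measurable_cong_sets[OF sets_W refl] by blast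

lemma after_W: "after t \<in> W \<rightarrow>\<^sub>M paths"
 using after_measurable' measurable_cong_sets[OF sets_W refl] by blast

lemma markov_indep:
 assumes t: "0 \<le> t" shows "indep_var paths (stop t) paths (after t)"
proof -
 let ?Z = "%X A. {X -` A \<inter> space W | A. A \<in> cylinders}"
 have gen: "sigma_sets (space W) {X -` A \<inter> space W | A. A \<in> sets paths} = sigma_sets (space W) (?Z X
  A)" if X: "X \<in> W \<rightarrow>\<^sub>M paths" for X
 proof -
  have "X \<in> space W \<rightarrow> space paths" using measurable_space[OF X] by auto
  from sigma_sets_vimage_commute[OF this, of cylinders]
  have "{X -` A \<inter> space W | A. A \<in> sets paths} = sigma_sets (space W) (?Z X A)"
   by (simp add: sets_paths)
  thus ?thesis by (simp only:) (rule sigma_sets_sigma_sets_eq, auto)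
 qed
 have Int: "Int_stable (?Z X A)" for X :: "_ => (real => 'a)"
 proof (rule Int_stableI, goal_cases)
  case (1 a b)
  then obtain A B where AB: "a = X -` A \<inter> space W" "A \<in> cylinders" "b = X -` B \<inter> space W" "B \<in>
   cylinders" by auto
  hence "A \<inter> B \<in> cylinders" using Int_stable_cylinders by (auto simp: Int_stable_def)
  moreover have "a \<inter> b = X -` (A \<inter> B) \<inter> space W" using AB by auto
  ultimately show ?case by blast
 qed
 have cyl: "A \<in> sets paths" if "A \<in> cylinders" for A :: "(real => 'a) set"
  using that by (simp add: sets_paths sigma_sets.Basic)
 let ?X = "{after t -` A \<inter> space W | A. A \<in> cylinders}"
 let ?Y = "{stop t -` A \<inter> space W | A. A \<in> cylinders}"
 have "indep_set ?Y ?X"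
 proof (rule indep_setI)
  show "?Y \<subseteq> events" using cyl by (auto intro: measurable_sets[OF stop_W])
  show "?X \<subseteq> events" using cyl by (auto intro: measurable_sets[OF after_W])
  fix a b assume "a \<in> ?Y" "b \<in> ?X"
  then obtain A B where AB: "a = stop t -` A \<inter> space W" "A \<in> cylinders" "b = after t -` B \<inter> space W"
   "B \<in> cylinders" by auto
  have "a = {f \<in> space W. stop t f \<in> A}" "b = {f \<in> space W. after t f \<in> B}"
   "a \<inter> b = {f \<in> space W. stop t f \<in> A \<and> after t f \<in> B}" using AB by auto
  thus "prob (a \<inter> b) = prob a * prob b" using markov_cylinders[OF t AB(2,4)] by simp
 qed
 from indep_set_sigma_sets[OF this Int Int] show ?thesis
  unfolding indep_var_eq gen[OF stop_W] gen[OF after_W] using stop_W after_W by blast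
qed

lemma markov:
 assumes t: "0 \<le> t" and G: "G \<in> bmeas (paths \<Otimes>\<^sub>M paths)"
 shows "(NINT f|W. G (stop t f, after t f)) = (NINT f|W. (NINT g|W. G (stop t f, g)))"
proof -
 let ?X = "paths \<Otimes>\<^sub>M paths"
 let ?Z = "distr W paths (stop t) \<Otimes>\<^sub>M W"
 have s: "sets ?Z = sets ?X" by (intro sets_pair_measure_cong) (simp_all add: sets_W)
 let ?Y = "%f. (stop t f, after t f)"
 have d: "distr W ?X ?Y = distr W paths (stop t) \<Otimes>\<^sub>M W"
  using markov_indep[OF t] unfolding indep_var_distribution_eq after_distr[OF t] by simp
 have p: "?Y \<in> W \<rightarrow>\<^sub>M paths \<Otimes>\<^sub>M paths" using stop_W after_W by (rule measurable_Pair)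
 have "(NINT f|W. G (stop t f, after t f)) = (NINT x|distr W ?X ?Y. G x)"
  by (rule nn_integral_distr[OF p, symmetric]) (use G in simp)
 also have "... = (NINT x|?Z. G x)" by (simp only: d)
 also have "... = (NINT h|distr W paths (stop t). (NINT g|W. G (h, g)))"
  by (rule nn_integral_fst[symmetric]) (use G measurable_cong_sets[OF s refl] in blast)
 also have "... = (NINT f|W. (NINT g|W. G (stop t f, g)))"
  using nn_integral_distr stop_W sets_pair_measure_cong sets_W G measurable_cong_sets
   borel_measurable_nn_integral_fst by measurable
 finally show ?thesis .
qed

end

text \<open>Galmarino's test: the value of \<open>T\<close> can be read off the path stopped at \<open>T\<close>.\<close>

definition stopping :: "((real => 'a::euclidean_space) => ennreal) => bool" where
 "stopping T \<longleftrightarrow> T \<in> bmeas paths \<and> (\<forall>f\<in>space paths. \<forall>t\<ge>0. (T f \<le> en t \<longrightarrow> T (stop t f) = T f) \<and> (T (stop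
  t f) \<le> en t \<longrightarrow> T f \<le> en t))"

abbreviation stop_at :: "((real => 'a) => ennreal) => (real => 'a) => real => 'a" where
 "stop_at T f \<equiv> stop (enn2real (T f)) f"

abbreviation after_at :: "((real => 'a::real_vector) => ennreal) => (real => 'a) => real => 'a" where
 "after_at T f \<equiv> after (enn2real (T f)) f"

lemma stopping_const: "stopping (%_. en t)" by (simp add: stopping_def)

lemma stopping_stop_at:
 assumes "stopping T" "f \<in> space paths" "T f < \<infinity>" shows "T (stop_at T f) = T f"
 using assms unfolding stopping_def by (cases "T f") auto

lemma stop_at_measurable: "stopping T ==> (%f. stop_at T f) \<in> paths \<rightarrow>\<^sub>M paths"
 unfolding stopping_def by (intro stop_measurable) auto

lemma after_at_measurable: "stopping T ==> (%f. after_at T f) \<in> paths \<rightarrow>\<^sub>M paths"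
 unfolding stopping_def by (intro after_measurable) auto

text \<open>Indicators of closed cylinders are limits of products of continuous functions.
  Continuity is what survives the approximation of random times in
  \<open>strong_markov_product\<close>.\<close>

lemma path_measure_eqI_product:
 fixes M N :: "(real => 'a::euclidean_space) measure"
 assumes M: "sets M = sets paths" "finite_measure M" and N: "sets N = sets paths" "finite_measure N"
 and eq: "!!J \<phi>. finite J ==> (!!t. continuous_on UNIV (\<phi> t)) ==> (!!t x. 0 \<le> \<phi> t x \<and> \<phi> t x \<le>
  (1::real)) ==> (NINT f|M. en (\<Prod>t\<in>J. \<phi> t (f t))) = (NINT f|N. en (\<Prod>t\<in>J. \<phi> t (f t)))"
 shows "M = N"
proof (rule path_measure_eqI[OF M(1) N(1) M(2)])
 fix J :: "real set" and F :: "real => 'a set" assume J: "finite J" and F: "!!t. closed (F t)"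
 show "emeasure M (cyl J F) = emeasure N (cyl J F)"
 \<comment> \<open>\<open>infdist\<close> to the empty set is 0, which would turn the approximating
   functions into 1; so empty sides are treated separately.\<close>
 proof (cases "\<exists>s\<in>J. F s = {}")
  case True
  hence "cyl J F = {}" by (auto simp: cyl_def)
  thus ?thesis by simp
 next
  case False
  define \<phi> where "\<phi> m s x = max 0 (1 - real m * infdist x (F s))" for m :: nat and s x
  have c: "continuous_on UNIV (\<phi> m t)" for m t unfolding \<phi>_def by (intro continuous_intros)
  have b: "0 \<le> \<phi> m t x \<and> \<phi> m t x \<le> 1" for m t x by (auto simp: \<phi>_def infdist_nonneg)
  have lim: "(%m. en (\<Prod>t\<in>J. \<phi> m t (g t))) ----> ind (cyl J F) g" if g: "g \<in> space paths" for g
  proof (cases "g \<in> cyl J F")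
   case True
   thus ?thesis by (simp add: cyl_def \<phi>_def)
  next
   case False
   then obtain s where s: "s \<in> J" "g s \<notin> F s" using g by (auto simp: cyl_def)
   hence d: "0 < infdist (g s) (F s)" using F[of s] \<open>\<not> (\<exists>s\<in>J. F s = {})\<close>
    by (metis in_closed_iff_infdist_zero infdist_nonneg order_le_less)
   hence "eventually (%m. 1 \<le> real m * infdist (g s) (F s)) sequentially" by real_asymp
   hence "eventually (%m. en (\<Prod>t\<in>J. \<phi> m t (g t)) = 0) sequentially"
   proof eventually_elim
    case (elim m)
    hence "(\<Prod>t\<in>J. \<phi> m t (g t)) = 0" using s J by (intro prod_zero bexI[of _ s]) (auto simp: \<phi>_def)
    thus ?case by simp
   qed
   thus ?thesis using False by (simp add: tendsto_eventually)
  qed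
  have "(%m. (NINT f|K. en (\<Prod>t\<in>J. \<phi> m t (f t)))) ----> emeasure K (cyl J F)"
   if K: "sets K = sets paths" "finite_measure K" for K :: "(real => 'a) measure"
  proof -
   interpret finite_measure K by fact
   have cm: "cyl J F \<in> sets K" using cyl_sets[OF J F] K(1) by simp
   have "(%m. (NINT f|K. en (\<Prod>t\<in>J. \<phi> m t (f t)))) ----> (NINT f|K. ind (cyl J F) f)"
   proof (rule nn_integral_dominated_convergence[where w="%_. 1"])
    show "(%f. en (\<Prod>t\<in>J. \<phi> m t (f t))) \<in> bmeas K" for m
     using borel_measurable_continuous_on[OF c path_eval] unfolding measurable_cong_sets[OF K(1)
      refl] by measurable
    show "AE f in K. (%m. en (\<Prod>t\<in>J. \<phi> m t (f t))) ----> ind (cyl J F) f"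
     using lim sets_eq_imp_space_eq[OF K(1)] by auto
   qed (use cm b emeasure_finite in \<open>auto simp: prod_le_1 less_top[symmetric]\<close>)
   thus ?thesis using cm by simp
  qed
  from this[OF M] this[OF N] show ?thesis unfolding eq[OF J c b] by (rule LIMSEQ_unique)
 qed
qed

lemma stopped_event [measurable]:
 assumes "stopping T" "A \<in> sets paths" shows "{f \<in> space paths. T f < \<infinity> \<and> stop_at T f \<in> A} \<in> sets paths"
proof -
 have [measurable]: "T \<in> bmeas paths" using assms(1) by (simp add: stopping_def)
 note [measurable] = stop_at_measurable[OF assms(1)] assms(2)
 show ?thesis by measurable
qed

context wiener
begin

lemma measurable_WI: "f \<in> paths \<rightarrow>\<^sub>M N ==> f \<in> W \<rightarrow>\<^sub>M N"
 using measurable_cong_sets[OF sets_W refl] by blast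

text \<open>\<open>T\<close> is replaced by the next dyadic time strictly after it. This takes
  countably many values, so the Markov property applies to each value; continuity of the paths and
  of \<phi> gives the limit.\<close>

lemma strong_markov_product:
 fixes \<phi> :: "real => 'a => real" and J :: "real set"
 assumes T: "stopping T" and A: "A \<in> sets paths"
 and \<phi>c: "!!t. continuous_on UNIV (\<phi> t)" and \<phi>1: "!!t x. 0 \<le> \<phi> t x \<and> \<phi> t x \<le> 1"
 defines "H \<equiv> {f \<in> space paths. T f < \<infinity> \<and> stop_at T f \<in> A}" and "\<Phi> \<equiv> %g. en (\<Prod>t\<in>J. \<phi> t (g t))"
 shows "(NINT f|W. ind H f * \<Phi> (after_at T f)) = emeasure W H * (NINT g|W. \<Phi> g)"
proof -
 have [measurable]: "T \<in> bmeas paths" using T by (simp add: stopping_def)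
 have \<Phi>m[measurable]: "\<Phi> \<in> bmeas paths"
  unfolding \<Phi>_def using borel_measurable_continuous_on[OF \<phi>c path_eval] by measurable
 have \<Phi>1: "\<Phi> g \<le> 1" for g using \<phi>1 by (simp add: \<Phi>_def prod_le_1)
 have Hm[measurable]: "H \<in> sets paths" unfolding H_def by (rule stopped_event[OF T A])
 have im: "(%f. ind H f * \<Phi> (after (g f) f)) \<in> bmeas W" if [measurable]: "g \<in> bmeas paths" for g
 proof (rule measurable_WI, goal_cases)
  case 1
  have [measurable]: "(%f. after (g f) f) \<in> paths \<rightarrow>\<^sub>M paths" by (intro after_measurable) auto
  show ?case by measurable
 qed
 define t where "t n f = (real_of_int \<lfloor>2 ^ n * enn2real (T f)\<rfloor> + 1) / 2 ^ n" for n :: nat and f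
 have t_lim: "(%n. t n f) ----> enn2real (T f)" for f
 proof -
  have "norm (t n f - enn2real (T f)) \<le> (1 / 2) ^ n" for n
  proof -
   have "t n f - enn2real (T f) = (real_of_int \<lfloor>2 ^ n * enn2real (T f)\<rfloor> + 1 - 2 ^ n * enn2real (T
    f)) / 2 ^ n"
    by (simp add: t_def diff_divide_distrib)
   also have "norm ... \<le> 1 / 2 ^ n" using floor_correct[of "2 ^ n * enn2real (T f)"] by (auto simp:
    divide_le_cancel)
   finally show ?thesis by (simp add: power_one_over)
  qed
  hence "(%n. t n f - enn2real (T f)) ----> 0"
   by (rule Lim_null_comparison[OF always_eventually[OF allI] LIMSEQ_realpow_zero]) auto
  thus ?thesis by (rule LIM_zero_cancel)
 qed
 define D where "D n k = {f \<in> H. \<lfloor>2 ^ n * enn2real (T f)\<rfloor> = int k}" for n k :: nat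
 define u where "u n k = (real k + 1) / 2 ^ n" for n k :: nat
 have tu: "t n f = u n k" if "f \<in> D n k" for n k f using that by (simp add: D_def t_def u_def)
 have u0: "0 \<le> u n k" for n k by (simp add: u_def)
 have Dm[measurable]: "D n k \<in> sets paths" for n k unfolding D_def by measurable
 have D_le: "T f \<le> en (u n k)" if "f \<in> D n k" for f n k
 proof -
  have "2 ^ n * enn2real (T f) \<le> real k + 1" using that floor_correct[of "2 ^ n * enn2real (T f)"]
   by (simp add: D_def)
  hence "en (enn2real (T f)) \<le> en (u n k)" by (intro ennreal_leI) (simp add: u_def le_divide_eq
   mult.commute)
  thus ?thesis using that by (simp add: D_def H_def)
 qed
 \<comment> \<open>By Galmarino's test the path up to time \<open>u n k\<close> decides whether
   \<open>T\<close> was rounded to \<open>u n k\<close>.\<close>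
 have D_stop: "stop (u n k) f \<in> D n k \<longleftrightarrow> f \<in> D n k" if f: "f \<in> space paths" for f n k
 proof -
  have *: "T f \<le> en (u n k)" if "f \<in> D n k \<or> stop (u n k) f \<in> D n k"
   using that D_le T f u0 unfolding stopping_def by blast
  have "stop (u n k) f \<in> D n k \<longleftrightarrow> f \<in> D n k" if le: "T f \<le> en (u n k)"
  proof -
   have "T (stop (u n k) f) = T f" using le T f u0 by (auto simp: stopping_def)
   moreover have "enn2real (T f) \<le> u n k" using le u0 by (simp add: enn2real_leI)
   ultimately show ?thesis using f stop_path[OF f] by (simp add: D_def H_def stop_stop)
  qed
  with * show ?thesis by blast
 qed
 let ?X = "(NINT g|W. \<Phi> g)"
 have step: "(NINT f|W. ind H f * \<Phi> (after (t n f) f)) = emeasure W H * ?X" for n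
 proof -
  have "disjoint_family (D n)" "(\<Union>k. D n k) = H" by (auto simp: disjoint_family_on_def D_def intro!:
   exI[of _ "nat \<lfloor>2 ^ n * enn2real (T _)\<rfloor>"])
  hence HD: "ind H f = (\<Sum>k. ind (D n k) f :: ennreal)" for f using suminf_indicator by metis
  have trm: "(NINT f|W. ind (D n k) f * \<Phi> (after (t n f) f)) = emeasure W (D n k) * ?X" for k
  proof -
   let ?G = "%(h, g). ind (D n k) h * \<Phi> g"
   have "(NINT f|W. ind (D n k) f * \<Phi> (after (t n f) f)) = (NINT f|W. ?G (stop (u n k) f, after (u n k) f))"
    by (intro nn_integral_cong) (auto simp: indicator_def D_stop space_W tu)
   also have "... = (NINT f|W. (NINT g|W. ?G (stop (u n k) f, g)))" by (rule markov[OF u0]) measurable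
   also have "... = (NINT f|W. ?X * ind (D n k) f)"
    by (intro nn_integral_cong) (auto simp: indicator_def D_stop space_W)
   finally show ?thesis by (simp add: nn_integral_cmult_indicator sets_W mult.commute)
  qed
  have "(NINT f|W. ind H f * \<Phi> (after (t n f) f)) = (\<Sum>k. (NINT f|W. ind (D n k) f * \<Phi> (after (t n f) f)))"
  proof (subst nn_integral_suminf[symmetric], goal_cases)
   case (1 k)
   have [measurable]: "(%f. after (t n f) f) \<in> paths \<rightarrow>\<^sub>M paths" unfolding t_def by (intro
    after_measurable) auto
   show ?case by (rule measurable_WI) measurable
  qed (simp add: HD ennreal_suminf_multc)
  also have "... = (\<Sum>k. (NINT f|W. ind (D n k) f)) * ?X" by (simp add: trm ennreal_suminf_multc sets_W)
  also have "(\<Sum>k. (NINT f|W. ind (D n k) f)) = (NINT f|W. ind H f)"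
   unfolding HD by (rule nn_integral_suminf[symmetric]) (simp add: sets_W)
  finally show ?thesis by (simp add: sets_W)
 qed
 have "(%n. (NINT f|W. ind H f * \<Phi> (after (t n f) f))) ----> (NINT f|W. ind H f * \<Phi> (after_at T f))"
 proof (rule nn_integral_dominated_convergence[where w="%_. 1"])
  show "AE f in W. (%n. ind H f * \<Phi> (after (t n f) f)) ----> ind H f * \<Phi> (after_at T f)"
  proof (rule AE_I2, goal_cases)
   case (1 f)
   hence c: "isCont f x" for x using path_cont[of f UNIV] by (simp add: space_W
    continuous_on_eq_continuous_at)
   have "(%n. after (t n f) f r) ----> after_at T f r" for r
    unfolding after_def by (intro tendsto_diff isCont_tendsto_compose[OF c] tendsto_add t_lim tendsto_const)
   hence "(%n. \<Phi> (after (t n f) f)) ----> \<Phi> (after_at T f)"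
    unfolding \<Phi>_def using \<phi>c by (intro tendsto_ennrealI tendsto_prod) (auto intro:
     isCont_tendsto_compose simp: continuous_on_eq_continuous_at)
   thus ?case by (simp add: indicator_def)
  qed
  show "(%f. ind H f * \<Phi> (after (t n f) f)) \<in> bmeas W" for n unfolding t_def by (rule im) measurable
  show "(%f. ind H f * \<Phi> (after_at T f)) \<in> bmeas W" by (rule im) measurable
 qed (use \<Phi>1 in \<open>auto simp: indicator_def emeasure_space_1\<close>)
 thus ?thesis unfolding step by (simp add: LIMSEQ_const_iff)
qed

text \<open>For every event \<open>A\<close> of the stopped path, the later path, restricted to
  finite \<open>T\<close> and to \<open>A\<close>, has as its law a multiple of \<open>W\<close>.
  Hence the joint law of both parts is a product measure, which admits arbitrary
  \<open>G\<close>.\<close>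

theorem strong_markov_pair:
 assumes T: "stopping T" and G: "G \<in> bmeas (paths \<Otimes>\<^sub>M paths)"
 shows "(NINT f|W. ind {f. T f < \<infinity>} f * G (stop_at T f, after_at T f)) = (NINT f|W. ind {f. T f < \<infinity>}
  f * (NINT g|W. G (stop_at T f, g)))"
proof -
 let ?s = "%f. stop_at T f" and ?a = "%f. after_at T f"
 have sm: "?s \<in> W \<rightarrow>\<^sub>M paths" and am: "?a \<in> W \<rightarrow>\<^sub>M paths"
  by (intro measurable_WI stop_at_measurable[OF T] after_at_measurable[OF T])+
 define H where "H A = {f \<in> space paths. T f < \<infinity> \<and> ?s f \<in> A}" for A
 have Hm: "H A \<in> sets W" if "A \<in> sets paths" for A unfolding H_def sets_W using stopped_event[OF T that] .
 define \<mu> where "\<mu> A = density W (ind (H A))" for A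
 have \<mu>s: "sets (\<mu> A) = sets W" "space (\<mu> A) = space W" for A by (simp_all add: \<mu>_def)
 have e\<mu>: "emeasure (\<mu> A) X = emeasure W (H A \<inter> X)" if "A \<in> sets paths" "X \<in> sets W" for A X
  using Hm[OF that(1)] that(2) unfolding \<mu>_def
  by (subst emeasure_density) (auto simp: indicator_inter_arith[symmetric])
 have f\<mu>: "finite_measure (\<mu> A)" if A: "A \<in> sets paths" for A
  using e\<mu>[OF A sets.top] Hm[OF A] by (intro finite_measureI) (simp add: \<mu>s)
 have law: "distr (\<mu> A) paths ?a = scale_measure (emeasure W (H A)) W" if A: "A \<in> sets paths" for A
 proof (rule path_measure_eqI_product)
  have am': "?a \<in> \<mu> A \<rightarrow>\<^sub>M paths" using am measurable_cong_sets[OF \<mu>s(1) refl] by blast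
  show "finite_measure (distr (\<mu> A) paths ?a)" by (rule finite_measure.finite_measure_distr[OF f\<mu>[OF
   A] am'])
  show "finite_measure (scale_measure (emeasure W (H A)) W)"
   by (intro finite_measureI) (simp add: emeasure_space_1 space_scale_measure)
  fix J :: "real set" and \<phi> assume J: "finite J" and \<phi>: "!!t. continuous_on UNIV (\<phi> t)" "!!(t::real)
   (x::'a). 0 \<le> \<phi> t x \<and> \<phi> t x \<le> (1::real)"
  let ?\<Phi> = "%g. en (\<Prod>t\<in>J. \<phi> t (g t))"
  have \<Phi>m: "?\<Phi> \<in> bmeas paths" using borel_measurable_continuous_on[OF \<phi>(1) path_eval] by measurable
  let ?Y = "(NINT g|distr (\<mu> A) paths ?a. ?\<Phi> g)"
  have "?Y = (NINT f|\<mu> A. ?\<Phi> (?a f))" by (rule nn_integral_distr[OF am']) (use \<Phi>m in simp)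
  also have "... = (NINT f|W. ind (H A) f * ?\<Phi> (?a f))"
   unfolding \<mu>_def using Hm[OF A] measurable_compose[OF am \<Phi>m] by (intro nn_integral_density) auto
  also have "... = emeasure W (H A) * (NINT g|W. ?\<Phi> g)" unfolding H_def by (rule
   strong_markov_product[OF T A \<phi>])
  also have "... = (NINT g|scale_measure (emeasure W (H A)) W. ?\<Phi> g)"
   using measurable_WI[OF \<Phi>m] by (simp add: nn_integral_scale_measure)
  finally show "?Y = (NINT g|scale_measure (emeasure W (H A)) W. ?\<Phi> g)" .
 qed (simp_all add: sets_W)
 let ?m = "\<mu> (space paths)"
 have top: "space paths \<in> sets paths" by simp
 have ss: "?s f \<in> space paths" if "f \<in> space paths" for f using that by (rule stop_path)
 have sm': "?s \<in> ?m \<rightarrow>\<^sub>M paths" and am': "?a \<in> ?m \<rightarrow>\<^sub>M paths"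
  using sm am measurable_cong_sets[OF \<mu>s(1) refl] by blast+
 let ?X = "paths \<Otimes>\<^sub>M paths"
 let ?Z = "%f. (?s f, ?a f)"
 have prod: "distr ?m paths ?s \<Otimes>\<^sub>M W = distr ?m ?X ?Z"
 proof (rule pair_measure_eqI)
  let ?U = "distr ?m paths ?s"
  show "sigma_finite_measure ?U"
   by (intro finite_measure.axioms(1) finite_measure.finite_measure_distr[OF f\<mu>[OF top] sm'])
  fix A B assume "A \<in> sets ?U" "B \<in> sets W"
  hence A: "A \<in> sets paths" and B: "B \<in> sets paths" by (simp_all add: sets_W)
  have B': "?a -` B \<inter> space W \<in> sets W" and A': "?s -` A \<inter> space W \<in> sets W" using
   measurable_sets[OF am B] measurable_sets[OF sm A] .
  have hA: "H (space paths) \<inter> (?s -` A \<inter> X) = H A \<inter> X" if "X \<subseteq> space W" for X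
   using that ss by (auto simp: H_def space_W)
  have "emeasure ?U A * emeasure W B = emeasure W (H A) * emeasure W B"
   using sm' A e\<mu>[OF top A'] hA[of "space W"] Hm[OF A] sets.sets_into_space[OF Hm[OF A]]
   by (simp add: emeasure_distr \<mu>s Int_absorb2)
  also have "... = emeasure (distr (\<mu> A) paths ?a) B" unfolding law[OF A] by simp
  also have "... = emeasure W (H A \<inter> (?a -` B \<inter> space W))"
   using am B e\<mu>[OF A B'] measurable_cong_sets[OF \<mu>s(1)[of A] refl] by (subst emeasure_distr) (auto
    simp: \<mu>s)
  also have "... = emeasure ?m (?s -` A \<inter> (?a -` B \<inter> space W))"
   using e\<mu>[OF top sets.Int[OF A' B']] hA[of "?a -` B \<inter> space W"] by (simp add: Int_ac)
  also have "... = emeasure (distr ?m ?X ?Z) (A \<times> B)"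
   using measurable_Pair[OF sm' am'] A B by (subst emeasure_distr) (auto simp: \<mu>s intro!:
    arg_cong[where f="emeasure ?m"])
  finally show "emeasure ?U A * emeasure W B = emeasure (distr ?m ?X ?Z) (A \<times> B)" .
 qed (simp_all add: sigma_finite_measure_axioms sets_W cong: sets_pair_measure_cong)
 have GW: "G \<in> bmeas (K \<Otimes>\<^sub>M W)" if "sets K = sets paths" for K
  using G measurable_cong_sets[OF sets_pair_measure_cong[OF that sets_W] refl] by blast
 have GI: "(%h. (NINT g|W. G (h, g))) \<in> bmeas paths" by (rule borel_measurable_nn_integral_fst[OF
  GW[OF refl]])
 let ?V = "{f. T f < \<infinity>}"
 have dens: "(NINT f|W. ind ?V f * X f) = (NINT f|?m. X f)" if "X \<in> bmeas W" for X
  unfolding \<mu>_def using Hm[OF top] that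
  by (subst nn_integral_density) (auto intro!: nn_integral_cong simp: H_def space_W indicator_def ss)
 have "(NINT f|W. ind ?V f * G (?s f, ?a f)) = (NINT x|distr ?m ?X ?Z. G x)"
  unfolding dens[OF measurable_compose[OF measurable_Pair[OF sm am] G]]
  by (rule nn_integral_distr[OF measurable_Pair[OF sm' am'], symmetric]) (use G in simp)
 also have "... = (NINT h|distr ?m paths ?s. (NINT g|W. G (h, g)))"
  unfolding prod[symmetric] by (rule nn_integral_fst[symmetric]) (simp add: GW)
 also have "... = (NINT f|W. ind ?V f * (NINT g|W. G (?s f, g)))"
  unfolding dens[OF measurable_compose[OF sm GI]] by (rule nn_integral_distr[OF sm']) (use GI in simp)
 finally show ?thesis .
qed

text \<open>\<open>A\<close> is a weight of the past, as expressed by its invariance under stopping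
  at \<open>T\<close>; the future enters together with the position and the time at
  \<open>T\<close>.\<close>

theorem strong_markov:
 assumes T: "stopping T" and A: "A \<in> bmeas paths"
 and past: "!!f. f \<in> space paths ==> T f < \<infinity> ==> A (stop_at T f) = A f"
 and G: "(%(x, t, g). G x t g) \<in> bmeas (borel \<Otimes>\<^sub>M borel \<Otimes>\<^sub>M paths)"
 shows "(NINT f|W. ind {f. T f < \<infinity>} f * A f * G (f (enn2real (T f))) (enn2real (T f)) (after_at T
  f)) = (NINT f|W. ind {f. T f < \<infinity>} f * A f * (NINT g|W. G (f (enn2real (T f))) (enn2real (T f))
  g))"
proof -
 have Tm: "T \<in> bmeas paths" using T by (simp add: stopping_def)
 define G' where "G' = (%(h, g). A h * G (h (enn2real (T h))) (enn2real (T h)) g)"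
 let ?X = "paths \<Otimes>\<^sub>M paths"
 have t: "(%x. enn2real (T (fst x))) \<in> bmeas ?X"
  using measurable_compose[OF measurable_fst Tm] by measurable
 have "(%x. fst x (enn2real (T (fst x)))) \<in> bmeas ?X"
  by (rule path_eval_measurable[OF measurable_fst t])
 from measurable_compose[OF measurable_Pair[OF this measurable_Pair[OF t measurable_snd]] G]
 have "(%x. G (fst x (enn2real (T (fst x)))) (enn2real (T (fst x))) (snd x)) \<in> bmeas ?X" by simp
 moreover have "(%x. A (fst x)) \<in> bmeas ?X" using measurable_compose[OF measurable_fst A] .
 ultimately have G'm: "G' \<in> bmeas ?X" unfolding G'_def case_prod_unfold by measurable
 have st: "stop_at T f (enn2real (T (stop_at T f))) = f (enn2real (T f))" "T (stop_at T f) = T f" "A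
  (stop_at T f) = A f"
  "stop_at T f (enn2real (T f)) = f (enn2real (T f))" if "f \<in> space paths" "T f < \<infinity>" for f
  using that stopping_stop_at[OF T that] past by (auto simp: stop_def)
 let ?U = "%g f. (NINT g|W. G (f (enn2real (T f))) (enn2real (T f)) g)"
 let ?V = "%g f. (NINT g|W. G' (stop_at T f, g))"
 have inner: "(?V g f) = A f * (?U g f)" if f: "f \<in> space paths" "T f < \<infinity>" for f
 proof -
  let ?Z = "%g. G (f (enn2real (T f))) (enn2real (T f)) g"
  show ?thesis using measurable_compose[OF measurable_Pair1'[of "f (enn2real (T f))"] G]
   measurable_compose[OF measurable_Pair[OF measurable_const[of "f (enn2real (T f))"]
    measurable_Pair[OF measurable_const[of "enn2real (T f)"] measurable_ident]] G] using
    measurable_cong_sets[OF sets_W refl] unfolding G'_def using st[OF f] by (simp add: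
    nn_integral_cmult)
 qed
 let ?Y = "{f. T f < \<infinity>}"
 have "(NINT f|W. ind ?Y f * A f * G (f (enn2real (T f))) (enn2real (T f)) (after_at T f)) = (NINT
  f|W. ind ?Y f * G' (stop_at T f, after_at T f))"
  by (intro nn_integral_cong) (auto simp: indicator_def G'_def st space_W)
 also have "... = (NINT f|W. ind ?Y f * (?V g f))" by (rule strong_markov_pair[OF T G'm])
 also have "... = (NINT f|W. ind ?Y f * A f * (?U g f))"
  by (intro nn_integral_cong) (auto simp: indicator_def inner space_W)
 finally show ?thesis .
qed

end

section \<open>Hitting times and killing\<close>

definition hit :: "'a::euclidean_space set => (real => 'a) => ennreal" where
 "hit S f = (INF t\<in>{t. 0 \<le> t \<and> f t \<in> S}. en t)"

lemma hit_attained: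
 assumes S: "closed S" and f: "continuous_on UNIV f" and fin: "hit S f < \<infinity>"
 shows "f (enn2real (hit S f)) \<in> S"
proof -
 let ?A = "{t. 0 \<le> t \<and> f t \<in> S}"
 have "closed ({0..} \<inter> f -` S)"
  using continuous_closed_vimage[OF S] f by (intro closed_Int) (auto simp: continuous_on_eq_continuous_at)
 hence A: "closed ?A" by (simp add: vimage_def Int_def)
 have ne: "?A \<noteq> {}"
 proof
  assume "?A = {}"
  hence "hit S f = \<top>" unfolding hit_def by (simp only: image_empty Inf_empty)
  with fin show False by simp
 qed
 have bd: "bdd_below ?A" by (rule bdd_belowI[of _ 0]) auto
 have mem: "Inf ?A \<in> ?A" using closed_contains_Inf[OF ne bd A] .
 have "hit S f = en (Inf ?A)" unfolding hit_def
  by (auto intro!: order_antisym INF_lower mem INF_greatest ennreal_leI cInf_lower bd)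
 thus ?thesis using mem by auto
qed

lemma hit_le: "0 \<le> t ==> f t \<in> S ==> hit S f \<le> en t" unfolding hit_def by (rule INF_lower) auto

lemma hit_le_iff:
 assumes "closed S" "continuous_on UNIV f" "0 \<le> t"
 shows "hit S f \<le> en t \<longleftrightarrow> (\<exists>s\<in>{0..t}. f s \<in> S)"
proof
 assume le: "hit S f \<le> en t"
 hence fin: "hit S f < \<infinity>" by (auto simp: top_unique less_top[symmetric])
 have "enn2real (hit S f) \<le> t" using le assms(3) by (simp add: enn2real_leI)
 thus "\<exists>s\<in>{0..t}. f s \<in> S" using hit_attained[OF assms(1,2) fin] by (intro bexI[of _ "enn2real (hit
  S f)"]) auto
next
 assume "\<exists>s\<in>{0..t}. f s \<in> S"
 then obtain s where "0 \<le> s" "s \<le> t" "f s \<in> S" by auto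
 thus "hit S f \<le> en t" using hit_le[of s f S] by (auto intro: order_trans ennreal_leI)
qed

text \<open>By compactness a continuous path meets \<open>S\<close> up to time \<open>t\<close> iff
  its distance to \<open>S\<close> gets arbitrarily small on a countable dense set of times.\<close>

lemma hit_measurable:
 fixes h :: "'n => real => 'a::euclidean_space"
 assumes S: "closed S" and h: "!!t. (%x. h x t) \<in> bmeas N" and c: "!!x. x \<in> space N ==>
  continuous_on UNIV (h x)"
 shows "(%x. hit S (h x)) \<in> bmeas N"
proof (cases "S = {}")
 case True
 thus ?thesis by (simp add: hit_def)
next
 case False
 show ?thesis
 proof (rule borel_measurableI_le, goal_cases)
  case (1 a)
  show ?case
  proof (cases a)
   case top
   thus ?thesis by simp
  next
   case (real t)
   \<comment> \<open>Rational fractions of \<open>t\<close> replace rational times, so that the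
     parameter interval stays nondegenerate when \<open>t = 0\<close>.\<close>
   have eq: "hit S (h x) \<le> a \<longleftrightarrow> (\<forall>n::nat. \<exists>r\<in>\<rat> \<inter> {0..1}. infdist (h x (t * r)) S < 1 / Suc n)"
    if x: "x \<in> space N" for x
   proof
    assume "hit S (h x) \<le> a"
    then obtain s where s: "0 \<le> s" "s \<le> t" "h x s \<in> S" using hit_le_iff[OF S c[OF x] real(1)] real by auto
    define u where "u = (if t = 0 then 0 else s / t)"
    have u: "0 \<le> u" "u \<le> 1" "t * u = s" using s by (auto simp: u_def)
    have ci: "continuous_on UNIV (%r. infdist (h x (t * r)) S)"
     by (intro continuous_intros continuous_on_compose2[OF c[OF x]]) auto
    show "\<forall>n::nat. \<exists>r\<in>\<rat> \<inter> {0..1}. infdist (h x (t * r)) S < 1 / Suc n"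
    proof
     fix n :: nat
     have "infdist (h x (t * u)) S < 1 / Suc n" using s u by simp
     hence "eventually (%r. infdist (h x (t * r)) S < 1 / Suc n) (at u)"
      using ci by (intro order_tendstoD(2)) (auto simp: continuous_on_def)
     then obtain d where d: "0 < d" "!!r. r \<noteq> u ==> dist r u < d ==> infdist (h x (t * r)) S < 1 / Suc n"
      by (auto simp: eventually_at)
     have "max 0 (u - d) < min 1 (u + d)" using d(1) u by auto
     then obtain r where r: "r \<in> \<rat>" "max 0 (u - d) < r" "r < min 1 (u + d)" using Rats_dense_in_real
      by blast
     have "infdist (h x (t * r)) S < 1 / Suc n"
      using d(2)[of r] r \<open>infdist (h x (t * u)) S < 1 / Suc n\<close> by (cases "r = u") (auto simp: dist_real_def)
     thus "\<exists>r\<in>\<rat> \<inter> {0..1}. infdist (h x (t * r)) S < 1 / Suc n" using r by (intro bexI[of _ r]) auto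
    qed
   next
    assume *: "\<forall>n::nat. \<exists>r\<in>\<rat> \<inter> {0..1}. infdist (h x (t * r)) S < 1 / Suc n"
    have "continuous_on {0..t} (%s. infdist (h x s) S)"
     by (intro continuous_intros continuous_on_subset[OF c[OF x]]) auto
    moreover have "{0..t} \<noteq> {}" using real by simp
    ultimately obtain s where s: "s \<in> {0..t}" "!!s'. s' \<in> {0..t} ==> infdist (h x s) S \<le> infdist (h x s') S"
     using continuous_attains_inf[of "{0..t}"] by (metis compact_Icc)
    have "infdist (h x s) S < 1 / Suc n" for n :: nat
    proof -
     obtain r where r: "r \<in> {0..1}" "infdist (h x (t * r)) S < 1 / Suc n" using * by blast
     show ?thesis using r real s(2)[of "t * r"] r(2) by (auto simp: mult_left_le)
    qed
    hence "infdist (h x s) S = 0" using infdist_nonneg[of "h x s" S] nat_approx_posE[of "infdist (h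
     x s) S"] by (metis less_asym order_le_less)
    thus "hit S (h x) \<le> a" using in_closed_iff_infdist_zero[OF S False] hit_le_iff[OF S c[OF x]
     real(1)] s(1) real by auto
   qed
   have [measurable]: "(%x. infdist (h x s) S) \<in> bmeas N" for s
    by (rule borel_measurable_continuous_on[OF _ h]) (intro continuous_intros)
   have "countable (\<rat> \<inter> {0..1::real})" using countable_rat by auto
   hence "{x \<in> space N. \<forall>n::nat. \<exists>r\<in>\<rat> \<inter> {0..1}. infdist (h x (t * r)) S < 1 / Suc n} \<in> sets N"
    by (intro sets.sets_Collect_countable_All sets.sets_Collect_countable_Bex) measurable
   also have "{x \<in> space N. \<forall>n::nat. \<exists>r\<in>\<rat> \<inter> {0..1}. infdist (h x (t * r)) S < 1 / Suc n} = {x \<in>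
    space N. hit S (h x) \<le> a}"
    using eq by blast
   finally show ?thesis .
  qed
 qed
qed

lemma stopping_hit:
 assumes S: "closed (S :: 'a::euclidean_space set)" shows "stopping (hit S)" unfolding stopping_def
proof (intro conjI ballI allI impI)
 show "hit S \<in> bmeas paths" using hit_measurable[OF S path_eval path_cont[of _ UNIV]] by simp
 fix f :: "real => 'a" and t :: real assume f: "f \<in> space paths" and t: "0 \<le> t"
 note cf = path_cont[OF f, of UNIV] and cs = path_cont[OF stop_path[OF f], of UNIV]
 show "hit S f \<le> en t" if "hit S (stop t f) \<le> en t"
  using that hit_le_iff[OF S cs t, of t] hit_le_iff[OF S cf t] by (auto simp: stop_def)
 show "hit S (stop t f) = hit S f" if le: "hit S f \<le> en t"
 proof (rule order_antisym)
  have fin: "hit S f < \<infinity>" using le by (auto simp: top_unique less_top[symmetric])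
  have "stop t f (enn2real (hit S f)) \<in> S" using le t hit_attained[OF S cf fin] by (simp add:
   enn2real_leI stop_def min_absorb1)
  hence "hit S (stop t f) \<le> en (enn2real (hit S f))" by (intro hit_le) auto
  thus "hit S (stop t f) \<le> hit S f" using fin by simp
  show "hit S f \<le> hit S (stop t f)" unfolding hit_def[of S "stop t f"]
  proof (rule INF_greatest, goal_cases)
   case (1 s)
   hence "0 \<le> min s t" "f (min s t) \<in> S" using t by (auto simp: stop_def)
   hence "hit S f \<le> en (min s t)" by (rule hit_le)
   also have "... \<le> en s" by (intro ennreal_leI) auto
   finally show ?case .
  qed
 qed
qed

lemma hit_shift_le:
 assumes S: "closed S" and f: "continuous_on UNIV f" and t: "0 \<le> t"
 shows "hit S f \<le> en t + hit S (%s. f (t + s))"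
proof (cases "hit S (%s. f (t + s)) = \<infinity>")
 case False
 let ?X = "%s. f (t + s)"
 let ?s = "enn2real (hit S ?X)"
 have c: "continuous_on UNIV ?X" by (rule continuous_on_compose2[OF f]) (auto intro!: continuous_intros)
 have "f (t + ?s) \<in> S" using hit_attained[OF S c] False by (auto simp: less_top)
 hence "hit S f \<le> en (t + ?s)" using t by (intro hit_le) auto
 also have "... = en t + hit S ?X" using t False by (simp add: less_top)
 finally show ?thesis .
qed simp

lemma hit_shift_eq:
 assumes S: "closed S" and f: "continuous_on UNIV f" and t: "0 \<le> t" and le: "en t \<le> hit S f"
 shows "hit S f = en t + hit S (%s. f (t + s))"
proof (rule order_antisym)
 let ?X = "%s. f (t + s)"
 show "hit S f \<le> en t + hit S ?X" by (rule hit_shift_le[OF S f t])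
 show "en t + hit S ?X \<le> hit S f"
 proof (cases "hit S f")
  case (real u)
  hence u: "t \<le> u" using le by simp
  have "hit S ?X \<le> en (u - t)" using hit_attained[OF S f] real u by (intro hit_le) auto
  hence "en t + hit S ?X \<le> en t + en (u - t)" by (intro add_left_mono)
  also have "... = hit S f" using real t u by (simp add: ennreal_plus[symmetric])
  finally show ?thesis .
 qed simp
qed

definition cost :: "('a => ennreal) => ennreal => (real => 'a) => ennreal" where
 "cost v h f = (\<integral>\<^sup>+ s\<in>{s. 0 \<le> s \<and> en s \<le> h}. v (f s) \<partial>lborel)"

lemma cost_mono: "h \<le> h' ==> cost v h f \<le> cost v h' f"
 unfolding cost_def by (intro nn_integral_mono mult_left_mono indicator_leI) (auto intro: order_trans)

lemma cost_split:
 fixes f :: "real => 'a::euclidean_space"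
 assumes v[measurable]: "v \<in> bmeas borel" and f: "continuous_on UNIV f" and t: "0 \<le> t"
 shows "cost v (en t + h) f = cost v (en t) f + cost v h (%s. f (t + s))"
proof -
 have [measurable]: "f \<in> bmeas borel" using f by (rule borel_measurable_continuous_onI)
 let ?X = "{s. t < s \<and> en s \<le> en t + h}"
 have "cost v (en t + h) f = (NINT s|lborel. v (f s) * ind {s. 0 \<le> s \<and> en s \<le> en t} s + v (f s) * ind ?X s)"
  unfolding cost_def
 proof (intro nn_integral_cong, goal_cases)
  case (1 s)
  have "en s \<le> en t + h" if "s \<le> t" using that t by (intro order_trans[OF ennreal_leI[OF that]]) simp
  thus ?case using t by (auto simp: indicator_def)
 qed
 also have "... = cost v (en t) f + (NINT s|lborel. v (f s) * ind ?X s)"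
  unfolding cost_def by (rule nn_integral_add) measurable
 also have "(NINT s|lborel. v (f s) * ind ?X s) = (NINT s|lborel. v (f (t + 1 * s)) * ind ?X (t + 1 * s))"
  by (subst nn_integral_real_affine[where c=1 and t=t]) (auto simp: one_ennreal_def[symmetric])
 also have "... = cost v h (%s. f (t + s))" unfolding cost_def
 proof (rule nn_integral_cong_AE, goal_cases)
  case 1
  have eq: "en (t + s) \<le> en t + h \<longleftrightarrow> en s \<le> h" if "0 < s" for s
  proof -
   show ?thesis using t that by (simp add: ennreal_add_left_cancel_le)
  qed
  show ?case using AE_lborel_singleton[of "0::real"] by (auto simp: eq indicator_def)
 qed
 finally show ?thesis .
qed

lemma cost_bound:
 assumes "!!s. 0 \<le> s ==> s \<le> t ==> v (f s) \<le> c" and t: "0 \<le> t"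
 shows "cost v (en t) f \<le> c * en t"
proof -
 have "cost v (en t) f \<le> (NINT s|lborel. c * ind {0..t} s)"
  unfolding cost_def using assms by (intro nn_integral_mono) (auto simp: indicator_def)
 also have "... = c * en t" using t by (simp add: nn_integral_cmult_indicator)
 finally show ?thesis .
qed

lemma cost_measurable:
 fixes h :: "'n => real => 'a::euclidean_space" and v :: "'n => 'a => ennreal"
 assumes v: "(%(x, y). v x y) \<in> bmeas (N \<Otimes>\<^sub>M borel)"
 and h: "!!t. (%x. h x t) \<in> bmeas N" and c: "!!x. x \<in> space N ==> continuous_on UNIV (h x)"
 and T[measurable]: "T \<in> bmeas N"
 shows "(%x. cost (v x) (T x) (h x)) \<in> bmeas N"
proof -
 let ?X = "N \<Otimes>\<^sub>M borel"
 have "(%p. h (fst p) (snd p)) \<in> bmeas ?X"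
  by (rule cont_eval_measurable) (use h c in \<open>auto simp: space_pair_measure intro:
   measurable_compose[OF measurable_fst]\<close>)
 from measurable_compose[OF measurable_Pair[OF measurable_fst this] v]
 have "(%p. v (fst p) (h (fst p) (snd p))) \<in> bmeas ?X" by simp
 moreover have "(%p. ind {s. 0 \<le> s \<and> en s \<le> T (fst p)} (snd p) :: ennreal) \<in> bmeas ?X"
  by (auto intro!: measurable measurable_cong iffD1 indicator_def)
 ultimately show ?thesis by (simp add: cost_def)
qed

section \<open>Time reversal, and the Wiener measure of a given Brownian motion\<close>

lemma gauss_uminus: "distr (gauss t) borel uminus = (gauss t :: 'a::euclidean_space measure)"
proof (rule measure_eqI, goal_cases)
 case (2 A)
 hence A[measurable]: "A \<in> sets borel" by simp
 let ?g = "%x::'a. en (\<Prod>b\<in>Basis. normal_density 0 (sqrt t) (x \<bullet> b))"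
 have lb: "distr lborel borel (uminus :: 'a => 'a) = lborel"
  using lborel_affine[of "-1" "0::'a"] by (simp add: density_1)
 have even: "?g (- x) = ?g x" for x by (simp add: normal_density_def)
 have um: "uminus -` A \<in> sets borel" using measurable_sets[of uminus "borel :: 'a measure" borel A]
  A by simp
 have "emeasure (distr (gauss t) borel uminus) A = (NINT x|lborel. ?g x * ind (uminus -` A) x)"
  using um by (subst emeasure_distr) (auto simp: gauss_def emeasure_density)
 also have "... = (NINT x|lborel. ?g (- x) * ind A (- x))"
  unfolding even by (simp only: indicator_def vimage_eq)
 also have "... = (NINT x|distr lborel borel uminus. ?g x * ind A x)" by (subst nn_integral_distr) auto
 also have "... = (NINT x|lborel. ?g x * ind A x)" by (simp only: lb)
 also have "... = emeasure (gauss t) A" by (simp add: gauss_def emeasure_density)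
 finally show ?case .
qed simp

definition rev_path :: "real => (real => 'a::real_vector) => real => 'a" where
 "rev_path t f = (%s. f (t - max 0 (min s t)) - f t)"

lemma rev_path_path:
 assumes f: "f \<in> space paths" and t: "0 \<le> t" shows "rev_path t f \<in> space paths"
proof -
 have "continuous_on UNIV (%s. f (t - max 0 (min s t)))"
  by (rule continuous_on_compose2[OF path_cont[OF f, of UNIV]]) (auto intro!: continuous_intros)
 thus ?thesis using t by (auto simp: space_paths rev_path_def max_def min_def intro!: continuous_intros)
qed

context wiener
begin

lemma path_eval_W: "(%f. f t) \<in> bmeas W"
 using path_eval measurable_cong_sets[OF sets_W refl] by blast

lemma increment_distr: "0 \<le> s ==> s < t ==> distr W borel (%f. f t - f s) = gauss (t - s)"
 using brownian_W[of t] by (simp add: brownian_on_def)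

lemma eval_distr: "0 < t ==> distr W borel (%f. f t) = gauss t"
proof -
 assume t: "0 < t"
 have "distr W borel (%f. f t) = distr W borel (%f. f t - f 0)"
  by (rule distr_cong) (auto simp: space_W path_0)
 thus ?thesis using increment_distr[of 0 t] t by simp
qed

lemma rev_path_W:
 assumes t: "0 \<le> t" shows "rev_path t \<in> W \<rightarrow>\<^sub>M paths"
proof (rule measurable_pathsI)
 show "rev_path t f \<in> space paths" if "f \<in> space W" for f using that t by (simp add: space_W rev_path_path)
 show "(%f. rev_path t f s) \<in> bmeas W" for s unfolding rev_path_def by (intro borel_measurable_diff
  path_eval_W)
qed

text \<open>Increments of the reversed path are negated increments of the path over the reflected
  intervals, in the opposite order, and the Gaussian law is even.\<close>

lemma brownian_rev_path:
 assumes t: "0 \<le> t" shows "brownian_on t W (rev_path t)" unfolding brownian_on_def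
proof (intro conjI allI impI)
 show "prob_space W" by unfold_locales
 show "rev_path t \<in> W \<rightarrow>\<^sub>M paths" by (rule rev_path_W[OF t])
 fix s u :: real assume su: "0 \<le> s" "s < u" "u \<le> t"
 let ?X = "%f. f (t - s) - f (t - u)"
 have m: "?X \<in> bmeas W" by (intro borel_measurable_diff path_eval_W)
 let ?Z = "%f. rev_path t f u - rev_path t f s"
 have "distr W borel ?Z = distr W borel (uminus \<circ> ?X)"
  using su by (intro distr_cong) (auto simp: rev_path_def)
 also have "... = distr (distr W borel ?X) borel uminus" using m by (intro distr_distr[symmetric]) auto
 also have "distr W borel ?X = gauss (u - s)" using increment_distr[of "t - u" "t - s"] su by simp
 also have "distr (gauss (u - s)) borel uminus = (gauss (u - s) :: 'a measure)" by (rule gauss_uminus)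
 finally show "distr W borel ?Z = gauss (u - s)" .
next
 fix \<tau> :: "nat => real" and n assume \<tau>: "0 \<le> \<tau> 0" "strict_mono \<tau>" "\<tau> n \<le> t"
 \<comment> \<open>The reflected grid of times, continued with unit steps beyond index
   \<open>n\<close> so that it stays strictly increasing.\<close>
 define \<sigma> where "\<sigma> i = (if i \<le> n then t - \<tau> (n - i) else t - \<tau> 0 + real (i - n))" for i
 have \<sigma>1: "\<sigma> i = t - \<tau> (n - i)" if "i \<le> n" for i unfolding \<sigma>_def by (rule if_P[OF that])
 have \<sigma>2: "\<sigma> i = t - \<tau> 0 + real (i - n)" if "n < i" for i unfolding \<sigma>_def using that by (intro
  if_not_P) simp
 have \<sigma>0: "0 \<le> \<sigma> 0" using \<tau>(3) by (simp add: \<sigma>1)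
 have \<sigma>m: "strict_mono \<sigma>"
 proof (rule strict_mono_Suc_iff[THEN iffD2], rule allI, goal_cases)
  case (1 i)
  consider "i < n" | "i = n" | "n < i" by linarith
  thus ?case
  proof cases
   case 1
   hence "n - Suc i < n - i" by simp
   hence "\<tau> (n - Suc i) < \<tau> (n - i)" by (rule strict_monoD[OF \<tau>(2)])
   thus ?thesis using 1 \<sigma>1[of i] \<sigma>1[of "Suc i"] by simp
  next
   case 2
   thus ?thesis using \<sigma>1[of i] \<sigma>2[of "Suc i"] by simp
  next
   case 3
   thus ?thesis using 3 \<sigma>2[of i] \<sigma>2[of "Suc i"] by simp
  qed
 qed
 let ?Y = "%i f. f (\<sigma> (Suc i)) - f (\<sigma> i) :: 'a"
 have "indep_vars (%_. borel) ?Y {..<n}"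
  using brownian_W[of "\<sigma> n"] \<sigma>0 \<sigma>m by (simp add: brownian_on_def)
 \<comment> \<open>Blocks of one index each carry out the reordering of the independent
   family.\<close>
 hence "indep_vars (%j. PiM {n - Suc j} (%_. borel)) (%j f. restrict (%i. ?Y i f) {n - Suc j}) {..<n}"
  by (rule indep_vars_restrict) (auto simp: disjoint_family_on_def)
 hence "indep_vars (%_. borel) (%j f. - (restrict (%i. ?Y i f) {n - Suc j}) (n - Suc j)) {..<n}"
  by (rule indep_vars_compose2) (auto intro!: borel_measurable_uminus measurable_component_singleton)
 also have "?this \<longleftrightarrow> indep_vars (%_. borel) (%i f. rev_path t f (\<tau> (Suc i)) - rev_path t f (\<tau> i)) {..<n}"
 proof (rule indep_vars_cong, goal_cases)
  case i: (2 i)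
  have pos: "0 \<le> \<tau> k" for k using \<tau>(1) strict_mono_less_eq[OF \<tau>(2), of 0 k] by simp
  have le: "\<tau> k \<le> t" if "k \<le> n" for k using \<tau>(3) strict_mono_less_eq[OF \<tau>(2), of k n] that by simp
  show ?case using i \<sigma>1[of "Suc (n - Suc i)"] \<sigma>1[of "n - Suc i"] i pos[of i] pos[of "Suc i"] le[of
   i] le[of "Suc i"] by (auto simp: rev_path_def fun_eq_iff)
 qed simp_all
 finally show "indep_vars (%_. borel) (%i f. rev_path t f (\<tau> (Suc i)) - rev_path t f (\<tau> i)) {..<n}" .
qed

lemma rev_path_nn_integral:
 assumes t: "0 \<le> t" and F: "F \<in> bmeas paths"
 shows "(NINT f|W. F (stop t (rev_path t f))) = (NINT f|W. F (stop t f))"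
proof -
 let ?X = "%f. stop t (rev_path t f)"
 have d: "distr W paths ?X = distr W paths (%f. stop t f)"
  by (rule brownian_stop_unique[OF t brownian_rev_path[OF t] brownian_W])
 have m: "?X \<in> W \<rightarrow>\<^sub>M paths" by (rule measurable_compose[OF rev_path_W[OF t] stop_measurable'])
 have "(NINT f|W. F (stop t (rev_path t f))) = (NINT f|distr W paths ?X. F f)"
  by (rule nn_integral_distr[OF m, symmetric]) (use F in simp)
 also have "... = (NINT f|distr W paths (stop t). F f)" by (simp only: d)
 also have "... = (NINT f|W. F (stop t f))" by (rule nn_integral_distr[OF stop_W]) (use F in simp)
 finally show ?thesis .
qed

end

lemma brownian_on_distr:
 assumes X: "brownian_on T N X"
 shows "brownian_on T (distr N paths X) (%f. f)"
proof -
 interpret N: prob_space N using X by (simp add: brownian_on_def)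
 have Xm: "X \<in> N \<rightarrow>\<^sub>M paths" using X by (simp add: brownian_on_def)
 interpret D: prob_space "distr N paths X" by (rule N.prob_space_distr[OF Xm])
 have im: "(%f. f u - f s) \<in> bmeas paths" for u s by (intro borel_measurable_diff path_eval)
 let ?Y = "distr N paths X"
 have ev: "distr ?Y borel (%f. f u - f s) = distr N borel (%x. X x u - X x s)" for u s
  using distr_distr[OF im Xm] by (simp add: comp_def)
 show ?thesis unfolding brownian_on_def
 proof (intro conjI allI impI)
  show "prob_space ?Y" by unfold_locales
  show "(%f. f) \<in> distr N paths X \<rightarrow>\<^sub>M paths" by simp
  show "distr ?Y borel (%f. f t - f s) = gauss (t - s)" if "0 \<le> s" "s < t" "t \<le> T" for s t
   using X that by (simp add: ev brownian_on_def)
  fix \<tau> :: "nat => real" and n assume \<tau>: "0 \<le> \<tau> 0" "strict_mono \<tau>" "\<tau> n \<le> T"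
  show "D.indep_vars (%_. borel) (%i f. f (\<tau> (Suc i)) - f (\<tau> i)) {..<n}"
  proof (cases "n = 0")
   case True
   thus ?thesis by (simp add: D.indep_vars_def D.indep_sets_def)
  next
   case False
   let ?X = "%f. \<lambda>i\<in>{..<n}. f (\<tau> (Suc i)) - f (\<tau> i)"
   have r: "?X \<in> paths \<rightarrow>\<^sub>M PiM {..<n} (%_. borel)" by (intro measurable_restrict im)
   let ?Z = "PiM {..<n} (%_. borel)"
   have "distr ?Y ?Z ?X = distr N ?Z (%x. \<lambda>i\<in>{..<n}. X x (\<tau> (Suc i)) - X x (\<tau> i))"
    using distr_distr[OF r Xm] by (simp add: comp_def)
   also have "... = PiM {..<n} (%i. distr N borel (%x. X x (\<tau> (Suc i)) - X x (\<tau> i)))"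
   proof -
    have "N.indep_vars (%_. borel) (%i x. X x (\<tau> (Suc i)) - X x (\<tau> i)) {..<n}" using X \<tau> by (simp
     add: brownian_on_def)
    thus ?thesis using False by (subst (asm) N.indep_vars_iff_distr_eq_PiM') (auto intro!:
     borel_measurable_diff path_eval'[OF Xm])
   qed
   finally show ?thesis using False by (subst D.indep_vars_iff_distr_eq_PiM') (auto simp: ev im)
  qed
 qed
qed

text \<open>\<open>Z\<close> may start away from 0 on a null set and is arbitrary at negative times;
  the correction puts every path into \<open>paths\<close> without changing increments.\<close>

lemma wiener_of_standard_brownian_motion:
 fixes Z :: "real => 'w => 'a::euclidean_space"
 assumes Z: "standard_brownian_motion M Z"
 shows "wiener (distr M paths (%w t. Z (max 0 t) w - Z 0 w))"
 and "(%w t. Z (max 0 t) w - Z 0 w) \<in> M \<rightarrow>\<^sub>M paths"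
proof -
 interpret M: prob_space M using Z by (simp add: standard_brownian_motion_def)
 define X where "X w t = Z (max 0 t) w - Z 0 w" for w t
 have Zm: "Z t \<in> bmeas M" if "0 \<le> t" for t using Z that by (simp add: standard_brownian_motion_def)
 have Xp: "X w \<in> space paths" if "w \<in> space M" for w
 proof -
  have "continuous_on {0..} (%t. Z t w)" using Z that by (simp add: standard_brownian_motion_def)
  hence "continuous_on UNIV (%t. Z (max 0 t) w)"
   by (rule continuous_on_compose2) (auto intro!: continuous_intros)
  thus ?thesis by (auto simp: space_paths X_def intro!: continuous_intros)
 qed
 have Xm: "X \<in> M \<rightarrow>\<^sub>M paths"
  by (rule measurable_pathsI[OF Xp]) (auto simp: X_def intro!: borel_measurable_diff Zm)
 thus "(%w t. Z (max 0 t) w - Z 0 w) \<in> M \<rightarrow>\<^sub>M paths" unfolding X_def[abs_def] .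
 have b: "brownian_on T M X" for T unfolding brownian_on_def
 proof (intro conjI allI impI)
  show "prob_space M" by unfold_locales
  show "X \<in> M \<rightarrow>\<^sub>M paths" by (rule Xm)
  fix s t :: real assume st: "0 \<le> s" "s < t"
  let ?X = "%w. Z t w - Z s w"
  have "distr M lborel ?X = gauss (t - s)" using Z st by (simp add: standard_brownian_motion_def
   distributed_def gauss_def)
  moreover have "distr M borel (%w. X w t - X w s) = distr M lborel ?X"
   using st by (intro distr_cong) (auto simp: X_def max_absorb2)
  ultimately show "distr M borel (%w. X w t - X w s) = gauss (t - s)" by simp
 next
  fix \<tau> :: "nat => real" and n assume \<tau>: "0 \<le> \<tau> 0" "strict_mono \<tau>"
  have pos: "0 \<le> \<tau> k" for k using \<tau>(1) strict_mono_less_eq[OF \<tau>(2), of 0 k] by simp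
  show "M.indep_vars (%_. borel) (%i w. X w (\<tau> (Suc i)) - X w (\<tau> i)) {..<n}" using Z \<tau> pos by (simp
   add: standard_brownian_motion_def X_def max_absorb2)
 qed
 have "wiener (distr M paths X)"
  by (intro wiener.intro wiener_axioms.intro M.prob_space_distr Xm brownian_on_distr b) simp
 thus "wiener (distr M paths (%w t. Z (max 0 t) w - Z 0 w))" unfolding X_def[abs_def] .
qed

section \<open>Crossing weights\<close>

definition start :: "'a::euclidean_space => (real => 'a) => real => 'a" where
 "start z f = (%t. z + f t)"

lemma start_cont: "f \<in> space paths ==> continuous_on UNIV (start z f)"
 unfolding start_def by (intro continuous_intros path_cont)

lemma hit_cong:
 assumes "!!t. 0 \<le> t ==> f t = g t" shows "hit S f = hit S g"
proof -
 have "{t. 0 \<le> t \<and> f t \<in> S} = {t. 0 \<le> t \<and> g t \<in> S}" using assms by auto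
 thus ?thesis by (simp only: hit_def)
qed

lemma cost_cong:
 assumes "!!t. 0 \<le> t ==> en t \<le> h ==> v (f t) = v (g t)" shows "cost v h f = cost v h g"
 unfolding cost_def using assms by (intro nn_integral_cong) (auto simp: indicator_def)

lemma hit_start: "hit S (start z f) = hit {x. z + x \<in> S} f" by (simp add: hit_def start_def)

lemma closed_translated: "closed S ==> closed {x::'a::euclidean_space. z + x \<in> S}"
 using continuous_closed_vimage[of S "%x. z + x"] by (simp add: vimage_def)

lemma stopping_hit_start:
 assumes "closed S" shows "stopping (%f. hit S (start z f))"
 unfolding hit_start using stopping_hit[OF closed_translated[OF assms]] by simp

lemma start_shift: "0 \<le> s ==> start z f (t + s) = start (start z f t) (after t f) s"
 by (simp add: start_def after_def max_absorb1)

definition wgt :: "('a => ennreal) => 'a::euclidean_space set => (real => 'a) => ennreal" where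
 "wgt v S g = (if hit S g < \<infinity> then em (cost v (hit S g) g) else 0)"

lemma wgt_le_1: "wgt v S g \<le> 1" by (simp add: wgt_def em_le_1)

lemma wgt_cong:
 assumes "!!t. 0 \<le> t ==> f t = g t" shows "wgt v S f = wgt v S g"
 unfolding wgt_def by (metis assms hit_cong cost_cong)

text \<open>A hit after time \<open>t\<close> bounds the hitting time from above; stopping at an
  earlier hit only saves cost.\<close>

lemma wgt_shift_le:
 assumes S: "closed S" and v: "v \<in> bmeas borel" and g: "continuous_on UNIV g" and t: "0 \<le> t"
 shows "em (cost v (en t) g) * wgt v S (%s. g (t + s)) \<le> wgt v S g"
proof (cases "hit S (%s. g (t + s)) < \<infinity>")
 case True
 let ?X = "%s. g (t + s)"
 have le: "hit S g \<le> en t + hit S ?X" by (rule hit_shift_le[OF S g t])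
 have fin: "hit S g < \<infinity>" by (rule le_less_trans[OF le]) (use True in simp)
 have "em (cost v (en t) g) * wgt v S ?X = em (cost v (en t + hit S ?X) g)"
  using True by (simp add: wgt_def em_add[symmetric] cost_split[OF v g t])
 also have "... \<le> em (cost v (hit S g) g)" by (intro em_antimono cost_mono le)
 finally show ?thesis using fin by (simp add: wgt_def)
qed (simp add: wgt_def)

lemma wgt_shift_eq:
 assumes S: "closed S" and v: "v \<in> bmeas borel" and g: "continuous_on UNIV g" and t: "0 \<le> t"
 and le: "en t \<le> hit S g"
 shows "wgt v S g = em (cost v (en t) g) * wgt v S (%s. g (t + s))"
proof -
 have "hit S g = en t + hit S (%s. g (t + s))" by (rule hit_shift_eq[OF S g t le])
 thus ?thesis by (auto simp: wgt_def cost_split[OF v g t] em_add less_top)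
qed

text \<open>Either \<open>S\<close> is hit up to time \<open>t\<close>, where the weight is at most
  1, or the cost up to \<open>t\<close> is dropped.\<close>

lemma wgt_le_shift:
 assumes S: "closed S" and v: "v \<in> bmeas borel" and g: "continuous_on UNIV g" and t: "0 \<le> t"
 shows "wgt v S g \<le> ind {g. hit S g \<le> en t} g + wgt v S (%s. g (t + s))"
proof (cases "hit S g \<le> en t")
 case True
 hence "wgt v S g \<le> ind {g. hit S g \<le> en t} g" by (simp add: wgt_le_1)
 thus ?thesis by (rule order_trans) simp
next
 case False
 hence "wgt v S g = em (cost v (en t) g) * wgt v S (%s. g (t + s))" by (intro wgt_shift_eq[OF S v g t]) simp
 also have "... \<le> 1 * wgt v S (%s. g (t + s))" by (intro mult_right_mono em_le_1) auto
 finally show ?thesis by (simp add: add_increasing)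
qed

lemma wgt_measurable:
 fixes h :: "'n => real => 'a::euclidean_space" and v :: "'n => 'a => ennreal"
 assumes S: "closed S" and v: "(%(x, y). v x y) \<in> bmeas (N \<Otimes>\<^sub>M borel)"
 and h: "!!t. (%x. h x t) \<in> bmeas N" and c: "!!x. x \<in> space N ==> continuous_on UNIV (h x)"
 shows "(%x. wgt (v x) S (h x)) \<in> bmeas N"
proof -
 have [measurable]: "(%x. hit S (h x)) \<in> bmeas N" by (rule hit_measurable[OF S h c])
 have [measurable]: "(%x. cost (v x) (hit S (h x)) (h x)) \<in> bmeas N" by (rule cost_measurable[OF v h
  c]) measurable
 show ?thesis unfolding wgt_def by measurable
qed

context wiener
begin

lemma measurable_W_iff: "f \<in> W \<rightarrow>\<^sub>M N \<longleftrightarrow> f \<in> paths \<rightarrow>\<^sub>M N"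
 using measurable_cong_sets[OF sets_W refl] by blast

lemma pair_W_measurable: "f \<in> N \<Otimes>\<^sub>M W \<rightarrow>\<^sub>M N' \<longleftrightarrow> f \<in> N \<Otimes>\<^sub>M paths \<rightarrow>\<^sub>M N'"
 using measurable_cong_sets[OF sets_pair_measure_cong[OF refl sets_W] refl] by blast

definition cross :: "('a => ennreal) => 'a set => 'a => ennreal" where
 "cross v S z = (NINT f|W. wgt v S (start z f))"

lemma cross_le_1: "cross v S z \<le> 1"
proof -
 have "cross v S z \<le> (NINT f|W. 1)" unfolding cross_def by (intro nn_integral_mono wgt_le_1)
 thus ?thesis by (simp add: emeasure_space_1)
qed

lemma start_measurable:
 assumes z: "z \<in> bmeas N"
 shows "(%p. start (z (fst p)) (snd p) t) \<in> bmeas (N \<Otimes>\<^sub>M paths)"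
 unfolding start_def using measurable_compose[OF measurable_fst z] path_eval'[OF measurable_snd] by
  (rule borel_measurable_add)

lemma wgt_start_measurable:
 assumes S: "closed S" and v: "(%(x, y). v x y) \<in> bmeas (N \<Otimes>\<^sub>M borel)" and z: "z \<in> bmeas N"
 shows "(%(x, f). wgt (v x) S (start (z x) f)) \<in> bmeas (N \<Otimes>\<^sub>M paths)"
proof -
 let ?X = "N \<Otimes>\<^sub>M paths"
 have "(%p. wgt (v (fst p)) S (start (z (fst p)) (snd p))) \<in> bmeas ?X"
 proof (rule wgt_measurable[OF S], goal_cases)
  case 1
  have "(%q. (fst (fst q), snd q)) \<in> ?X \<Otimes>\<^sub>M borel \<rightarrow>\<^sub>M N \<Otimes>\<^sub>M borel" by measurable
  from measurable_compose[OF this v] show ?case by (simp add: case_prod_unfold)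
 qed (use start_measurable[OF z] start_cont in \<open>auto simp: space_pair_measure\<close>)
 thus ?thesis by (simp add: case_prod_unfold)
qed

lemma cross_measurable:
 assumes S: "closed S" and v: "(%(x, y). v x y) \<in> bmeas (N \<Otimes>\<^sub>M borel)" and z: "z \<in> bmeas N"
 shows "(%x. cross (v x) S (z x)) \<in> bmeas N"
proof -
 have "(%(x, f). wgt (v x) S (start (z x) f)) \<in> bmeas (N \<Otimes>\<^sub>M W)"
  unfolding pair_W_measurable by (rule wgt_start_measurable[OF S v z])
 from borel_measurable_nn_integral_fst[OF this] show ?thesis unfolding cross_def by simp
qed

lemma cross_measurable':
 assumes S: "closed S" and v: "v \<in> bmeas borel"
 shows "cross v S \<in> bmeas borel"
proof -
 have "(%(x::'a, y). v y) \<in> bmeas (borel \<Otimes>\<^sub>M borel)"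
  using measurable_compose[OF measurable_snd v] by (simp add: case_prod_unfold)
 from cross_measurable[OF S this, of "%z. z"] show ?thesis by simp
qed

lemma wgt_start_measurable':
 fixes S :: "'a set"
 assumes S: "closed S" and v: "v \<in> bmeas borel"
 shows "(%(x, f). wgt v S (start x f)) \<in> bmeas (borel \<Otimes>\<^sub>M paths)"
proof -
 have "(%(x::'a, y). v y) \<in> bmeas (borel \<Otimes>\<^sub>M borel)"
  using measurable_compose[OF measurable_snd v] by (simp add: case_prod_unfold)
 from wgt_start_measurable[OF S this, where z="%z. z"] show ?thesis by simp
qed

lemma cost_start_measurable:
 assumes v: "v \<in> bmeas borel" and T: "T \<in> bmeas paths"
 shows "(%f. cost v (T f) (start z f)) \<in> bmeas paths"
proof (rule cost_measurable)
 show "(%(x, y). v y) \<in> bmeas (paths \<Otimes>\<^sub>M borel)" using v by (simp add: case_prod_unfold)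
 show "(%f. start z f t) \<in> bmeas paths" for t unfolding start_def by (intro borel_measurable_add
  path_eval) simp
qed (use T start_cont in auto)

lemma cost_past:
 assumes T: "stopping T" and f: "f \<in> space paths" "T f < \<infinity>"
 shows "cost v (T (stop_at T f)) (start z (stop_at T f)) = cost v (T f) (start z f)"
 unfolding stopping_stop_at[OF T f]
proof (rule cost_cong, goal_cases)
 case (1 t)
 hence "t \<le> enn2real (T f)" using f(2) by (cases "T f") auto
 thus ?case by (simp add: start_def stop_def min_absorb1)
qed

lemma start_at: "start z f (enn2real (T f)) = z + f (enn2real (T f))" by (simp add: start_def)

text \<open>The strong Markov property for the path started at \<open>z\<close>, with the cost up to
  \<open>T\<close> as weight of the past. By \<open>cong\<close> the functional \<open>F\<close>
  ignores negative times, where the shifted path differs from the restarted one.\<close>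

lemma start_markov:
 assumes T: "stopping T" and v: "v \<in> bmeas borel"
 and cong: "!!f g. (!!t. 0 \<le> t ==> f t = g t) ==> F f = F g"
 and F: "(%(x, f). F (start x f)) \<in> bmeas (borel \<Otimes>\<^sub>M paths)"
 shows "(NINT f|W. ind {f. T f < \<infinity>} f * em (cost v (T f) (start z f)) * F (%s. start z f (enn2real
  (T f) + s))) = (NINT f|W. ind {f. T f < \<infinity>} f * em (cost v (T f) (start z f)) * (NINT g|W. F (start
  (z + f (enn2real (T f))) g)))"
proof -
 have Tm: "T \<in> bmeas paths" using T by (simp add: stopping_def)
 let ?X = "%f. cost v (T f) (start z f)"
 let ?Y = "{f. T f < \<infinity>}"
 have "(NINT f|W. ind ?Y f * em (?X f) * F (%s. start z f (enn2real (T f) + s))) = (NINT f|W. ind ?Y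
  f * em (?X f) * F (start (z + f (enn2real (T f))) (after_at T f)))"
 proof (rule nn_integral_cong, goal_cases)
  case (1 f)
  have "F (%s. start z f (enn2real (T f) + s)) = F (start (z + f (enn2real (T f))) (after_at T f))"
   by (rule cong) (simp add: start_shift start_at)
  thus ?case by simp
 qed
 also have "... = (NINT f|W. ind ?Y f * em (?X f) * (NINT g|W. F (start (z + f (enn2real (T f))) g)))"
 proof (rule strong_markov[OF T, where G="%x t g. F (start (z + x) g)" and A="%f. em (?X f)"])
  show "(%f. em (?X f)) \<in> bmeas paths" using cost_start_measurable[OF v Tm] by measurable
  show "em (cost v (T (stop_at T f)) (start z (stop_at T f))) = em (?X f)"
   if "f \<in> space paths" "T f < \<infinity>" for f using cost_past[OF T that] by simp
  have "(%(x, t, g). (z + x, g)) \<in> borel \<Otimes>\<^sub>M (borel :: real measure) \<Otimes>\<^sub>M paths \<rightarrow>\<^sub>M borel \<Otimes>\<^sub>M paths"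
   by measurable
  from measurable_compose[OF this F]
  show "(%(x, t, g). F (start (z + x) g)) \<in> bmeas (borel \<Otimes>\<^sub>M (borel :: real measure) \<Otimes>\<^sub>M paths)"
   by (simp add: case_prod_unfold)
 qed
 finally show ?thesis .
qed

lemma cross_markov:
 assumes T: "stopping T" and S: "closed S" and v: "v \<in> bmeas borel"
 shows "(NINT f|W. ind {f. T f < \<infinity>} f * em (cost v (T f) (start z f)) * wgt v S (%s. start z f
  (enn2real (T f) + s))) = (NINT f|W. ind {f. T f < \<infinity>} f * em (cost v (T f) (start z f)) * cross v S
  (z + f (enn2real (T f))))"
 unfolding cross_def by (rule start_markov[OF T v wgt_cong wgt_start_measurable'[OF S v]])

text \<open>One way of crossing is to wait until \<open>T\<close> and to cross from there.\<close>

lemma cross_ge: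
 assumes T: "stopping T" and S: "closed S" and v: "v \<in> bmeas borel"
 shows "(NINT f|W. ind {f. T f < \<infinity>} f * em (cost v (T f) (start z f)) * cross v S (z + f (enn2real
  (T f)))) \<le> cross v S z"
 unfolding cross_markov[OF T S v, symmetric] unfolding cross_def
proof (rule nn_integral_mono, goal_cases)
 case (1 f)
 note f = this[unfolded space_W]
 show ?case
 proof (cases "T f < \<infinity>")
  case True
  thus ?thesis using wgt_shift_le[OF S v start_cont[OF f], of "enn2real (T f)" z] True by simp
 qed simp
qed

lemma cross_time_le:
 assumes S: "closed S" and v: "v \<in> bmeas borel" and t: "0 \<le> t"
 shows "cross v S z \<le> emeasure W {f \<in> space W. hit S (start z f) \<le> en t} + (NINT f|W. cross v S (z + f t))"
proof -
 have hm: "(%f. hit S (start z f)) \<in> bmeas paths" using stopping_hit_start[OF S, of z] by (simp add: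
  stopping_def)
 let ?X = "{f \<in> space W. hit S (start z f) \<le> en t}"
 have m1: "?X \<in> sets W" using hm unfolding measurable_W_iff[symmetric] by measurable
 let ?Y = "%s f. %s. start z f (t + s)"
 have m2: "(%f. wgt v S (?Y s f)) \<in> bmeas W" unfolding measurable_W_iff
 proof (rule wgt_measurable[OF S])
  show "(%(x, y). v y) \<in> bmeas (paths \<Otimes>\<^sub>M borel)" using v by (simp add: case_prod_unfold)
  show "(%f. start z f (t + s)) \<in> bmeas paths" for s unfolding start_def by (intro
   borel_measurable_add path_eval) simp
  show "continuous_on UNIV (?Y s f)" if "f \<in> space paths" for f
   by (rule continuous_on_compose2[OF start_cont[OF that]]) (auto intro!: continuous_intros)
 qed
 have "cross v S z \<le> (NINT f|W. ind ?X f + wgt v S (?Y s f))" unfolding cross_def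
 proof (rule nn_integral_mono, goal_cases)
  case (1 f)
  thus ?case using wgt_le_shift[OF S v start_cont t, of f z] by (simp add: space_W indicator_def)
 qed
 also have "... = emeasure W ?X + (NINT f|W. wgt v S (?Y s f))"
  using m1 m2 by (subst nn_integral_add) auto
 also have "(NINT f|W. wgt v S (?Y s f)) = (NINT f|W. cross v S (z + f t))"
 proof -
  \<comment> \<open>With potential 0 the weight of the past is 1, and \<open>start_markov\<close>
    becomes the plain Markov property at time \<open>t\<close>.\<close>
  let ?T = "%_::real => 'a. en t"
  have c0: "cost (%_::'a. 0) h f = 0" for h f by (simp add: cost_def)
  have "(NINT f|W. wgt v S (?Y s f)) = (NINT f|W. ind {f. ?T f < \<infinity>} f * em (cost (%_. 0) (?T f)
   (start z f)) * wgt v S (%s. start z f (enn2real (?T f) + s)))"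
   using t by (simp add: c0)
  also have "... = (NINT f|W. ind {f. ?T f < \<infinity>} f * em (cost (%_. 0) (?T f) (start z f)) * (NINT
   g|W. wgt v S (start (z + f (enn2real (?T f))) g)))"
   by (rule start_markov[OF stopping_const _ wgt_cong wgt_start_measurable'[OF S v]]) simp
  also have "... = (NINT f|W. cross v S (z + f t))" using t by (simp add: c0 cross_def)
  finally show ?thesis .
 qed
 finally show ?thesis .
qed

text \<open>Taking the infimum over the starting ball turns the strong Markov property into
 supermultiplicativity.\<close>

definition ib :: "('a => ennreal) => 'a => 'a => ennreal" where
 "ib v x y = (INF z\<in>cball x 1. cross v (cball y 1) z)"

lemma ib_le_1: "ib v x y \<le> 1" unfolding ib_def by (rule INF_lower2[of x]) (auto simp: cross_le_1)

lemma ib_le: "dist x z \<le> 1 ==> ib v x y \<le> cross v (cball y 1) z"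
 unfolding ib_def by (rule INF_lower) auto

lemma wgt_W:
 assumes "closed S" "v \<in> bmeas borel"
 shows "(%f. wgt v S (start z f)) \<in> bmeas W"
 unfolding measurable_W_iff using measurable_compose[OF measurable_Pair1'[of z borel paths]
  wgt_start_measurable'[OF assms]] by simp

lemma cross_self:
 assumes z: "z \<in> S"
 shows "cross v S z = 1"
proof -
 have "wgt v S (start z f) = 1" if f: "f \<in> space W" for f
 proof -
  have "hit S (start z f) \<le> en 0" using f z by (intro hit_le) (auto simp: start_def space_W path_0)
  hence h: "hit S (start z f) = 0" by simp
  have "v (g s) * ind {s. 0 \<le> s \<and> en s \<le> 0} s = v (g 0) * ind {0} s" for g s
   by (auto simp: indicator_def ennreal_eq_0_iff)
  thus ?thesis by (simp add: wgt_def h cost_def)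
 qed
 thus ?thesis unfolding cross_def by (simp add: emeasure_space_1 cong: nn_integral_cong)
qed

lemma ib_refl: "ib v x x = 1"
 unfolding ib_def by (intro order_antisym INF_greatest) (auto simp: cross_self intro: INF_lower2[of
  x] cross_le_1)

text \<open>The strong Markov property at the hitting time of \<open>S\<close>, for a functional
  whose mean is at least \<open>c\<close> from every point of \<open>S\<close>. In
  \<open>ib_mult_le\<close> this functional is a further crossing, in \<open>reach_lower\<close> a
  stay near the target.\<close>

lemma first_passage:
 assumes S: "closed S" and v: "v \<in> bmeas borel"
 and cong: "!!f g. (!!t. 0 \<le> t ==> f t = g t) ==> F f = F g"
 and F: "(%(x, f). F (start x f)) \<in> bmeas (borel \<Otimes>\<^sub>M paths)"
 and c: "!!x. x \<in> S ==> c \<le> (NINT g|W. F (start x g))"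
 and G: "!!f t. f \<in> space paths ==> 0 \<le> t ==> em (cost v (en t) (start z f)) * F (%s. start z f (t +
  s)) \<le> G f"
 shows "cross v S z * c \<le> (NINT f|W. G f)"
proof -
 let ?T = "%f. hit S (start z f)"
 let ?w = "%f. ind {f. ?T f < \<infinity>} f * em (cost v (?T f) (start z f))"
 have "cross v S z * c = (NINT f|W. wgt v S (start z f) * c)"
  unfolding cross_def by (rule nn_integral_multc[OF wgt_W[OF S v], symmetric])
 also have "... \<le> (NINT f|W. ?w f * (NINT g|W. F (start (z + f (enn2real (?T f))) g)))"
 proof (rule nn_integral_mono, goal_cases)
  case (1 f)
  show ?case
  proof (cases "?T f < \<infinity>")
   case True
   hence "start z f (enn2real (?T f)) \<in> S" using 1 by (intro hit_attained S start_cont) (auto simp: space_W)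
   from c[OF this] True show ?thesis by (simp add: wgt_def start_def mult_left_mono)
  qed (simp add: wgt_def)
 qed
 also have "... = (NINT f|W. ?w f * F (%s. start z f (enn2real (?T f) + s)))"
  by (rule start_markov[OF stopping_hit_start[OF S] v cong F, symmetric])
 also have "... \<le> (NINT f|W. G f)"
 proof (rule nn_integral_mono, goal_cases)
  case (1 f)
  show ?case
  proof (cases "?T f < \<infinity>")
   case True
   thus ?thesis using G[of f "enn2real (?T f)"] 1 by (simp add: space_W)
  qed simp
 qed
 finally show ?thesis .
qed

lemma ib_mult_le:
 assumes v: "v \<in> bmeas borel"
 shows "ib v x y * ib v y w \<le> ib v x w" unfolding ib_def[of v x w]
proof (rule INF_greatest, goal_cases)
 case z: (1 z)
 have "ib v x y * ib v y w \<le> cross v (cball y 1) z * ib v y w"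
  using z by (intro mult_right_mono ib_le) auto
 also have "... \<le> cross v (cball w 1) z" unfolding cross_def[of v "cball w 1"]
  by (rule first_passage[OF _ v wgt_cong wgt_start_measurable'[of "cball w 1", OF _ v]])
  (use ib_le in \<open>auto simp: cross_def[symmetric] intro!: wgt_shift_le v start_cont\<close>)
 finally show ?case .
qed

end

section \<open>Exit estimates and the Harnack inequality\<close>

definition pg :: "real => 'a::euclidean_space => real" where
 "pg t x = (1 / sqrt (2 * pi * t)) ^ DIM('a) * exp (- (norm x)\<^sup>2 / (2 * t))"

lemma pg_nonneg: "0 \<le> t ==> 0 \<le> pg t x" by (simp add: pg_def)

lemma pg_measurable [measurable]: "pg t \<in> bmeas borel" unfolding pg_def[abs_def] by measurable

lemma gauss_eq:
 assumes "0 < t" shows "gauss t = density lborel (%x::'a::euclidean_space. en (pg t x))"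
proof -
 let ?X = "%b x. \<Prod>b\<in>Basis. normal_density 0 (sqrt t) (x \<bullet> b)"
 have "(?X b x) = pg t x" for x :: 'a
 proof -
  have "(?X b x) = (\<Prod>b\<in>(Basis::'a set). (1 / sqrt (2 * pi * t)) * exp (- (x \<bullet> b)\<^sup>2 / (2 * t)))"
   using assms by (simp add: normal_density_def)
  also have "... = (1 / sqrt (2 * pi * t)) ^ DIM('a) * exp (\<Sum>b\<in>Basis. - (x \<bullet> b)\<^sup>2 / (2 * t))"
   by (simp only: prod.distrib exp_sum finite_Basis prod_constant)
  also have "(\<Sum>b\<in>Basis. - (x \<bullet> b)\<^sup>2 / (2 * t)) = - (norm x)\<^sup>2 / (2 * t)"
   by (simp add: norm_eq_sqrt_inner euclidean_inner[of x x] power2_eq_square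
    sum_divide_distrib[symmetric] sum_negf sum_nonneg)
  finally show ?thesis by (simp add: pg_def)
 qed
 thus ?thesis by (simp add: gauss_def)
qed

lemma nn_integral_lborel_shift:
 fixes F :: "'a::euclidean_space => ennreal"
 assumes [measurable]: "F \<in> bmeas borel"
 shows "(NINT x|lborel. F (x + a)) = (NINT x|lborel. F x)"
proof -
 have "(NINT x|lborel. F x) = (NINT x|distr lborel borel ((+) a). F x)" by (simp add: lborel_distr_plus)
 also have "... = (NINT x|lborel. F (x + a))" by (subst nn_integral_distr) (auto simp: add.commute)
 finally show ?thesis ..
qed

context wiener
begin

lemma W_eval:
 assumes t: "0 < t" and F[measurable]: "F \<in> bmeas borel"
 shows "(NINT f|W. F (f t)) = (NINT x|lborel. en (pg t x) * F x)"
proof -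
 have "(NINT f|W. F (f t)) = (NINT x|distr W borel (%f. f t). F x)"
  by (rule nn_integral_distr[symmetric]) (use path_eval_W in auto)
 also have "... = (NINT x|lborel. en (pg t x) * F x)"
  unfolding eval_distr[OF t] gauss_eq[OF t] by (subst nn_integral_density) auto
 finally show ?thesis .
qed

lemma W_eval_shift:
 assumes t: "0 < t" and F[measurable]: "F \<in> bmeas borel"
 shows "(NINT f|W. F (z + f t)) = (NINT x|lborel. en (pg t (x - z)) * F x)"
proof -
 have "(NINT f|W. F (z + f t)) = (NINT x|lborel. en (pg t x) * F (z + x))"
  by (rule W_eval[OF t]) measurable
 also have "... = (NINT x|lborel. (%x. en (pg t (x - z)) * F x) (x + z))" by (simp add: add.commute)
 also have "... = (NINT x|lborel. en (pg t (x - z)) * F x)" by (rule nn_integral_lborel_shift) measurable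
 finally show ?thesis .
qed

text \<open>Completing the square turns the exponential factor into a translation of the Gaussian
  density by \<open>(t * \<theta>) *\<^sub>R c\<close>.\<close>

lemma mgf:
 assumes t: "0 < t" and c: "norm c = 1"
 shows "(NINT f|W. en (exp (\<theta> * (f t \<bullet> c)))) = en (exp (\<theta>\<^sup>2 * t / 2))"
proof -
 let ?Y = "\<theta>\<^sup>2 * t / 2"
 let ?Z = "%x. \<theta> * (x \<bullet> c)"
 have sq: "pg t x * exp (?Z x) = exp ?Y * pg t (x - (t * \<theta>) *\<^sub>R c)" for x
 proof -
  let ?X = "norm (x - (t * \<theta>) *\<^sub>R c)"
  have "- (norm x)\<^sup>2 / (2 * t) + \<theta> * (x \<bullet> c) = \<theta>\<^sup>2 * t / 2 + - ?X\<^sup>2 / (2 * t)" using c unfolding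
   power2_norm_eq_inner norm_eq_1 using t by (simp add: inner_diff inner_commute power2_eq_square
   algebra_simps field_simps)
  hence "exp (- (norm x)\<^sup>2 / (2 * t)) * exp (?Z x) = exp ?Y * exp (- ?X\<^sup>2 / (2 * t))"
   by (simp only: exp_add[symmetric])
  thus ?thesis by (simp add: pg_def)
 qed
 have 1: "(NINT x|(lborel :: 'a measure). en (pg t x)) = 1"
  using W_eval[OF t, of "%_. 1"] by (simp add: emeasure_space_1)
 have "(NINT f|W. en (exp (\<theta> * (f t \<bullet> c)))) = (NINT x|lborel. en (pg t x) * en (exp (?Z x)))"
  by (rule W_eval[OF t]) measurable
 also have "... = (NINT x|lborel. en (exp ?Y) * en (pg t (x + (- (t * \<theta>)) *\<^sub>R c)))"
  by (intro nn_integral_cong) (simp add: ennreal_mult'[symmetric] sq pg_nonneg t less_imp_le flip: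
   ennreal_mult')
 also have "... = en (exp ?Y) * (NINT x|lborel. en (pg t (x + (- (t * \<theta>)) *\<^sub>R c)))"
  by (rule nn_integral_cmult) measurable
 also have "(NINT x|lborel. en (pg t (x + (- (t * \<theta>)) *\<^sub>R c))) = 1"
  by (subst nn_integral_lborel_shift) (simp_all only: 1, measurable)
 finally show ?thesis by simp
qed

lemma hit_event: "closed S ==> {f \<in> space W. hit S (start z f) \<le> a} \<in> sets W"
proof -
 assume S: "closed S"
 have "(%f. hit S (start z f)) \<in> bmeas paths" using stopping_hit_start[OF S, of z] by (simp add:
  stopping_def)
 thus ?thesis unfolding measurable_W_iff[symmetric] by measurable
qed

text \<open>Exponential supermartingale inequality: after the path has reached level \<open>l\<close>, its exponential
 moment does not decrease.\<close>

lemma half_space_exit: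
 assumes t: "0 < t" and c: "norm c = 1" and \<theta>: "0 \<le> \<theta>"
 shows "emeasure W {f \<in> space W. hit {x. l \<le> x \<bullet> c} f \<le> en t} \<le> en (exp (\<theta>\<^sup>2 * t / 2 - \<theta> * l))"
proof -
 let ?T = "hit {x. l \<le> x \<bullet> c}" and ?X = "%x. en (exp (\<theta> * (x \<bullet> c)))"
 have cl: "closed {x. l \<le> x \<bullet> c}" using closed_halfspace_ge[of l c] by (simp add: inner_commute)
 let ?A = "%f. ind {..ennreal t} (?T f) :: ennreal"
 let ?r = "%f. t - enn2real (?T f)"
 have T: "stopping ?T" by (rule stopping_hit[OF cl])
 have [measurable]: "?T \<in> bmeas paths" using T by (simp add: stopping_def)
 have Am: "?A \<in> bmeas paths" by measurable
 let ?Y = "(borel :: 'a measure) \<Otimes>\<^sub>M borel \<Otimes>\<^sub>M paths"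
 have [measurable]: "(%p. snd (snd p) (t - fst (snd p))) \<in> bmeas ?Y"
  by (rule path_eval_measurable) measurable
 have Gm: "(%(x, s, g). ?X (g (t - s))) \<in> bmeas ?Y" unfolding case_prod_unfold by measurable
 \<comment> \<open>\<open>mgf\<close> speaks of positive times, but the level may be reached exactly
   at time \<open>t\<close>, with no time remaining.\<close>
 have ge1: "1 \<le> (NINT g|W. ?X (g r))" if "0 \<le> r" for r
 proof (cases "r = 0")
  case True
  hence "(NINT g|W. ?X (g r)) = (NINT g|W. 1)" by (intro nn_integral_cong) (simp add: space_W path_0)
  thus ?thesis by (simp add: emeasure_space_1)
 qed (use that mgf[OF _ c, of r] in simp)
 let ?Z = "{f \<in> space W. ?T f \<le> en t}"
 have "emeasure W ?Z = (NINT f|W. ind ?Z f)"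
  using hit_event[OF cl, of 0] by (intro nn_integral_indicator[symmetric]) (simp add: start_def)
 also have "... \<le> (NINT f|W. ind {f. ?T f < \<infinity>} f * ?A f * (NINT g|W. ?X (g (?r f))))"
 proof (rule nn_integral_mono, goal_cases)
  case (1 f)
  show ?case
  proof (cases "?T f \<le> en t")
   case True
   thus ?thesis using t True ge1[of "?r f"] by (auto intro: le_less_trans enn2real_leI simp: indicator_def)
  qed simp
 qed
 also have "... = (NINT f|W. ind {f. ?T f < \<infinity>} f * ?A f * ?X (after_at ?T f (?r f)))"
  by (rule strong_markov[OF T Am _ Gm, symmetric]) (simp add: stopping_stop_at[OF T])
 also have "... \<le> (NINT f|W. en (exp (- \<theta> * l)) * ?X (f t))"
 proof (rule nn_integral_mono, goal_cases)
  case (1 f)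
  show ?case
  proof (cases "?T f \<le> en t")
   case True
   hence fin: "?T f < \<infinity>" "enn2real (?T f) \<le> t" using t by (auto intro: le_less_trans enn2real_leI)
   show ?thesis using hit_attained[OF cl _ fin(1)] 1 mult_left_mono[OF _ \<theta>] True fin by (simp add:
    space_W path_cont inner_diff_left right_diff_distrib ennreal_leI exp_add[symmetric] after_def
    flip: ennreal_mult')
  qed simp
 qed
 also have "... = en (exp (- \<theta> * l)) * (NINT f|W. ?X (f t))"
  by (rule nn_integral_cmult) (use path_eval_W[of t] in measurable)
 also have "... = en (exp (\<theta>\<^sup>2 * t / 2 - \<theta> * l))"
  by (simp add: mgf[OF t c] ennreal_mult'[symmetric] exp_add[symmetric])
 finally show ?thesis .
qed

text \<open>Leaving the ball forces one of the \<open>2 * DIM('a)\<close> signed coordinates to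
  reach \<open>l / DIM('a)\<close>, since the norm is at most the sum of the absolute
  coordinates.\<close>

lemma exit_bound:
 assumes t: "0 < t" and \<theta>: "0 \<le> \<theta>"
 shows "emeasure W {f \<in> space W. hit (- ball z l) (start z f) \<le> en t} \<le> en (4 * real DIM('a) * exp
  (\<theta>\<^sup>2 * t / 2 - \<theta> * l / real DIM('a)))"
proof -
 define D where "D = (Basis :: 'a set) \<union> uminus ` Basis"
 define h where "h c = {f \<in> space W. hit {x. l / real DIM('a) \<le> x \<bullet> c} f \<le> en t}" for c :: 'a
 have cl: "closed {x. a \<le> x \<bullet> c}" for a and c :: 'a using closed_halfspace_ge[of a c] by (simp add:
  inner_commute)
 have D: "finite D" "!!c. c \<in> D ==> norm c = 1" "card D \<le> 2 * DIM('a)"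
  unfolding D_def using card_Un_le[of "Basis :: 'a set" "uminus ` Basis"] card_image_le[of "Basis ::
   'a set" uminus] by auto
 have hs: "h c \<in> sets W" for c using hit_event[OF cl[of "l / real DIM('a)" c], where z=0 and a="en
  t"] unfolding h_def start_def by (simp only: add_0_left)
 let ?X = "{f \<in> space W. hit (- ball z l) (start z f) \<le> en t}"
 let ?Y = "\<Union>c\<in>D. h c"
 have "?X \<subseteq> ?Y"
 proof
  fix f assume "f \<in> ?X"
  hence f: "f \<in> space W" and h: "hit (- ball z l) (start z f) \<le> en t" by auto
  have f': "f \<in> space paths" using f by (simp add: space_W)
  obtain s where s: "0 \<le> s" "s \<le> t" "start z f s \<in> - ball z l"
   using h hit_le_iff[OF _ start_cont[OF f'], of "- ball z l" t z] t by (auto simp: closed_Compl)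
  hence "l \<le> norm (f s)" by (simp add: start_def dist_norm)
  also have "... \<le> (\<Sum>b\<in>Basis. \<bar>f s \<bullet> b\<bar>)" by (rule norm_le_l1)
  finally have sum: "l \<le> (\<Sum>b\<in>Basis. \<bar>f s \<bullet> b\<bar>)" .
  have "\<exists>b\<in>Basis. l / real DIM('a) \<le> \<bar>f s \<bullet> b\<bar>"
  proof (rule ccontr)
   assume "\<not> ?thesis"
   hence "(\<Sum>b\<in>Basis. \<bar>f s \<bullet> b\<bar>) < (\<Sum>b\<in>(Basis :: 'a set). l / real DIM('a))" by (intro sum_strict_mono) auto
   thus False using sum by simp
  qed
  then obtain b where b: "b \<in> Basis" "l / real DIM('a) \<le> \<bar>f s \<bullet> b\<bar>" by auto
  then obtain c where c: "c \<in> D" "l / real DIM('a) \<le> f s \<bullet> c"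
  proof (cases "0 \<le> f s \<bullet> b")
   case True
   thus ?thesis using b by (intro that[of b]) (auto simp: D_def)
  next
   case False
   thus ?thesis using b by (intro that[of "- b"]) (auto simp: D_def)
  qed
  have "hit {x. l / real DIM('a) \<le> x \<bullet> c} f \<le> en s" using s c(2) by (intro hit_le) auto
  also have "... \<le> en t" using s by (intro ennreal_leI) auto
  finally show "f \<in> ?Y" using f c(1) by (auto simp: h_def)
 qed
 hence "emeasure W ?X \<le> emeasure W ?Y" using hs D(1) by (intro emeasure_mono) auto
 also have "... \<le> (\<Sum>c\<in>D. emeasure W (h c))" using hs D(1) by (intro emeasure_subadditive_finite) auto
 also have "... \<le> (\<Sum>c\<in>D. en (exp (\<theta>\<^sup>2 * t / 2 - \<theta> * (l / real DIM('a)))))"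
  unfolding h_def by (intro sum_mono half_space_exit t \<theta> D(2))
 also have "... = en (real (card D) * exp (\<theta>\<^sup>2 * t / 2 - \<theta> * l / real DIM('a)))"
  by (simp add: ennreal_mult' ennreal_of_nat_eq_real_of_nat)
 also have "... \<le> en (4 * real DIM('a) * exp (\<theta>\<^sup>2 * t / 2 - \<theta> * l / real DIM('a)))"
  using D(3) by (intro ennreal_leI mult_right_mono) auto
 finally show ?thesis .
qed

lemma cost_no_exit:
 assumes f: "f \<in> space paths" and t: "0 \<le> t" and v: "!!x. x \<in> ball p \<rho> ==> v x \<le> en s" and s: "0 \<le> s"
 and no: "\<not> hit (- ball p \<rho>) (start z f) \<le> en t"
 shows "cost v (en t) (start z f) \<le> en (s * t)"
proof -
 have "start z f r \<in> ball p \<rho>" if "0 \<le> r" "r \<le> t" for r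
  using no hit_le_iff[OF _ start_cont[OF f], of "- ball p \<rho>" t z] t that by (auto simp: closed_Compl)
 hence "cost v (en t) (start z f) \<le> en s * en t" by (intro cost_bound t v) auto
 thus ?thesis using s t by (simp add: ennreal_mult)
qed

lemma exit_mono:
 assumes "dist p z \<le> R" and l: "l + R \<le> \<rho>"
 shows "{f \<in> space W. hit (- ball p \<rho>) (start z f) \<le> en t} \<subseteq> {f \<in> space W. hit (- ball z l) (start z
  f) \<le> en t}"
proof -
 have "- ball p \<rho> \<subseteq> - ball z l"
 proof (rule subsetI, goal_cases)
  case (1 x)
  thus ?case using dist_triangle[of p x z] assms by auto
 qed
 hence "hit (- ball z l) g \<le> hit (- ball p \<rho>) g" for g unfolding hit_def by (intro INF_superset_mono) auto
 thus ?thesis by (auto intro: order_trans)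
qed

lemma exit_small:
 assumes \<delta>: "0 < \<delta>" and t: "0 < t"
 obtains R where "1 \<le> R"
 "!!p z. dist p z \<le> 1 ==> emeasure W {f \<in> space W. hit (- ball p R) (start z f) \<le> en t} \<le> en \<delta>"
proof -
 let ?X = "%n. 1\<^sup>2 * t / 2 - 1 * real n / real DIM('a)"
 have "(%n. 4 * real DIM('a) * exp (?X n)) ----> 0" by (rule tendsto_mult_right_zero) real_asymp
 from order_tendstoD(2)[OF this \<delta>] obtain n where n: "4 * real DIM('a) * exp (?X n) < \<delta>"
  by (auto simp: eventually_sequentially)
 show ?thesis
 proof (rule that[of "real n + 1"], goal_cases)
  case (2 p z)
  hence "emeasure W {f \<in> space W. hit (- ball p (real n + 1)) (start z f) \<le> en t} \<le> emeasure W {f \<in>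
   space W. hit (- ball z (real n)) (start z f) \<le> en t}"
   by (intro emeasure_mono exit_mono[where R=1] hit_event) (auto simp: closed_Compl)
  also have "... \<le> en (4 * real DIM('a) * exp (?X n))" by (rule exit_bound[OF t]) simp
  also have "... \<le> en \<delta>" using n by (intro ennreal_leI) simp
  finally show ?case .
 qed simp
qed

lemma pg_neq_0: "0 < t ==> en (pg t x) \<noteq> 0" by (simp add: pg_def ennreal_eq_0_iff not_le)

lemma pg_lower: "0 < t ==> norm x \<le> K ==> (1 / sqrt (2 * pi * t)) ^ DIM('b) * exp (- K\<^sup>2 / (2 * t))
 \<le> pg t (x::'b::euclidean_space)"
 unfolding pg_def by (intro mult_left_mono) (auto simp: divide_right_mono power_mono intro!:
  divide_right_mono)

text \<open>With probability at least \<open>2 * \<delta>\<close> the path is in the target ball at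
  time 1, where \<open>b\<close> bounds the heat kernel from below. \<open>R\<close> is chosen so
  that leaving \<open>ball x R\<close> before that time takes away at most \<delta>; on what remains
  the cost is at most \<open>s\<close>. The constants depend on \<open>K\<close> but not on the
  potential.\<close>

lemma cross_lower:
 obtains \<delta> R where "0 < \<delta>" and "0 < R"
 "!!v s x y z. v \<in> bmeas borel ==> 0 \<le> s ==> (!!w. w \<in> ball x R ==> v w \<le> en s) ==> dist x y \<le> K ==>
  dist x z \<le> 1 ==> en (\<delta> * exp (- s)) \<le> cross v (cball y 1) z"
proof -
 define K' where "K' = \<bar>K\<bar> + 2"
 define b where "b = (1 / sqrt (2 * pi * 1)) ^ DIM('a) * exp (- K'\<^sup>2 / (2 * 1))"
 define m where "m = measure lborel (cball (0::'a) 1)"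
 define \<delta> where "\<delta> = b * m / 2"
 have b: "0 < b" by (simp add: b_def)
 have m: "0 < m" unfolding m_def using content_cball_pos[of 1 "0::'a"] by simp
 have \<delta>: "0 < \<delta>" using b m by (simp add: \<delta>_def)
 obtain R where R: "1 \<le> R"
  "!!p z. dist p z \<le> 1 ==> emeasure W {f \<in> space W. hit (- ball p R) (start z f) \<le> en 1} \<le> en \<delta>"
  using exit_small[OF \<delta>, of 1] by auto
 show ?thesis
 proof (rule that[OF \<delta>, of R])
  show "0 < R" using R by simp
  fix v :: "'a => ennreal" and s x y z
  assume vm: "v \<in> bmeas borel" and s: "0 \<le> s" and v: "!!w. w \<in> ball x R ==> v w \<le> en s"
   and xy: "dist x y \<le> K" and xz: "dist x z \<le> 1"
  let ?E = "{f \<in> space W. hit (- ball x R) (start z f) \<le> en 1}"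
  let ?F = "{f \<in> space W. z + f 1 \<in> cball y 1}"
  have Em: "?E \<in> sets W" by (intro hit_event) (simp add: closed_Compl)
  have Fm: "?F \<in> sets W"
   by (simp add: path_eval_W measurable measurable_sets vimage_def Int_def conj_commute)
  have "en (2 * \<delta>) = en b * en m" by (simp add: \<delta>_def ennreal_mult'[symmetric] b less_imp_le)
  also have "... = en b * emeasure lborel (cball y 1)"
   unfolding m_def by (simp add: emeasure_cball measure_def)
  also have "... = (NINT w|lborel. en b * ind (cball y 1) w)" by (simp add: nn_integral_cmult_indicator)
  also have "... \<le> (NINT w|lborel. en (pg 1 (w - z)) * ind (cball y 1) w)"
  proof (rule nn_integral_mono, goal_cases)
   case (1 w)
   show ?case
   proof (cases "w \<in> cball y 1")
    case True
    have "norm (w - z) \<le> K'" using dist_triangle[of w z y] dist_triangle[of y z x] True xy xz by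
     (simp add: dist_commute K'_def dist_norm)
    hence "b \<le> pg 1 (w - z)" unfolding b_def by (intro pg_lower) auto
    thus ?thesis using True by (simp add: ennreal_leI)
   qed simp
  qed
  also have "... = (NINT f|W. ind (cball y 1) (z + f 1))"
   by (rule W_eval_shift[symmetric]) (auto intro: borel_measurable_indicator)
  also have "... = (NINT f|W. ind ?F f)" by (intro nn_integral_cong) (simp add: indicator_def)
  also have "... = emeasure W ?F" by (rule nn_integral_indicator[OF Fm])
  finally have F: "en (2 * \<delta>) \<le> emeasure W ?F" .
  have "emeasure W ?F \<le> emeasure W ((?F - ?E) \<union> ?E)" using Em Fm by (intro emeasure_mono) auto
  also have "... \<le> emeasure W (?F - ?E) + emeasure W ?E" using Em Fm by (intro emeasure_subadditive) auto
  also have "... \<le> emeasure W (?F - ?E) + en \<delta>" by (intro add_left_mono R xz)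
  finally have "en (2 * \<delta>) \<le> emeasure W (?F - ?E) + en \<delta>" using F by (rule order_trans[rotated])
  hence FE: "en \<delta> \<le> emeasure W (?F - ?E)" using \<delta> emeasure_finite[of "?F - ?E"]
   by (cases "emeasure W (?F - ?E)") (auto simp: ennreal_plus[symmetric] ennreal_le_iff2 simp del:
    ennreal_plus)
  have "en (\<delta> * exp (- s)) = en \<delta> * en (exp (- s))" using \<delta> by (simp add: ennreal_mult')
  also have "... \<le> emeasure W (?F - ?E) * en (exp (- s))" by (intro mult_right_mono FE) simp
  also have "... = (NINT f|W. en (exp (- s)) * ind (?F - ?E) f)"
   using Em Fm by (subst nn_integral_cmult_indicator) (auto simp: mult.commute)
  also have "... \<le> cross v (cball y 1) z" unfolding cross_def
  proof (rule nn_integral_mono, goal_cases)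
   case f: (1 f)
   note f' = this[unfolded space_W]
   show ?case
   proof (cases "f \<in> ?F - ?E")
    case True
    hence h: "hit (cball y 1) (start z f) \<le> en 1" by (intro hit_le) (auto simp: start_def)
    hence fin: "hit (cball y 1) (start z f) < \<infinity>" by (rule le_less_trans) simp
    let ?X = "hit (cball y 1) (start z f)"
    have "cost v ?X (start z f) \<le> cost v (en 1) (start z f)" by (rule cost_mono[OF h])
    also have "... \<le> en (s * 1)" by (rule cost_no_exit[OF f' _ v s]) (use True in auto)
    finally have "em (en s) \<le> em (cost v ?X (start z f))" by (intro em_antimono) simp
    thus ?thesis using True fin s by (simp add: wgt_def em_ennreal)
   qed simp
  qed
  finally show "en (\<delta> * exp (- s)) \<le> cross v (cball y 1) z" .
 qed
qed

text \<open>The square of \<open>norm (w - z')\<close> is at most twice the sum of the squares of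
  \<open>norm (w - z)\<close> and \<open>norm (z - z')\<close>. Doubling the time absorbs the factor
  2, so moving the centre costs only a constant.\<close>

lemma pg_compare: "pg 1 (w - z) \<le> 2 ^ DIM('b) * exp ((norm (z - z'))\<^sup>2 / 2) * pg 2 (w - z' ::
 'b::euclidean_space)"
proof -
 have "(norm (w - z'))\<^sup>2 \<le> (norm (w - z) + norm (z - z'))\<^sup>2"
  using norm_triangle_ineq[of "w - z" "z - z'"] by (intro power_mono) auto
 also have "... \<le> 2 * (norm (w - z))\<^sup>2 + 2 * (norm (z - z'))\<^sup>2"
  using zero_le_power2[of "norm (w - z) - norm (z - z')"] by (simp add: power2_eq_square algebra_simps)
 finally have e: "exp (- (norm (w - z))\<^sup>2 / (2 * 1)) \<le> exp ((norm (z - z'))\<^sup>2 / 2) * exp (- (norm (w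
  - z'))\<^sup>2 / (2 * 2))" by (simp only: exp_add[symmetric] exp_le_cancel_iff)
 let ?X = "1 / sqrt (2 * pi * 2)"
 have s: "1 / sqrt (2 * pi * 1) \<le> 2 * ?X"
  by (simp add: real_sqrt_le_mono real_sqrt_mult real_sqrt_four field_simps)
 have "(1 / sqrt (2 * pi * 1)) ^ DIM('b) \<le> (2 * ?X) ^ DIM('b)" by (intro power_mono s) simp
 also have "... = 2 ^ DIM('b) * ?X ^ DIM('b)" by (rule power_mult_distrib)
 finally have "pg 1 (w - z) \<le> (2 ^ DIM('b) * ?X ^ DIM('b)) * (exp ((norm (z - z'))\<^sup>2 / 2) * exp (-
  (norm (w - z'))\<^sup>2 / (2 * 2)))"
  unfolding pg_def by (intro mult_mono e) auto
 thus ?thesis by (simp add: pg_def mult_ac)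
qed

text \<open>Compare the positions at times \<open>1\<close> and \<open>2\<close> of the paths from \<open>z\<close> and \<open>z'\<close>.\<close>

lemma harnack:
 fixes z z' p :: 'a
 assumes S: "closed S" and vm: "v \<in> bmeas borel" and s: "0 \<le> s"
 and v: "!!w. w \<in> ball p \<rho> ==> v w \<le> en s" and away: "S \<inter> ball p \<rho> = {}"
 and z: "dist p z \<le> R" "dist p z' \<le> R" and \<theta>: "0 \<le> \<theta>" and C: "C = 2 ^ DIM('a) * exp (2 * R\<^sup>2)"
 shows "en (exp (- 2 * s)) * cross v S z \<le> en C * cross v S z' + en ((C + 1) * (4 * real DIM('a) *
  exp (\<theta>\<^sup>2 - \<theta> * (\<rho> - R) / real DIM('a))))"
proof -
 \<comment> \<open>Bounds the probability of leaving \<open>ball p \<rho>\<close> before time 2 from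
   any start within \<open>R\<close> of \<open>p\<close>. The constant \<open>C\<close> is that of
   \<open>pg_compare\<close> for centres at distance at most \<open>2 * R\<close>.\<close>
 define \<eta> where "\<eta> = 4 * real DIM('a) * exp (\<theta>\<^sup>2 - \<theta> * (\<rho> - R) / real DIM('a))"
 have \<eta>0: "0 \<le> \<eta>" by (simp add: \<eta>_def)
 have C0: "0 \<le> C" by (simp add: C)
 let ?E = "%z t. {f \<in> space W. hit (- ball p \<rho>) (start z f) \<le> en t}"
 have Em: "?E z t \<in> sets W" for z t by (intro hit_event) (simp add: closed_Compl)
 have E: "emeasure W (?E z t) \<le> en \<eta>" if z: "dist p z \<le> R" and t: "0 < t" "t \<le> 2" for z t
 proof -
  have "emeasure W (?E z t) \<le> emeasure W {f \<in> space W. hit (- ball z (\<rho> - R)) (start z f) \<le> en t}"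
   using z by (intro emeasure_mono exit_mono[where R=R] hit_event) (auto simp: closed_Compl)
  also have "... \<le> en (4 * real DIM('a) * exp (\<theta>\<^sup>2 * t / 2 - \<theta> * (\<rho> - R) / real DIM('a)))"
   by (rule exit_bound[OF t(1) \<theta>])
  also have "... \<le> en \<eta>"
   unfolding \<eta>_def using t mult_left_mono[of t 2 "\<theta>\<^sup>2"] by (intro ennreal_leI mult_left_mono) auto
  finally show ?thesis .
 qed
 have cm[measurable]: "cross v S \<in> bmeas borel" by (rule cross_measurable'[OF S vm])
 let ?I1 = "(NINT f|W. cross v S (z + f 1))" and ?I2 = "(NINT f|W. cross v S (z' + f 2))"
 have "hit (- ball p \<rho>) g \<le> hit S g" for g unfolding hit_def using away by (intro INF_superset_mono) auto
 hence "{f \<in> space W. hit S (start z f) \<le> en 1} \<subseteq> ?E z 1" by (auto intro: order_trans)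
 hence "emeasure W {f \<in> space W. hit S (start z f) \<le> en 1} \<le> emeasure W (?E z 1)" by (rule
  emeasure_mono[OF _ Em])
 also have "... \<le> en \<eta>" by (rule E[OF z(1)]) auto
 finally have 1: "cross v S z \<le> en \<eta> + ?I1" using cross_time_le[OF S vm, of 1 z] by (meson
  add_right_mono order_trans zero_le_one)
 have "?I1 = (NINT w|lborel. en (pg 1 (w - z)) * cross v S w)" by (rule W_eval_shift) auto
 also have "... \<le> (NINT w|lborel. en C * (en (pg 2 (w - z')) * cross v S w))"
 proof (rule nn_integral_mono, goal_cases)
  case (1 w)
  have "norm (z - z') \<le> 2 * R" using z dist_triangle[of z z' p] by (simp add: dist_norm[symmetric]
   dist_commute)
  hence "(norm (z - z'))\<^sup>2 \<le> (2 * R)\<^sup>2" by (intro power_mono) auto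
  hence "2 ^ DIM('a) * exp ((norm (z - z'))\<^sup>2 / 2) * pg 2 (w - z') \<le> C * pg 2 (w - z')"
   unfolding C by (intro mult_right_mono mult_left_mono pg_nonneg) (auto simp: power_mult_distrib)
  thus ?case using pg_compare[of w z z'] by (simp add: ennreal_leI ennreal_mult'[symmetric] C0
   mult.assoc[symmetric] mult_right_mono)
 qed
 also have "... = en C * (NINT w|lborel. en (pg 2 (w - z')) * cross v S w)" by (rule
  nn_integral_cmult) measurable
 also have "(NINT w|lborel. en (pg 2 (w - z')) * cross v S w) = ?I2" by (rule W_eval_shift[symmetric]) auto
 finally have 2: "?I1 \<le> en C * ?I2" .
 let ?T = "%_::real => 'a. en 2"
 have m1: "(%f. cross v S (z' + f 2)) \<in> bmeas W" using path_eval_W[of 2] by measurable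
 let ?X = "%f. cost v (?T f) (start z' f)"
 have m2: "(%f. em (?X f)) \<in> bmeas W"
  unfolding measurable_W_iff using cost_start_measurable[OF vm, of ?T z'] by measurable
 have "en (exp (- 2 * s)) * ?I2 = (NINT f|W. en (exp (- 2 * s)) * cross v S (z' + f 2))"
  by (rule nn_integral_cmult[OF m1, symmetric])
 also have "... \<le> (NINT f|W. ind {f. ?T f < \<infinity>} f * em (?X f) * cross v S (z' + f (enn2real (?T f)))
  + ind (?E z' 2) f)"
 proof (rule nn_integral_mono, goal_cases)
  case f: (1 f)
  note f' = this[unfolded space_W]
  show ?case
  proof (cases "f \<in> ?E z' 2")
   case True
   have "en (exp (- 2 * s)) * cross v S (z' + f 2) \<le> 1 * 1" using s by (intro mult_mono cross_le_1)
    (auto simp: ennreal_le_1)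
   thus ?thesis using True by (simp add: add_increasing)
  next
   case False
   hence "cost v (en 2) (start z' f) \<le> en (s * 2)" using f by (intro cost_no_exit[OF f' _ v s]) auto
   hence "em (en (s * 2)) \<le> em (cost v (en 2) (start z' f))" by (rule em_antimono)
   thus ?thesis using s False by (simp add: em_ennreal mult.commute mult_right_mono)
  qed
 qed
 also have "... = (NINT f|W. ind {f. ?T f < \<infinity>} f * em (?X f) * cross v S (z' + f (enn2real (?T f))))
  + emeasure W (?E z' 2)"
 proof (subst nn_integral_add, goal_cases)
  case 1
  show ?case using m1 m2 by simp
 qed (use borel_measurable_indicator[OF Em[of z' 2]] nn_integral_indicator[OF Em[of z' 2]] in simp_all)
 also have "... \<le> cross v S z' + en \<eta>"
  by (intro add_mono cross_ge[OF stopping_const S vm] E[OF z(2)]) auto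
 finally have 3: "en (exp (- 2 * s)) * ?I2 \<le> cross v S z' + en \<eta>" .
 have "en (exp (- 2 * s)) * cross v S z \<le> en (exp (- 2 * s)) * (en \<eta> + en C * ?I2)"
  by (intro mult_left_mono order_trans[OF 1] add_left_mono 2) auto
 also have "... = en (exp (- 2 * s)) * en \<eta> + en C * (en (exp (- 2 * s)) * ?I2)"
  by (simp add: distrib_left mult_ac)
 also have "... \<le> 1 * en \<eta> + en C * (cross v S z' + en \<eta>)"
  using s by (intro add_mono mult_right_mono mult_left_mono 3) (auto simp: ennreal_le_1)
 also have "... = en C * cross v S z' + en ((C + 1) * \<eta>)"
  using C0 \<eta>0 by (simp add: distrib_left ennreal_mult[symmetric] add_ac ennreal_plus[symmetric]
   distrib_right del: ennreal_plus)
 finally show ?thesis by (simp add: \<eta>_def)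
qed

end

section \<open>Path reversal\<close>

text \<open>Turns an estimate for each single starting point into one for the infimum
  \<open>ib\<close>; the slack \<open>e / (\<bar>C\<bar> + 1)\<close> becomes at most
  \<open>e\<close> after multiplication by \<open>C\<close>.\<close>

lemma le_INF_affine:
 fixes g :: "'b => ennreal"
 assumes le: "!!z. z \<in> A ==> a \<le> en C * g z + b" and ne: "A \<noteq> {}"
 shows "a \<le> en C * (INF z\<in>A. g z) + b"
proof (cases "(INF z\<in>A. g z) = \<top> \<or> b = \<top>")
 case True
 obtain z where z: "z \<in> A" using ne by auto
 have "g z = \<top>" if "(INF z\<in>A. g z) = \<top>" using that INF_lower[OF z, of g] by (simp add: top_unique)
 thus ?thesis using True le[OF z] by auto
next
 case False
 show ?thesis
 proof (rule ennreal_le_epsilon, goal_cases)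
  case e: (1 e)
  let ?X = "e / (\<bar>C\<bar> + 1)"
  have "(INF z\<in>A. g z) < (INF z\<in>A. g z) + en ?X" using e False by (cases "INF z\<in>A. g z") (auto simp:
   ennreal_plus[symmetric] ennreal_less_iff simp del: ennreal_plus)
  then obtain z where z: "z \<in> A" "g z < (INF z\<in>A. g z) + en ?X" by (auto simp: INF_less_iff)
  have "a \<le> en C * g z + b" by (rule le[OF z(1)])
  also have "... \<le> en C * ((INF z\<in>A. g z) + en ?X) + b"
   using z(2) by (intro add_right_mono mult_left_mono) auto
  also have "... = en C * (INF z\<in>A. g z) + b + en C * en ?X" by (simp add: distrib_left add_ac)
  also have "... \<le> en C * (INF z\<in>A. g z) + b + en e"
  proof (intro add_left_mono, goal_cases)
   case 1
   have "C * ?X \<le> (\<bar>C\<bar> + 1) * ?X" using e by (intro mult_right_mono) auto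
   thus ?case using e by (simp add: ennreal_mult''[symmetric] ennreal_leI)
  qed
  finally show ?case .
 qed
qed

context wiener
begin

lemma start_kernel_measurable:
 assumes v: "v \<in> bmeas borel" and A[measurable]: "A \<in> sets borel" and z[measurable]: "z \<in> bmeas N"
 and f: "f \<in> N \<rightarrow>\<^sub>M paths"
 shows "(%x. em (cost v (en t) (start (z x) (f x))) * ind A (start (z x) (f x) t)) \<in> bmeas N"
proof -
 note [measurable] = path_eval'[OF f]
 have s[measurable]: "(%x. start (z x) (f x) s) \<in> bmeas N" for s unfolding start_def by measurable
 have [measurable]: "(%x. cost v (en t) (start (z x) (f x))) \<in> bmeas N"
  by (rule cost_measurable[OF _ s]) (use start_cont measurable_space[OF f] measurable_compose[OF
   measurable_snd v] in \<open>auto simp: case_prod_unfold\<close>)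
 show ?thesis by measurable
qed

text \<open>The sampling step 3 consists of two time units for comparing heat kernels by
  \<open>pg_compare\<close> and one unit in which the path is killed; see
  \<open>killing\<close>.\<close>

definition kern :: "('a => ennreal) => 'a set => nat => 'a => ennreal" where
 "kern v A n z = (NINT f|W. em (cost v (en (3 * real n)) (start z f)) * ind A (start z f (3 * real n)))"

lemma kern_measurable:
 assumes "v \<in> bmeas borel" "A \<in> sets borel"
 shows "kern v A n \<in> bmeas borel"
proof -
 have "(%p. em (cost v (en (3 * real n)) (start (fst p) (snd p))) * ind A (start (fst p) (snd p) (3
  * real n))) \<in> bmeas (borel \<Otimes>\<^sub>M W)"
  unfolding pair_W_measurable by (rule start_kernel_measurable[OF assms]) auto
 thus ?thesis unfolding kern_def[abs_def] by (intro borel_measurable_nn_integral) (simp add: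
  case_prod_unfold)
qed

lemma kern_Suc:
 assumes v: "v \<in> bmeas borel" and A: "A \<in> sets borel"
 shows "kern v A (Suc n) z = (NINT f|W. em (cost v (en 3) (start z f)) * kern v A n (z + f 3))"
proof -
 let ?X = "en (3 * real n)"
 let ?F = "%h. em (cost v ?X h) * ind A (h (3 * real n))"
 have "kern v A (Suc n) z = (NINT f|W. em (cost v (en 3) (start z f)) * ?F (%s. start z f (3 + s)))"
  unfolding kern_def
 proof (rule nn_integral_cong, goal_cases)
  case (1 f)
  show ?case using ennreal_plus[of 3 "3 * real n"] cost_split[OF v start_cont, of f 3 "en (3 * real
   n)" z] 1 by (simp add: space_W em_add mult.assoc distrib_left)
 qed
 also have "... = (NINT f|W. em (cost v (en 3) (start z f)) * kern v A n (z + f 3))"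
 proof -
  have c: "?F f = ?F g" if "!!t. 0 \<le> t ==> f t = g t" for f g
  proof -
   have "cost v ?X f = cost v ?X g" by (rule cost_cong) (simp add: that)
   thus ?thesis by (simp add: that)
  qed
  have "(%(x, f). ?F (start x f)) \<in> bmeas (borel \<Otimes>\<^sub>M paths)"
   unfolding case_prod_unfold by (rule start_kernel_measurable[OF v A]) auto
  from start_markov[OF stopping_const v c this, of 3 z] show ?thesis by (simp add: kern_def)
 qed
 finally show ?thesis .
qed

lemma cost_reverse:
 fixes h :: "real => 'b::euclidean_space"
 assumes v[measurable]: "v \<in> bmeas borel" and h: "continuous_on UNIV h" and t: "0 \<le> t"
 and g: "!!s. 0 \<le> s ==> s \<le> t ==> g s = h (t - s)"
 shows "cost v (en t) g = cost v (en t) h"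
proof -
 have [measurable]: "h \<in> bmeas borel" using h by (rule borel_measurable_continuous_onI)
 have S: "{s. 0 \<le> s \<and> en s \<le> en t} = {0..t}" using t by (auto simp: ennreal_le_iff)
 have "cost v (en t) h = (NINT s|lborel. v (h s) * ind {0..t} s)" by (simp add: cost_def S)
 also have "... = en \<bar>-1\<bar> * (NINT s|lborel. v (h (t + (-1) * s)) * ind {0..t} (t + (-1) * s))"
  by (rule nn_integral_real_affine) auto
 also have "... = cost v (en t) g" unfolding cost_def S using g by (auto intro!: nn_integral_cong
  simp: indicator_def)
 finally show ?thesis ..
qed

text \<open>Reversing the path and moving its starting point to its end point exchanges \<open>A\<close> and \<open>B\<close>.\<close>

lemma kern_symmetric:
 assumes v: "v \<in> bmeas borel" and [measurable]: "A \<in> sets borel" "B \<in> sets borel"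
 shows "(NINT z|lborel. ind B z * kern v A n z) = (NINT z|lborel. ind A z * kern v B n z)"
proof -
 define t where "t = 3 * real n"
 have t: "0 \<le> t" by (simp add: t_def)
 let ?k = "%A z f. em (cost v (en t) (start z f)) * ind A (start z f t)"
 let ?F = "%A B f. (NINT z|lborel. ind A z * ?k B z f)"
 interpret LW: pair_sigma_finite lborel W by unfold_locales
 have km: "(%x. ind A (z x) * ?k B (z x) (f x)) \<in> bmeas N"
  if [measurable]: "z \<in> bmeas N" "A \<in> sets borel" "B \<in> sets borel" and f: "f \<in> N \<rightarrow>\<^sub>M paths" for z f
   and N :: "'z measure" and A B
  by (intro borel_measurable_times_ennreal start_kernel_measurable v f that) measurable
 have m: "(%(z, f). ind A z * ?k B z f) \<in> bmeas (lborel \<Otimes>\<^sub>M paths)" if "A \<in> sets borel" "B \<in> sets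
  borel" for A B
  unfolding case_prod_unfold by (rule km) (use that in auto)
 have F: "(NINT z|lborel. ind A z * kern v B n z) = (NINT f|W. ?F A B f)" if AB: "A \<in> sets borel" "B
  \<in> sets borel" for A B
 proof -
  have "(%f. ?k B z f) \<in> bmeas W" for z by (rule measurable_WI, rule start_kernel_measurable[OF v
   AB(2)]) auto
  hence "(NINT z|lborel. ind A z * kern v B n z) = (NINT z|lborel. (NINT f|W. ind A z * ?k B z f))"
   unfolding kern_def t_def[symmetric] by (simp add: nn_integral_cmult)
  also have "... = (NINT f|W. ?F A B f)" by (rule LW.Fubini'[symmetric]) (unfold pair_W_measurable,
   rule m[OF AB])
  finally show ?thesis .
 qed
 have "(NINT f|W. ?F B A f) = (NINT f|W. ?F A B (stop t (rev_path t f)))"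
 proof (rule nn_integral_cong, goal_cases)
  case (1 f)
  note f = this[unfolded space_W]
  let ?g = "stop t (rev_path t f)"
  have gt: "?g t = - f t" using t path_0[OF f] by (simp add: stop_def rev_path_def)
  have "?F B A f = (NINT z|lborel. ind B (z + - f t) * ?k A (z + - f t) f)"
   by (rule nn_integral_lborel_shift[symmetric], rule km) (use f in auto)
  also have "... = ?F A B ?g"
  proof (rule nn_integral_cong, goal_cases)
   case (1 z)
   have "cost v (en t) (start z ?g) = cost v (en t) (start (z + - f t) f)"
    by (rule cost_reverse[OF v start_cont[OF f] t]) (simp add: start_def stop_def rev_path_def)
   thus ?case by (simp add: start_def gt mult_ac)
  qed
  finally show ?case .
 qed
 also have "... = (NINT f|W. ?F A B (stop t f))"
 proof (rule rev_path_nn_integral[OF t], goal_cases)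
  case 1
  have "(%(f, z). ind A z * ?k B z f) \<in> bmeas (paths \<Otimes>\<^sub>M lborel)"
   unfolding case_prod_unfold by (rule km) auto
  thus ?case by (rule lborel.borel_measurable_nn_integral)
 qed
 also have "... = (NINT f|W. ?F A B f)"
 proof (intro nn_integral_cong, goal_cases)
  case (1 f z)
  have "cost v (en t) (start z (stop t f)) = cost v (en t) (start z f)"
   by (rule cost_cong) (use t in \<open>simp add: start_def stop_def ennreal_le_iff min_absorb1\<close>)
  thus ?case by (simp add: start_def stop_def)
 qed
 finally show ?thesis by (simp add: F)
qed

text \<open>Green's function of the path sampled at the times \<open>3 n\<close> is at most the crossing probability
 times a geometric series, since each visit to \<open>A\<close> survives the following step with probability at
 most \<open>1 - q\<close>.\<close>

lemma sum_kern_le: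
 assumes v: "v \<in> bmeas borel" and A: "closed A" and q: "0 < q" "q \<le> 1"
 and kill: "!!a. a \<in> A ==> (NINT f|W. em (cost v (en 3) (start a f))) \<le> en (1 - q)"
 shows "(\<Sum>n<m. kern v A n z) \<le> cross v A z * en (1 / q)"
proof (induction m arbitrary: z)
 case (Suc m)
 have Ab: "A \<in> sets borel" using A by (rule borel_closed)
 let ?c = "%f. em (cost v (en 3) (start z f))"
 have e[measurable]: "(%f. z + f 3) \<in> bmeas W" using path_eval_W[of 3] by measurable
 have cm[measurable]: "?c \<in> bmeas W"
  unfolding measurable_W_iff using cost_start_measurable[OF v, of "%_. en 3" z] by measurable
 note [measurable] = measurable_compose[OF e kern_measurable[OF v Ab]] measurable_compose[OF e
  cross_measurable'[OF A v]]
 have "(\<Sum>n<m. kern v A (Suc n) z) = (NINT f|W. ?c f * (\<Sum>n<m. kern v A n (z + f 3)))"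
  unfolding kern_Suc[OF v Ab] sum_distrib_left by (rule nn_integral_sum[symmetric]) measurable
 also have "... \<le> (NINT f|W. ?c f * cross v A (z + f 3) * en (1 / q))"
  unfolding mult.assoc by (intro nn_integral_mono mult_left_mono Suc) simp
 also have "... = (NINT f|W. ?c f * cross v A (z + f 3)) * en (1 / q)" by (rule nn_integral_multc)
  measurable
 finally have *: "(\<Sum>n<Suc m. kern v A n z) \<le> kern v A 0 z + (NINT f|W. ?c f * cross v A (z + f 3)) *
  en (1 / q)"
  unfolding sum.lessThan_Suc_shift by (rule add_left_mono)
 show ?case
 proof (cases "z \<in> A")
  case True
  have "kern v A 0 z \<le> (NINT f|W. 1)" unfolding kern_def
   using em_le_1 by (intro nn_integral_mono) (auto simp: indicator_def)
  moreover have "(NINT f|W. ?c f * cross v A (z + f 3)) \<le> (NINT f|W. ?c f * 1)"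
   by (intro nn_integral_mono mult_left_mono cross_le_1) simp
  ultimately have "kern v A 0 z + (NINT f|W. ?c f * cross v A (z + f 3)) * en (1 / q) \<le> 1 + en (1 -
   q) * en (1 / q)"
   using kill[OF True] by (intro add_mono mult_right_mono) (auto simp: emeasure_space_1)
  \<comment> \<open>The present visit counts 1, later ones need survival of a step:
    \<open>1 + (1 - q) / q = 1 / q\<close>.\<close>
  also have "... = en (1 / q)" using q
   by (simp add: ennreal_mult'[symmetric] diff_divide_distrib flip: ennreal_plus ennreal_1)
  finally show ?thesis using * cross_self[OF True] by simp
 next
  case False
  hence "kern v A 0 z = (NINT f|W. 0)" unfolding kern_def by (intro nn_integral_cong) (simp add:
   start_def space_W path_0)
  hence "kern v A 0 z = 0" by simp
  moreover have "(NINT f|W. ?c f * cross v A (z + f 3)) \<le> cross v A z"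
   using cross_ge[OF stopping_const[of 3] A v, of z] by simp
  ultimately show ?thesis by (intro order_trans[OF *]) (simp add: mult_right_mono)
 qed
qed simp

text \<open>Were there no killing during one time unit from some starting point, then
  \<open>v\<close> would vanish almost everywhere, as the heat kernel is positive. So the mean
  \<open>c\<close> of the killing probability \<phi> under the heat kernel at time 1 is positive.
  \<open>pg_compare\<close> transfers it, up to the constant \<open>C\<close>, to the position at
  time 2 of a path from any \<open>a\<close> in the unit ball, which is then exposed for one more
  unit.\<close>

lemma killing:
 assumes v[measurable]: "v \<in> bmeas borel" and nz: "\<not> (AE x in lborel. v x = 0)"
 obtains q where "0 < q" "q \<le> 1" "!!a. norm a \<le> 1 ==> (NINT f|W. em (cost v (en 3) (start a f))) \<le>
  en (1 - q)"
proof -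
 interpret WL: pair_sigma_finite W lborel by unfold_locales
 let ?c = "%w f. cost v 1 (start w f)"
 define \<phi> \<psi> where "\<phi> w = (NINT f|W. 1 - em (?c w f))" and "\<psi> w = (NINT f|W. em (?c w f))" for w
 define C :: real where "C = 2 ^ DIM('a) * exp (1 / 2)"
 have C: "1 \<le> C" unfolding C_def using mult_mono[of 1 "2 ^ DIM('a)" 1 "exp (1 / 2 :: real)"] by simp
 have cm: "(%(w, f). em (?c w f)) \<in> bmeas (borel \<Otimes>\<^sub>M paths)"
  using start_kernel_measurable[OF v, of UNIV fst "borel \<Otimes>\<^sub>M paths" snd 1] by (simp add: case_prod_unfold)
 hence [measurable]: "(%(w, f). em (?c w f)) \<in> bmeas (borel \<Otimes>\<^sub>M W)" by (simp only: pair_W_measurable)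
 have cW[measurable]: "?c w \<in> bmeas W" for w
  unfolding measurable_W_iff using cost_start_measurable[OF v, of "%_. 1" w] by measurable
 have [measurable]: "\<phi> \<in> bmeas borel" "\<psi> \<in> bmeas borel" unfolding \<phi>_def[abs_def] \<psi>_def[abs_def] by
  measurable
 have 1: "\<psi> w + \<phi> w = 1" for w
  unfolding \<phi>_def \<psi>_def by (subst nn_integral_add[symmetric]) (auto simp: em_le_1 emeasure_space_1
   add_diff_inverse_ennreal)
 define c where "c = (NINT x|lborel. en (pg 1 x) * \<phi> x)"
 have "c \<noteq> 0"
 proof
  assume "c = 0"
  hence "AE w in lborel. \<phi> w = 0"
   unfolding c_def by (subst (asm) nn_integral_0_iff_AE) (auto simp: pg_neq_0)
  then obtain w where "\<phi> w = 0" using eventually_happens'[of "ae_filter lborel"] by (auto simp: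
   ae_filter_eq_bot_iff)
  moreover have "1 - em x = 0 ==> x = 0" for x using em_less_1[of x] by (auto simp:
   diff_eq_0_iff_ennreal zero_less_iff_neq_zero simp flip: not_le)
  ultimately have "AE f in W. ?c w f = 0"
   unfolding \<phi>_def by (subst (asm) nn_integral_0_iff_AE) (auto elim!: eventually_mono)
  hence "(NINT f|W. ?c w f) = 0" by (simp add: nn_integral_0_iff_AE)
  moreover have sm[measurable]: "(%p. start w (fst p) (snd p)) \<in> bmeas (W \<Otimes>\<^sub>M lborel)"
  proof (rule cont_eval_measurable)
   show "(%p. start w (fst p) t) \<in> bmeas (W \<Otimes>\<^sub>M lborel)" for t
    using measurable_compose[OF measurable_fst path_eval_W[of t]] unfolding start_def by measurable
  qed (auto simp: space_pair_measure space_W intro: start_cont)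
  moreover have "(NINT f|W. ?c w f) = (NINT s|lborel. ind {0..1} s * (NINT f|W. v (w + f s)))"
  proof -
   have [measurable]: "(%f. v (w + f s)) \<in> bmeas W" for s using path_eval_W[of s] by measurable
   have "(NINT f|W. ?c w f) = (NINT f|W. (NINT s|lborel. ind {0..1} s * v (start w f s)))"
    unfolding cost_def by (intro nn_integral_cong) (auto simp: indicator_def ennreal_le_1)
   also have "... = (NINT s|lborel. (NINT f|W. ind {0..1} s * v (start w f s)))"
    by (rule WL.Fubini'[symmetric]) (unfold case_prod_unfold, measurable)
   finally show ?thesis by (simp add: start_def nn_integral_cmult)
  qed
  ultimately have 0: "(NINT s|lborel. ind {0..1} s * (NINT f|W. v (w + f s))) = 0" by simp
  \<comment> \<open>A vanishing time integral yields a single positive time at which the mean of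
    \<open>v\<close> vanishes; there the path has a positive density.\<close>
  have "\<exists>s\<in>{0<..1}. (NINT f|W. v (w + f s)) = 0"
  proof (rule ccontr)
   assume no: "\<not> ?thesis"
   have "(%s. (NINT f|W. v (start w f s))) \<in> bmeas lborel"
    by (rule borel_measurable_nn_integral) (use measurable_compose[OF measurable_compose[OF
     measurable_pair_swap' sm] v] in \<open>simp add: case_prod_unfold\<close>)
   hence "AE s in lborel. ind {0..1} s * (NINT f|W. v (w + f s)) = 0"
    using 0 by (simp add: nn_integral_0_iff_AE start_def)
   hence "AE s in lborel. s \<notin> {0<..1::real}" by eventually_elim (use no in \<open>auto simp: indicator_def\<close>)
   hence "emeasure lborel {0<..1::real} = 0" by (subst (asm) AE_iff_measurable[of "{0<..1}"]) auto
   thus False by simp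
  qed
  then obtain s where s: "0 < s" "(NINT f|W. v (w + f s)) = 0" by auto
  hence "AE x in lborel. v x = 0" by (simp add: W_eval_shift nn_integral_0_iff_AE pg_neq_0)
  with nz show False ..
 qed
 moreover have "\<phi> w \<le> 1" for w using 1[of w] by (metis le_iff_add add.commute)
 hence "(NINT f|W. \<phi> (f 1)) \<le> (NINT f|W. 1)" by (intro nn_integral_mono)
 moreover have "c = (NINT f|W. \<phi> (f 1))" unfolding c_def by (rule W_eval[symmetric]) auto
 ultimately have "c \<noteq> 0" "c \<le> 1" by (auto simp: emeasure_space_1)
 then obtain r where r: "c = en r" "0 < r" "r \<le> 1" by (cases c) (auto simp: top_unique)
 show ?thesis
 proof (rule that[of "r / C"])
  show "0 < r / C" "r / C \<le> 1" using r C by (auto simp: divide_le_eq)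
  fix a :: 'a assume a: "norm a \<le> 1"
  have [measurable]: "(%f. a + f 2) \<in> bmeas W" using path_eval_W[of 2] by measurable
  have "en (r / C) * en C = c" using r C by (simp add: ennreal_mult'[symmetric])
  also have "... \<le> (NINT x|lborel. en (pg 2 (x - a)) * \<phi> x * en C)" unfolding c_def
  proof (rule nn_integral_mono, goal_cases)
   case (1 x)
   have "pg 1 x \<le> C * pg 2 (x - a)"
    using a by (intro order_trans[OF pg_compare[of x 0 a, simplified]] mult_right_mono) (auto simp:
     C_def pg_nonneg power_le_one)
   hence "en (pg 1 x) \<le> en C * en (pg 2 (x - a))" using C by (simp add: ennreal_mult'[symmetric]
    ennreal_leI)
   from mult_right_mono[OF this, of "\<phi> x"] show ?case by (simp add: mult_ac)
  qed
  also have "... = (NINT f|W. \<phi> (a + f 2)) * en C" by (simp add: W_eval_shift nn_integral_multc)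
  finally have "en (r / C) \<le> (NINT f|W. \<phi> (a + f 2))" using C ennreal_mult_le_mult_iff[of "en C" "en
   (r / C)"] by (simp add: mult.commute)
  moreover have "(NINT f|W. em (cost v (en 3) (start a f))) \<le> (NINT f|W. \<psi> (a + f 2))"
  proof -
   have "(NINT f|W. em (cost v (en 3) (start a f))) \<le> (NINT f|W. em (cost v (en 1) (%s. start a f (2
    + s))))"
   proof (intro nn_integral_mono em_antimono, goal_cases)
    case (1 f)
    thus ?case using cost_split[OF v start_cont, of f 2 "en 1" a] by (simp add: space_W)
   qed
   also have "... = (NINT f|W. \<psi> (a + f 2))"
   proof -
    have c: "em (cost v 1 f) = em (cost v 1 g)" if "!!t. 0 \<le> t ==> f t = g t" for f g
     using cost_cong[of 1 v f g] that by simp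
    have "cost (%_. 0) h f = 0" for h and f :: "real => 'a" by (simp add: cost_def)
    thus ?thesis using start_markov[OF stopping_const[of 2] _ c cm, of "%_. 0" a] by (simp add: \<psi>_def)
   qed
   finally show ?thesis .
  qed
  ultimately have "(NINT f|W. em (cost v (en 3) (start a f))) + en (r / C) \<le> (NINT f|W. \<psi> (a + f 2))
   + (NINT f|W. \<phi> (a + f 2))"
   by (intro add_mono)
  also have "... = 1" by (subst nn_integral_add[symmetric]) (auto simp: 1 emeasure_space_1)
  finally show "(NINT f|W. em (cost v (en 3) (start a f))) \<le> en (1 - r / C)"
   using r C by (cases "(NINT f|W. em (cost v (en 3) (start a f)))")
   (auto simp: ennreal_plus[symmetric] ennreal_le_iff2 top_unique divide_le_eq simp del:
    ennreal_plus simp flip: ennreal_1)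
 qed
qed

text \<open>At least half of the paths stay in the ball for three time units, and each of them pays
  at most \<open>3 * s\<close>.\<close>

lemma stay_lower:
 assumes v: "v \<in> bmeas borel" and s: "0 \<le> s" and vs: "!!w. w \<in> ball y R ==> v w \<le> en s"
 and e: "emeasure W {f \<in> space W. hit (- ball y R) (start w f) \<le> en 3} \<le> en (1 / 2)"
 shows "en (exp (- 3 * s) / 2) \<le> (NINT f|W. em (cost v (en 3) (start w f)) * ind {f. \<not> hit (- ball y
  R) f \<le> en 3} (start w f))"
proof -
 let ?E = "{f \<in> space W. hit (- ball y R) (start w f) \<le> en 3}"
 have Em: "?E \<in> sets W" by (intro hit_event) (simp add: closed_Compl)
 have "prob ?E \<le> 1 / 2" using e by (simp only: emeasure_eq_measure) (simp add: ennreal_le_iff del: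
  ennreal_half)
 hence "1 / 2 \<le> prob (space W - ?E)" using Em by (simp add: prob_compl)
 hence "en (exp (- 3 * s)) * en (1 / 2) \<le> en (exp (- 3 * s)) * emeasure W (space W - ?E)"
  unfolding emeasure_eq_measure by (intro mult_left_mono ennreal_leI) auto
 also have "... = (NINT f|W. en (exp (- 3 * s)) * ind (space W - ?E) f)"
  using Em by (subst nn_integral_cmult_indicator) auto
 also have "... \<le> (NINT f|W. em (cost v (en 3) (start w f)) * ind {f. \<not> hit (- ball y R) f \<le> en 3}
  (start w f))"
 proof (rule nn_integral_mono, goal_cases)
  case (1 f)
  have "en (exp (- 3 * s)) \<le> em (cost v (en 3) (start w f))" if "\<not> hit (- ball y R) (start w f) \<le> en 3"
   using cost_no_exit[OF _ _ vs s that] 1 s em_antimono[of _ "en (s * 3)"] by (simp add: em_ennreal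
    space_W mult.commute)
  thus ?case by (auto simp: indicator_def)
 qed
 finally show ?thesis using ennreal_mult''[of "1 / 2" "exp (- 3 * s)"] by simp
qed

text \<open>A path that stays in \<open>ball y R\<close> for three time units after reaching the
  unit ball is seen there at one of the sampling times.\<close>

lemma reach_lower:
 assumes v: "v \<in> bmeas borel" and s: "0 \<le> s" and vs: "!!w. w \<in> ball y R ==> v w \<le> en s"
 and e: "!!w. dist y w \<le> 1 ==> emeasure W {f \<in> space W. hit (- ball y R) (start w f) \<le> en 3} \<le> en (1 / 2)"
 shows "cross v (cball y 1) z * en (exp (- 3 * s) / 2) \<le> (\<Sum>n. kern v (cball y R) n z)"
proof -
 let ?k = "%n f. em (cost v (en (3 * real n)) (start z f)) * ind (cball y R) (start z f (3 * real n))"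
 let ?F = "%f. em (cost v (en 3) f) * ind {f. \<not> hit (- ball y R) f \<le> en 3} f"
 have "cross v (cball y 1) z * en (exp (- 3 * s) / 2) \<le> (NINT f|W. (\<Sum>n. ?k n f))"
 proof (rule first_passage[OF _ v, where F="?F"])
  show "?F f = ?F g" if "!!t. 0 \<le> t ==> f t = g t" for f g
   using hit_cong[of f g] cost_cong[of "en 3" v f g] that by (simp add: indicator_def)
  let ?Y = "borel \<Otimes>\<^sub>M paths"
  have "(%p. hit (- ball y R) (start (fst p) (snd p))) \<in> bmeas ?Y"
   by (rule hit_measurable) (use start_measurable[of "%x. x" borel] start_cont in \<open>auto simp:
    space_pair_measure closed_Compl\<close>)
  hence [measurable]: "(%(x, f). hit (- ball y R) (start x f)) \<in> bmeas ?Y" by (simp add: case_prod_unfold)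
  have [measurable]: "(%(x, f). em (cost v (en 3) (start x f))) \<in> bmeas ?Y"
   using start_kernel_measurable[OF v, of UNIV fst "borel \<Otimes>\<^sub>M paths" snd 3] by (simp add: case_prod_unfold)
  show "(%(x, f). ?F (start x f)) \<in> bmeas ?Y" unfolding indicator_def mem_Collect_eq by measurable
  fix f :: "real => 'a" and t :: real assume f: "f \<in> space paths" and t: "0 \<le> t"
  let ?X = "%s. start z f (t + s)"
  let ?Z = "cost v (en t) (start z f)"
  show "em ?Z * ?F ?X \<le> (\<Sum>n. ?k n f)"
  proof (cases "hit (- ball y R) ?X \<le> en 3")
   case False
   \<comment> \<open>The first sampling time not before \<open>t\<close>, hence at most
     \<open>t + 3\<close>.\<close>
   define n where "n = nat \<lceil>t / 3\<rceil>"
   have n: "t \<le> 3 * real n" "3 * real n \<le> t + 3" unfolding n_def using t by linarith+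
   have c: "continuous_on UNIV ?X"
    by (rule continuous_on_compose2[OF start_cont[OF f]]) (auto intro!: continuous_intros)
   have "\<forall>s\<in>{0..3}. start z f (t + s) \<in> ball y R"
    using False hit_le_iff[OF _ c, of "- ball y R" 3] by (auto simp: closed_Compl)
   from bspec[OF this, of "3 * real n - t"] n have "start z f (3 * real n) \<in> ball y R" by simp
   moreover have "em ?Z * em (cost v (en 3) ?X) \<le> em (cost v (en (3 * real n)) (start z f))"
    unfolding em_add[symmetric] cost_split[OF v start_cont[OF f] t, symmetric]
    using ennreal_leI[OF n(2)] t by (intro em_antimono cost_mono) simp
   ultimately have "em ?Z * ?F ?X \<le> ?k n f" using False by simp
   moreover have "g n \<le> (\<Sum>n. g n)" for g :: "nat => ennreal" using sum_le_suminf[of g "{n}"] by simp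
   note this[of "%n. ?k n f"]
   ultimately show ?thesis by (rule order_trans)
  qed simp
 qed (use stay_lower[OF v s vs e] in auto)
 also have "... = (\<Sum>n. kern v (cball y R) n z)"
  unfolding kern_def by (rule nn_integral_suminf) (rule measurable_WI, rule
   start_kernel_measurable[OF v], auto)
 finally show ?thesis .
qed

text \<open>The Green function, integrated over the unit ball at 0, is bounded from below by
  \<open>reach_lower\<close>; \<open>kern_symmetric\<close> exchanges the balls,
  \<open>sum_kern_le\<close> bounds the result from above, and \<open>harnack\<close> passes to the
  infimum over the ball around \<open>y\<close>. The exponent \<open>5 * s\<close> is
  \<open>3 * s\<close> from the stay plus \<open>2 * s\<close> from Harnack. In \<kappa>,
  \<open>q\<close> stems from the Green function, 2 from the stay, the volumes from integrating over
  the two balls, and \<open>C\<close> from Harnack.\<close>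

lemma crossing_reversal:
 assumes vm: "v \<in> bmeas borel" and nz: "\<not> (AE x in lborel. v x = 0)"
 obtains \<kappa> R D where "0 < \<kappa>" "0 < R" "0 < D"
 "!!s y (\<theta> :: real) \<rho>. 0 \<le> s ==> (!!w. w \<in> ball y \<rho> ==> v w \<le> en s) ==> R \<le> \<rho> ==> cball 0 1 \<inter> ball y
  \<rho> = {} ==> 0 \<le> \<theta> ==> en (\<kappa> * exp (- 5 * s)) * ib v 0 y \<le> ib v y 0 + en (D * exp (\<theta>\<^sup>2 - \<theta> * (\<rho> - R)
  / real DIM('a)))"
proof -
 obtain q where q: "0 < q" "q \<le> 1" "!!a. norm a \<le> 1 ==> (NINT f|W. em (cost v (en 3) (start a f))) \<le>
  en (1 - q)"
  using killing[OF assms] by metis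
 obtain R where R: "1 \<le> R"
  "!!p z. dist p z \<le> 1 ==> emeasure W {f \<in> space W. hit (- ball p R) (start z f) \<le> en 3} \<le> en (1 / 2)"
  using exit_small[of "1 / 2" 3] by auto
 define C where "C = 2 ^ DIM('a) * exp (2 * R\<^sup>2)"
 define mA mB where "mA = measure lborel (cball (0::'a) 1)" and "mB = measure lborel (cball (0::'a) R)"
 define \<kappa> where "\<kappa> = q * mA / (2 * mB * C)"
 define D where "D = (C + 1) * (4 * real DIM('a)) / C"
 have C: "0 < C" by (simp add: C_def)
 have m: "0 < mA" "0 < mB" unfolding mA_def mB_def using content_cball_pos[of 1 "0::'a"]
  content_cball_pos[of R "0::'a"] R by auto
 show ?thesis
 proof (rule that[of \<kappa> R D])
  show "0 < \<kappa>" "0 < R" "0 < D" using m q C R by (auto simp: \<kappa>_def D_def)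
  fix s :: real and y :: 'a and \<theta> \<rho> :: real
  assume s: "0 \<le> s" and v: "!!w. w \<in> ball y \<rho> ==> v w \<le> en s" and \<rho>: "R \<le> \<rho>" and away: "cball 0 1 \<inter>
   ball y \<rho> = {}" and \<theta>: "0 \<le> \<theta>"
  let ?A = "cball (0::'a) 1" and ?B = "cball y R"
  let ?X = "\<theta>\<^sup>2 - \<theta> * (\<rho> - R) / real DIM('a)"
  define E where "E = (C + 1) * (4 * real DIM('a) * exp ?X)"
  have E: "0 \<le> E" using C by (simp add: E_def)
  have im: "(%z. cross v ?A z * ind ?B z) \<in> bmeas lborel" by (intro borel_measurable_times_ennreal
   borel_measurable_indicator) (auto intro: cross_measurable' vm)
  define I where "I = (NINT z|lborel. cross v ?A z * ind ?B z)"
  have eA: "emeasure lborel ?A = en mA" unfolding mA_def by (rule emeasure_eq_ennreal_measure) (simp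
   add: emeasure_cball)
  have eB: "emeasure lborel ?B = en mB" unfolding mB_def using R by (simp add: emeasure_cball measure_def)
  note [measurable] = kern_measurable[OF vm] cross_measurable'[OF closed_cball vm]
  have S: "(NINT z|lborel. (\<Sum>n. ind A z * kern v B n z)) = (\<Sum>n. (NINT z|lborel. ind A z * kern v B n z))"
   if "A \<in> sets borel" "B \<in> sets borel" for A B
   by (rule nn_integral_suminf) (use that in measurable)
  have "en (exp (- 3 * s) / 2) * ib v 0 y * en mA = (NINT z|lborel. en (exp (- 3 * s) / 2) * ib v 0
   y * ind ?A z)"
   by (simp add: nn_integral_cmult_indicator eA)
  also have "... \<le> (NINT z|lborel. (\<Sum>n. ind ?A z * kern v ?B n z))"
  proof (rule nn_integral_mono, goal_cases)
   case (1 z)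
   show ?case
   proof (cases "z \<in> ?A")
    case True
    hence "ib v 0 y * en (exp (- 3 * s) / 2) \<le> cross v (cball y 1) z * en (exp (- 3 * s) / 2)"
     by (intro mult_right_mono ib_le) auto
    also have "... \<le> (\<Sum>n. kern v ?B n z)" by (rule reach_lower[OF vm s v R(2)]) (use \<rho> in auto)
    finally show ?thesis using True by (simp add: mult.commute)
   qed simp
  qed
  also have "... = (NINT z|lborel. (\<Sum>n. ind ?B z * kern v ?A n z))"
   by (subst (1 2) S) (auto intro!: suminf_cong kern_symmetric vm)
  also have "... \<le> (NINT z|lborel. en (1 / q) * (cross v ?A z * ind ?B z))"
  proof (rule nn_integral_mono, goal_cases)
   case (1 z)
   have "(\<Sum>n. kern v ?A n z) \<le> cross v ?A z * en (1 / q)"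
    by (rule suminf_le_const[OF _ sum_kern_le[OF vm _ q(1,2)]]) (use q in auto)
   thus ?case by (auto simp: indicator_def mult.commute)
  qed
  also have "... = en (1 / q) * I" unfolding I_def by (rule nn_integral_cmult[OF im])
  finally have 1: "en (exp (- 3 * s) / 2) * ib v 0 y * en mA \<le> en (1 / q) * I" .
  have "en (exp (- 2 * s)) * cross v ?A z \<le> en C * ib v y 0 + en E" if z: "z \<in> ?B" for z
   unfolding ib_def
  proof (rule le_INF_affine, goal_cases)
   case (1 z')
   thus ?case using R z unfolding E_def using away by (intro harnack[OF _ vm s v _ _ _ \<theta> C_def]) auto
  qed simp
  hence "(NINT z|lborel. en (exp (- 2 * s)) * (cross v ?A z * ind ?B z)) \<le> (NINT z|lborel. (en C *
   ib v y 0 + en E) * ind ?B z)"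
   by (intro nn_integral_mono) (auto simp: indicator_def simp del: mult_minus_left)
  hence 2: "en (exp (- 2 * s)) * I \<le> (en C * ib v y 0 + en E) * en mB"
   by (simp add: I_def nn_integral_cmult[OF im] nn_integral_cmult_indicator eB del: mult_minus_left)
  define k where "k = q / (mB * C)"
  have k: "0 < k" using q m C by (simp add: k_def)
  have "\<kappa> * exp (- 5 * s) = k * (exp (- 2 * s) * (exp (- 3 * s) / 2 * mA))"
   using mult_exp_exp[of "- 2 * s" "- 3 * s"] by (simp add: \<kappa>_def k_def mult_ac)
  hence "en (\<kappa> * exp (- 5 * s)) = en k * (en (exp (- 2 * s)) * (en (exp (- 3 * s) / 2) * en mA))"
   using k m by (simp only: ennreal_mult' exp_ge_zero mult_nonneg_nonneg less_imp_le
    divide_nonneg_nonneg zero_le_numeral)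
  hence "en (\<kappa> * exp (- 5 * s)) * ib v 0 y = en k * (en (exp (- 2 * s)) * (en (exp (- 3 * s) / 2) *
   ib v 0 y * en mA))"
   by (simp only: mult_ac)
  also have "... \<le> en k * (en (exp (- 2 * s)) * (en (1 / q) * I))" by (intro mult_left_mono 1) auto
  also have "... = en k * en (1 / q) * (en (exp (- 2 * s)) * I)" by (simp only: mult_ac)
  also have "... \<le> en k * en (1 / q) * ((en C * ib v y 0 + en E) * en mB)" by (intro mult_left_mono 2) auto
  also have "... = ib v y 0 * (en k * en (1 / q) * en C * en mB) + en k * en (1 / q) * en E * en mB"
   by (simp only: distrib_left distrib_right mult_ac)
  also have "... = ib v y 0 + en (E / C)" using k q m C E by (simp add: ennreal_mult''[symmetric] k_def)
  also have "E / C = D * exp ?X" by (simp add: E_def D_def)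
  finally show "en (\<kappa> * exp (- 5 * s)) * ib v 0 y \<le> ib v y 0 + en (D * exp ?X)" .
 qed
qed

end

section \<open>Annealed crossing estimate\<close>

context poisson
begin

lemma potential_measurable:
 assumes [measurable]: "w \<in> bmeas borel"
 shows "(%(\<omega>, x). potential w x \<omega>) \<in> bmeas (P \<Otimes>\<^sub>M borel)"
proof -
 have "(%(x, y). en (w (x - y))) \<in> bmeas (borel \<Otimes>\<^sub>M borel)" by measurable
 from sum_measurable[OF this]
 have "(%(x, \<omega>). potential w x \<omega>) \<in> bmeas (borel \<Otimes>\<^sub>M P)" by (simp add: potential_def)
 from measurable_compose[OF measurable_pair_swap' this] show ?thesis by (simp add: case_prod_unfold)
qed

lemma potential_measurable':
 assumes [measurable]: "w \<in> bmeas borel" and "\<omega> \<in> space P"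
 shows "(%x. potential w x \<omega>) \<in> bmeas borel"
 using measurable_compose[OF measurable_Pair1'[OF assms(2), of borel] potential_measurable[OF
  assms(1)]] by simp

text \<open>Fubini's theorem for points and times; a configuration is countable, so its counting
  measure is sigma-finite.\<close>

lemma cost_potential:
 assumes [measurable]: "w \<in> bmeas borel" and f: "continuous_on UNIV f" and \<omega>: "\<omega> \<in> space P"
 shows "cost (%x. potential w x \<omega>) h f = (NINT y|count_space \<omega>. cost (%x. en (w (x - y))) h f)"
proof -
 have [measurable]: "f \<in> bmeas borel" using f by (rule borel_measurable_continuous_onI)
 have c: "countable \<omega>" using \<omega> by (simp add: space_P config_countable)
 interpret C: sigma_finite_measure "count_space \<omega>" by (rule
  sigma_finite_measure_count_space_countable[OF c])
 interpret CL: pair_sigma_finite "count_space \<omega>" "lborel :: real measure" ..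
 let ?S = "{s. 0 \<le> s \<and> en s \<le> h}"
 have m: "(%(y, s). en (w (f s - y)) * ind ?S s) \<in> bmeas (count_space \<omega> \<Otimes>\<^sub>M lborel)"
  by (rule measurable_pair_measure_countable1[OF c]) simp
 have "cost (%x. potential w x \<omega>) h f = (NINT s|lborel. (NINT y|count_space \<omega>. en (w (f s - y)) *
  ind ?S s))"
  unfolding cost_def potential_def by (intro nn_integral_cong nn_integral_multc[symmetric]) simp
 also have "... = (NINT y|count_space \<omega>. (NINT s|lborel. en (w (f s - y)) * ind ?S s))"
  by (rule CL.Fubini'[OF m])
 finally show ?thesis by (simp add: cost_def)
qed

end

text \<open>Half-open, so that consecutive slabs are disjoint and fit together without a
  gap.\<close>

definition slab :: "'a::euclidean_space => real => real => 'a set" where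
 "slab e a b = {y. a \<le> y \<bullet> e \<and> y \<bullet> e < b}"

lemma slab_measurable [measurable]: "slab e a b \<in> sets borel" unfolding slab_def by measurable

text \<open>\<open>em (absorb w D h f)\<close> is the average, over the Poisson points in \<open>D\<close>, of \<open>em\<close> of the cost they
 inflict.\<close>

definition absorb :: "('a => real) => 'a::euclidean_space set => ennreal => (real => 'a) => ennreal" where
 "absorb w D h f = (NINT y|lborel. ind D y * (1 - em (cost (%x. en (w (x - y))) h f)))"

lemma cost_family_measurable:
 fixes w :: "'a::euclidean_space => real"
 assumes [measurable]: "w \<in> bmeas borel"
 and h: "!!t. (%x. h x t) \<in> bmeas N" and c: "!!x. x \<in> space N ==> continuous_on UNIV (h x)"
 and T: "T \<in> bmeas N" and y[measurable]: "y \<in> bmeas N"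
 shows "(%x. cost (%z. en (w (z - y x))) (T x) (h x)) \<in> bmeas N"
 by (rule cost_measurable[OF _ h c T]) measurable

lemma absorb_measurable:
 assumes [measurable]: "w \<in> bmeas borel" "D \<in> sets borel" and T: "T \<in> bmeas paths"
 shows "(%f. absorb w D (T f) f) \<in> bmeas paths"
proof -
 let ?X = "paths \<Otimes>\<^sub>M lborel"
 have [measurable]: "(%p. cost (%z. en (w (z - snd p))) (T (fst p)) (fst p)) \<in> bmeas ?X"
  by (rule cost_family_measurable)
  (use path_eval'[OF measurable_fst] measurable_compose[OF measurable_fst T] in \<open>auto simp:
   space_pair_measure intro: path_cont\<close>)
 have "(%(f, y). ind D y * (1 - em (cost (%x. en (w (x - y))) (T f) f))) \<in> bmeas ?X"
  unfolding case_prod_unfold by measurable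
 thus ?thesis unfolding absorb_def by (rule lborel.borel_measurable_nn_integral)
qed

lemma absorb_integrand_measurable:
 fixes w :: "'a::euclidean_space => real"
 assumes "w \<in> bmeas borel" "D \<in> sets borel" "continuous_on UNIV f"
 shows "(%y. ind D y * (1 - em (cost (%x. en (w (x - y))) h f))) \<in> bmeas borel"
proof -
 have [measurable]: "(%y. cost (%x. en (w (x - y))) h f) \<in> bmeas borel"
  by (rule cost_family_measurable[OF assms(1), where h="%_. f"]) (use assms in auto)
 show ?thesis using assms(2) by measurable
qed

text \<open>Points below height \<open>L\<close> are charged only for the path up to
  \<open>t\<close>, points between \<open>L\<close> and \<open>L + b\<close> only for the path after
  \<open>t\<close>. A translation by \<open>f t\<close>, which has height \<open>L\<close>, brings
  the second slab to the origin.\<close>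

lemma absorb_split:
 assumes w[measurable]: "w \<in> bmeas borel" and f: "f \<in> space paths" and t: "0 \<le> t" "t \<le> h"
 and L: "f t \<bullet> e = L" "0 \<le> L" and b: "0 \<le> b"
 shows "absorb w (slab e 0 L) (en t) f + absorb w (slab e 0 b) (en (h - t)) (after t f) \<le> absorb w
  (slab e 0 (L + b)) (en h) f"
proof -
 let ?X = "%x y. %x. en (w (x - y))"
 let ?g = "%D h f y. ind D y * (1 - em (cost (?X x y) h f))"
 have cf: "continuous_on UNIV f" by (rule path_cont[OF f])
 have ca: "continuous_on UNIV (after t f)" by (rule path_cont[OF after_path[OF f]])
 note m = absorb_integrand_measurable[OF w slab_measurable cf] and m' =
  absorb_integrand_measurable[OF w slab_measurable ca]
 have "absorb w (slab e 0 b) (en (h - t)) (after t f) = (NINT y|lborel. ?g (slab e 0 b) (en (h - t))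
  (after t f) (y + - f t))"
  unfolding absorb_def by (rule nn_integral_lborel_shift[OF m', symmetric])
 also have "... \<le> (NINT y|lborel. ?g (slab e L (L + b)) (en h) f y)"
 proof (rule nn_integral_mono, goal_cases)
  case (1 y)
  let ?Y = "%x. en (w (x - (y + - f t)))"
  have "cost ?Y (en (h - t)) (after t f) = cost (?X x y) (en (h - t)) (%s. f (t + s))"
   unfolding cost_def by (intro nn_integral_cong) (simp add: after_def indicator_def max_absorb1
    algebra_simps)
  also have "... \<le> cost (?X x y) (en h) f"
  proof -
   have "(?X x y) \<in> bmeas borel" by measurable
   from cost_split[OF this cf t(1), of "en (h - t)"] show ?thesis
    using t by (simp add: ennreal_plus[symmetric] del: ennreal_plus)
  qed
  finally have "em (cost (?X x y) (en h) f) \<le> em (cost ?Y (en (h - t)) (after t f))"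
   by (rule em_antimono)
  hence "1 - em (cost ?Y (en (h - t)) (after t f)) \<le> 1 - em (cost (?X x y) (en h) f)"
   by (rule ennreal_minus_mono[OF order_refl])
  moreover have "ind (slab e 0 b) (y + - f t) = (ind (slab e L (L + b)) y :: ennreal)"
   using L by (auto simp: indicator_def slab_def inner_diff_left)
  ultimately show ?case by (simp add: mult_left_mono)
 qed
 finally have 2: "absorb w (slab e 0 b) (en (h - t)) (after t f) \<le> (NINT y|lborel. ?g (slab e L (L +
  b)) (en h) f y)" .
 let ?Z = "(NINT y|lborel. ?g (slab e 0 L) (en h) f y)"
 have 1: "absorb w (slab e 0 L) (en t) f \<le> ?Z" unfolding absorb_def using t
  by (intro nn_integral_mono mult_left_mono ennreal_minus_mono[OF order_refl] em_antimono cost_mono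
   ennreal_leI) auto
 have "?Z + (NINT y|lborel. ?g (slab e L (L + b)) (en h) f y) = (NINT y|lborel. ?g (slab e 0 L) (en
  h) f y + ?g (slab e L (L + b)) (en h) f y)"
  by (rule nn_integral_add[symmetric]) (use m in auto)
 also have "... = absorb w (slab e 0 (L + b)) (en h) f"
  unfolding absorb_def using L b by (intro nn_integral_cong) (auto simp: indicator_def slab_def)
 finally show ?thesis using add_mono[OF 1 2] by simp
qed

definition plane_time :: "'a::euclidean_space => real => (real => 'a) => ennreal" where
 "plane_time e L f = hit {x. x \<bullet> e = L} f"

lemma closed_plane: "closed {x::'a::euclidean_space. x \<bullet> e = L}"
 using closed_hyperplane[of e L] by (simp add: inner_commute)

lemma stopping_plane_time: "stopping (plane_time e L)"
 unfolding plane_time_def by (rule stopping_hit[OF closed_plane])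

lemma plane_time_le:
 fixes f :: "real => 'a::euclidean_space"
 assumes f: "f \<in> space paths" and h: "0 \<le> h" "L \<le> f h \<bullet> e" and L: "0 \<le> L"
 shows "plane_time e L f \<le> en h"
proof -
 have "continuous_on {0..h} (%s. f s \<bullet> e)" by (intro continuous_intros path_cont[OF f])
 moreover have "f 0 \<bullet> e = 0" by (simp add: path_0[OF f])
 ultimately obtain s where "0 \<le> s" "s \<le> h" "f s \<bullet> e = L"
  using IVT'[of "%s. f s \<bullet> e" 0 L h] h L by auto
 hence "plane_time e L f \<le> en s" unfolding plane_time_def by (intro hit_le) auto
 also have "... \<le> en h" using \<open>s \<le> h\<close> by (rule ennreal_leI)
 finally show ?thesis .
qed

lemma plane_time_at:
 assumes "f \<in> space paths" "plane_time e L f < \<infinity>" shows "f (enn2real (plane_time e L f)) \<bullet> e = L"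
 using hit_attained[OF closed_plane[of e L] path_cont[OF assms(1), of UNIV]] assms(2) by (simp add:
  plane_time_def)

text \<open>The path is cut at its successive first passages through planes at mutual distance
  \<open>L\<close>, and each piece is charged with the points of its own slab only. Restarting every
  piece at the origin makes the factors identically distributed.\<close>

fun crossing_weight :: "('a::euclidean_space => real) => 'a => real => nat => (real => 'a) => ennreal" where
 "crossing_weight w e L 0 f = 1"
 | "crossing_weight w e L (Suc n) f = ind {f. plane_time e L f < \<infinity>} f * em (absorb w (slab e 0 L)
  (plane_time e L f) f) * crossing_weight w e L n (after_at (plane_time e L) f)"

lemma plane_time_measurable: "plane_time e L \<in> bmeas paths"
 using stopping_plane_time[of e L] by (simp add: stopping_def)

lemma crossing_weight_measurable:
 assumes w: "w \<in> bmeas borel"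
 shows "crossing_weight w e L n \<in> bmeas paths"
proof (induction n)
 case (Suc n)
 note [measurable] = plane_time_measurable absorb_measurable[OF w slab_measurable plane_time_measurable]
  measurable_compose[OF after_at_measurable[OF stopping_plane_time] Suc]
 show ?case by (simp only: crossing_weight.simps[abs_def]) measurable
qed (simp add: crossing_weight.simps[abs_def])

text \<open>A path that ends above height \<open>n * L\<close> has passed height \<open>L\<close>
  before; \<open>absorb_split\<close> at that passage separates one slab from the remaining
  ones.\<close>

lemma absorb_le_crossing_weight:
 assumes w: "w \<in> bmeas borel" and L: "0 \<le> L"
 shows "f \<in> space paths ==> 0 \<le> h ==> real n * L \<le> f h \<bullet> e ==> em (absorb w (slab e 0 (real n * L))
  (en h) f) \<le> crossing_weight w e L n f"
proof (induction n arbitrary: f h)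
 case 0
 thus ?case by (simp add: em_le_1)
next
 case (Suc n)
 let ?T = "plane_time e L f"
 define t where "t = enn2real ?T"
 have nL: "0 \<le> real n * L" using L by simp
 have "L \<le> f h \<bullet> e" using Suc.prems(3) nL by (simp add: algebra_simps)
 hence T: "?T \<le> en h" by (rule plane_time_le[OF Suc.prems(1,2) _ L])
 hence fin: "?T < \<infinity>" by (rule le_less_trans) simp
 have t: "0 \<le> t" "t \<le> h" "?T = en t" using T fin Suc.prems(2) by (auto simp: t_def enn2real_leI)
 have ft: "f t \<bullet> e = L" unfolding t_def by (rule plane_time_at[OF Suc.prems(1) fin])
 have "real n * L \<le> after t f (h - t) \<bullet> e"
  using Suc.prems(3) t ft by (simp add: after_def inner_diff_left algebra_simps)
 hence IH: "em (absorb w (slab e 0 (real n * L)) (en (h - t)) (after t f)) \<le> crossing_weight w e L n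
  (after t f)"
  using t by (intro Suc.IH after_path[OF Suc.prems(1)]) auto
 have "absorb w (slab e 0 L) (en t) f + absorb w (slab e 0 (real n * L)) (en (h - t)) (after t f) \<le>
  absorb w (slab e 0 (L + real n * L)) (en h) f"
  by (rule absorb_split[OF w Suc.prems(1) t(1,2) ft L nL])
 hence "em (absorb w (slab e 0 (L + real n * L)) (en h) f) \<le> em (absorb w (slab e 0 L) (en t) f) *
  em (absorb w (slab e 0 (real n * L)) (en (h - t)) (after t f))"
  unfolding em_add[symmetric] by (rule em_antimono)
 also have "... \<le> em (absorb w (slab e 0 L) (en t) f) * crossing_weight w e L n (after t f)"
  by (intro mult_left_mono IH) simp
 also have "... = crossing_weight w e L (Suc n) f" using fin t by (simp add: t_def[symmetric])
 finally show ?case by (simp add: algebra_simps)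
qed

text \<open>On its way to the plane at height \<open>L\<close> the path passes through height \<open>L / 2\<close>, where the whole
 ball carrying \<open>w\<close> lies inside the slab.\<close>

lemma absorb_pos:
 fixes f :: "real => 'a::euclidean_space"
 assumes w[measurable]: "w \<in> bmeas borel" and e: "norm e = 1" and \<rho>: "0 < \<rho>" and L: "2 * (\<rho> + 1) \<le> L"
 and K: "0 < (NINT x|lborel. en (w x) * ind (ball 0 \<rho>) x)"
 and f: "f \<in> space paths" and fin: "plane_time e L f < \<infinity>"
 shows "0 < absorb w (slab e 0 L) (plane_time e L f) f"
proof (rule ccontr)
 assume "\<not> ?thesis"
 hence z: "absorb w (slab e 0 L) (plane_time e L f) f = 0" by simp
 define K where "K = (NINT x|lborel. en (w x) * ind (ball (0::'a) \<rho>) x)"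
 define t where "t = enn2real (plane_time e L f)"
 have t: "0 \<le> t" "plane_time e L f = en t" "f t \<bullet> e = L"
  using fin plane_time_at[OF f fin] by (auto simp: t_def)
 have cf: "continuous_on UNIV f" by (rule path_cont[OF f])
 have [measurable]: "f \<in> bmeas borel" using cf by (rule borel_measurable_continuous_onI)
 let ?D = "slab e 0 L" and ?S = "{s. 0 \<le> s \<and> en s \<le> en t}"
 have S: "?S = {0..t}" using t(1) by (auto simp: ennreal_le_iff)
 let ?X = "%x y. %x. en (w (x - y))"
 have "AE y in lborel. ind ?D y * (1 - em (cost (?X x y) (en t) f)) = 0"
  using z absorb_integrand_measurable[OF w slab_measurable cf, of e 0 L "en t"]
  unfolding absorb_def t(2) by (subst (asm) nn_integral_0_iff_AE) auto
 hence "AE y in lborel. ind ?D y * cost (?X x y) (en t) f = 0"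
 proof eventually_elim
  case (elim y)
  have "cost (?X x y) (en t) f = 0" if "y \<in> ?D"
  proof (rule ccontr)
   assume "cost (?X x y) (en t) f \<noteq> 0"
   hence "em (cost (?X x y) (en t) f) < 1" by (intro em_less_1) (simp add: zero_less_iff_neq_zero)
   hence "0 < 1 - em (cost (?X x y) (en t) f)" by (simp add: diff_gr0_ennreal)
   with elim that show False by simp
  qed
  thus ?case by (auto simp: indicator_def)
 qed
 hence "0 = (NINT y|lborel. ind ?D y * cost (?X x y) (en t) f)"
  by (subst nn_integral_0_iff_AE[THEN iffD2])
  (use cost_family_measurable[OF w, where h="%_. f" and y="%y. y" and T="%_. en t"] cf in auto)
 also have "... = (NINT y|lborel. (NINT s|lborel. ind ?D y * (en (w (f s - y)) * ind {0..t} s)))"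
  unfolding cost_def S by (intro nn_integral_cong nn_integral_cmult[symmetric]) measurable
 also have "... = (NINT s|lborel. (NINT y|lborel. ind ?D y * (en (w (f s - y)) * ind {0..t} s)))"
  by (rule lborel_pair.Fubini') measurable
 finally have zero: "(NINT s|lborel. (NINT y|lborel. ind ?D y * (en (w (f s - y)) * ind {0..t} s))) = 0" ..
 let ?Y = "%y s. (NINT y|lborel. ind ?D y * en (w (f s - y)))"
 \<comment> \<open>Within distance 1 of height \<open>L / 2\<close>, the whole ball of radius \<rho>
   around \<open>f s\<close> lies in the slab, since
   \<open>2 * (\<rho> + 1) \<le> L\<close>.\<close>
 have inner: "K \<le> (?Y y s)" if s: "\<bar>f s \<bullet> e - L / 2\<bar> \<le> 1" for s
 proof -
  have "K \<le> (NINT x|lborel. ind ?D (f s - x) * en (w x))" unfolding K_def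
  proof (rule nn_integral_mono, goal_cases)
   case (1 x)
   show ?case
   proof (cases "x \<in> ball 0 \<rho>")
    case True
    hence D: "f s - x \<in> ?D" using Cauchy_Schwarz_ineq2[of x e] e s L by (simp add: slab_def
     inner_diff_left abs_le_iff abs_less_iff)
    thus ?thesis using True by simp
   qed simp
  qed
  also have "... = (NINT x|distr lborel borel uminus. ind ?D (f s - x) * en (w x))"
   using lborel_affine[of "-1" "0::'a"] by (simp add: density_1)
  also have "... = (NINT x|lborel. ind ?D (f s + x) * en (w (- x)))" by (subst nn_integral_distr) auto
  also have "... = (NINT y|lborel. (%y. ind ?D y * en (w (f s - y))) (y + f s))" by (simp add: add.commute)
  also have "... = (?Y y s)" by (rule nn_integral_lborel_shift) measurable
  finally show ?thesis .
 qed
 let ?Z = "%s. f s \<bullet> e"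
 have "continuous_on {0..t} ?Z" by (intro continuous_intros path_cont[OF f])
 moreover have f0: "f 0 \<bullet> e = 0" by (simp add: path_0[OF f])
 ultimately obtain s0 where s0: "0 \<le> s0" "s0 \<le> t" "f s0 \<bullet> e = L / 2"
  using IVT'[of "%s. f s \<bullet> e" 0 "L / 2" t] t L \<rho> by auto
 have "isCont ?Z s0" using cf by (intro continuous_intros) (simp add: continuous_on_eq_continuous_at)
 then obtain d where d: "0 < d" "!!s. \<bar>s - s0\<bar> < d ==> \<bar>f s \<bullet> e - L / 2\<bar> < 1"
  unfolding continuous_at_eps_delta dist_real_def s0(3) by (meson zero_less_one)
 have ds: "d \<le> s0"
 proof (rule ccontr)
  assume "\<not> ?thesis"
  hence "\<bar>f 0 \<bullet> e - L / 2\<bar> < 1" using s0 by (intro d(2)) auto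
  thus False using f0 L \<rho> by simp
 qed
 \<comment> \<open>The path stays within distance 1 of that height during
   \<open>{s0 - d / 2..s0}\<close>, an interval of positive length.\<close>
 have "K * en (d / 2) = (NINT s|lborel. K * ind {s0 - d / 2..s0} s)" using d by (simp add:
  nn_integral_cmult_indicator)
 also have "... \<le> (NINT s|lborel. (NINT y|lborel. ind ?D y * (en (w (f s - y)) * ind {0..t} s)))"
 proof (rule nn_integral_mono, goal_cases)
  case (1 s)
  show ?case
  proof (cases "s \<in> {s0 - d / 2..s0}")
   case True
   hence "\<bar>f s \<bullet> e - L / 2\<bar> < 1" using d by (intro d(2)) auto
   moreover have "s \<in> {0..t}" using True ds d s0 by auto
   ultimately show ?thesis using True inner[of s] by simp
  qed simp
 qed
 finally show False using zero K d by (simp add: K_def ennreal_eq_0_iff)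
qed

context wiener
begin

text \<open>By the strong Markov property at each plane the pieces are independent copies of the
  first one, so the means multiply.\<close>

lemma crossing_weight_integral:
 assumes w: "w \<in> bmeas borel"
 shows "(NINT f|W. crossing_weight w e L n f) = (NINT f|W. ind {f. plane_time e L f < \<infinity>} f * em
  (absorb w (slab e 0 L) (plane_time e L f) f)) ^ n"
proof (induction n)
 case (Suc n)
 let ?T = "plane_time e L" and ?E = "%f. em (absorb w (slab e 0 L) (plane_time e L f) f)"
 have T: "stopping ?T" by (rule stopping_plane_time)
 have Em: "?E \<in> bmeas paths"
  using absorb_measurable[OF w slab_measurable plane_time_measurable] by measurable
 have "(%f. ind {..<\<infinity>} (?T f) * ?E f) \<in> bmeas paths" using Em plane_time_measurable by measurable
 hence Im: "(%f. ind {f. ?T f < \<infinity>} f * ?E f) \<in> bmeas W" unfolding measurable_W_iff by (simp add: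
  indicator_def)
 have "(NINT f|W. crossing_weight w e L (Suc n) f) = (NINT f|W. ind {f. ?T f < \<infinity>} f * ?E f *
  crossing_weight w e L n (after_at ?T f))"
  by simp
 also have "... = (NINT f|W. ind {f. ?T f < \<infinity>} f * ?E f * (NINT g|W. crossing_weight w e L n g))"
 proof (rule strong_markov[OF T Em, where G="%x t g. crossing_weight w e L n g"])
  show "?E (stop_at ?T f) = ?E f" if f: "f \<in> space paths" "?T f < \<infinity>" for f
  proof -
   have "cost v (?T (stop_at ?T f)) (stop_at ?T f) = cost v (?T f) f" for v :: "'a => ennreal"
    using cost_past[OF T f, of v 0] by (simp add: start_def)
   thus ?thesis by (simp add: absorb_def)
  qed
  show "(%(x, t, g). crossing_weight w e L n g) \<in> bmeas (borel \<Otimes>\<^sub>M borel \<Otimes>\<^sub>M paths)"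
   using measurable_compose[OF measurable_snd measurable_compose[OF measurable_snd
    crossing_weight_measurable[OF w]]]
   by (simp add: case_prod_unfold)
 qed
 also have "... = (NINT f|W. ind {f. ?T f < \<infinity>} f * ?E f) * (NINT g|W. crossing_weight w e L n g)"
  by (rule nn_integral_multc[OF Im])
 finally show ?case by (simp add: Suc)
qed (simp add: emeasure_space_1)

text \<open>Fubini's theorem fixes the path first; then \<open>laplace_le\<close> evaluates the
  Poisson average of its weight, where boundedness of \<open>w\<close> makes the cost inflicted by a
  single point finite. The mean \<open>q\<close> of one factor is below 1 because by
  \<open>absorb_pos\<close> the factor is below 1 for every path.\<close>

lemma annealed_bound:
 assumes P: "poisson_process P" and w[measurable]: "w \<in> bmeas borel" and w0: "!!x. 0 \<le> w x" and wc:
  "!!x. w x \<le> c"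
 and nz: "\<not> (AE x in lborel. w x = 0)" and e: "norm e = 1"
 obtains L q where "0 < L" "q < 1"
 "!!n S. closed S ==> S \<subseteq> {x. real n * L \<le> x \<bullet> e} ==> (NINT \<omega>|P. cross (%x. potential w x \<omega>) S 0) \<le> q ^ n"
proof -
 interpret P: poisson P using P by unfold_locales
 interpret PW: pair_sigma_finite P W by unfold_locales
 obtain \<rho> where \<rho>: "0 < \<rho>" "0 < (NINT x|lborel. en (w x) * ind (ball (0::'a) \<rho>) x)"
 proof -
  let ?Z = "%n. ball (0::'a) (real n)"
  let ?X = "%x n. (NINT x|lborel. en (w x) * ind (?Z n) x)"
  have "\<exists>n. 0 < (?X x n)"
  proof (rule ccontr)
   assume "\<not> ?thesis"
   hence z: "(?X x n) = 0" for n by auto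
   have m: "(%x. en (w x) * ind (?Z n) x) \<in> bmeas lborel" for n
    by (intro borel_measurable_times_ennreal borel_measurable_indicator) auto
   have "AE x in lborel. en (w x) * ind (?Z n) x = 0" for n
    using z[of n] nn_integral_0_iff_AE[OF m[of n]] by blast
   hence "AE x in lborel. \<forall>n. en (w x) * ind (?Z n) x = 0" by (intro AE_all_countable[THEN iffD2] allI)
   hence "AE x in lborel. w x = 0"
   proof eventually_elim
    case (elim x)
    obtain n where "norm x < real n" using reals_Archimedean2 by blast
    with elim[rule_format, of n] show ?case using w0[of x] by (simp add: ennreal_eq_0_iff)
   qed
   with nz show False by simp
  qed
  then obtain n where n: "0 < (?X x n)" by blast
  moreover have "0 < real n" using n by (cases "n = 0") auto
  ultimately show ?thesis by (intro that)
 qed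
 define L where "L = 2 * (\<rho> + 1)"
 have L: "0 < L" using \<rho> by (simp add: L_def)
 let ?I = "%f. ind {f. plane_time e L f < \<infinity>} f * em (absorb w (slab e 0 L) (plane_time e L f) f)"
 define q where "q = (NINT f|W. ?I f)"
 have "(%f. ind {..<\<infinity>} (plane_time e L f) * em (absorb w (slab e 0 L) (plane_time e L f) f)) \<in> bmeas paths"
  using absorb_measurable[OF w slab_measurable plane_time_measurable] plane_time_measurable by measurable
 hence Im: "?I \<in> bmeas W" unfolding measurable_W_iff by (simp add: indicator_def)
 have I1: "?I f < 1" if "f \<in> space W" for f
 proof (cases "plane_time e L f < \<infinity>")
  case True
  have "0 < absorb w (slab e 0 L) (plane_time e L f) f"
   by (rule absorb_pos[OF w e \<rho>(1) _ \<rho>(2) _ True]) (use that in \<open>auto simp: L_def space_W\<close>)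
  thus ?thesis using True em_less_1 by simp
 qed simp
 let ?Y = "(NINT f|W. 1)"
 have le: "q \<le> ?Y" unfolding q_def using I1 by (intro nn_integral_mono less_imp_le) auto
 hence "q \<noteq> \<infinity>" by (auto simp: emeasure_space_1 top_unique)
 have "q < ?Y" unfolding q_def
 proof (rule nn_integral_less)
  show "\<not> (AE f in W. 1 \<le> ?I f)"
  proof
   assume "AE f in W. 1 \<le> ?I f"
   hence "AE f in W. False" using AE_space by eventually_elim (use I1 leD in blast)
   thus False by simp
  qed
 qed (use Im I1 \<open>q \<noteq> \<infinity>\<close> in \<open>auto simp: q_def intro!: AE_I2 less_imp_le\<close>)
 hence "q < 1" by (simp add: emeasure_space_1)
 show ?thesis
 proof (rule that[OF L \<open>q < 1\<close>], goal_cases)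
  case S: (1 n S)
  have "(NINT \<omega>|P. cross (%x. potential w x \<omega>) S 0) = (NINT f|W. (NINT \<omega>|P. wgt (%x. potential w x
   \<omega>) S (start 0 f)))"
   by (simp add: pair_W_measurable wgt_start_measurable S P.potential_measurable w PW.Fubini' cross_def)
  also have "... \<le> (NINT f|W. crossing_weight w e L n f)"
  proof (rule nn_integral_mono, goal_cases)
   case (1 f)
   note f = this[unfolded space_W]
   have s0: "start 0 f = f" by (simp add: start_def)
   show ?case
   proof (cases "hit S f < \<infinity>")
    case True
    define h where "h = enn2real (hit S f)"
    have h: "0 \<le> h" "hit S f = en h" using True by (auto simp: h_def)
    have fh: "real n * L \<le> f h \<bullet> e" using hit_attained[OF S(1) path_cont[OF f] True] S(2) by (auto
     simp: h_def)
    let ?U = "%x y. %x. en (w (x - y))"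
    define \<phi> where "\<phi> y = enn2real (cost (?U x y) (en h) f)" for y
    have c: "cost (?U x y) (en h) f = en (\<phi> y)" for y
    proof -
     have "cost (?U x y) (en h) f \<le> en c * en h" using wc by (intro cost_bound h ennreal_leI)
     also have "... < \<top>" by (simp add: ennreal_mult_less_top)
     finally show ?thesis by (simp add: \<phi>_def)
    qed
    have \<phi>m: "\<phi> \<in> bmeas borel"
     unfolding \<phi>_def using cost_family_measurable[OF w, where h="%_. f" and y="%y. y" and T="%_. en
      h" and N=borel] path_cont[OF f, of UNIV]
     by measurable
    have "(NINT \<omega>|P. wgt (%x. potential w x \<omega>) S (start 0 f)) = (NINT \<omega>|P. em (psum \<phi> \<omega>))"
     using True by (intro nn_integral_cong) (simp add: s0 wgt_def h(2) P.cost_potential[OF w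
      path_cont[OF f]] c psum_def)
    also have "... \<le> em (NINT y|lborel. 1 - em (en (\<phi> y)))" by (rule P.laplace_le[OF \<phi>m]) (simp add: \<phi>_def)
    \<comment> \<open>Points outside the slab are discarded here, which only increases the
      weight.\<close>
    also have "... \<le> em (absorb w (slab e 0 (real n * L)) (en h) f)"
     unfolding absorb_def c by (intro em_antimono nn_integral_mono) (auto simp: indicator_def)
    also have "... \<le> crossing_weight w e L n f" by (rule absorb_le_crossing_weight[OF w _ f h(1)
     fh]) (use L in simp)
    finally show ?thesis .
   qed (simp add: s0 wgt_def)
  qed
  also have "... = q ^ n" unfolding q_def by (rule crossing_weight_integral[OF w])
  finally show ?case .
 qed
qed

end

section \<open>The potential\<close>

lemma power_powr_inverse:
 fixes s :: real assumes "0 \<le> s" "0 < k" shows "(s ^ k) powr (1 / real k) = s"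
 using assms by (cases "s = 0") (auto simp: powr_realpow[symmetric] powr_powr)

lemma psum_shift: "psum f (shift u \<omega>) = psum (%y. f (y - u)) \<omega>" unfolding psum_def shift_def
 by (subst nn_integral_bij_count_space[where g="%y. y - u" and A=\<omega>, symmetric]) (auto simp:
  bij_betw_def inj_on_def)

lemma psum_cmult: "0 \<le> a ==> psum (%y. a * f y) \<omega> = en a * psum f \<omega>"
 unfolding psum_def by (simp add: ennreal_mult' nn_integral_cmult)

lemma (in prob_space) prob_eventually_tendsto_1:
 assumes Q: "!!n. Q n \<in> events" and ev: "AE x in M. eventually (%n. x \<in> Q n) sequentially"
 shows "(%n. prob (Q n)) ----> 1"
proof -
 have "(%n. (LINT x|M. ind (Q n) x)) ----> (LINT x|M. (1 :: real))"
 proof (rule integral_dominated_convergence[where w="%_. 1"])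
  show "AE x in M. (%n. ind (Q n) x) ----> (1 :: real)" using ev
   by (simp add: tendsto_eventually eventually_mono)
 qed (use Q in auto)
 thus ?thesis using Q by (simp add: prob_space)
qed

locale poisson_potential = poisson P for P :: "'a::euclidean_space set measure" +
 fixes w :: "'a => real" and \<gamma> c :: real
 assumes w_borel [measurable]: "w \<in> bmeas borel" and w_nonneg: "!!x. 0 \<le> w x"
 and w_nonnull: "\<not> (AE x in lborel. w x = 0)" and \<gamma>: "real DIM('a) < \<gamma>" and c: "0 < c"
 and w_le: "!!x. w x \<le> c * (if x = 0 then 1 else min (norm x powr (- \<gamma>)) 1)"
begin

lemma \<gamma>_nonneg: "0 \<le> \<gamma>" using \<gamma> by linarith

abbreviation S :: "'a set => ennreal" where "S \<equiv> psum (wt \<gamma>)"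

lemma w_le_c: "w x \<le> c"
proof -
 have "c * (if x = 0 then 1 else min (norm x powr (- \<gamma>)) 1) \<le> c * 1" using c by (intro mult_left_mono) auto
 thus ?thesis using w_le[of x] by simp
qed

lemma S_measurable [measurable]: "S \<in> bmeas P" by (rule psum_measurable) measurable

lemma S_exp: "AE \<omega> in P. S \<omega> < \<infinity>" "integrable P (%\<omega>. exp (enn2real (S \<omega>)))"
proof -
 obtain J where J: "0 \<le> J" "(NINT y|lborel. en (wt \<gamma> (y::'a))) = en J"
  using wt_integrable[OF \<gamma>] by (cases "(NINT y|lborel. en (wt \<gamma> (y::'a)))") auto
 have *: "!!x::'a. 0 \<le> wt \<gamma> x" "!!x::'a. wt \<gamma> x \<le> 1" using wt_pos wt_le_1[OF \<gamma>_nonneg] by (auto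
  intro: less_imp_le)
 show "AE \<omega> in P. S \<omega> < \<infinity>" using J * by (intro exp_moment(1)[where J=J]) auto
 let ?X = "(NINT \<omega>|P. en (exp (enn2real (S \<omega>))))"
 have "?X \<le> en (exp (3 * J))" using J * by (intro exp_moment(2)) auto
 hence "?X < \<infinity>" by (rule le_less_trans) simp
 thus "integrable P (%\<omega>. exp (enn2real (S \<omega>)))" by (intro integrableI_nonneg) auto
qed

lemma S_moment: "integrable P (%\<omega>. enn2real (S \<omega>) ^ k)"
proof (rule Bochner_Integration.integrable_bound)
 show "integrable P (%\<omega>. fact k * exp (enn2real (S \<omega>)))" using S_exp(2) by simp
qed (use power_div_fact_le_exp[of _ k] in \<open>auto intro!: AE_I2 simp: divide_le_eq mult.commute\<close>)

lemma S_moment_nn: "(NINT \<omega>|P. S \<omega> ^ k) < \<infinity>"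
proof -
 have "(NINT \<omega>|P. S \<omega> ^ k) = (NINT \<omega>|P. en (enn2real (S \<omega>) ^ k))"
  using S_exp(1) by (intro nn_integral_cong_AE) (auto elim!: eventually_mono simp: ennreal_power[symmetric])
 thus ?thesis using S_moment[of k] by (simp add: integrable_iff_bounded)
qed

lemma S_shift_le: "S (shift x \<omega>) \<le> en ((1 + norm (x - u)) powr \<gamma>) * S (shift u \<omega>)"
proof -
 have "S (shift x \<omega>) = psum (%y. wt \<gamma> (y - x)) \<omega>" by (rule psum_shift)
 also have "... \<le> psum (%y. (1 + norm (x - u)) powr \<gamma> * wt \<gamma> (y - u)) \<omega>"
 proof (rule psum_mono, goal_cases)
  case (1 y) show ?case using wt_shift_le[OF \<gamma>_nonneg, of "y - u" "x - u"] by simp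
 qed
 also have "... = en ((1 + norm (x - u)) powr \<gamma>) * S (shift u \<omega>)" by (simp add: psum_cmult psum_shift)
 finally show ?thesis .
qed

lemma potential_le: "potential w x \<omega> \<le> en (c * (2 + norm x) powr \<gamma>) * S \<omega>"
proof -
 have "potential w x \<omega> \<le> psum (%y. (c * (2 + norm x) powr \<gamma>) * wt \<gamma> y) \<omega>"
  unfolding potential_psum by (intro psum_mono W_le_wt[OF w_le c \<gamma>_nonneg])
 thus ?thesis using c by (simp add: psum_cmult)
qed

lemma potential_le_shift: "potential w (x + p) \<omega> \<le> en (c * (2 + norm x) powr \<gamma>) * S (shift p \<omega>)"
 unfolding potential_shift by (rule potential_le)

lemma S_shift_measurable: "(%(u, \<omega>). S (shift u \<omega>)) \<in> bmeas (borel \<Otimes>\<^sub>M P)"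
proof -
 have "(%(u, y). en (wt \<gamma> (y - u))) \<in> bmeas (borel \<Otimes>\<^sub>M borel)" by measurable
 from sum_measurable[OF this] show ?thesis unfolding psum_shift unfolding psum_def .
qed

text \<open>All moments of \<open>S\<close> are finite, so \<open>S (shift u \<omega>) ^ (d + 2)\<close> is integrable against a weight of
 order \<open>norm u ^ - (d + 1)\<close> for almost every \<open>\<omega>\<close>.\<close>

lemma sublinear_growth:
 "AE \<omega> in P. \<exists>B\<ge>0. \<forall>x. potential w x \<omega> \<le> en (B * (2 + norm x) powr (real (DIM('a) + 1) / real
  (DIM('a) + 2)))"
proof -
 let ?d = "real (DIM('a) + 1)" and ?k = "DIM('a) + 2"
 define G where "G \<omega> = (NINT u|(lborel :: 'a measure). en (wt ?d u) * S (shift u \<omega>) ^ ?k)" for \<omega>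
 interpret LP: pair_sigma_finite "lborel :: 'a measure" P by unfold_locales
 let ?X = "lborel \<Otimes>\<^sub>M P"
 have sm: "(%(u, \<omega>). S (shift u \<omega>)) \<in> bmeas ?X" using S_shift_measurable by simp
 note [measurable] = sm[unfolded case_prod_unfold]
 have jm: "(%(u, \<omega>). en (wt ?d u) * S (shift u \<omega>) ^ ?k) \<in> bmeas ?X"
  unfolding case_prod_unfold by measurable
 have Gm: "G \<in> bmeas P" using measurable_compose[OF measurable_pair_swap' jm]
  unfolding G_def[abs_def] by (intro lborel.borel_measurable_nn_integral) (simp add: case_prod_unfold)
 have "(NINT \<omega>|P. G \<omega>) = (NINT u|lborel. (NINT \<omega>|P. en (wt ?d u) * S (shift u \<omega>) ^ ?k))"
  unfolding G_def by (rule LP.Fubini'[OF jm])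
 also have "... = (NINT u|lborel. en (wt ?d (u::'a)) * (NINT \<omega>|P. S \<omega> ^ ?k))"
 proof (rule nn_integral_cong, goal_cases)
  case (1 u)
  have "(NINT \<omega>|P. S (shift u \<omega>) ^ ?k) = (NINT \<omega>|distr P P (shift u). S \<omega> ^ ?k)"
   by (rule nn_integral_distr[symmetric]) auto
  thus ?case by (simp add: nn_integral_cmult shift_distr)
 qed
 also have "... = (NINT u|lborel. en (wt ?d (u::'a))) * (NINT \<omega>|P. S \<omega> ^ ?k)"
  by (rule nn_integral_multc) measurable
 also have "... < \<infinity>"
  using wt_integrable[of ?d, where 'a='a] S_moment_nn[of ?k] by (simp add: ennreal_mult_less_top)
 finally have "AE \<omega> in P. G \<omega> \<noteq> \<infinity>" by (intro nn_integral_PInf_AE[OF Gm]) auto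
 thus ?thesis using AE_space
 proof eventually_elim
  case (elim \<omega>)
  then obtain g where g: "0 \<le> g" "G \<omega> = en g" by (cases "G \<omega>") auto
  define m where "m = measure lborel (ball (0::'a) 1)"
  have m: "0 < m" unfolding m_def using content_ball_pos[of 1 "0::'a"] by simp
  define B0 where "B0 = (2 powr \<gamma>) ^ ?k * g / m"
  have B0: "0 \<le> B0" using g m by (simp add: B0_def)
  define B where "B = c * 2 powr \<gamma> * B0 powr (1 / real ?k)"
  have "potential w x \<omega> \<le> en (B * (2 + norm x) powr (?d / real ?k))" for x
  proof -
   let ?a = "(2 + norm x) powr (- ?d)"
   have pos: "0 < 2 + norm x" by (simp add: add_pos_nonneg)
   hence a: "0 < ?a" by simp
   \<comment> \<open>A local average bounds the value at \<open>x\<close>: on the unit ball around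
     \<open>x\<close>, the weight \<open>wt ?d u\<close> is at least \<open>?a\<close>, and
     \<open>S (shift x \<omega>)\<close> is at most \<open>2 powr \<gamma>\<close> times
     \<open>S (shift u \<omega>)\<close>.\<close>
   have "en ?a * S (shift x \<omega>) ^ ?k * en m = (NINT u|lborel. en ?a * S (shift x \<omega>) ^ ?k * ind (ball x 1) u)"
    by (simp add: nn_integral_cmult_indicator m_def emeasure_ball measure_def)
   also have "... \<le> (NINT u|lborel. en ((2 powr \<gamma>) ^ ?k) * (en (wt ?d u) * S (shift u \<omega>) ^ ?k))"
   proof (rule nn_integral_mono, goal_cases)
    case (1 u)
    show ?case
    proof (cases "u \<in> ball x 1")
     case True
     hence xu: "norm (x - u) < 1" by (simp add: dist_norm)
     have "?a \<le> wt ?d u" using norm_triangle_ineq4[of x "x - u"] unfolding wt_def using xu by (intro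
      powr_mono2') (auto simp: add_pos_nonneg)
     moreover have "S (shift x \<omega>) \<le> en (2 powr \<gamma>) * S (shift u \<omega>)"
     proof -
      have "(1 + norm (x - u)) powr \<gamma> \<le> 2 powr \<gamma>" using xu \<gamma>_nonneg by (intro powr_mono2) auto
      thus ?thesis by (intro order_trans[OF S_shift_le[of x \<omega> u]] mult_right_mono ennreal_leI) auto
     qed
     hence "S (shift x \<omega>) ^ ?k \<le> (en (2 powr \<gamma>) * S (shift u \<omega>)) ^ ?k" by (rule power_mono) simp
     ultimately have "en ?a * S (shift x \<omega>) ^ ?k \<le> en (wt ?d u) * (en (2 powr \<gamma>) * S (shift u \<omega>)) ^ ?k"
      by (intro mult_mono ennreal_leI) auto
     thus ?thesis using True by (simp only: power_mult_distrib ennreal_power[symmetric] powr_ge_zero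
      indicator_simps mult_1_right mult.left_commute)
    qed simp
   qed
   also have "... = en ((2 powr \<gamma>) ^ ?k) * G \<omega>" unfolding G_def
   proof (rule nn_integral_cmult, goal_cases)
    case 1
    have "(%u. S (shift u \<omega>)) \<in> bmeas lborel"
     using measurable_compose[OF measurable_Pair2'[OF \<open>\<omega> \<in> space P\<close>, of borel] S_shift_measurable] by simp
    thus ?case by measurable
   qed
   also have "... = en ((2 powr \<gamma>) ^ ?k * g)" using g by (simp add: ennreal_mult'')
   finally have le: "en ?a * S (shift x \<omega>) ^ ?k * en m \<le> en ((2 powr \<gamma>) ^ ?k * g)" .
   have "S (shift x \<omega>) \<noteq> \<infinity>"
   proof
    assume "S (shift x \<omega>) = \<infinity>"
    thus False using le a m by (simp add: ennreal_mult_top ennreal_top_mult top_unique)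
   qed
   then obtain s where s: "0 \<le> s" "S (shift x \<omega>) = en s" by (cases "S (shift x \<omega>)") auto
   have "en (?a * s ^ ?k * m) \<le> en ((2 powr \<gamma>) ^ ?k * g)"
    using le s m by (simp only: s(2) ennreal_power ennreal_mult' ennreal_mult'' powr_ge_zero
     less_imp_le zero_le_power mult_nonneg_nonneg)
   hence "s ^ ?k \<le> B0 * (2 + norm x) powr ?d" using g using m pos unfolding B0_def powr_minus_divide
    by (simp add: field_simps)
   \<comment> \<open>The root of order \<open>DIM('a) + 2\<close> of a bound of order
     \<open>DIM('a) + 1\<close> leaves an exponent below 1.\<close>
   hence "(s ^ ?k) powr (1 / real ?k) \<le> (B0 * (2 + norm x) powr ?d) powr (1 / real ?k)" using s by
    (intro powr_mono2) auto
   also have "(s ^ ?k) powr (1 / real ?k) = s" by (rule power_powr_inverse[OF s(1)]) simp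
   also have "(B0 * (2 + norm x) powr ?d) powr (1 / real ?k) = B0 powr (1 / real ?k) * (2 + norm x)
    powr (?d / real ?k)"
    using B0 by (simp add: powr_mult powr_powr)
   finally have "s \<le> B0 powr (1 / real ?k) * (2 + norm x) powr (?d / real ?k)" .
   hence "c * 2 powr \<gamma> * s \<le> B * (2 + norm x) powr (?d / real ?k)"
    using c by (simp add: B_def mult.assoc mult_left_mono)
   moreover have "potential w x \<omega> \<le> en (c * 2 powr \<gamma> * s)"
    using potential_le_shift[of 0 x \<omega>] s c by (simp add: ennreal_mult')
   ultimately show ?thesis by (auto intro: order_trans ennreal_leI)
  qed
  moreover have "0 \<le> B" using c by (simp add: B_def)
  ultimately show ?case by blast
 qed
qed

section \<open>Local supremum, bottom of the spectrum and a bump near the origin\<close>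

lemma sup_potential_le: "(SUP x\<in>ball 0 1. potential w x \<omega>) \<le> en (c * 3 powr \<gamma>) * S \<omega>"
proof (rule SUP_least, goal_cases)
 case (1 x)
 hence "c * (2 + norm x) powr \<gamma> \<le> c * 3 powr \<gamma>" using c \<gamma>_nonneg by (intro mult_left_mono powr_mono2) auto
 thus ?case by (intro order_trans[OF potential_le] mult_right_mono ennreal_leI) auto
qed

lemma sup_potential: "AE \<omega> in P. (SUP x\<in>ball 0 1. potential w x \<omega>) < \<infinity>"
 "(%\<omega>. enn2real (SUP x\<in>ball 0 1. potential w x \<omega>)) \<in> lorentz_space (completion P) DIM('a)"
proof -
 let ?f = "%\<omega>. SUP x\<in>ball 0 1. potential w x \<omega>" and ?a = "c * 3 powr \<gamma>"
 show fin: "AE \<omega> in P. ?f \<omega> < \<infinity>" using S_exp(1)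
 proof eventually_elim
  case (elim \<omega>)
  thus ?case using sup_potential_le[of \<omega>] by (auto intro!: le_less_trans[OF sup_potential_le] simp:
   ennreal_mult_less_top)
 qed
 interpret C: prob_space "completion P" by (intro prob_spaceI) (simp add: emeasure_space_1)
 have fm: "?f \<in> bmeas (completion P)"
  by (rule borel_measurable_SUP_completion[OF _ _ potential_measurable[OF w_borel]]) (auto intro:
   finite_measure_axioms)
 show "(%\<omega>. enn2real (?f \<omega>)) \<in> lorentz_space (completion P) DIM('a)"
 proof (rule lorentz_spaceI)
  show "integrable (completion P) (%x. \<bar>enn2real (?f x)\<bar> ^ Suc DIM('a))"
  proof (rule Bochner_Integration.integrable_bound)
   let ?X = "%\<omega>. ?a ^ Suc DIM('a) * enn2real (S \<omega>) ^ Suc DIM('a)"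
   have "integrable P ?X" by (intro integrable_mult_right S_moment)
   thus "integrable (completion P) ?X" by (subst integrable_completion) auto
   show "AE \<omega> in completion P. norm (\<bar>enn2real (?f \<omega>)\<bar> ^ Suc DIM('a)) \<le> norm (?a ^ Suc DIM('a) *
    enn2real (S \<omega>) ^ Suc DIM('a))"
    using AE_completion[OF S_exp(1)]
   proof eventually_elim
    case (elim \<omega>)
    have "enn2real (?f \<omega>) \<le> enn2real (en ?a * S \<omega>)"
     using elim by (intro enn2real_mono sup_potential_le) (simp add: ennreal_mult_less_top)
    also have "... = ?a * enn2real (S \<omega>)" using c by (simp add: enn2real_mult)
    finally have "enn2real (?f \<omega>) ^ Suc DIM('a) \<le> (?a * enn2real (S \<omega>)) ^ Suc DIM('a)" by (intro
     power_mono) auto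
    thus ?case using c by (simp only: power_mult_distrib) (simp add: abs_mult)
   qed
  qed (use fm in measurable)
 qed (use fm C.prob_space_axioms in auto)
qed

text \<open>With positive probability a large ball contains no point, and independently the points
  outside contribute little, since the tails of the convergent sum \<open>S\<close> tend to
  0.\<close>

lemma quiet_event:
 assumes R: "0 \<le> R" and \<epsilon>: "0 < \<epsilon>"
 obtains E where "E \<in> sets P" "0 < prob E" "!!\<omega> x. \<omega> \<in> E ==> norm x \<le> R ==> potential w x \<omega> \<le> en \<epsilon>"
proof -
 define a where "a = en (c * (2 + R) powr \<gamma>)"
 let ?B = "%m. ball (0::'a) (real m)"
 define A where "A = {\<omega> \<in> space P. a * S \<omega> \<le> en \<epsilon>}"
 define Q where "Q m = {\<omega> \<in> space P. \<omega> \<inter> - ?B m \<in> A}" for m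
 have A: "A \<in> sets P" unfolding A_def by measurable
 have Q: "Q m \<in> sets P" for m
  using measurable_sets[OF restrict_measurable A, of "- ?B m"] by (simp add: Q_def vimage_def
   Int_def conj_commute)
 have sub: "\<omega> \<inter> D \<in> space P" if "\<omega> \<in> space P" for \<omega> D using that by (auto simp: space_P intro:
  config_subset)
 have "(%m. prob (Q m)) ----> 1"
 proof (rule prob_eventually_tendsto_1[OF Q], goal_cases)
  case 1
  show ?case using S_exp(1) AE_space
  proof eventually_elim
   case (elim \<omega>)
   have "(%m. (NINT y|count_space \<omega>. en (wt \<gamma> y) * ind (- ?B m) y)) ----> (NINT y|count_space \<omega>. 0)"
   proof (rule nn_integral_dominated_convergence[where w="%y. en (wt \<gamma> y)"])
    show "AE y in count_space \<omega>. (%m. en (wt \<gamma> y) * ind (- ?B m) y) ----> 0"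
    proof (rule AE_I2, goal_cases)
     case (1 y)
     have "eventually (%m. norm y < real m) sequentially" by real_asymp
     thus ?case by (intro tendsto_eventually) (erule eventually_mono, simp)
    qed
   qed (use elim in \<open>auto simp: psum_def indicator_def\<close>)
   moreover have "S (\<omega> \<inter> - ?B m) = (NINT y|count_space \<omega>. en (wt \<gamma> y) * ind (- ?B m) y)" for m
    unfolding psum_def by (subst (1 2) nn_integral_count_space_indicator) (auto intro!:
     nn_integral_cong simp: indicator_def)
   ultimately have "(%m. a * S (\<omega> \<inter> - ?B m)) ----> a * 0" by (intro ennreal_tendsto_cmult) (auto
    simp: a_def)
   hence "eventually (%m. a * S (\<omega> \<inter> - ?B m) < en \<epsilon>) sequentially" using \<epsilon> by (intro order_tendstoD) auto
   thus ?case by eventually_elim (use elim sub in \<open>auto simp: Q_def A_def\<close>)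
  qed
 qed
 from order_tendstoD(1)[OF this, of 0] obtain m where m: "0 < prob (Q m)" by (auto simp:
  eventually_sequentially)
 define A1 where "A1 = {\<omega> \<in> space P. \<omega> \<inter> ?B m = {}}"
 define E where "E = {\<omega> \<in> space P. \<omega> \<inter> ?B m \<in> A1 \<and> \<omega> \<inter> - ?B m \<in> A}"
 have A1: "A1 \<in> sets P" unfolding A1_def by (rule void_event) auto
 let ?X = "{\<omega> \<in> space P. \<omega> \<inter> ?B m \<in> A1}"
 have p1: "0 < prob ?X" using prob_void[of "?B m"] sub by (simp add: A1_def conj_commute cong: conj_cong)
 show ?thesis
 proof (rule that[of E])
  have "E = ((%\<omega>. \<omega> \<inter> ?B m) -` A1 \<inter> space P) \<inter> Q m" by (auto simp: E_def Q_def)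
  thus "E \<in> sets P" using measurable_sets[OF restrict_measurable A1, of "?B m"] Q by simp
  show "0 < prob E" unfolding E_def using p1 m A1 A by (subst indep_regions) (auto simp: Q_def)
  fix \<omega> :: "'a set" and x :: 'a assume w: "\<omega> \<in> E" and x: "norm x \<le> R"
  have "\<omega> \<inter> - ?B m = \<omega>" using w by (auto simp: E_def A1_def)
  hence "a * S \<omega> \<le> en \<epsilon>" using w by (simp add: E_def A_def)
  moreover have "potential w x \<omega> \<le> a * S \<omega>" unfolding a_def using x c \<gamma>_nonneg
   by (intro order_trans[OF potential_le] mult_right_mono ennreal_leI mult_left_mono powr_mono2) auto
  ultimately show "potential w x \<omega> \<le> en \<epsilon>" by simp
 qed
qed

text \<open>The right-hand side is 0, attained at the empty configuration, so it suffices to find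
  quiet balls of every size and level; countably many of each are enough.\<close>

lemma bottom_spectrum_potential:
 "AE \<omega> in P. bottom_spectrum (%x. potential w x \<omega>) = (INF \<omega>'\<in>configurations. potential w 0 \<omega>')"
proof -
 obtain b :: 'a where b: "b \<in> Basis" using nonempty_Basis by blast
 have "{} \<in> (configurations :: 'a set set)" by (simp add: configurations_def)
 hence "(INF \<omega>'\<in>configurations. potential w 0 \<omega>') \<le> potential w 0 {}" by (rule INF_lower)
 also have "... = 0" by (simp add: potential_def nn_integral_count_space_finite)
 finally have inf0: "(INF \<omega>'\<in>configurations. potential w 0 \<omega>') = 0" by simp
 have "AE \<omega> in P. \<exists>x0. \<forall>x\<in>ball x0 (Suc n). potential w x \<omega> \<le> en (1 / Suc n)" for n :: nat
 proof -
  obtain E where E: "E \<in> sets P" "0 < prob E"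
   "!!\<omega> x. \<omega> \<in> E ==> norm x \<le> real (Suc n) ==> potential w x \<omega> \<le> en (1 / real (Suc n))"
   using quiet_event[of "real (Suc n)" "1 / real (Suc n)"] by auto
  have "b \<noteq> 0" using b by auto
  from AE_exists_shift[OF this E(1,2)] show ?thesis
  proof eventually_elim
   case (elim \<omega>)
   then obtain k :: nat where k: "shift (real k *\<^sub>R b) \<omega> \<in> E" by blast
   have "potential w x \<omega> \<le> en (1 / Suc n)" if "x \<in> ball (real k *\<^sub>R b) (Suc n)" for x
    using E(3)[OF k, of "x - real k *\<^sub>R b"] that potential_shift[of w "x - real k *\<^sub>R b" "real k *\<^sub>R b" \<omega>]
    by (simp add: dist_norm norm_minus_commute)
   thus ?case by blast
  qed
 qed
 hence "AE \<omega> in P. \<forall>n::nat. \<exists>x0. \<forall>x\<in>ball x0 (Suc n). potential w x \<omega> \<le> en (1 / Suc n)"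
  by (simp add: AE_all_countable)
 thus ?thesis by eventually_elim (simp add: bottom_spectrum_eq_0 inf0)
qed

text \<open>\<open>w\<close> exceeds some \<open>1 / Suc n\<close> on a bounded set
  \<open>A n\<close> of positive measure, and every point \<open>y\<close> of the configuration
  carries a translate of it. The radius \<open>n + 1\<close> allows for the distance of
  \<open>p\<close> and \<open>y\<close>.\<close>

lemma large_near_point:
 obtains \<rho> e where "0 < \<rho>" "0 < e"
 "!!\<omega> y p. \<omega> \<in> space P ==> y \<in> \<omega> ==> dist p y < 1 ==> en e < emeasure lborel ({x. en e < potential w
  x \<omega>} \<inter> ball p \<rho>)"
proof -
 define A where "A n = {x. 1 / real (Suc n) < w x} \<inter> ball 0 (real n)" for n :: nat
 have Am[measurable]: "A n \<in> sets lborel" for n unfolding A_def by measurable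
 have "\<exists>n. emeasure lborel (A n) \<noteq> 0"
 proof (rule ccontr)
  assume "\<not> ?thesis"
  hence "AE x in lborel. \<forall>n. x \<notin> A n" using Am by (intro AE_all_countable[THEN iffD2] allI
   AE_not_in) (auto simp: null_sets_def simp del: sets_lborel)
  hence "AE x in lborel. w x = 0"
  proof eventually_elim
   case (elim x)
   show ?case
   proof (rule ccontr)
    assume "w x \<noteq> 0"
    hence "0 < w x" using w_nonneg[of x] by simp
    then obtain i where i: "1 / real (Suc i) < w x" using nat_approx_posE by blast
    obtain j where j: "norm x < real j" using reals_Archimedean2 by blast
    have "1 / real (Suc (max i j)) \<le> 1 / real (Suc i)" by (intro divide_left_mono) auto
    hence "x \<in> A (max i j)" using i j by (auto simp: A_def)
    with elim show False by blast
   qed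
  qed
  with w_nonnull show False by simp
 qed
 then obtain n where n: "emeasure lborel (A n) \<noteq> 0" by blast
 have "emeasure lborel (A n) \<le> emeasure lborel (ball (0::'a) (real n))" by (intro emeasure_mono)
  (auto simp: A_def)
 then obtain m where m: "0 < m" "emeasure lborel (A n) = en m"
  using n by (cases "emeasure lborel (A n)") (auto simp: top_unique emeasure_ball less_le)
 define e where "e = min (m / 2) (1 / real (Suc n))"
 have e: "0 < e" "e < m" "e \<le> 1 / real (Suc n)" using m by (auto simp: e_def)
 show ?thesis
 proof (rule that[of "real n + 1" e])
  fix \<omega> y p assume w: "\<omega> \<in> space P" and y: "y \<in> \<omega>" and d: "dist p y < 1"
  have vm[measurable]: "(%x. potential w x \<omega>) \<in> bmeas borel" by (rule potential_measurable'[OF w_borel w])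
  have "(+) y ` A n = (+) (- y) -` A n \<inter> space lborel" by (auto intro!: image_eqI[where x="_ - y"])
  hence "emeasure lborel ((+) y ` A n) = emeasure (distr lborel borel ((+) (- y))) (A n)"
   using Am[of n] by (simp add: emeasure_distr)
  hence "emeasure lborel ((+) y ` A n) = en m" by (simp add: lborel_distr_plus m)
  moreover have "emeasure lborel ((+) y ` A n) \<le> emeasure lborel ({x. en e < potential w x \<omega>} \<inter> ball
   p (real n + 1))"
  proof (rule emeasure_mono)
   show "(+) y ` A n \<subseteq> {x. en e < potential w x \<omega>} \<inter> ball p (real n + 1)"
   proof (rule image_subsetI, goal_cases)
    case x: (1 x)
    have "en e < en (w (y + x - y))" using x e by (intro ennreal_lessI) (auto simp: A_def)
    also have "... \<le> potential w (y + x) \<omega>" unfolding potential_def by (rule nn_integral_ge_point[OF y])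
    finally have "en e < potential w (y + x) \<omega>" .
    moreover have "dist p (y + x) \<le> dist p y + norm x" using dist_triangle[of p "y + x" y] by (simp
     add: dist_norm)
    ultimately show ?case using x d by (auto simp: A_def)
   qed
   show "{x. en e < potential w x \<omega>} \<inter> ball p (real n + 1) \<in> sets lborel" by measurable
  qed
  ultimately have "en m \<le> emeasure lborel ({x. en e < potential w x \<omega>} \<inter> ball p (real n + 1))" by simp
  moreover have "en e < en m" using e by (intro ennreal_lessI) auto
  ultimately show "en e < emeasure lborel ({x. en e < potential w x \<omega>} \<inter> ball p (real n + 1))" by
   (rule less_le_trans[rotated])
 qed (use e in auto)
qed

text \<open>The index of the first nonempty ball has the geometric tail
  \<open>exp (- \<kappa>) ^ m\<close>, against which every power of the distance is
  summable.\<close>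

lemma nearby_bump:
 "\<exists>\<rho> e (u :: 'a set => 'a). 0 < \<rho> \<and> 0 < e \<and> u \<in> bmeas P \<and> (AE \<omega> in P. en e < emeasure lborel ({x. en
  e < potential w x \<omega>} \<inter> ball (u \<omega>) \<rho>)) \<and> integrable P (%\<omega>. norm (u \<omega>) ^ DIM('a))"
proof -
 obtain \<rho> e where re: "0 < \<rho>" "0 < e"
  "!!\<omega> y p. \<omega> \<in> space P ==> y \<in> \<omega> ==> dist p y < 1 ==> en e < emeasure lborel ({x. en e < potential
   w x \<omega>} \<inter> ball p \<rho>)"
  using large_near_point by blast
 obtain b :: 'a where "b \<in> Basis" using nonempty_Basis by blast
 hence b: "norm b = 1" by simp
 define p where "p k = (2 * real k) *\<^sub>R b" for k :: nat
 define B where "B k = ball (p k) 1" for k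
 define U where "U m = (\<Union>k<m. B k)" for m
 have disj: "disjoint_family B" unfolding disjoint_family_on_def
 proof (intro ballI impI, goal_cases)
  case (1 i j)
  have "dist (p i) (p j) = \<bar>2 * real i - 2 * real j\<bar>" by (simp add: p_def dist_norm
   scaleR_diff_left[symmetric] b)
  also have "2 \<le> ..." using \<open>i \<noteq> j\<close> by linarith
  finally have far: "2 \<le> dist (p i) (p j)" .
  show ?case
  proof (rule ccontr)
   assume "B i \<inter> B j \<noteq> {}"
   then obtain x where "dist (p i) x < 1" "dist (p j) x < 1" by (auto simp: B_def)
   thus False using far dist_triangle[of "p i" "p j" x] by (simp add: dist_commute)
  qed
 qed
 define \<kappa> where "\<kappa> = measure lborel (ball (0::'a) 1)"
 have \<kappa>: "0 < \<kappa>" unfolding \<kappa>_def using content_ball_pos[of 1 "0::'a"] by simp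
 have mB: "measure lborel (B k) = \<kappa>" "emeasure lborel (B k) < \<infinity>" for k
  unfolding B_def \<kappa>_def by (simp_all add: emeasure_ball measure_def)
 have U: "U m \<in> sets borel" "bounded (U m)" "measure lborel (U m) = real m * \<kappa>" for m
 proof -
  show "U m \<in> sets borel" "bounded (U m)" by (auto simp: U_def B_def)
  have "measure lborel (U m) = (\<Sum>k<m. measure lborel (B k))" unfolding U_def
  proof (rule measure_finite_Union)
   show "disjoint_family_on B {..<m}" using disj unfolding disjoint_family_on_def by blast
   show "emeasure lborel (B k) \<noteq> \<infinity>" if "k \<in> {..<m}" for k using mB(2)[of k] by auto
  qed (auto simp: B_def)
  thus "measure lborel (U m) = real m * \<kappa>" by (simp add: mB)
 qed
 define Q where "Q m = {\<omega> \<in> space P. \<omega> \<inter> U m = {}}" for m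
 have Qm[measurable]: "Q m \<in> sets P" for m unfolding Q_def by (rule void_event) (use U in auto)
 have Qp: "prob (Q m) = exp (- \<kappa>) ^ m" for m
  unfolding Q_def using prob_void[OF U(1,2), of m] by (simp add: U(3) exp_of_nat_mult[symmetric])
 \<comment> \<open>\<open>Q (Suc m)\<close> fails for the first time when the ball with index
   \<open>m\<close> is the first nonempty one; the default 0 concerns the null set on which all
   balls are empty.\<close>
 define k where "k \<omega> = (if \<exists>m. \<omega> \<notin> Q m then (LEAST m. \<omega> \<notin> Q (Suc m)) else 0)" for \<omega>
 have km: "k \<in> P \<rightarrow>\<^sub>M count_space UNIV" unfolding k_def by measurable
 have Q0: "\<omega> \<in> Q 0" if "\<omega> \<in> space P" for \<omega> using that by (simp add: Q_def U_def)
 have "prob (\<Inter>m. Q m) \<le> exp (- \<kappa>) ^ m" for m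
  unfolding Qp[symmetric] by (rule finite_measure_mono) auto
 moreover have "(%m. exp (- \<kappa>) ^ m) ----> 0" using \<kappa> by (intro LIMSEQ_realpow_zero) auto
 ultimately have "prob (\<Inter>m. Q m) \<le> 0" by (intro LIMSEQ_le_const) auto
 hence "(\<Inter>m. Q m) \<in> null_sets P" by (auto simp: emeasure_eq_measure measure_le_0_iff null_sets_def)
 from AE_not_in[OF this] have ex: "AE \<omega> in P. \<exists>m. \<omega> \<notin> Q m" by simp
 have kQ: "k \<omega> = m ==> \<omega> \<in> Q m" if w: "\<omega> \<in> space P" and e: "\<exists>m. \<omega> \<notin> Q m" for \<omega> m
 proof (cases m)
  case (Suc i)
  assume "k \<omega> = m"
  thus ?thesis using e Suc not_less_Least[of i "%m. \<omega> \<notin> Q (Suc m)"] Suc by (simp add: k_def)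
 qed (use Q0[OF w] in simp)
 define u where "u \<omega> = p (k \<omega>)" for \<omega>
 have um: "u \<in> bmeas P" unfolding u_def using km by measurable
 have "AE \<omega> in P. en e < emeasure lborel ({x. en e < potential w x \<omega>} \<inter> ball (u \<omega>) \<rho>)"
  using ex AE_space
 proof eventually_elim
  case (elim \<omega>)
  then obtain m where m: "\<omega> \<notin> Q m" by blast
  hence "m \<noteq> 0" using Q0[OF elim(2)] by (intro notI) simp
  hence "\<omega> \<notin> Q (Suc (m - 1))" using m by simp
  hence "\<omega> \<notin> Q (Suc (LEAST m. \<omega> \<notin> Q (Suc m)))" by (rule LeastI)
  hence "\<omega> \<notin> Q (Suc (k \<omega>))" using elim by (simp add: k_def)
  moreover have "\<omega> \<in> Q (k \<omega>)" using elim by (intro kQ) auto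
  ultimately obtain y where "y \<in> \<omega>" "y \<in> B (k \<omega>)" using elim(2) by (auto simp: Q_def U_def lessThan_Suc)
  thus ?case using elim(2) by (intro re(3)[of \<omega> y]) (auto simp: B_def u_def)
 qed
 moreover have "integrable P (%\<omega>. norm (u \<omega>) ^ DIM('a))"
 proof (rule integrableI_nonneg, goal_cases)
  case 3
  let ?d = "DIM('a)"
  have "(NINT \<omega>|P. en (norm (u \<omega>) ^ ?d)) \<le> (NINT \<omega>|P. (\<Sum>m. en ((2 * real m) ^ ?d) * ind (Q m) \<omega>))"
  proof (rule nn_integral_mono_AE, goal_cases)
   case 1
   show ?case using ex AE_space
   proof eventually_elim
    case (elim \<omega>)
    have "en (norm (u \<omega>) ^ ?d) = (\<Sum>m\<in>{k \<omega>}. en ((2 * real m) ^ ?d) * ind (Q m) \<omega>)"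
     using kQ[OF elim(2,1) refl] by (simp add: u_def p_def b)
    also have "... \<le> (\<Sum>m. en ((2 * real m) ^ ?d) * ind (Q m) \<omega>)" by (intro sum_le_suminf) auto
    finally show ?case .
   qed
  qed
  also have "... = (\<Sum>m. (NINT \<omega>|P. en ((2 * real m) ^ ?d) * ind (Q m) \<omega>))"
   by (rule nn_integral_suminf) measurable
  also have "... = (\<Sum>m. en ((2 * real m) ^ ?d * exp (- \<kappa>) ^ m))"
   by (simp add: nn_integral_cmult_indicator emeasure_eq_measure Qp ennreal_mult'')
  also have "... < \<infinity>"
  proof -
   have "summable (%m. (2 * real m) ^ ?d * exp (- \<kappa>) ^ m)"
   proof (rule summable_comparison_test_ev)
    show "summable (%m. exp (- \<kappa> / 2) ^ m)" using \<kappa> by (intro summable_geometric) auto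
    let ?X = "%m. - \<kappa> / 2 * real m"
    have "(%m. (2 * real m) ^ ?d * exp (?X m)) ----> 0" using \<kappa> by real_asymp
    hence "eventually (%m. (2 * real m) ^ ?d * exp (?X m) < 1) sequentially" by (rule order_tendstoD) simp
    thus "eventually (%m. norm ((2 * real m) ^ ?d * exp (- \<kappa>) ^ m) \<le> exp (- \<kappa> / 2) ^ m) sequentially"
    proof eventually_elim
     case (elim m)
     have "(2 * real m) ^ ?d * exp (- \<kappa>) ^ m = ((2 * real m) ^ ?d * exp (?X m)) * exp (- \<kappa> / 2) ^ m"
      by (simp add: exp_of_nat_mult[symmetric] mult_exp_exp)
     also have "... \<le> 1 * exp (- \<kappa> / 2) ^ m" using elim by (intro mult_right_mono) auto
     finally show ?case by simp
    qed
   qed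
   thus ?thesis by (simp add: suminf_ennreal_eq less_top summable_sums[THEN suminf_ennreal_eq[rotated]])
  qed
  finally show ?case .
 qed (use um in auto)
 ultimately show ?thesis using re(1,2) um by blast
qed

end

section \<open>Quenched crossing costs\<close>

text \<open>A property of a single potential: the estimates for a fixed environment rest on it, and
  randomness enters through \<open>AE_sublinear\<close>.\<close>

definition sublinear :: "('a::real_normed_vector => ennreal) => bool" where
 "sublinear v \<longleftrightarrow> (\<exists>B \<beta>. 0 \<le> B \<and> 0 < \<beta> \<and> \<beta> < 1 \<and> (\<forall>x. v x \<le> en (B * (2 + norm x) powr \<beta>)))"

lemma sublinear_ball:
 assumes v: "!!x. v x \<le> en (B * (2 + norm x) powr \<beta>)" and B: "0 \<le> B" "0 < \<beta>" and z: "z \<in> ball p \<rho>"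
  and t: "norm p + \<rho> \<le> t"
 shows "v z \<le> en (B * (2 + t) powr \<beta>)"
proof -
 have "norm z \<le> norm p + dist p z" using norm_triangle_ineq[of p "z - p"] by (simp add: dist_norm
  norm_minus_commute)
 hence "B * (2 + norm z) powr \<beta> \<le> B * (2 + t) powr \<beta>" using z t B by (intro mult_left_mono powr_mono2) auto
 thus ?thesis by (rule order_trans[OF v ennreal_leI])
qed

context wiener
begin

text \<open>If \<open>ib\<close> vanishes, this is \<open>- ln 0 = 0\<close> in HOL and not
  infinity; so \<open>crossing_cost_triangle\<close> asks for positivity, which
  \<open>ib_pos\<close> supplies.\<close>

definition crossing_cost :: "('a => ennreal) => 'a => 'a => real" where
 "crossing_cost v x y = - ln (enn2real (ib v x y))"

lemma ib_lower:
 obtains \<delta> R where "0 < \<delta>" "0 < R"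
 "!!v s x y. v \<in> bmeas borel ==> 0 \<le> s ==> (!!w. w \<in> ball x R ==> v w \<le> en s) ==> dist x y \<le> K ==>
  en (\<delta> * exp (- s)) \<le> ib v x y"
proof -
 obtain \<delta> R where dR: "0 < \<delta>" "0 < R"
  "!!v s x y z. v \<in> bmeas borel ==> 0 \<le> s ==> (!!w. w \<in> ball x R ==> v w \<le> en s) ==> dist x y \<le> K
   ==> dist x z \<le> 1 ==> en (\<delta> * exp (- s)) \<le> cross v (cball y 1) z"
  using cross_lower[of K] by blast
 show ?thesis by (rule that[OF dR(1,2)]) (auto simp: ib_def intro!: INF_greatest dR(3))
qed

lemma ib_finite: "ib v x y = en (enn2real (ib v x y))"
proof -
 have "ib v x y < \<top>" using ib_le_1[of v x y] by (rule le_less_trans) simp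
 thus ?thesis by simp
qed

lemma ib_exp:
 assumes "0 < ib v x y" shows "ib v x y = en (exp (- crossing_cost v x y))"
proof -
 have "0 < enn2real (ib v x y)" using assms ib_finite[of v x y] by (metis enn2real_nonneg ennreal_0 less_le)
 thus ?thesis using ib_finite[of v x y] by (simp add: crossing_cost_def)
qed

lemma crossing_cost_nonneg: "0 \<le> crossing_cost v x y"
proof (cases "enn2real (ib v x y) = 0")
 case False
 show ?thesis using enn2real_mono[OF ib_le_1[of v x y]] False enn2real_nonneg[of "ib v x y"] by
  (simp add: crossing_cost_def less_le)
qed (simp add: crossing_cost_def)

lemma crossing_cost_refl: "crossing_cost v x x = 0" by (simp add: crossing_cost_def ib_refl)

lemma crossing_cost_le:
 assumes "en (exp (- t)) \<le> ib v x y" shows "crossing_cost v x y \<le> t"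
proof -
 have "0 < ib v x y" using assms by (rule less_le_trans[rotated]) simp
 thus ?thesis using assms by (simp add: ib_exp)
qed

lemma crossing_cost_triangle:
 assumes v: "v \<in> bmeas borel" and pos: "0 < ib v x y" "0 < ib v y z"
 shows "crossing_cost v x z \<le> crossing_cost v x y + crossing_cost v y z"
proof (rule crossing_cost_le, goal_cases)
 case 1
 have "en (exp (- (crossing_cost v x y + crossing_cost v y z))) = ib v x y * ib v y z"
  unfolding ib_exp[OF pos(1)] ib_exp[OF pos(2)] by (simp add: ennreal_mult'[symmetric] exp_add[symmetric])
 also have "... \<le> ib v x z" by (rule ib_mult_le[OF v])
 finally show ?case .
qed

lemma ib_pos:
 assumes v: "v \<in> bmeas borel" and s: "sublinear v"
 shows "0 < ib v x y"
proof -
 obtain B \<beta> where B: "0 \<le> B" "0 < \<beta>" "!!x. v x \<le> en (B * (2 + norm x) powr \<beta>)" using s by (auto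
  simp: sublinear_def)
 obtain \<delta> R where dR: "0 < \<delta>" "0 < R"
  "!!v s x' y'. v \<in> bmeas borel ==> 0 \<le> s ==> (!!w. w \<in> ball x' R ==> v w \<le> en s) ==> dist x' y' \<le>
   dist x y ==> en (\<delta> * exp (- s)) \<le> ib v x' y'"
  using ib_lower[of "dist x y"] by blast
 let ?X = "\<delta> * exp (- (B * (2 + (norm x + R)) powr \<beta>))"
 have "en ?X \<le> ib v x y"
  by (rule dR(3)[OF v]) (use B sublinear_ball[OF B(3,1,2), of _ x R "norm x + R"] in auto)
 moreover have "0 < en ?X" using dR by simp
 ultimately show ?thesis by (rule less_le_trans[rotated])
qed

text \<open>\<open>r *\<^sub>R x\<close> and the preceding integer multiple of \<open>x\<close> are
  at distance at most \<open>norm x\<close>. A crossing between them in either direction costs at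
  most \<open>e r\<close>, which is governed by the local size of \<open>v\<close> and hence of
  smaller order than \<open>r\<close>.\<close>

lemma crossing_cost_limit_real:
 assumes v: "v \<in> bmeas borel" and s: "sublinear v"
 and lim: "(%n. crossing_cost v 0 (real n *\<^sub>R x) / real n) ----> a"
 shows "((%r. crossing_cost v 0 (r *\<^sub>R x) / r) \<longlongrightarrow> a) at_top"
proof -
 obtain B \<beta> where B: "0 \<le> B" "0 < \<beta>" "\<beta> < 1" "!!x. v x \<le> en (B * (2 + norm x) powr \<beta>)" using s by
  (auto simp: sublinear_def)
 obtain \<delta> R where dR: "0 < \<delta>" "0 < R"
  "!!v s x' y'. v \<in> bmeas borel ==> 0 \<le> s ==> (!!w. w \<in> ball x' R ==> v w \<le> en s) ==> dist x' y' \<le>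
   norm x ==> en (\<delta> * exp (- s)) \<le> ib v x' y'"
  using ib_lower[of "norm x"] by blast
 let ?F = "%r. crossing_cost v 0 (r *\<^sub>R x)" and ?n = "%r. nat \<lfloor>r\<rfloor>"
 define e where "e r = B * (2 + (r * norm x + R)) powr \<beta> - ln \<delta>" for r
 have local: "crossing_cost v p y \<le> e r" if "norm p \<le> r * norm x" "dist p y \<le> norm x" "0 \<le> r" for p y r
 proof (rule crossing_cost_le, goal_cases)
  case 1
  let ?Y = "- (B * (2 + (r * norm x + R)) powr \<beta>)"
  have "exp (- e r) = \<delta> * exp ?Y" using dR by (simp add: e_def exp_diff exp_minus field_simps)
  moreover have "en (\<delta> * exp ?Y) \<le> ib v p y"
   by (rule dR(3)[OF v]) (use B that sublinear_ball[OF B(4,1,2), of _ p R "r * norm x + R"] in auto)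
  ultimately show ?case by simp
 qed
 have e0: "((%r. e r / r) \<longlongrightarrow> 0) at_top" unfolding e_def using B(2,3) dR(2) norm_ge_zero[of x]
  by (cases "norm x = 0") (simp, real_asymp, subst (asm) le_less, simp, real_asymp)
 have nr: "((%r. real (?n r) / r) \<longlongrightarrow> 1) at_top"
 proof (rule tendsto_sandwich)
  show "((%r::real. (r - 1) / r) \<longlongrightarrow> 1) at_top" by real_asymp
  show "eventually (%r. (r - 1) / r \<le> real (?n r) / r) at_top"
   using eventually_gt_at_top[of 0] by eventually_elim (intro divide_right_mono, linarith, simp)
  show "eventually (%r. real (?n r) / r \<le> 1) at_top"
   using eventually_gt_at_top[of 0] by eventually_elim (simp add: divide_le_eq)
 qed simp
 have fl: "filterlim ?n at_top at_top"
  by (rule filterlim_compose[OF filterlim_nat_sequentially filterlim_floor_sequentially])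
 have "((%r. ?F (real (?n r)) / real (?n r) * (real (?n r) / r)) \<longlongrightarrow> a * 1) at_top"
  by (intro tendsto_mult nr filterlim_compose[OF lim fl])
 moreover have "eventually (%r. ?F (real (?n r)) / real (?n r) * (real (?n r) / r) = ?F (real (?n
  r)) / r) at_top"
  using eventually_ge_at_top[of 1] by eventually_elim (auto simp: crossing_cost_refl)
 ultimately have Fn: "((%r. ?F (real (?n r)) / r) \<longlongrightarrow> a) at_top"
  by (subst (asm) tendsto_cong) simp_all
 note pos = ib_pos[OF v s]
 have close: "\<bar>?F r - ?F (real (?n r))\<bar> \<le> e r" if r: "1 \<le> r" for r
 proof -
  have n: "real (?n r) \<le> r" "r - real (?n r) \<le> 1" using r by linarith+
  let ?X = "real (?n r) *\<^sub>R x"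
  have d: "dist ?X (r *\<^sub>R x) \<le> norm x"
   using dist_norm scaleR_diff_left n mult_right_mono by fastforce
  have "?F r \<le> ?F (real (?n r)) + crossing_cost v ?X (r *\<^sub>R x)" by (rule crossing_cost_triangle[OF v
   pos pos])
  moreover have "?F (real (?n r)) \<le> ?F r + crossing_cost v (r *\<^sub>R x) ?X" by (rule
   crossing_cost_triangle[OF v pos pos])
  moreover have "crossing_cost v ?X (r *\<^sub>R x) \<le> e r" using n d r by (intro local) (auto simp:
   mult_right_mono)
  moreover have "crossing_cost v (r *\<^sub>R x) ?X \<le> e r" using n d r by (intro local) (auto simp: dist_commute)
  ultimately show ?thesis by linarith
 qed
 have "((%r. (?F r - ?F (real (?n r))) / r) \<longlongrightarrow> 0) at_top"
 proof (rule Lim_null_comparison[OF _ e0], goal_cases)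
  case 1
  show ?case
   using eventually_ge_at_top[of 1] by eventually_elim (use close in \<open>auto simp: divide_right_mono\<close>)
 qed
 from tendsto_add[OF this Fn] show ?thesis by (simp add: add_divide_distrib[symmetric])
qed

text \<open>As an infimum over starting points \<open>ib\<close> bounds the survival probability
  from below. Conversely, Harnack is applied in the ball of radius \<open>r * norm x / 2\<close>
  about 0, which keeps away from the target.\<close>

lemma survival_limit:
 assumes v: "v \<in> bmeas borel" and s: "sublinear v" and x: "x \<noteq> 0" and a: "0 \<le> a"
 and lim: "(%n. crossing_cost v 0 (real n *\<^sub>R x) / real n) ----> a"
 shows "((%r. - ln (enn2real (cross v (cball (r *\<^sub>R x) 1) 0)) / r) \<longlongrightarrow> a) at_top"
 and "0 < cross v (cball y 1) 0"
proof -
 note pos = ib_pos[OF v s]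
 have cr_ib: "ib v 0 y \<le> cross v (cball y 1) 0" for y by (rule ib_le) simp
 show cpos: "0 < cross v (cball y 1) 0" for y using pos cr_ib by (rule less_le_trans)
 let ?Z = "%r x. cball (r *\<^sub>R x) 1"
 define cr where "cr r = enn2real (cross v (?Z r x) 0)" for r
 have cr: "0 < cr r" "cross v (?Z r x) 0 = en (cr r)" for r
 proof -
  have fin: "cross v (?Z r x) 0 < \<top>" using cross_le_1 by (rule le_less_trans) simp
  thus "cross v (?Z r x) 0 = en (cr r)" by (simp add: cr_def)
  thus "0 < cr r" using cpos[of "r *\<^sub>R x"] by (simp add: ennreal_less_zero_iff)
 qed
 let ?F = "%r. crossing_cost v 0 (r *\<^sub>R x)"
 have F: "((%r. ?F r / r) \<longlongrightarrow> a) at_top" by (rule crossing_cost_limit_real[OF v s lim])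
 obtain B \<beta> where B: "0 \<le> B" "0 < \<beta>" "\<beta> < 1" "!!x. v x \<le> en (B * (2 + norm x) powr \<beta>)" using s by
  (auto simp: sublinear_def)
 define d where "d = real DIM('a)"
 have d: "0 < d" by (simp add: d_def)
 \<comment> \<open>Makes the probability of leaving that ball of order
   \<open>exp (- (a + 1) * r)\<close>, negligible against crossings of order
   \<open>exp (- a * r)\<close>.\<close>
 define \<theta> where "\<theta> = 2 * d * (a + 1) / norm x"
 have \<theta>: "0 \<le> \<theta>" using a d by (simp add: \<theta>_def)
 define C where "C = 2 ^ DIM('a) * exp (2 * (1::real)\<^sup>2)"
 let ?U = "\<theta>\<^sup>2 + \<theta> / d"
 define D where "D = (C + 1) * (4 * d * exp ?U)"
 define sr where "sr r = B * (2 + r * norm x / 2) powr \<beta>" for r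
 have C: "0 < C" by (simp add: C_def)
 have D: "0 < D" using C d by (simp add: D_def)
 let ?X = "%r. C * exp (- ?F r) + D * exp (- ((a + 1) * r))"
 have up: "cr r \<le> exp (2 * sr r) * (?X r)" if r: "2 \<le> r * norm x" for r
 proof -
  have "\<theta> * (r * norm x / 2 - 1) / d = (a + 1) * r - \<theta> / d"
   using x d by (simp add: \<theta>_def field_simps)
  hence "\<theta>\<^sup>2 - \<theta> * (r * norm x / 2 - 1) / d = ?U + - ((a + 1) * r)" by linarith
  hence E: "(C + 1) * (4 * real DIM('a) * exp (\<theta>\<^sup>2 - \<theta> * (r * norm x / 2 - 1) / real DIM('a))) = D *
   exp (- ((a + 1) * r))" by (simp only: D_def d_def[symmetric] exp_add mult.assoc)
  have "en (exp (- 2 * sr r)) * cross v (?Z r x) 0 \<le> en C * ib v 0 (r *\<^sub>R x) + en (D * exp (- ((a +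
   1) * r)))"
   unfolding ib_def
  proof (rule le_INF_affine, goal_cases)
   case z': (1 z')
   show ?case unfolding E[symmetric]
   proof (rule harnack[OF _ v _ _ _ _ _ \<theta> C_def, where p=0])
    show "0 \<le> sr r" using B by (simp add: sr_def)
    show "v w \<le> en (sr r)" if "w \<in> ball 0 (r * norm x / 2)" for w
     unfolding sr_def by (rule sublinear_ball[OF B(4,1,2) that]) simp
    show "cball (r *\<^sub>R x) 1 \<inter> ball 0 (r * norm x / 2) = {}"
    proof (rule ccontr)
     assume "\<not> ?thesis"
     then obtain y where y: "dist (r *\<^sub>R x) y \<le> 1" "norm y < r * norm x / 2" by auto
     have "0 < r" using r x by (metis less_le_trans zero_less_norm_iff zero_less_mult_pos2
      zero_less_numeral)
     hence "r * norm x \<le> dist (r *\<^sub>R x) y + norm y" using norm_triangle_ineq[of "r *\<^sub>R x - y" y] by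
      (simp add: dist_norm)
     thus False using y r by linarith
    qed
   qed (use z' in auto)
  qed simp
  hence "en (exp (- 2 * sr r) * cr r) \<le> en (?X r)"
   using C D cr by (simp add: ib_exp[OF pos] ennreal_mult'[symmetric] ennreal_plus[symmetric]
    less_imp_le del: ennreal_plus)
  hence "exp (- 2 * sr r) * cr r \<le> C * exp (- ?F r) + D * exp (- ((a + 1) * r))"
   using C D by (subst (asm) ennreal_le_iff) (auto intro!: add_nonneg_nonneg)
  hence "exp (2 * sr r) * (exp (- 2 * sr r) * cr r) \<le> exp (2 * sr r) * (?X r)"
   by (rule mult_left_mono) simp
  thus ?thesis by (simp add: mult.assoc[symmetric] mult_exp_exp)
 qed
 have sr0: "((%r. (2 * sr r + ln (C + D)) / r) \<longlongrightarrow> 0) at_top" using x unfolding sr_def using B(2,3) by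
  real_asymp
 have "((%r. - ln (cr r) / r) \<longlongrightarrow> a) at_top"
 proof (rule order_tendstoI)
  fix b assume b: "a < b"
  show "eventually (%r. - ln (cr r) / r < b) at_top"
   using order_tendstoD(2)[OF F b] eventually_gt_at_top[of 0]
  proof eventually_elim
   case (elim r)
   have "en (exp (- ?F r)) \<le> en (cr r)" unfolding cr(2)[symmetric] ib_exp[OF pos, symmetric] by (rule cr_ib)
   hence "- ln (cr r) / r \<le> ?F r / r" using cr(1)[of r] ln_mono[of "exp (- ?F r)" "cr r"] elim by
    (intro divide_right_mono) auto
   thus ?case using elim by linarith
  qed
 next
  fix b assume b: "b < a"
  define \<epsilon> where "\<epsilon> = (a - b) / 2"
  have \<epsilon>: "0 < \<epsilon>" using b by (simp add: \<epsilon>_def)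
  have "eventually (%r. a - \<epsilon> < ?F r / r) at_top" using \<epsilon> by (intro order_tendstoD[OF F]) auto
  moreover have "eventually (%r. (2 * sr r + ln (C + D)) / r < \<epsilon>) at_top" using \<epsilon> by (intro
   order_tendstoD[OF sr0]) auto
  moreover have "eventually (%r. 2 \<le> r * norm x) at_top"
   using eventually_ge_at_top[of "2 / norm x"] by eventually_elim (use x in \<open>simp add: divide_le_eq\<close>)
  ultimately show "eventually (%r. b < - ln (cr r) / r) at_top" using eventually_gt_at_top[of 0]
  proof eventually_elim
   case (elim r)
   let ?Y = "- ((a - \<epsilon>) * r)"
   have 1: "exp (- ?F r) \<le> exp ?Y" using elim by (simp add: field_simps)
   have 2: "exp (- ((a + 1) * r)) \<le> exp ?Y" using elim \<epsilon> by simp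
   have "cr r \<le> exp (2 * sr r) * (?X r)" by (rule up) (use elim in simp)
   also have "... \<le> exp (2 * sr r) * (C * exp ?Y + D * exp ?Y)"
    using C D by (intro mult_left_mono add_mono 1 2) auto
   also have "... = exp (2 * sr r + ln (C + D) - (a - \<epsilon>) * r)"
    using C D by (simp add: exp_add exp_diff exp_minus field_simps)
   finally have "ln (cr r) \<le> 2 * sr r + ln (C + D) - (a - \<epsilon>) * r"
    using cr(1)[of r] ln_mono[of "cr r" "exp (2 * sr r + ln (C + D) - (a - \<epsilon>) * r)"] by simp
   moreover have "2 * sr r + ln (C + D) < \<epsilon> * r" using elim by (simp add: divide_less_eq)
   ultimately have "ln (cr r) < (\<epsilon> + \<epsilon> - a) * r" by (simp add: algebra_simps)
   hence "b * r < - ln (cr r)" by (simp add: \<epsilon>_def algebra_simps)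
   hence "b < (- ln (cr r)) / r" using elim by (subst less_divide_eq) simp
   thus ?case by simp
  qed
 qed
 thus "((%r. - ln (enn2real (cross v (?Z r x) 0)) / r) \<longlongrightarrow> a) at_top" by (simp add: cr_def)
qed

text \<open>\<open>crossing_reversal\<close> is applied in the ball of radius
  \<open>n * norm x / 2\<close> about the far end. Its factor \<open>exp (- 5 * sn n)\<close> is
  subexponential by sublinearity and is absorbed by half of \<epsilon>.\<close>

lemma reverse_crossing:
 assumes v: "v \<in> bmeas borel" and s: "sublinear v" and x: "x \<noteq> 0" and a: "0 \<le> a" and \<epsilon>: "0 < \<epsilon>"
 and lim: "(%n. crossing_cost v 0 (real n *\<^sub>R x) / real n) ----> a"
 and nz: "\<not> (AE x in lborel. v x = 0)"
 shows "eventually (%n. crossing_cost v (real n *\<^sub>R x) 0 \<le> (a + \<epsilon>) * real n) sequentially"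
proof -
 note pos = ib_pos[OF v s]
 let ?F = "%n. crossing_cost v 0 (real n *\<^sub>R x)"
 obtain k R D where k: "0 < k" and kRD: "0 < R" "0 < D"
  "!!s y (\<theta> :: real) \<rho>. 0 \<le> s ==> (!!w. w \<in> ball y \<rho> ==> v w \<le> en s) ==> R \<le> \<rho> ==> cball 0 1 \<inter> ball
   y \<rho> = {} ==> 0 \<le> \<theta> ==> en (k * exp (- 5 * s)) * ib v 0 y \<le> ib v y 0 + en (D * exp (\<theta>\<^sup>2 - \<theta> * (\<rho> -
   R) / real DIM('a)))"
  using crossing_reversal[OF v nz] by blast
 obtain B \<beta> where B: "0 \<le> B" "0 < \<beta>" "\<beta> < 1" "!!x. v x \<le> en (B * (2 + norm x) powr \<beta>)" using s by
  (auto simp: sublinear_def)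
 define d where "d = real DIM('a)"
 have d: "0 < d" by (simp add: d_def)
 \<comment> \<open>Chosen so that the exit error decays with rate \<open>a + \<epsilon> + 1\<close>,
   faster than the bound \<open>exp (- (a + \<epsilon>) * n)\<close> to be shown.\<close>
 define \<theta> where "\<theta> = 2 * d * (a + \<epsilon> + 1) / norm x"
 have \<theta>: "0 \<le> \<theta>" using a d \<epsilon> by (simp add: \<theta>_def)
 let ?U = "\<theta>\<^sup>2 + \<theta> * R / d"
 define D' where "D' = D * exp ?U"
 have D': "0 < D'" using kRD by (simp add: D'_def)
 \<comment> \<open>Points within half of \<open>n * norm x\<close> of the far end have norm at most
   \<open>3 / 2\<close> times \<open>n * norm x\<close>.\<close>
 define sn where "sn n = B * (2 + 3 / 2 * (real n * norm x)) powr \<beta>" for n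
 have nx: "0 < norm x" using x by simp
 let ?Y = "%n. (a + \<epsilon> + 1) * real n"
 have low: "k * exp (- 5 * sn n) * exp (- ?F n) \<le> exp (- crossing_cost v (real n *\<^sub>R x) 0) + D' *
  exp (- (?Y n))"
  if n: "2 \<le> real n * norm x" "2 * R \<le> real n * norm x" for n
 proof -
  let ?Z = "real n * norm x / 2 - R"
  have "\<theta> * ?Z / d = (a + \<epsilon> + 1) * real n - \<theta> * R / d" using x d by (simp add: \<theta>_def field_simps)
  hence "\<theta>\<^sup>2 - \<theta> * ?Z / d = ?U + - (?Y n)" by linarith
  hence E: "D * exp (\<theta>\<^sup>2 - \<theta> * ?Z / real DIM('a)) = D' * exp (- (?Y n))" by (simp only: D'_def
   d_def[symmetric] exp_add mult.assoc)
  have "en (k * exp (- 5 * sn n)) * ib v 0 (real n *\<^sub>R x) \<le> ib v (real n *\<^sub>R x) 0 + en (D * exp (\<theta>\<^sup>2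
   - \<theta> * ?Z / real DIM('a)))"
  proof (rule kRD(3)[OF _ _ _ _ \<theta>])
   show "0 \<le> sn n" using B by (simp add: sn_def)
   show "v w \<le> en (sn n)" if "w \<in> ball (real n *\<^sub>R x) (real n * norm x / 2)" for w
    unfolding sn_def by (rule sublinear_ball[OF B(4,1,2) that]) simp
   show "R \<le> real n * norm x / 2" using n by simp
   show "cball 0 1 \<inter> ball (real n *\<^sub>R x) (real n * norm x / 2) = {}"
   proof (rule ccontr)
    assume "\<not> ?thesis"
    then obtain y where y: "norm y \<le> 1" "dist (real n *\<^sub>R x) y < real n * norm x / 2" by auto
    have "real n * norm x \<le> dist (real n *\<^sub>R x) y + norm y" using norm_triangle_ineq[of "real n *\<^sub>R
     x - y" y] by (simp add: dist_norm)
    thus False using y n by linarith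
   qed
  qed
  hence "en (k * exp (- 5 * sn n) * exp (- ?F n)) \<le> en (exp (- crossing_cost v (real n *\<^sub>R x) 0) +
   D' * exp (- (?Y n)))"
   unfolding E using D' k by (simp add: ib_exp[OF pos] ennreal_mult'[symmetric]
    ennreal_plus[symmetric] less_imp_le del: ennreal_plus)
  thus ?thesis using D' by (subst (asm) ennreal_le_iff) (auto intro!: add_nonneg_nonneg)
 qed
 have "eventually (%n. ?F n / real n < a + \<epsilon> / 2) sequentially" using \<epsilon> by (intro order_tendstoD[OF
  lim]) auto
 moreover have "eventually (%n. 1 + D' \<le> k * exp (\<epsilon> / 2 * real n - 5 * sn n)) sequentially"
 proof -
  have "filterlim (%n. k * exp (\<epsilon> / 2 * real n - 5 * sn n)) at_top sequentially"
   unfolding sn_def using k \<epsilon> B(2,3) nx by real_asymp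
  thus ?thesis by (simp add: filterlim_at_top)
 qed
 moreover have "eventually (%n. 2 \<le> real n * norm x) sequentially" "eventually (%n. 2 * R \<le> real n *
  norm x) sequentially"
  using nx by real_asymp+
 ultimately show ?thesis using eventually_gt_at_top[of 0]
 proof eventually_elim
  case (elim n)
  let ?V = "- ((a + \<epsilon> / 2) * real n)"
  have F: "exp ?V \<le> exp (- ?F n)" using elim by (simp add: divide_less_eq algebra_simps)
  let ?X = "- ((a + \<epsilon>) * real n)"
  have "(1 + D') * exp ?X \<le> k * exp (\<epsilon> / 2 * real n - 5 * sn n) * exp ?X"
   using elim by (intro mult_right_mono) auto
  also have "... = k * exp (- 5 * sn n) * exp ?V"
   by (simp add: mult.assoc mult_exp_exp algebra_simps add_divide_distrib)
  also have "... \<le> k * exp (- 5 * sn n) * exp (- ?F n)" using k by (intro mult_left_mono F) auto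
  also have "... \<le> exp (- crossing_cost v (real n *\<^sub>R x) 0) + D' * exp (- (?Y n))" using elim by
   (intro low) auto
  also have "... \<le> exp (- crossing_cost v (real n *\<^sub>R x) 0) + D' * exp ?X"
   using D' by (intro add_left_mono mult_left_mono) (auto intro: mult_right_mono)
  finally show ?case by (simp add: algebra_simps)
 qed
qed

end

section \<open>The Lyapunov exponent\<close>

lemma preserves_completion:
 assumes T: "preserves M T" shows "preserves (completion M) T"
proof -
 have m: "T \<in> M \<rightarrow>\<^sub>M M" and d: "distr M M T = M" using T by (auto simp: preserves_def)
 have d': "distr (completion M) M T = M" using distr_completion[OF m] d by simp
 have "T \<in> completion M \<rightarrow>\<^sub>M completion M"
  by (rule completion.measurable_completion2[OF measurable_completion[OF m]]) (simp add: d')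
 moreover have "completion (distr (completion M) M T) = distr (completion M) (completion M) T"
  by (rule completion.completion_distr_eq[OF measurable_completion[OF m]]) (simp add: d')
 ultimately show ?thesis by (simp add: preserves_def d')
qed

lemma (in prob_space) prob_Int3_ge:
 assumes "A \<in> events" "B \<in> events" "C \<in> events"
 shows "prob A + prob B + prob C - 2 \<le> prob (A \<inter> B \<inter> C)"
proof -
 have *: "prob X + prob Y - 1 \<le> prob (X \<inter> Y)" if "X \<in> events" "Y \<in> events" for X Y
 proof -
  have "prob (X \<union> Y) + prob (X \<inter> Y) = prob X + prob Y"
   using that measure_Un3[of X M Y] by (simp add: fmeasurable_eq_sets)
  thus ?thesis using prob_le_1[of "X \<union> Y"] by linarith
 qed
 show ?thesis using *[of A B] *[of "A \<inter> B" C] assms by fastforce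
qed

context wiener
begin

lemma cross_translate: "cross (%x. v (x + u)) (cball b 1) z = cross v (cball (b + u) 1) (z + u)"
proof -
 have "wgt (%x. v (x + u)) (cball b 1) (start z f) = wgt v (cball (b + u) 1) (start (z + u) f)" for f
  by (simp add: start_def dist_norm algebra_simps hit_def wgt_def cost_def)
 thus ?thesis by (simp add: cross_def)
qed

lemma crossing_cost_translate: "crossing_cost (%x. v (x + u)) a b = crossing_cost v (a + u) (b + u)"
proof -
 have "(%z. z + u) ` cball a 1 = cball (a + u) 1"
  using cball_translation[of u a 1] by (simp add: add.commute image_def)
 hence "ib (%x. v (x + u)) a b = ib v (a + u) (b + u)"
  unfolding ib_def cross_translate by (simp add: image_image flip: \<open>(%z. z + u) ` cball a 1 = cball
   (a + u) 1\<close>)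
 thus ?thesis by (simp add: crossing_cost_def)
qed

end

locale random_crossing = poisson_potential P w \<gamma> c + B: wiener W
 for P :: "'a::euclidean_space set measure" and w :: "'a => real" and \<gamma> c :: real and W :: "(real =>
  'a) measure"
begin

abbreviation V :: "'a set => 'a => ennreal" where "V \<omega> \<equiv> (%x. potential w x \<omega>)"

lemma V_borel: "\<omega> \<in> space P ==> V \<omega> \<in> bmeas borel" by (rule potential_measurable'[OF w_borel])

lemma V_shift: "V (shift u \<omega>) = (%x. V \<omega> (x + u))" by (simp add: potential_shift)

lemma crossing_cost_shift: "B.crossing_cost (V (shift u \<omega>)) a b = B.crossing_cost (V \<omega>) (a + u) (b + u)"
 unfolding V_shift by (rule B.crossing_cost_translate)

lemma AE_sublinear: "AE \<omega> in P. sublinear (V \<omega>)" using sublinear_growth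
proof eventually_elim
 case (elim \<omega>)
 then obtain B where B: "0 \<le> B" "!!x. V \<omega> x \<le> en (B * (2 + norm x) powr (real (DIM('a) + 1) / real
  (DIM('a) + 2)))" by blast
 show ?case unfolding sublinear_def
  by (rule exI[of _ B], rule exI[of _ "real (DIM('a) + 1) / real (DIM('a) + 2)"]) (use B in auto)
qed

lemma crossing_cost_measurable: "(%\<omega>. B.crossing_cost (V \<omega>) x y) \<in> bmeas (completion P)"
proof -
 let ?X = "P \<Otimes>\<^sub>M borel"
 have "(%p. B.cross (V (fst p)) (cball y 1) (snd p)) \<in> bmeas ?X"
 proof (rule B.cross_measurable, goal_cases)
  case 2
  have "(%q. (fst (fst q), snd q)) \<in> ?X \<Otimes>\<^sub>M borel \<rightarrow>\<^sub>M P \<Otimes>\<^sub>M borel" by measurable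
  from measurable_compose[OF this potential_measurable[OF w_borel]]
  show ?case by (simp add: case_prod_unfold)
 qed auto
 hence "(%(\<omega>, z). B.cross (V \<omega>) (cball y 1) z) \<in> bmeas ?X" by (simp add: case_prod_unfold)
 from borel_measurable_INF_completion[OF finite_measure_axioms _ this, of "cball x 1"]
 have "(%\<omega>. B.ib (V \<omega>) x y) \<in> bmeas (completion P)" unfolding B.ib_def by simp
 thus ?thesis unfolding B.crossing_cost_def by measurable
qed

lemma crossing_cost_event: "{\<omega> \<in> space P. B.crossing_cost (V \<omega>) x y < b} \<in> sets (completion P)"
 "{\<omega> \<in> space P. B.crossing_cost (V \<omega>) x y \<le> b} \<in> sets (completion P)"
proof -
 note m = crossing_cost_measurable[of x y]
 show "{\<omega> \<in> space P. B.crossing_cost (V \<omega>) x y < b} \<in> sets (completion P)" using m[unfolded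
  borel_measurable_iff_less] by simp
 show "{\<omega> \<in> space P. B.crossing_cost (V \<omega>) x y \<le> b} \<in> sets (completion P)" using m[unfolded
  borel_measurable_iff_le] by simp
qed

text \<open>By \<open>ib_lower\<close> near the origin the cost is at most an affine function of
  \<open>S\<close>, which has all moments. \<open>kingman\<close> requires this for its first
  term.\<close>

lemma crossing_cost_square_integrable: "integrable (completion P) (%\<omega>. (B.crossing_cost (V \<omega>) 0 x)\<^sup>2)"
proof -
 obtain \<delta> R where dR: "0 < \<delta>" "0 < R"
  "!!v s x' y'. v \<in> bmeas borel ==> 0 \<le> s ==> (!!w. w \<in> ball x' R ==> v w \<le> en s) ==> dist x' y' \<le>
   norm x ==> en (\<delta> * exp (- s)) \<le> B.ib v x' y'"
  using B.ib_lower[of "norm x"] by blast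
 define a where "a = c * (2 + R) powr \<gamma>"
 have a: "0 \<le> a" using c by (simp add: a_def)
 let ?X = "%\<omega>. (a * enn2real (S \<omega>) + \<bar>ln \<delta>\<bar>)\<^sup>2"
 have "integrable P ?X"
  using S_moment[of 1] S_moment[of 2] by (simp add: power2_sum power_mult_distrib)
 hence i: "integrable (completion P) ?X" by (subst integrable_completion) auto
 show ?thesis
 proof (rule Bochner_Integration.integrable_bound[OF i], goal_cases)
  case 2
  show ?case unfolding AE_completion_iff using S_exp(1) AE_space
  proof eventually_elim
   case (elim \<omega>)
   let ?s = "a * enn2real (S \<omega>)"
   have "en (\<delta> * exp (- ?s)) \<le> B.ib (V \<omega>) 0 x"
   proof (rule dR(3)[OF V_borel[OF elim(2)]], goal_cases)
    case z: (2 z)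
    have "V \<omega> z \<le> en (c * (2 + norm z) powr \<gamma>) * S \<omega>" by (rule potential_le)
    also have "... \<le> en a * S \<omega>"
     unfolding a_def using z c \<gamma>_nonneg by (intro mult_right_mono ennreal_leI mult_left_mono
      powr_mono2) auto
    also have "... = en ?s" using elim a by (simp add: ennreal_mult')
    finally show ?case .
   qed (use a in auto)
   moreover have "exp (- (?s - ln \<delta>)) = \<delta> * exp (- ?s)" using dR by (simp add: exp_diff exp_minus
    field_simps)
   ultimately have "en (exp (- (?s - ln \<delta>))) \<le> B.ib (V \<omega>) 0 x" by simp
   hence "B.crossing_cost (V \<omega>) 0 x \<le> ?s - ln \<delta>" by (rule B.crossing_cost_le)
   also have "... \<le> ?s + \<bar>ln \<delta>\<bar>" by linarith
   finally show ?case using B.crossing_cost_nonneg[of "V \<omega>" 0 x] by (simp add: power_mono)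
  qed
 qed (use crossing_cost_measurable in measurable)
qed

lemma prob_space_completion: "prob_space (completion P)"
 by (intro prob_spaceI) (simp add: emeasure_space_1)

text \<open>An event of the completion agrees almost surely with its main part, to which
  \<open>shift_ergodic\<close> applies.\<close>

lemma completion_ergodic:
 assumes u: "u \<noteq> 0" and A: "A \<in> sets (completion P)" and inv: "AE \<omega> in completion P. \<omega> \<in> A \<longleftrightarrow> shift u \<omega> \<in> A"
 shows "measure (completion P) A = 0 \<or> measure (completion P) A = 1"
proof -
 let ?A = "main_part P A"
 have Am: "?A \<in> sets P" by (rule main_part_sets[OF A])
 have eq: "AE \<omega> in P. \<omega> \<in> A \<longleftrightarrow> \<omega> \<in> ?A"
  using AE_notin_null_part[OF A] by eventually_elim (use main_part_null_part_Un[OF A] in blast)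
 have "AE \<omega> in P. \<omega> \<in> ?A \<longleftrightarrow> shift u \<omega> \<in> ?A"
  using eq preserves_AE[OF preserves_shift eq, of u] inv unfolding AE_completion_iff by eventually_elim auto
 hence "prob ?A = 0 \<or> prob ?A = 1" by (rule shift_ergodic[OF u Am])
 thus ?thesis using emeasure_completion[OF A] by (simp add: measure_def)
qed

lemma crossing_cost_sub:
 "AE \<omega> in P. \<forall>x y z. B.crossing_cost (V \<omega>) x z \<le> B.crossing_cost (V \<omega>) x y + B.crossing_cost (V \<omega>) y z"
 using AE_sublinear AE_space
 by eventually_elim (auto intro!: B.crossing_cost_triangle B.ib_pos V_borel)

text \<open>\<open>kingman\<close> is applied over the completion, where the infimum in
  \<open>ib\<close> is measurable. For \<open>x = 0\<close> the shift is the identity and not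
  ergodic, but all costs are 0.\<close>

lemma ex_norm: "\<exists>a\<ge>0. AE \<omega> in P. (%n. B.crossing_cost (V \<omega>) 0 (real n *\<^sub>R x) / real n) ----> a"
proof (cases "x = 0")
 case True
 thus ?thesis by (intro exI[of _ 0]) (simp add: B.crossing_cost_refl)
next
 case False
 obtain a where "0 \<le> a" "AE \<omega> in completion P. (%n. B.crossing_cost (V \<omega>) 0 (real n *\<^sub>R x) / real n)
  ----> a"
 proof (rule kingman[OF prob_space_completion preserves_completion[OF preserves_shift[of x]],
  where X="%n \<omega>. B.crossing_cost (V \<omega>) 0 (real n *\<^sub>R x)"])
  show "measure (completion P) A = 0 \<or> measure (completion P) A = 1"
   if "A \<in> sets (completion P)" "AE \<omega> in completion P. \<omega> \<in> A \<longleftrightarrow> shift x \<omega> \<in> A" for A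
   by (rule completion_ergodic[OF False that])
  show "AE \<omega> in completion P. B.crossing_cost (V \<omega>) 0 (real (m + n) *\<^sub>R x) \<le> B.crossing_cost (V \<omega>) 0
   (real m *\<^sub>R x) + B.crossing_cost (V ((shift x ^^ m) \<omega>)) 0 (real n *\<^sub>R x)" for m n
   unfolding AE_completion_iff using crossing_cost_sub
   by (auto simp: shift_funpow crossing_cost_shift algebra_simps)
 qed (use crossing_cost_measurable crossing_cost_square_integrable B.crossing_cost_nonneg
  B.crossing_cost_refl in auto)
 thus ?thesis unfolding AE_completion_iff by blast
qed

definition N :: "'a => real" where
 "N x = (SOME a. 0 \<le> a \<and> (AE \<omega> in P. (%n. B.crossing_cost (V \<omega>) 0 (real n *\<^sub>R x) / real n) ----> a))"

lemma N: "0 \<le> N x" "AE \<omega> in P. (%n. B.crossing_cost (V \<omega>) 0 (real n *\<^sub>R x) / real n) ----> N x"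
 using someI_ex[OF ex_norm[of x, unfolded Bex_def]] unfolding N_def by (auto simp: conj_commute)

lemma N_eqI:
 assumes "AE \<omega> in P. (%n. B.crossing_cost (V \<omega>) 0 (real n *\<^sub>R x) / real n) ----> a"
 shows "N x = a"
proof -
 have "AE \<omega> in P. N x = a" using N(2)[of x] assms by eventually_elim (rule LIMSEQ_unique)
 thus ?thesis by simp
qed

lemma N_0: "N 0 = 0" by (rule N_eqI) (simp add: B.crossing_cost_refl)

lemma N_scale_pos:
 assumes t: "0 < t" shows "N (t *\<^sub>R x) = t * N x"
proof (rule N_eqI, goal_cases)
 case 1
 show ?case using N(2)[of x] AE_sublinear AE_space
 proof eventually_elim
  case (elim \<omega>)
  have "((%r. B.crossing_cost (V \<omega>) 0 (r *\<^sub>R x) / r) \<longlongrightarrow> N x) at_top"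
   by (rule B.crossing_cost_limit_real[OF V_borel[OF elim(3)] elim(2,1)])
  moreover have "filterlim (%n. real n * t) at_top sequentially" using t by real_asymp
  ultimately have "(%n. B.crossing_cost (V \<omega>) 0 ((real n * t) *\<^sub>R x) / (real n * t)) ----> N x" by
   (rule filterlim_compose)
  hence "(%n. t * (B.crossing_cost (V \<omega>) 0 ((real n * t) *\<^sub>R x) / (real n * t))) ----> t * N x" by
   (rule tendsto_mult_left)
  thus ?case using t by (simp add: field_simps)
 qed
qed

lemma prob_stationary:
 assumes "A \<in> sets (completion P)"
 shows "measure (completion P) {\<omega> \<in> space P. shift u \<omega> \<in> A} = measure (completion P) A"
 and "{\<omega> \<in> space P. shift u \<omega> \<in> A} \<in> sets (completion P)"
proof -
 have p: "preserves (completion P) (shift u)" by (rule preserves_completion[OF preserves_shift])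
 let ?X = "{\<omega> \<in> space P. shift u \<omega> \<in> A}"
 have e: "?X = shift u -` A \<inter> space (completion P)" by auto
 show "measure (completion P) ?X = measure (completion P) A"
  unfolding e measure_def preserves_emeasure[OF p assms] ..
 show "?X \<in> sets (completion P)"
  unfolding e by (rule measurable_sets[OF preserves_measurable[OF p] assms])
qed

lemma shift_space: "\<omega> \<in> space P ==> shift u \<omega> \<in> space P" by (simp add: space_P shift_config)

text \<open>The crossing from \<open>n x\<close> to \<open>n (x + y)\<close> is a crossing from 0 to
  \<open>n y\<close> in the configuration shifted by \<open>n x\<close>, which has the same law.
  Three events of probability above \<open>2 / 3\<close> must meet, and on their intersection the
  triangle inequality of the costs would fail.\<close>

lemma N_triangle: "N (x + y) \<le> N x + N y"
proof (rule ccontr)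
 assume neg: "\<not> N (x + y) \<le> N x + N y"
 define e where "e = (N (x + y) - (N x + N y)) / 3"
 have e: "0 < e" "N x + N y + 3 * e = N (x + y)" using neg by (auto simp: e_def field_simps)
 interpret C: prob_space "completion P" by (rule prob_space_completion)
 let ?cc = "%n \<omega> x. B.crossing_cost (V \<omega>) 0 (real n *\<^sub>R x)"
 define Q where "Q z n = {\<omega> \<in> space P. ?cc n \<omega> z < (N z + e) * real n}" for z n
 define Q' where "Q' n = space P - {\<omega> \<in> space P. ?cc n \<omega> (x + y) \<le> (N (x + y) - e) * real n}" for n
 have Qm: "Q z n \<in> C.events" for z n unfolding Q_def by (rule crossing_cost_event)
 have Q'm: "Q' n \<in> C.events" for n
  unfolding Q'_def using sets.compl_sets[OF crossing_cost_event(2)] by simp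
 have "(%n. C.prob (Q z n)) ----> 1" for z
 proof (rule C.prob_eventually_tendsto_1[OF Qm], unfold AE_completion_iff, goal_cases)
  case 1
  show ?case using N(2)[of z] AE_space
  proof eventually_elim
   case (elim \<omega>)
   have "eventually (%n. ?cc n \<omega> z / real n < N z + e) sequentially" using e by (intro
    order_tendstoD[OF elim(1)]) auto
   thus ?case using eventually_gt_at_top[of 0] by eventually_elim (use elim in \<open>auto simp: Q_def
    divide_less_eq\<close>)
  qed
 qed
 hence "eventually (%n. 2 / 3 < C.prob (Q z n)) sequentially" for z by (rule order_tendstoD) simp
 moreover have "(%n. C.prob (Q' n)) ----> 1"
 proof (rule C.prob_eventually_tendsto_1[OF Q'm], unfold AE_completion_iff, goal_cases)
  case 1
  show ?case using N(2)[of "x + y"] AE_space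
  proof eventually_elim
   case (elim \<omega>)
   have "eventually (%n. N (x + y) - e < ?cc n \<omega> (x + y) / real n) sequentially" using e by (intro
    order_tendstoD[OF elim(1)]) auto
   thus ?case using eventually_gt_at_top[of 0] by eventually_elim (use elim in \<open>auto simp: Q'_def
    less_divide_eq\<close>)
  qed
 qed
 hence "eventually (%n. 2 / 3 < C.prob (Q' n)) sequentially" by (rule order_tendstoD) simp
 ultimately have "eventually (%n. 2 / 3 < C.prob (Q x n) \<and> 2 / 3 < C.prob (Q y n) \<and> 2 / 3 < C.prob
  (Q' n) \<and> 0 < n) sequentially"
  using eventually_gt_at_top[of 0] by (intro eventually_conj)
 then obtain n where n: "2 / 3 < C.prob (Q x n)" "2 / 3 < C.prob (Q y n)" "2 / 3 < C.prob (Q' n)" "0 < n"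
  using eventually_happens'[OF sequentially_bot] by fast
 let ?Qy = "{\<omega> \<in> space P. shift (real n *\<^sub>R x) \<omega> \<in> Q y n}"
 have Qy: "?Qy \<in> C.events" "C.prob ?Qy = C.prob (Q y n)" using prob_stationary[OF Qm] by auto
 have "0 < C.prob (Q x n) + C.prob ?Qy + C.prob (Q' n) - 2" using n Qy by linarith
 also have "... \<le> C.prob (Q x n \<inter> ?Qy \<inter> Q' n)" by (rule C.prob_Int3_ge[OF Qm Qy(1) Q'm])
 also have "... = 0"
 proof -
  have "AE \<omega> in completion P. \<omega> \<notin> Q x n \<inter> ?Qy \<inter> Q' n"
   unfolding AE_completion_iff using crossing_cost_sub
  proof eventually_elim
   case (elim \<omega>)
   show ?case
   proof
    assume w: "\<omega> \<in> Q x n \<inter> ?Qy \<inter> Q' n"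
    let ?X = "shift (real n *\<^sub>R x) \<omega>"
    have "B.crossing_cost (V ?X) 0 (real n *\<^sub>R y) = B.crossing_cost (V \<omega>) (real n *\<^sub>R x) (real n *\<^sub>R
     (x + y))"
     unfolding crossing_cost_shift by (simp add: algebra_simps)
    hence "?cc n \<omega> (x + y) \<le> ?cc n \<omega> x + ?cc n ?X y" using elim by metis
    also have "... < (N x + e) * real n + (N y + e) * real n" using w by (intro add_strict_mono)
     (auto simp: Q_def)
    also have "... = (N (x + y) - e) * real n" using e(2)[symmetric] by (simp add: algebra_simps)
    finally show False using w by (auto simp: Q'_def)
   qed
  qed
  thus ?thesis using Qm Qy Q'm by (subst C.prob_eq_0) auto
 qed
 finally show False by simp
qed

text \<open>Seen from \<open>n x\<close>, the crossing from \<open>n x\<close> to 0 is one from 0 to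
  \<open>- n x\<close> in a shifted configuration of the same law. If \<open>N (- x)\<close>
  exceeded \<open>N x\<close>, the probabilities of \<open>Q n\<close> and of its complement would
  both tend to 1.\<close>

lemma N_minus_le: "N (- x) \<le> N x"
proof (cases "x = 0")
 case False
 show ?thesis
 proof (rule ccontr)
  assume neg: "\<not> N (- x) \<le> N x"
  define e where "e = (N (- x) - N x) / 2"
  have e: "0 < e" "N x + e < N (- x)" using neg by (auto simp: e_def field_simps)
  interpret C: prob_space "completion P" by (rule prob_space_completion)
  define Q where "Q n = {\<omega> \<in> space P. B.crossing_cost (V \<omega>) 0 (real n *\<^sub>R (- x)) \<le> (N x + e) * real
   n}" for n
  define Q' where "Q' n = {\<omega> \<in> space P. shift (real n *\<^sub>R x) \<omega> \<in> Q n}" for n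
  have Qm: "Q n \<in> C.events" for n unfolding Q_def by (rule crossing_cost_event)
  have Q'm: "Q' n \<in> C.events" "C.prob (Q' n) = C.prob (Q n)" for n unfolding Q'_def using
   prob_stationary[OF Qm] by auto
  have "(%n. C.prob (Q' n)) ----> 1"
  proof (rule C.prob_eventually_tendsto_1[OF Q'm(1)], unfold AE_completion_iff, goal_cases)
   case 1
   obtain \<rho> b and u :: "'a set => 'a" where bump: "0 < \<rho>" "0 < b"
    "AE \<omega> in P. en b < emeasure lborel ({x. en b < V \<omega> x} \<inter> ball (u \<omega>) \<rho>)"
    using nearby_bump by blast
   show ?case using N(2)[of x] AE_sublinear AE_space bump(3)
   proof eventually_elim
    case (elim \<omega>)
    have "\<not> (AE x in lborel. V \<omega> x = 0)"
    proof
     assume "AE x in lborel. V \<omega> x = 0"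
     hence "emeasure lborel {x \<in> space lborel. en b < V \<omega> x \<and> x \<in> ball (u \<omega>) \<rho>} = 0"
      by (intro emeasure_eq_0_AE) (auto elim!: eventually_mono)
     thus False using elim(4) by (simp add: Int_def)
    qed
    from B.reverse_crossing[OF V_borel[OF elim(3)] elim(2) False N(1) e(1) elim(1) this]
    show ?case by (simp add: elim crossing_cost_shift shift_space Q'_def Q_def)
   qed
  qed
  moreover have "(%n. C.prob (space P - Q n)) ----> 1"
  proof (rule C.prob_eventually_tendsto_1, unfold AE_completion_iff)
   show "space P - Q n \<in> C.events" for n using sets.compl_sets[OF Qm[of n]] by simp
   show "AE \<omega> in P. eventually (%n. \<omega> \<in> space P - Q n) sequentially" using N(2)[of "- x"] AE_space
   proof eventually_elim
    case (elim \<omega>)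
    show ?case using order_tendstoD(1)[OF elim(1) e(2)] eventually_gt_at_top[of 0]
     by eventually_elim (use elim in \<open>auto simp: Q_def less_divide_eq\<close>)
   qed
  qed
  moreover have "C.prob (space P - Q n) = 1 - C.prob (Q' n)" for n using C.prob_compl[OF Qm[of n]]
   Q'm by simp
  ultimately have "(%n. C.prob (Q' n) + (1 - C.prob (Q' n))) ----> 1 + 1" by (intro tendsto_add) simp_all
  thus False by (simp add: LIMSEQ_const_iff)
 qed
qed (simp add: N_0)

lemma N_scale: "N (t *\<^sub>R x) = \<bar>t\<bar> * N x"
proof -
 have "N (- x) = N x" using N_minus_le[of x] N_minus_le[of "- x"] by simp
 moreover have "N (t *\<^sub>R x) = N (\<bar>t\<bar> *\<^sub>R (- x))" if "t < 0" using that by simp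
 ultimately show ?thesis using N_scale_pos[of "\<bar>t\<bar>" "- x"] N_scale_pos[of t x] by (cases "t = 0")
  (auto simp: N_0 abs_if)
qed

text \<open>If \<open>N x\<close> were 0, the probability of a cost of at most
  \<open>\<kappa> * n\<close> would tend to 1; by Markov's inequality and the annealed bound it is
  at most \<open>(q' / s) ^ n\<close>.\<close>

lemma N_pos:
 assumes x: "x \<noteq> 0" shows "0 < N x"
proof (rule ccontr)
 assume "\<not> 0 < N x"
 hence Nx: "N x = 0" using N(1)[of x] by simp
 define e where "e = x /\<^sub>R norm x"
 have e: "norm e = 1" using x by (simp add: e_def)
 have pp: "poisson_process P" by (rule poisson)
 obtain L q where Lq: "0 < L" "q < 1"
  "!!n S. closed S ==> S \<subseteq> {x. real n * L \<le> x \<bullet> e} ==> (NINT \<omega>|P. B.cross (V \<omega>) S 0) \<le> q ^ n"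
  using B.annealed_bound[OF pp w_borel w_nonneg w_le_c w_nonnull e] by blast
 \<comment> \<open>One unit more than \<open>L\<close> per step keeps the target ball of radius 1
   beyond height \<open>n * L\<close> as soon as \<open>n \<ge> 1\<close>.\<close>
 define y where "y = (L + 1) *\<^sub>R e"
 have Ny: "N y = 0" using N_scale[of "(L + 1) / norm x" x] Nx by (simp add: y_def e_def divide_inverse)
 obtain q' where q': "0 \<le> q'" "q' < 1" "q = en q'" using Lq(2) by (cases q) (auto simp:
  ennreal_less_iff simp flip: ennreal_1)
 \<comment> \<open>Any number strictly between \<open>q'\<close> and 1; the cost level \<kappa> is
   \<open>- ln s\<close>, so that crossings in \<open>Q n\<close> have weight at least
   \<open>s ^ n\<close>.\<close>
 define s where "s = (q' + 1) / 2"
 have s: "0 < s" "s < 1" "q' < s" using q' by (auto simp: s_def)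
 define \<kappa> where "\<kappa> = - ln s"
 have \<kappa>: "0 < \<kappa>" "exp (- \<kappa>) = s" using s by (auto simp: \<kappa>_def)
 interpret C: prob_space "completion P" by (rule prob_space_completion)
 define Q where "Q n = {\<omega> \<in> space P. B.crossing_cost (V \<omega>) 0 (real n *\<^sub>R y) \<le> \<kappa> * real n}" for n
 have Qm: "Q n \<in> C.events" for n unfolding Q_def by (rule crossing_cost_event)
 have "(%n. C.prob (Q n)) ----> 1"
 proof (rule C.prob_eventually_tendsto_1[OF Qm], unfold AE_completion_iff, goal_cases)
  case 1
  show ?case using N(2)[of y] AE_space
  proof eventually_elim
   case (elim \<omega>)
   have "eventually (%n. B.crossing_cost (V \<omega>) 0 (real n *\<^sub>R y) / real n < \<kappa>) sequentially"
    using \<kappa> Ny by (intro order_tendstoD[OF elim(1)]) auto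
   thus ?case using eventually_gt_at_top[of 0]
    by eventually_elim (use elim in \<open>auto simp: Q_def divide_less_eq\<close>)
  qed
 qed
 moreover have "(%n. C.prob (Q n)) ----> 0"
 proof (rule tendsto_sandwich[where f="%_. 0" and h="%n. (q' / s) ^ n"])
  show "(%n. (q' / s) ^ n) ----> 0" using q' s by (intro LIMSEQ_realpow_zero) auto
  show "eventually (%n. C.prob (Q n) \<le> (q' / s) ^ n) sequentially" using eventually_gt_at_top[of 0]
  proof eventually_elim
   case (elim n)
   let ?S = "cball (real n *\<^sub>R y) 1"
   have sub: "?S \<subseteq> {x. real n * L \<le> x \<bullet> e}"
   proof
    fix z assume z: "z \<in> ?S"
    have "\<bar>(real n *\<^sub>R y - z) \<bullet> e\<bar> \<le> norm (real n *\<^sub>R y - z) * norm e" by (rule Cauchy_Schwarz_ineq2)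
    also have "... \<le> 1" using z e by (simp add: dist_norm)
    finally have "real n * (L + 1) - z \<bullet> e \<le> 1"
     using e by (simp add: inner_diff_left y_def norm_eq_1 abs_le_iff)
    moreover have "1 \<le> real n" using elim by simp
    ultimately show "z \<in> {x. real n * L \<le> x \<bullet> e}" by (simp add: algebra_simps)
   qed
   have "en (s ^ n) * emeasure (completion P) (Q n) = (NINT \<omega>|completion P. en (s ^ n) * ind (Q n) \<omega>)"
    by (rule nn_integral_cmult_indicator[OF Qm, symmetric])
   also have "... \<le> (NINT \<omega>|completion P. B.cross (V \<omega>) ?S 0)"
   proof (rule nn_integral_mono_AE, unfold AE_completion_iff, goal_cases)
    case 1
    show ?case using AE_sublinear AE_space
    proof eventually_elim
     case (elim \<omega>)
     show ?case
     proof (cases "\<omega> \<in> Q n")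
      case True
      have "s ^ n = exp (- (\<kappa> * real n))" by (simp add: \<kappa>(2)[symmetric] exp_of_nat_mult[symmetric]
       mult.commute)
      also have "... \<le> exp (- B.crossing_cost (V \<omega>) 0 (real n *\<^sub>R y))" using True by (simp add: Q_def)
      finally have "en (s ^ n) \<le> B.ib (V \<omega>) 0 (real n *\<^sub>R y)"
       unfolding B.ib_exp[OF B.ib_pos[OF V_borel[OF elim(2)] elim(1)]] by (rule ennreal_leI)
      also have "... \<le> B.cross (V \<omega>) ?S 0" by (rule B.ib_le) simp
      finally show ?thesis using True by simp
     qed simp
    qed
   qed
   also have "... = (NINT \<omega>|P. B.cross (V \<omega>) ?S 0)" by (rule nn_integral_completion)
   also have "... \<le> q ^ n" by (rule Lq(3)[OF closed_cball sub])
   also have "... = en (q' ^ n)" using q' by (simp add: ennreal_power)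
   finally have "en (s ^ n * C.prob (Q n)) \<le> en (q' ^ n)"
    using s by (simp only: C.emeasure_eq_measure ennreal_mult' zero_le_power less_imp_le)
   thus ?case using q' s by (simp add: power_divide pos_le_divide_eq mult.commute)
  qed
 qed auto
 ultimately show False using LIMSEQ_unique by fastforce
qed

lemma N_is_norm: "is_norm N" unfolding is_norm_def
 using conjI allI N_pos N_0 N N_scale N_triangle by fastforce

lemma survival_limit_N:
 "AE \<omega> in P. ((%r. - ln (enn2real (B.cross (V \<omega>) (cball (r *\<^sub>R x) 1) 0)) / r) \<longlongrightarrow> N x) at_top \<and> (\<forall>y. 0
  < B.cross (V \<omega>) (cball y 1) 0)"
 using N(2)[of x] AE_sublinear AE_space
proof eventually_elim
 case (elim \<omega>)
 have pos: "0 < B.cross (V \<omega>) (cball y 1) 0" for y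
  by (rule less_le_trans[OF B.ib_pos[OF V_borel[OF elim(3)] elim(2)] B.ib_le[of 0 0]]) simp
 show ?case
 proof (cases "x = 0")
  case True
  have "1 \<le> B.cross (V \<omega>) (cball 0 1) 0" using B.ib_le[of 0 0 "V \<omega>" 0] by (simp add: B.ib_refl)
  hence "B.cross (V \<omega>) (cball 0 1) 0 = 1" using B.cross_le_1 by (intro order_antisym)
  thus ?thesis using True pos by (simp add: N_0)
 next
  case False
  thus ?thesis using B.survival_limit(1)[OF V_borel[OF elim(3)] elim(2) False N(1) elim(1)] pos by blast
 qed
qed

end

text \<open>Where \<open>Z 0 w = 0\<close>, hence almost surely, \<open>Z\<close> and the corrected
  path agree at all nonnegative times, and other times do not enter the weight.\<close>

lemma survival_eq_cross:
 fixes Z :: "real => 'w => 'a::euclidean_space"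
 assumes Z: "standard_brownian_motion M Z" and v: "v \<in> bmeas borel"
 shows "survival M Z v y = enn2real (wiener.cross (distr M paths (%w t. Z (max 0 t) w - Z 0 w)) v
  (cball y 1) 0)"
proof -
 let ?X = "%w t. Z (max 0 t) w - Z 0 w" and ?S = "cball y (1::real)"
 interpret B: wiener "distr M paths ?X" by (rule wiener_of_standard_brownian_motion(1)[OF Z])
 have Xm: "?X \<in> M \<rightarrow>\<^sub>M paths" by (rule wiener_of_standard_brownian_motion(2)[OF Z])
 have Zm: "!!t. 0 \<le> t ==> Z t \<in> bmeas M" and Z0: "AE w in M. Z 0 w = 0"
  and Zc: "!!w. w \<in> space M ==> continuous_on {0..} (%t. Z t w)"
  using Z by (auto simp: standard_brownian_motion_def)
 let ?h = "%w t. Z (max 0 t) w"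
 have hm: "(%w. wgt v ?S (?h w)) \<in> bmeas M"
 proof (rule wgt_measurable)
  show "(%(x, y). v y) \<in> bmeas (M \<Otimes>\<^sub>M borel)"
   using measurable_compose[OF measurable_snd v] by (simp add: case_prod_unfold)
  show "continuous_on UNIV (?h w)" if "w \<in> space M" for w
   by (rule continuous_on_compose2[OF Zc[OF that]]) (auto intro!: continuous_intros)
 qed (use Zm in auto)
 have eq: "exp_minus (\<integral>\<^sup>+ s\<in>{s. 0 \<le> s \<and> en s \<le> hitting_time Z y w}. v (Z s w) \<partial>lborel) * ind {w.
  hitting_time Z y w < \<infinity>} w = enn2real (wgt v ?S (?h w))" for w
 proof -
  have "{t. 0 \<le> t \<and> Z t w \<in> ?S} = {t. 0 \<le> t \<and> Z (max 0 t) w \<in> ?S}" by (auto simp: max_absorb2)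
  hence h: "hitting_time Z y w = hit ?S (?h w)" by (simp only: hitting_time_def hit_def)
  have "(\<integral>\<^sup>+ s\<in>{s. 0 \<le> s \<and> en s \<le> hit ?S (?h w)}. v (Z s w) \<partial>lborel) = cost v (hit ?S (?h w)) (?h w)"
   unfolding cost_def by (intro nn_integral_cong) (auto simp: indicator_def max_absorb2)
  thus ?thesis by (simp add: h wgt_def exp_minus_eq)
 qed
 have "survival M Z v y = (LINT w|M. enn2real (wgt v ?S (?h w)))" unfolding survival_def eq ..
 also have "... = enn2real (NINT w|M. en (enn2real (wgt v ?S (?h w))))"
  by (rule integral_eq_nn_integral) (use hm in auto)
 also have "(NINT w|M. en (enn2real (wgt v ?S (?h w)))) = (NINT w|M. wgt v ?S (start 0 (?X w)))"
 proof (rule nn_integral_cong_AE, goal_cases)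
  case 1
  show ?case using Z0
  proof eventually_elim
   case (elim w)
   have "wgt v ?S (?h w) < \<top>" using wgt_le_1 by (rule le_less_trans) simp
   thus ?case using elim by (simp add: start_def)
  qed
 qed
 also have "... = B.cross v ?S 0" unfolding B.cross_def
  using measurable_compose[OF measurable_Pair1'[of 0 borel paths] B.wgt_start_measurable'[OF _ v, of ?S]]
  by (intro nn_integral_distr[symmetric, OF Xm]) simp
 finally show ?thesis .
qed

theorem proposition4p4:
  fixes P :: "'a::euclidean_space set measure"
    and M :: "'w measure" and Z :: "real \<Rightarrow> 'w \<Rightarrow> 'a"
    and W :: "'a \<Rightarrow> real" and \<gamma> c :: real
    and V :: "'a \<Rightarrow> 'a set \<Rightarrow> ennreal"
  assumes "poisson_process P"
    and "standard_brownian_motion M Z"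
    and "W \<in> borel_measurable borel"
    and "\<And>x. 0 \<le> W x"
    and "\<not> (AE x in lborel. W x = 0)"
    and "real DIM('a) < \<gamma>" and "0 < c"
    and "\<And>x. W x \<le> c * (if x = 0 then 1 else min (norm x powr (- \<gamma>)) 1)"
    and "V = potential W"
  shows "((AE \<omega> in P. (SUP x\<in>ball 0 1. V x \<omega>) < \<infinity>) \<and>
          (\<lambda>\<omega>. enn2real (SUP x\<in>ball 0 1. V x \<omega>)) \<in> lorentz_space (completion P) DIM('a)) \<and>
         (AE \<omega> in P. bottom_spectrum (\<lambda>x. V x \<omega>) = (INF \<omega>'\<in>configurations. V 0 \<omega>')) \<and>
         (\<exists>\<rho> \<epsilon> (u :: 'a set \<Rightarrow> 'a). 0 < \<rho> \<and> 0 < \<epsilon> \<and> u \<in> borel_measurable P \<and>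
            (AE \<omega> in P. emeasure lborel ({x. V x \<omega> > ennreal \<epsilon>} \<inter> ball (u \<omega>) \<rho>) > ennreal \<epsilon>) \<and>
            integrable P (\<lambda>\<omega>. norm (u \<omega>) ^ DIM('a))) \<and>
         ((\<forall>x. AE \<omega> in P. lyapunov_limit M Z (\<lambda>y. V y \<omega>) x (lyapunov_exponent P M Z V x)) \<and>
          is_norm (lyapunov_exponent P M Z V))"
proof -
 let ?W = "distr M paths (%w t. Z (max 0 t) w - Z 0 w)"
 interpret random_crossing P W \<gamma> c ?W
 proof (intro random_crossing.intro poisson_potential.intro poisson_potential_axioms.intro)
  show "poisson P" by unfold_locales (rule assms(1))
  show "wiener ?W" by (rule wiener_of_standard_brownian_motion(1)[OF assms(2)])
 qed (use assms in auto)
 have lim: "AE \<omega> in P. lyapunov_limit M Z (%y. potential W y \<omega>) x (N x)" for x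
  using survival_limit_N[of x] AE_space
 proof eventually_elim
  case (elim \<omega>)
  let ?v = "%y. potential W y \<omega>"
  define s where "s r = enn2real (B.cross ?v (cball (r *\<^sub>R x) 1) 0)" for r
  have s: "survival M Z ?v (r *\<^sub>R x) = s r" for r
   unfolding s_def by (rule survival_eq_cross[OF assms(2) V_borel[OF elim(2)]])
  \<comment> \<open>\<open>minus_log\<close> takes the value infinity at 0, so positivity is what
    identifies it with the real logarithm.\<close>
  have spos: "s r \<noteq> 0" for r
  proof -
   have "B.cross ?v (cball (r *\<^sub>R x) 1) 0 < \<top>" using B.cross_le_1 by (rule le_less_trans) simp
   hence "0 < s r" using elim(1) unfolding s_def enn2real_positive_iff by blast
   thus ?thesis by simp
  qed
  have "((%r. ereal (- ln (s r) / r)) \<longlongrightarrow> ereal (N x)) at_top" using elim(1) by (simp add: s_def)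
  thus ?case unfolding lyapunov_limit_def s
  proof (rule Lim_transform_eventually, goal_cases)
   case 1
   show ?case using eventually_gt_at_top[of 0] by eventually_elim (simp add: minus_log_def spos)
  qed
 qed
 \<comment> \<open>Two candidates for the limit agree almost surely, hence agree, since they are
   constants and \<open>P\<close> is a probability measure; so \<open>THE\<close> selects
   \<open>N x\<close>.\<close>
 have eq: "lyapunov_exponent P M Z V = N"
 proof
  fix x
  show "lyapunov_exponent P M Z V x = N x" unfolding lyapunov_exponent_def assms(9)
  proof (rule the_equality)
   show "AE \<omega> in P. lyapunov_limit M Z (%y. potential W y \<omega>) x (N x)" by (rule lim)
  next
   fix a assume "AE \<omega> in P. lyapunov_limit M Z (%y. potential W y \<omega>) x a"
   with lim[of x] have "AE \<omega> in P. a = N x"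
   proof eventually_elim
    case (elim \<omega>)
    hence "ereal a = ereal (N x)" unfolding lyapunov_limit_def by (intro tendsto_unique[OF
     trivial_limit_at_top_linorder])
    thus ?case by simp
   qed
   thus "a = N x" by simp
  qed
 qed
 show ?thesis unfolding eq unfolding assms(9)
  using sup_potential bottom_spectrum_potential nearby_bump lim N_is_norm by blast
qed

end
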